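(* Let $m\ge 2$ and $n\ge 1$ be integers and let $f_c(x)=x^m+c$. Every prime $p\nmid m$ at which the curve $Y_1(n)$ has bad reduction divides $D_n$. Every prime $p\nmid m$ at which the curve $Y_0(n)$ has bad reduction divides $D_{n,n}$.
   Context: Let $f(x,c)=x^m+c$, $f_c(x)=f(x,c)$, and let $f_c^n$ be the $n$-th iterate in $x$. Put $\Psi_n(x,c)=f_c^n(x)-x$ and $\Phi_n(x,c)=\prod_{d\mid n}\Psi_d(x,c)^{\mu(n/d)}\in\mathbb{Z}[x,c]$ (the $n$-th dynatomic polynomial). $Y_1(n)$ is the closed subscheme of $\mathbb{A}^2_{\mathbb{Z}}$ defined by $\Phi_n(x,c)=0$; for a ring $R$, $Y_1(n)_R$ is its base change to $R$. The automorphism $\sigma:(x,c)\mapsto(f_c(x),c)$ generates an action of $\mathbb{Z}/n\mathbb{Z}$ on $Y_1(n)_R$, and $Y_0(n)_R:=Y_1(n)_R/\langle\sigma\rangle$. For $i\in\{0,1\}$, $Y_i(n)$ has good reduction modulo $p$ if $Y_i(n)_{\mathbb{F}_p}$ is smooth over $\mathbb{F}_p$, and bad reduction otherwise. Let $\nu(n)=\sum_{d\mid n}m^d\mu(n/d)$ and $r=\nu(n)/n$. The roots of $\Phi_n(x,c)$ in an algebraic closure of $\mathbb{Q}(c)$ form $r$ cycles of length $n$ under $f_c$; let $\alpha_1,\dots,\alpha_r$ be representatives of these cycles, and let $\lambda_n(\alpha)=(f_c^n)'(\alpha)$. Define $\delta_n(x,c)=\prod_{i=1}^r(x-\lambda_n(\alpha_i))$,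 which lies in $\mathbb{Z}[x,c]$, and $D_n=\operatorname{disc}\,\delta_n(1,c)$ (discriminant in $c$). With $C_j(x)$ the $j$-th cyclotomic polynomial, for $d\mid n$, $d\ne n$, put $\Delta_{n,d}(c)=\operatorname{Res}_x(C_{n/d}(x),\delta_d(x,c))$, and define $\Delta_{n,n}(c)$ by $\delta_n(1,c)=\Delta_{n,n}(c)\prod_{d\mid n,\,d\neq n}\Delta_{n,d}(c)$; all $\Delta_{n,d}$ lie in $\mathbb{Z}[c]$. Put $D_{n,n}=\operatorname{disc}\Delta_{n,n}(c)$. *)

theory Defs
  imports
    "HOL-Algebra.Algebraic_Closure_Type"
    "HOL-Algebra.QuotRing"
    "HOL-Algebra.Generated_Rings"
    "HOL-Computational_Algebra.Computational_Algebra"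
    "Subresultants.Resultant_Prelim"
begin

section \<open>Dynatomic polynomials of $x^m + c$\<close>

text \<open>
  Elements of $\mathbb{Z}[x,c] = \mathbb{Z}[c][x]$ have type \<^typ>\<open>int poly poly\<close>: the outer
  variable is $x$, the inner one is $c$.
\<close>

definition moebius :: "nat \<Rightarrow> int" where
  "moebius k = (if squarefree k then (-1) ^ card (prime_factors k) else 0)"

definition fc :: "nat \<Rightarrow> int poly poly" where
  "fc m = Polynomial.monom 1 m + [:[:0, 1:]:]"

definition fc_iter :: "nat \<Rightarrow> nat \<Rightarrow> int poly poly" where
  "fc_iter m k = ((\<lambda>g. pcompose (fc m) g) ^^ k) [:0, 1:]"

definition Psi :: "nat \<Rightarrow> nat \<Rightarrow> int poly poly" where
  "Psi m k = fc_iter m k - [:0, 1:]"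

text \<open>
  The product with exponents $\pm 1$ is formed in the fraction field of $\mathbb{Z}[x,c]$;
  it is (the image of) a unique polynomial.
\<close>

definition dynatomic :: "nat \<Rightarrow> nat \<Rightarrow> int poly poly" where
  "dynatomic m n = (THE P. to_fract P = (\<Prod>d | d dvd n. to_fract (Psi m d) powi moebius (n div d)))"


section \<open>The polynomials $\delta_n$ and $\Delta_{n,d}$ and their discriminants\<close>

type_synonym Qc_bar = "rat poly fract alg_closure"

definition emb :: "int poly \<Rightarrow> Qc_bar" where
  "emb q = to_ac (to_fract (map_poly rat_of_int q))"

definition orbit_of :: "nat \<Rightarrow> Qc_bar \<Rightarrow> Qc_bar set" where
  "orbit_of m \<alpha> = {poly (map_poly emb (fc_iter m k)) \<alpha> | k. True}"

definition cycles :: "nat \<Rightarrow> nat \<Rightarrow> Qc_bar set set" where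
  "cycles m n = orbit_of m ` {\<alpha>. poly (map_poly emb (dynatomic m n)) \<alpha> = 0}"

definition multiplier :: "nat \<Rightarrow> nat \<Rightarrow> Qc_bar \<Rightarrow> Qc_bar" where
  "multiplier m n \<alpha> = poly (pderiv (map_poly emb (fc_iter m n))) \<alpha>"

text \<open>
  Here \<open>SOME \<alpha>. \<alpha> \<in> C\<close> is the chosen representative of the cycle \<open>C\<close>; the multiplier does not
  depend on the choice.
\<close>

definition delta :: "nat \<Rightarrow> nat \<Rightarrow> int poly poly" where
  "delta m n = (THE P. map_poly emb P =
     (\<Prod>C\<in>cycles m n. [:- multiplier m n (SOME \<alpha>. \<alpha> \<in> C), 1:]))"

definition cyclotomic :: "nat \<Rightarrow> int poly" where
  "cyclotomic j = (THE P. map_poly of_int P =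
     (\<Prod>\<zeta> | \<zeta> ^ j = 1 \<and> (\<forall>k. 0 < k \<and> k < j \<longrightarrow> \<zeta> ^ k \<noteq> 1). [:- \<zeta>, 1 :: complex:]))"

text \<open>
  \<open>Delta_prop m n d\<close> is $\Delta_{n,d}$ for proper divisors $d$ of $n$; \<open>Delta_prim m n\<close> is
  $\Delta_{n,n}$. The evaluation \<open>poly (delta m n) 1\<close> is $\delta_n(1,c) \in \mathbb{Z}[c]$.
\<close>

definition Delta_prop :: "nat \<Rightarrow> nat \<Rightarrow> nat \<Rightarrow> int poly" where
  "Delta_prop m n d = resultant (map_poly (\<lambda>a. [:a:]) (cyclotomic (n div d))) (delta m d)"

definition Delta_prim :: "nat \<Rightarrow> nat \<Rightarrow> int poly" where
  "Delta_prim m n = (THE q. poly (delta m n) 1 = q * (\<Prod>d | d dvd n \<and> d \<noteq> n. Delta_prop m n d))"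

text \<open>
  The division by the leading coefficient is exact. Constants have discriminant $1$ (the empty
  product of root differences); this is needed for $m = n = 2$, where $\Delta_{2,2} = -1$.
\<close>

definition discriminant :: "int poly \<Rightarrow> int" where
  "discriminant P = (if degree P = 0 then 1
     else (-1) ^ (degree P * (degree P - 1) div 2) *
       (resultant P (pderiv P) div lead_coeff P))"

definition disc_delta :: "nat \<Rightarrow> nat \<Rightarrow> int" where
  "disc_delta m n = discriminant (poly (delta m n) 1)"

definition disc_Delta_prim :: "nat \<Rightarrow> nat \<Rightarrow> int" where
  "disc_Delta_prim m n = discriminant (Delta_prim m n)"


section \<open>The curves over $\mathbb{F}_p$ and good reduction\<close>

text \<open>
  Affine schemes are represented by their coordinate rings. The base change of
  $\operatorname{Spec} \mathbb{Z}[x,c]/(\Phi_n)$ to $\mathbb{F}_p$ has coordinate ring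
  $\mathbb{Z}[x,c]/(p,\Phi_n) = \mathbb{F}_p[x,c]/(\Phi_n)$.
\<close>

abbreviation Zxc :: "int poly poly ring" where
  "Zxc \<equiv> ring_of_type_algebra"

definition Y1_ideal :: "nat \<Rightarrow> nat \<Rightarrow> nat \<Rightarrow> int poly poly set" where
  "Y1_ideal m n p = Idl\<^bsub>Zxc\<^esub> {of_nat p, dynatomic m n}"

definition Y1_ring :: "nat \<Rightarrow> nat \<Rightarrow> nat \<Rightarrow> int poly poly set ring" where
  "Y1_ring m n p = Zxc Quot Y1_ideal m n p"

text \<open>
  The automorphism $\sigma : (x,c) \mapsto (f_c(x),c)$ acts on functions by
  $g(x,c) \mapsto g(f_c(x),c)$. This preserves the ideal, so all representatives of a coset are
  sent to the same coset.
\<close>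

definition sigma_star :: "nat \<Rightarrow> nat \<Rightarrow> nat \<Rightarrow> int poly poly set \<Rightarrow> int poly poly set" where
  "sigma_star m n p A = the_elem
     ((\<lambda>g. Y1_ideal m n p +>\<^bsub>Zxc\<^esub> pcompose g (fc m)) ` A)"

text \<open>
  The quotient of an affine scheme by a finite group is the spectrum of the ring of invariants;
  invariance under the generator \<open>\<sigma>\<close> is invariance under \<open>\<langle>\<sigma>\<rangle>\<close>.
\<close>

definition Y0_ring :: "nat \<Rightarrow> nat \<Rightarrow> nat \<Rightarrow> int poly poly set ring" where
  "Y0_ring m n p = (Y1_ring m n p)
     \<lparr>carrier := {A \<in> carrier (Y1_ring m n p). sigma_star m n p A = A}\<rparr>"

text \<open>
  A ring has at most one structure of $\mathbb{F}_p$-algebra, it has one if and only if $p = 0$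
  in it, and all ring homomorphisms between such rings are $\mathbb{F}_p$-linear.
\<close>

definition Fp_algebra :: "nat \<Rightarrow> 'a ring \<Rightarrow> bool" where
  "Fp_algebra p A \<longleftrightarrow> cring A \<and> [p] \<cdot>\<^bsub>A\<^esub> \<one>\<^bsub>A\<^esub> = \<zero>\<^bsub>A\<^esub>"

text \<open>
  Smooth means of finite presentation and formally smooth (homomorphisms into a quotient by an
  ideal of square zero lift). Over the field $\mathbb{F}_p$ finite presentation is finite type,
  and subalgebras are subrings. A definition cannot quantify over the types of the test rings
  \<open>B\<close>, so their type is a parameter. A ring is smooth if \<open>smooth_over_Fp\<close> holds for every type
  \<open>'b\<close>, and fails to be smooth if it fails for some type; hence a statement about non-smoothness
  has to be proved for arbitrary \<open>'b\<close>.
\<close>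

definition formally_smooth_over_Fp :: "'b itself \<Rightarrow> nat \<Rightarrow> 'a ring \<Rightarrow> bool" where
  "formally_smooth_over_Fp T p A \<longleftrightarrow>
     (\<forall>(B :: 'b ring) J \<phi>.
        Fp_algebra p B \<and> ideal J B \<and> (\<forall>a\<in>J. \<forall>b\<in>J. a \<otimes>\<^bsub>B\<^esub> b = \<zero>\<^bsub>B\<^esub>) \<and> \<phi> \<in> Ring.ring_hom A (B Quot J)
        \<longrightarrow> (\<exists>\<psi>\<in>Ring.ring_hom A B. \<forall>a\<in>carrier A. \<phi> a = J +>\<^bsub>B\<^esub> \<psi> a))"

definition smooth_over_Fp :: "'b itself \<Rightarrow> nat \<Rightarrow> 'a ring \<Rightarrow> bool" where
  "smooth_over_Fp T p A \<longleftrightarrow>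
     Fp_algebra p A \<and>
     (\<exists>S. finite S \<and> S \<subseteq> carrier A \<and> generate_ring A S = carrier A) \<and>
     formally_smooth_over_Fp T p A"

definition Y1_bad_reduction :: "'b itself \<Rightarrow> nat \<Rightarrow> nat \<Rightarrow> nat \<Rightarrow> bool" where
  "Y1_bad_reduction T m n p \<longleftrightarrow> \<not> smooth_over_Fp T p (Y1_ring m n p)"

definition Y0_bad_reduction :: "'b itself \<Rightarrow> nat \<Rightarrow> nat \<Rightarrow> nat \<Rightarrow> bool" where
  "Y0_bad_reduction T m n p \<longleftrightarrow> \<not> smooth_over_Fp T p (Y0_ring m n p)"

end

theory Submission
  imports Defs "Jordan_Normal_Form.Char_Poly" "Subresultants.Subresultant_Gcd"
begin

text \<open>
  The proof shows that a singular point of one of the curves over \<open>\<int>/p\<close> forces a double root of the corresponding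
  polynomial in \<open>c\<close>, and that a curve without singular points in this sense is smooth.

  Norms. Over an algebraic closure of \<open>\<rat>(c)\<close> the roots of \<open>\<Phi>\<^sub>n\<close> are the points of exact period \<open>n\<close>, and they are simple
  because \<open>(f\<^sup>n)'\<close> is divisible by \<open>m\<close>. The norm \<open>N n g\<close>, the product of the values of \<open>g\<close> at these points, is
  the determinant of the multiplication by \<open>g\<close> modulo \<open>\<Phi>\<^sub>n\<close> and lies in \<open>\<int>[c]\<close>. The multiplier is constant on
  cycles, so that \<open>\<delta>\<^sub>n(1,c)\<^sup>n\<close> is the norm of \<open>1 - \<lambda>\<^sub>n\<close> (\<open>delta_1_power\<close>). For the quotient curve let
  \<open>P(Y) = \<Prod>\<^sub>i (Y - f\<^sup>i(x))\<close> be the cycle polynomial (\<open>CP\<close>) and \<open>\<Phi>\<^sub>n(Y) = P(Y) Q(Y)\<close> the factorisation modulo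
  \<open>\<Phi>\<^sub>n(x)\<close>; then \<open>\<Delta>\<^sub>n\<^sub>,\<^sub>n\<^sup>n\<close> is, up to sign, the norm of \<open>Q(x)\<close> (\<open>Delta_prim\<close>), because the norm of \<open>\<Phi>\<^sub>d\<close>
  for a proper divisor \<open>d\<close> is \<open>\<Delta>\<^sub>n\<^sub>,\<^sub>d\<^sup>d\<close> up to sign.

  Multiple roots. At a singular point of \<open>Y\<^sub>1(n)\<close> of exact period \<open>n\<close> all points of the cycle are singular, so that
  \<open>\<Phi>\<^sub>n\<close> lies in the square of the ideal \<open>(P, c - c\<^sub>0)\<close>, where \<open>P\<close> now denotes the product of the \<open>X - f\<^sup>i(x\<^sub>0)\<close>.
  A determinant computation (\<open>norm_vanishing_order\<close>) then shows that norms of functions vanishing on the cycle are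
  divisible by \<open>(c - c\<^sub>0)\<^sup>2\<^sup>n\<close>, hence \<open>\<delta>\<^sub>n(1,c)\<close> by \<open>(c - c\<^sub>0)\<^sup>2\<close>. A singular point of smaller period is dealt with
  directly. For \<open>Y\<^sub>0(n)\<close> the same computation applies at points where \<open>P\<close> divides \<open>Q\<close> and \<open>\<partial>\<Phi>\<^sub>n/\<partial>c\<close> in the
  fibre. A double root modulo \<open>p\<close> makes \<open>p\<close> divide the discriminant as soon as \<open>p\<close> does not divide the leading
  coefficient. This is true for \<open>p\<close> not dividing \<open>m\<close>: when \<open>c\<close> tends to infinity all multipliers do, so that the
  leading coefficient of the norm of \<open>1 - \<lambda>\<^sub>n\<close> is that of the norm of \<open>\<lambda>\<^sub>n\<close>, up to sign a power of \<open>m\<close>.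

  Smoothness. If \<open>p\<close> does not divide the discriminant, then \<open>p\<close>, \<open>\<Phi>\<^sub>n\<close> and the two partial derivatives, or in the
  case of \<open>Y\<^sub>0(n)\<close> the coefficients of the remainders of \<open>Q\<close> and \<open>\<partial>\<Phi>\<^sub>n/\<partial>c\<close> modulo \<open>P\<close>, generate the unit
  ideal. Each of the generators is the weight of an explicit map that is, up to this weight, a lift of a given
  homomorphism over an ideal of square zero (the predicate \<open>tw\<close>); on \<open>Y\<^sub>1(n)\<close> these maps are the familiar corrections
  of a point by a derivation, and on \<open>Y\<^sub>0(n)\<close> they are computed in the ring of polynomials modulo \<open>P\<close>, where the
  generic cycle has a point. A partition of unity then gives a lift (\<open>tw_lift\<close>).
\<close>

section \<open>Ideals and division by monic polynomials\<close>

definition is_ideal :: "'a::comm_ring_1 set \<Rightarrow> bool" where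
  "is_ideal I \<longleftrightarrow> 0 \<in> I \<and> (\<forall>a\<in>I. \<forall>b\<in>I. a + b \<in> I) \<and> (\<forall>a\<in>I. \<forall>r. r * a \<in> I)"

lemma is_ideal_zero: "is_ideal I \<Longrightarrow> 0 \<in> I"
  and is_ideal_add: "is_ideal I \<Longrightarrow> a \<in> I \<Longrightarrow> b \<in> I \<Longrightarrow> a + b \<in> I"
  and is_ideal_multl: "is_ideal I \<Longrightarrow> a \<in> I \<Longrightarrow> r * a \<in> I"
  and is_ideal_multr: "is_ideal I \<Longrightarrow> a \<in> I \<Longrightarrow> a * r \<in> I"
  by (auto simp: is_ideal_def mult.commute[of a r])

lemma is_ideal_uminus: "is_ideal I \<Longrightarrow> a \<in> I \<Longrightarrow> - a \<in> I"
  using is_ideal_multl[of I a "-1"] by simp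

lemma is_ideal_diff: "is_ideal I \<Longrightarrow> a \<in> I \<Longrightarrow> b \<in> I \<Longrightarrow> a - b \<in> I"
  using is_ideal_add[of I a "-b"] is_ideal_uminus[of I b] by simp

lemma is_ideal_sum: "is_ideal I \<Longrightarrow> (\<And>x. x \<in> A \<Longrightarrow> f x \<in> I) \<Longrightarrow> sum f A \<in> I"
  by (induction A rule: infinite_finite_induct) (auto intro: is_ideal_zero is_ideal_add)

lemmas is_ideal_intros = is_ideal_zero is_ideal_add is_ideal_uminus is_ideal_diff is_ideal_multl
  is_ideal_multr is_ideal_sum

definition poly_ideal :: "'a::comm_ring_1 set \<Rightarrow> 'a poly set" where
  "poly_ideal I = {f. \<forall>i. coeff f i \<in> I}"

lemma is_ideal_poly_ideal: "is_ideal I \<Longrightarrow> is_ideal (poly_ideal I)"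
  unfolding is_ideal_def[of "poly_ideal I"]
  by (auto simp: poly_ideal_def coeff_mult intro!: is_ideal_zero is_ideal_add is_ideal_sum is_ideal_multl)

lemma poly_ideal_coeff: "f \<in> poly_ideal I \<Longrightarrow> coeff f i \<in> I"
  by (simp add: poly_ideal_def)

lemma poly_poly_ideal: "is_ideal I \<Longrightarrow> f \<in> poly_ideal I \<Longrightarrow> poly f x \<in> I"
  unfolding poly_altdef by (auto simp: poly_ideal_def intro!: is_ideal_intros)

lemma const_poly_ideal: "is_ideal I \<Longrightarrow> a \<in> I \<Longrightarrow> [:a:] \<in> poly_ideal I"
  by (auto simp: poly_ideal_def coeff_pCons is_ideal_zero split: nat.split)

lemma monic_mult_poly_ideal:
  assumes I: "is_ideal I" and P: "lead_coeff P = 1" and PS: "P * S \<in> poly_ideal I"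
  shows "S \<in> poly_ideal I"
  using PS
proof (induction "degree S" arbitrary: S rule: less_induct)
  case less
  note I' = is_ideal_poly_ideal[OF I]
  show ?case
  proof (cases "S = 0")
    case True
    then show ?thesis using I' by (simp add: is_ideal_zero)
  next
    case False
    let ?d = "degree S"
    define m where "m = monom (coeff S ?d) ?d"
    have "coeff (P * S) (degree P + ?d) = coeff S ?d"
      using P by (simp add: coeff_mult_degree_sum)
    hence c: "coeff S ?d \<in> I"
      using poly_ideal_coeff[OF less.prems] by metis
    have mI: "m \<in> poly_ideal I"
      using c I by (auto simp: m_def poly_ideal_def is_ideal_zero)
    show ?thesis
    proof (cases "?d = 0")
      case True
      then have "S = m"
        by (simp add: m_def monom_0) (metis degree_0_id)
      with mI show ?thesis by simp
    next
      case pos: False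
      have "degree (S - m) < ?d"
      proof (rule le_neq_trans)
        show le: "degree (S - m) \<le> ?d"
          by (rule degree_diff_le) (auto simp: m_def degree_monom_le)
        show "degree (S - m) \<noteq> ?d"
        proof
          assume a: "degree (S - m) = ?d"
          have "coeff (S - m) ?d = 0" by (simp add: m_def)
          with a have "S - m = 0" using leading_coeff_0_iff by metis
          with a pos show False by simp
        qed
      qed
      moreover have "P * (S - m) \<in> poly_ideal I"
        using is_ideal_diff[OF I' less.prems is_ideal_multl[OF I' mI]] by (simp add: algebra_simps)
      ultimately have "S - m \<in> poly_ideal I" using less.hyps by blast
      from is_ideal_add[OF I' this mI] show ?thesis by simp
    qed
  qed
qed

definition subring_set :: "'a::comm_ring_1 set \<Rightarrow> bool" where
  "subring_set A \<longleftrightarrow> 0 \<in> A \<and> 1 \<in> A \<and> (\<forall>a\<in>A. \<forall>b\<in>A. a - b \<in> A \<and> a + b \<in> A \<and> a * b \<in> A)"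

lemma subring_set_UNIV: "subring_set UNIV" by (simp add: subring_set_def)

lemma subring_set_sum: "subring_set A \<Longrightarrow> (\<And>x. x \<in> S \<Longrightarrow> f x \<in> A) \<Longrightarrow> sum f S \<in> A"
  by (induction S rule: infinite_finite_induct) (auto simp: subring_set_def)

definition poly_subring :: "'a::comm_ring_1 set \<Rightarrow> 'a poly set" where
  "poly_subring A = {f. \<forall>i. coeff f i \<in> A}"

lemma subring_set_poly_subring: "subring_set A \<Longrightarrow> subring_set (poly_subring A)"
  unfolding subring_set_def[of "poly_subring A"]
  by (auto simp: poly_subring_def coeff_mult coeff_1 intro!: subring_set_sum) (auto simp: subring_set_def)

text \<open>Division with remainder stays inside the subring generated by the coefficients.\<close>

lemma monic_division_exists:
  fixes P :: "'a::comm_ring_1 poly"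
  assumes A: "subring_set A" and P: "lead_coeff P = 1" "P \<in> poly_subring A" and F: "F \<in> poly_subring A"
  shows "\<exists>Q R. Q \<in> poly_subring A \<and> R \<in> poly_subring A \<and> F = P * Q + R \<and> (\<forall>i\<ge>degree P. coeff R i = 0)"
proof -
  note A' = subring_set_poly_subring[OF A]
  have "\<forall>F\<in>poly_subring A. (\<forall>i\<ge>k. coeff F i = 0) \<longrightarrow> (\<exists>Q R. Q \<in> poly_subring A \<and> R \<in> poly_subring A \<and> F = P * Q + R \<and> (\<forall>i\<ge>degree P. coeff R i = 0))" for k
  proof (induction k)
    case 0
    show ?case
    proof (intro ballI impI)
      fix F :: "'a poly" assume "F \<in> poly_subring A" "\<forall>i\<ge>0. coeff F i = 0"
      hence "F = 0" by (simp add: poly_eq_iff)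
      thus "\<exists>Q R. Q \<in> poly_subring A \<and> R \<in> poly_subring A \<and> F = P * Q + R \<and> (\<forall>i\<ge>degree P. coeff R i = 0)"
        using A' by (intro exI[of _ 0]) (simp add: subring_set_def)
    qed
  next
    case (Suc k)
    show ?case
    proof (intro ballI impI)
      fix F :: "'a poly" assume F: "F \<in> poly_subring A" and deg: "\<forall>i\<ge>Suc k. coeff F i = 0"
      show "\<exists>Q R. Q \<in> poly_subring A \<and> R \<in> poly_subring A \<and> F = P * Q + R \<and> (\<forall>i\<ge>degree P. coeff R i = 0)"
      proof (cases "k < degree P")
        case True
        thus ?thesis using F deg A' by (intro exI[of _ 0] exI[of _ F]) (auto simp: subring_set_def)
      next
        case False
        define m where "m = monom (coeff F k) (k - degree P)"
        have m: "m \<in> poly_subring A" using F A by (auto simp: m_def poly_subring_def subring_set_def)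
        define G where "G = F - P * m"
        have G: "G \<in> poly_subring A" using F P m A' by (auto simp: G_def subring_set_def)
        have "coeff G i = 0" if "i \<ge> k" for i
        proof (cases "i = k")
          case True
          have "coeff (P * m) k = coeff F k"
            using False P by (simp add: m_def mult.commute[of P] coeff_monom_mult)
          with True show ?thesis by (simp add: G_def)
        next
          case ne: False
          hence "coeff (P * m) i = 0" using False that
            by (simp add: m_def mult.commute[of P] coeff_monom_mult coeff_eq_0)
          with ne that deg show ?thesis by (simp add: G_def)
        qed
        with Suc.IH G obtain Q R where "Q \<in> poly_subring A" "R \<in> poly_subring A" "G = P * Q + R" "\<forall>i\<ge>degree P. coeff R i = 0"
          by blast
        thus ?thesis using m A'
          by (intro exI[of _ "Q + m"] exI[of _ R]) (auto simp: G_def algebra_simps subring_set_def)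
      qed
    qed
  qed
  from this[of "Suc (degree F)"] F show ?thesis by (auto simp: coeff_eq_0)
qed

lemma monic_division_unique:
  fixes P :: "'a::comm_ring_1 poly"
  assumes P: "lead_coeff P = 1" and eq: "P * Q + R = P * Q' + R'"
    and R: "\<And>i. i \<ge> degree P \<Longrightarrow> coeff R i = 0" "\<And>i. i \<ge> degree P \<Longrightarrow> coeff R' i = 0"
  shows "Q = Q'" "R = R'"
proof -
  have e: "P * (Q - Q') = R' - R" using eq by (simp add: algebra_simps)
  have "Q - Q' = 0"
  proof (rule ccontr)
    assume ne: "Q - Q' \<noteq> 0"
    hence "lead_coeff (Q - Q') \<noteq> 0" by (simp only: leading_coeff_0_iff not_False_eq_True)
    moreover have "coeff (P * (Q - Q')) (degree P + degree (Q - Q')) = 0"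
      unfolding e using R by simp
    ultimately show False using P by (simp only: coeff_mult_degree_sum mult_1)
  qed
  thus "Q = Q'" by simp
  with eq show "R = R'" by simp
qed

definition mdiv :: "'a::comm_ring_1 poly \<Rightarrow> 'a poly \<Rightarrow> 'a poly" where
  "mdiv P F = fst (SOME QR. F = P * fst QR + snd QR \<and> (\<forall>i\<ge>degree P. coeff (snd QR) i = 0))"
definition mmod :: "'a::comm_ring_1 poly \<Rightarrow> 'a poly \<Rightarrow> 'a poly" where
  "mmod P F = snd (SOME QR. F = P * fst QR + snd QR \<and> (\<forall>i\<ge>degree P. coeff (snd QR) i = 0))"

lemma mdiv_mmod:
  assumes "lead_coeff P = 1"
  shows "F = P * mdiv P F + mmod P F" "i \<ge> degree P \<Longrightarrow> coeff (mmod P F) i = 0"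
proof -
  have "\<exists>QR. F = P * fst QR + snd QR \<and> (\<forall>i\<ge>degree P. coeff (snd QR) i = 0)"
    using monic_division_exists[OF subring_set_UNIV assms, of F] by (auto simp: poly_subring_def)
  from someI_ex[OF this]
  show "F = P * mdiv P F + mmod P F" "i \<ge> degree P \<Longrightarrow> coeff (mmod P F) i = 0"
    unfolding mdiv_def mmod_def by auto
qed

lemma mdiv_mmod_eqI:
  assumes "lead_coeff P = 1" "F = P * Q + R" "\<And>i. i \<ge> degree P \<Longrightarrow> coeff R i = 0"
  shows "mdiv P F = Q" "mmod P F = R"
  using monic_division_unique[of P Q R "mdiv P F" "mmod P F"] mdiv_mmod(1)[OF assms(1), of F]
    mdiv_mmod(2)[OF assms(1), where F = F] assms by auto

lemma mmod_subring:
  assumes "subring_set A" "lead_coeff P = 1" "P \<in> poly_subring A" "F \<in> poly_subring A"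
  shows "mdiv P F \<in> poly_subring A" "mmod P F \<in> poly_subring A"
  using monic_division_exists[OF assms] mdiv_mmod_eqI[OF assms(2)] by metis+

lemma mmod_add:
  assumes "lead_coeff P = 1"
  shows "mmod P (F + G) = mmod P F + mmod P G"
proof (rule mdiv_mmod_eqI(2)[OF assms])
  show "F + G = P * (mdiv P F + mdiv P G) + (mmod P F + mmod P G)"
    by (subst mdiv_mmod(1)[OF assms, of F], subst mdiv_mmod(1)[OF assms, of G]) (simp add: distrib_left)
qed (simp add: mdiv_mmod(2)[OF assms])

lemma mmod_smult: "lead_coeff P = 1 \<Longrightarrow> mmod P (smult c F) = smult c (mmod P F)"
  using mdiv_mmod_eqI(2)[of P "smult c F" "smult c (mdiv P F)" "smult c (mmod P F)"]
    mdiv_mmod[where P = P and F = F] by (simp flip: smult_add_right)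

lemma mmod_diff: "lead_coeff P = 1 \<Longrightarrow> mmod P (F - G) = mmod P F - mmod P G"
  using mmod_add[of P F "smult (-1) G"] mmod_smult[of P "-1" G] by simp

lemma mmod_multiple: "lead_coeff P = 1 \<Longrightarrow> mmod P (P * F) = 0"
  by (rule mdiv_mmod_eqI(2)[where Q = F]) auto

lemma mmod_ideal:
  assumes "is_ideal I" "lead_coeff P = 1" "F \<in> poly_ideal I"
  shows "mmod P F \<in> poly_ideal I"
proof -
  define A where "A = I \<union> {}"
  note I' = is_ideal_poly_ideal[OF assms(1)]
  have "F \<in> poly_ideal I \<Longrightarrow> mmod P F \<in> poly_ideal I"
  proof (induction "degree F" arbitrary: F rule: less_induct)
    case less
    show ?case
    proof (cases "degree F < degree P")
      case True
      hence "mmod P F = F" by (intro mdiv_mmod_eqI[where Q = 0] assms) (auto simp: coeff_eq_0)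
      with less show ?thesis by simp
    next
      case False
      define m where "m = monom (lead_coeff F) (degree F - degree P)"
      have m: "m \<in> poly_ideal I" using less.prems assms(1) by (auto simp: m_def poly_ideal_def is_ideal_zero)
      have G: "F - P * m \<in> poly_ideal I" using less.prems m I' by (auto intro: is_ideal_intros)
      have e: "mmod P (F - P * m) = mmod P F" using assms(2) by (simp add: mmod_diff mmod_multiple)
      show ?thesis
      proof (cases "degree (F - P * m) < degree F")
        case True
        from less.hyps[OF this G] e show ?thesis by simp
      next
        case ge: False
        have c: "coeff (F - P * m) i = 0" if "i \<ge> degree F" for i
        proof (cases "i = degree F")
          case True
          have "coeff (P * m) i = coeff F i"
            using False assms(2) True by (simp add: m_def mult.commute[of P] coeff_monom_mult)
          thus ?thesis by simp
        next
          case ne: False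
          hence "coeff (P * m) i = 0" using False that
            by (simp add: m_def mult.commute[of P] coeff_monom_mult coeff_eq_0)
          with ne that show ?thesis by (simp add: coeff_eq_0)
        qed
        have "F - P * m = 0" using c[of "degree (F - P * m)"] ge by (simp only: leading_coeff_0_iff not_less)
        hence "mmod P F = 0" using e mmod_multiple[OF assms(2), of 0] by simp
        thus ?thesis using I' by (simp add: is_ideal_zero)
      qed
    qed
  qed
  with assms show ?thesis by blast
qed

lemma (in comm_ring_hom) degree_map_poly_monic:
  "lead_coeff P = 1 \<Longrightarrow> degree (map_poly hom P) = degree P"
  "lead_coeff P = 1 \<Longrightarrow> lead_coeff (map_poly hom P) = 1"
proof -
  assume a: "lead_coeff P = 1"
  hence "coeff (map_poly hom P) (degree P) = 1" by simp
  thus d: "degree (map_poly hom P) = degree P"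
  by (metis degree_map_poly_le le_antisym le_degree zero_neq_one)
  show "lead_coeff (map_poly hom P) = 1" unfolding d using a by simp
qed

text \<open>A factor of a monic polynomial over a larger field is defined over the small ring
  as soon as the other factor is.\<close>

lemma (in inj_comm_ring_hom) monic_quotient_descends:
  fixes r :: "'b poly"
  assumes "lead_coeff q = 1" "map_poly hom p = map_poly hom q * r"
  shows "\<exists>s. map_poly hom s = r \<and> p = q * s"
proof -
  interpret mp: map_poly_inj_comm_ring_hom hom ..
  note d = degree_map_poly_monic[OF assms(1)]
  have "map_poly hom p = map_poly hom q * map_poly hom (mdiv q p) + map_poly hom (mmod q p)"
    by (subst mdiv_mmod(1)[OF assms(1), of p]) (simp add: mp.hom_add mp.hom_mult)
  hence "map_poly hom q * map_poly hom (mdiv q p) + map_poly hom (mmod q p) = map_poly hom q * r + 0"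
    using assms by simp
  note u = monic_division_unique[OF d(2) this]
  have "map_poly hom (mdiv q p) = r" "map_poly hom (mmod q p) = 0"
    by (rule u; simp add: d mdiv_mmod(2)[OF assms(1)])+
  with mdiv_mmod(1)[OF assms(1), of p] show ?thesis by (intro exI[of _ "mdiv q p"]) auto
qed

section \<open>Norms as determinants\<close>

definition mult_mat :: "'a::comm_ring_1 poly \<Rightarrow> 'a poly \<Rightarrow> 'a mat" where
  "mult_mat P g = mat (degree P) (degree P) (\<lambda>(j, l). coeff (mmod P (monom 1 j * g)) l)"

lemma mult_mat_carrier [simp]: "mult_mat P g \<in> carrier_mat (degree P) (degree P)"
  by (simp add: mult_mat_def)

lemma poly_as_sum_lt:
  fixes p :: "'a::comm_ring_1 poly"
  assumes "\<And>i. i \<ge> n \<Longrightarrow> coeff p i = 0"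
  shows "poly p x = (\<Sum>i<n. coeff p i * x ^ i)" "p = (\<Sum>i<n. monom (coeff p i) i)"
proof -
  show e: "p = (\<Sum>i<n. monom (coeff p i) i)"
    using assms by (auto simp: poly_eq_iff coeff_sum not_less)
  show "poly p x = (\<Sum>i<n. coeff p i * x ^ i)"
    by (subst e) (simp add: poly_sum Polynomial.poly_monom)
qed

lemma vandermonde_nonzero:
  fixes \<alpha> :: "nat \<Rightarrow> 'l::field"
  assumes inj: "inj_on \<alpha> {..<N}" and e: "bij_betw e {..<N} {..<N}"
  shows "det (mat N N (\<lambda>(l, i). \<alpha> i ^ e l)) \<noteq> 0"
proof
  define V where "V = mat N N (\<lambda>(l, i). \<alpha> i ^ e l)"
  have V: "V \<in> carrier_mat N N" by (simp add: V_def)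
  assume "det (mat N N (\<lambda>(l, i). \<alpha> i ^ e l)) = 0"
  hence "det (transpose_mat V) = 0" using det_transpose[OF V] by (simp only: V_def)
  then obtain v where v: "v \<in> carrier_vec N" "v \<noteq> 0\<^sub>v N" "transpose_mat V *\<^sub>v v = 0\<^sub>v N"
    using det_0_iff_vec_prod_zero_field[of "transpose_mat V" N] V by auto
  define e' where "e' = inv_into {..<N} e"
  have e': "e' (e l) = l" "e l < N" if "l < N" for l
    using e that by (auto simp: e'_def bij_betw_def inv_into_f_f)
  define p where "p = (\<Sum>l<N. monom (v $ l) (e l))"
  have cp: "coeff p (e l) = v $ l" if "l < N" for l
  proof -
    have "coeff p (e l) = (\<Sum>k<N. if k = l then v $ k else 0)"
      unfolding p_def coeff_sum using e that
      by (intro sum.cong) (auto simp: bij_betw_def dest: inj_onD)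
    thus ?thesis using that by simp
  qed
  have cp0: "coeff p i = 0" if "i \<ge> N" for i
    unfolding p_def coeff_sum
  proof (intro sum.neutral ballI)
    fix l assume "l \<in> {..<N}"
    hence "e l \<noteq> i" using e'(2)[of l] that by simp
    thus "coeff (monom (v $ l) (e l)) i = 0" by simp
  qed
  have "poly p (\<alpha> i) = 0" if "i < N" for i
  proof -
    have "poly p (\<alpha> i) = (\<Sum>l<N. v $ l * \<alpha> i ^ e l)" by (simp add: p_def poly_sum poly_monom)
    also have "\<dots> = (transpose_mat V *\<^sub>v v) $ i"
      using that v(1) V by (auto simp: V_def scalar_prod_def atLeast0LessThan mult.commute intro!: sum.cong)
    finally show ?thesis using v that by simp
  qed
  hence sub: "\<alpha> ` {..<N} \<subseteq> {x. poly p x = 0}" by auto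
  have "p = 0"
  proof (rule ccontr)
    assume p0: "p \<noteq> 0"
    have "N = card (\<alpha> ` {..<N})" using inj by (simp add: card_image)
    also have "\<dots> \<le> card {x. poly p x = 0}" using sub p0 poly_roots_finite by (intro card_mono) auto
    also have "\<dots> \<le> degree p" using p0 by (rule card_poly_roots_bound)
    finally have "coeff p (degree p) = 0" using cp0 by simp
    with p0 show False by simp
  qed
  hence "v = 0\<^sub>v N" using v(1) cp by (intro eq_vecI) auto
  with v show False by simp
qed

text \<open>The Vandermonde matrix of the roots diagonalises multiplication by \<open>g\<close>.\<close>

lemma mult_mat_similar_diag:
  fixes h :: "'d::comm_ring_1 \<Rightarrow> 'l::field"
  assumes h: "comm_ring_hom h" and P: "lead_coeff P = 1" and N: "degree P = N"
    and inj: "inj_on \<alpha> {..<N}" and root: "\<And>i. i < N \<Longrightarrow> poly (map_poly h P) (\<alpha> i) = 0"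
  shows "similar_mat (map_mat h (mult_mat P g)) (mat N N (\<lambda>(i, j). if i = j then poly (map_poly h g) (\<alpha> i) else 0))"
proof -
  interpret h: comm_ring_hom h by fact
  interpret mp: map_poly_comm_ring_hom h ..
  define M where "M = map_mat h (mult_mat P g)"
  define V where "V = mat N N (\<lambda>(l, i). \<alpha> i ^ l)"
  define D where "D = mat N N (\<lambda>(i, j). if i = j then poly (map_poly h g) (\<alpha> i) else 0)"
  have M: "M \<in> carrier_mat N N" and V: "V \<in> carrier_mat N N" and D: "D \<in> carrier_mat N N"
    using N by (auto simp: M_def V_def D_def mult_mat_def)
  have MV: "M * V = V * D"
  proof (rule eq_matI)
    fix j i assume "j < dim_row (V * D)" "i < dim_col (V * D)"
    hence ji: "j < N" "i < N" by (auto simp: V_def D_def)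
    have "(M * V) $$ (j, i) = (\<Sum>l = 0..<N. h (coeff (mmod P (monom 1 j * g)) l) * \<alpha> i ^ l)"
      using ji N by (simp add: M_def V_def mult_mat_def scalar_prod_def)
    also have "\<dots> = poly (map_poly h (mmod P (monom 1 j * g))) (\<alpha> i)"
      by (subst poly_as_sum_lt(1)[where n = N]) (auto simp: mdiv_mmod(2)[OF P] N atLeast0LessThan)
    also have "\<dots> = poly (map_poly h (monom 1 j * g)) (\<alpha> i)"
      by (subst (2) mdiv_mmod(1)[OF P, of "monom 1 j * g"]) (simp add: mp.hom_add mp.hom_mult root ji)
    also have "\<dots> = \<alpha> i ^ j * poly (map_poly h g) (\<alpha> i)"
      by (simp add: mp.hom_mult poly_monom)
    also have "\<dots> = (V * D) $$ (j, i)"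
      using ji by (auto simp: V_def D_def scalar_prod_def if_distrib[of "\<lambda>x. _ * x"] cong: if_cong)
    finally show "(M * V) $$ (j, i) = (V * D) $$ (j, i)" .
  qed (auto simp: M_def V_def D_def mult_mat_def N)
  have "det V \<noteq> 0" unfolding V_def
    using vandermonde_nonzero[OF inj, of id] by (simp add: id_def bij_betw_def)
  hence "V \<in> Units (ring_mat TYPE('l) N ())" by (rule det_non_zero_imp_unit[OF V])
  then obtain W where W: "W \<in> carrier_mat N N" "V * W = 1\<^sub>m N" "W * V = 1\<^sub>m N"
    by (auto simp: Units_def ring_mat_simps)
  have "V * D * W = M * (V * W)" unfolding MV[symmetric] using M V W by (simp add: assoc_mult_mat)
  hence "M = V * D * W" using M W by simp
  thus ?thesis unfolding M_def[symmetric] D_def[symmetric] using M V W D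
    by (intro similar_matI[where n = N and P = V and Q = W]) auto
qed

lemma norm_det:
  fixes h :: "'d::comm_ring_1 \<Rightarrow> 'l::field"
  assumes h: "comm_ring_hom h" and P: "lead_coeff P = 1" and N: "degree P = N"
    and inj: "inj_on \<alpha> {..<N}" and root: "\<And>i. i < N \<Longrightarrow> poly (map_poly h P) (\<alpha> i) = 0"
  shows "h (det (mult_mat P g)) = (\<Prod>i<N. poly (map_poly h g) (\<alpha> i))"
    and "map_poly h (char_poly (mult_mat P g)) = (\<Prod>i<N. [:- poly (map_poly h g) (\<alpha> i), 1:])"
proof -
  interpret h: comm_ring_hom h by fact
  define D where "D = mat N N (\<lambda>(i, j). if i = j then poly (map_poly h g) (\<alpha> i) else 0)"
  note sim = mult_mat_similar_diag[OF assms, of g, folded D_def]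
  have D: "D \<in> carrier_mat N N" "upper_triangular D" by (auto simp: D_def)
  have "h (det (mult_mat P g)) = det D"
    using det_similar[OF sim] by simp
  also have "\<dots> = prod_list (diag_mat D)" by (rule det_upper_triangular[OF D(2,1)])
  also have dd: "diag_mat D = map (\<lambda>i. poly (map_poly h g) (\<alpha> i)) [0..<N]"
    by (simp add: diag_mat_def D_def)
  finally show "h (det (mult_mat P g)) = (\<Prod>i<N. poly (map_poly h g) (\<alpha> i))"
    by (simp add: prod.list_conv_set_nth atLeast0LessThan)
  have "map_poly h (char_poly (mult_mat P g)) = char_poly D"
    using char_poly_similar[OF sim] h.char_poly_hom[OF mult_mat_carrier] by simp
  also have "\<dots> = (\<Prod>a\<leftarrow>diag_mat D. [:- a, 1:])" by (rule char_poly_upper_triangular[OF D])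
  finally show "map_poly h (char_poly (mult_mat P g)) = (\<Prod>i<N. [:- poly (map_poly h g) (\<alpha> i), 1:])"
    by (simp add: dd prod.list_conv_set_nth atLeast0LessThan)
qed

section \<open>Moebius inversion\<close>

lemma moebius_1: "moebius 1 = 1" by (simp add: moebius_def)

lemma moebius_prime_mult:
  assumes q: "prime q" and nd: "\<not> q dvd d" and d0: "d > 0"
  shows "moebius (q * d) = - moebius d"
proof -
  have cop: "coprime q d" using q nd by (rule prime_imp_coprime)
  have sf: "squarefree (q * d) \<longleftrightarrow> squarefree d"
    using cop q by (auto intro: squarefree_mult_coprime squarefree_prime dest: squarefree_multD)
  have "prime_factors (q * d) = insert q (prime_factors d)"
    using q d0 by (subst prime_factors_product) (auto simp: prime_prime_factors)
  moreover have "q \<notin> prime_factors d" using nd by auto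
  ultimately show ?thesis by (simp add: moebius_def sf)
qed

lemma sum_moebius_divisors:
  assumes "n > 1"
  shows "(\<Sum>d | d dvd n. moebius d) = 0"
proof -
  obtain q where q: "prime q" "q dvd n" using assms prime_factor_nat[of n] by auto
  define A where "A = {d. d dvd n \<and> \<not> q dvd d}"
  define C where "C = {d. d dvd n \<and> q\<^sup>2 dvd d}"
  have fin: "finite {d. d dvd n}" using assms by simp
  have D: "{d. d dvd n} = A \<union> (*) q ` A \<union> C"
  proof (intro equalityI subsetI)
    fix d assume d: "d \<in> {d. d dvd n}"
    show "d \<in> A \<union> (*) q ` A \<union> C"
    proof (cases "d \<in> A \<or> d \<in> C")
      case False
      with d obtain e where e: "d = q * e" by (auto simp: A_def)
      with False d have "\<not> q dvd e" by (auto simp: C_def power2_eq_square)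
      with e d have "e \<in> A" by (auto simp: A_def intro: dvd_mult_right)
      with e show ?thesis by auto
    qed auto
  next
    fix d assume "d \<in> A \<union> (*) q ` A \<union> C"
    moreover have "q * e dvd n" if "e \<in> A" for e
      using that q by (intro divides_mult) (auto simp: A_def intro: prime_imp_coprime)
    ultimately show "d \<in> {d. d dvd n}" by (auto simp: A_def C_def)
  qed
  have fA: "finite A" and fC: "finite C" using fin by (auto simp: A_def C_def elim: finite_subset[rotated])
  have mC: "moebius d = 0" if "d \<in> C" for d
  proof -
    have "q\<^sup>2 dvd d" using that by (simp add: C_def)
    moreover have "\<not> is_unit q" using q(1) not_prime_unit by blast
    ultimately have "\<not> squarefree d" by (auto simp: squarefree_def)
    thus ?thesis by (simp add: moebius_def)
  qed
  have q0: "q > 0" using q(1) prime_gt_0_nat by blast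
  have "(\<Sum>d | d dvd n. moebius d) = (\<Sum>d\<in>A \<union> (*) q ` A. moebius d) + (\<Sum>d\<in>C - (A \<union> (*) q ` A). moebius d)"
    unfolding D using fA fC by (subst sum.union_disjoint[symmetric]) (auto intro: arg_cong[of _ _ "sum moebius"])
  also have "(\<Sum>d\<in>C - (A \<union> (*) q ` A). moebius d) = 0" using mC by (intro sum.neutral) auto
  also have "(\<Sum>d\<in>A \<union> (*) q ` A. moebius d) = (\<Sum>d\<in>A. moebius d) + (\<Sum>d\<in>(*) q ` A. moebius d)"
    using fA by (intro sum.union_disjoint) (auto simp: A_def)
  also have "(\<Sum>d\<in>(*) q ` A. moebius d) = (\<Sum>d\<in>A. moebius (q * d))"
    using q0 by (subst sum.reindex) (auto simp: inj_on_def)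
  also have "\<dots> = (\<Sum>d\<in>A. - moebius d)"
  proof (rule sum.cong[OF refl])
    fix d assume "d \<in> A"
    hence "\<not> q dvd d" "d > 0" using assms by (auto simp: A_def intro: Nat.gr0I)
    thus "moebius (q * d) = - moebius d" using q(1) by (intro moebius_prime_mult)
  qed
  finally show ?thesis by (simp add: sum_negf)
qed

lemma prod_power_int: "(\<Prod>x\<in>A. f x) powi k = (\<Prod>x\<in>A. f x powi k)" for f :: "_ \<Rightarrow> 'f::field"
  by (induction A rule: infinite_finite_induct) (auto simp: power_int_mult_distrib)

lemma power_int_sum: "x \<noteq> 0 \<Longrightarrow> (\<Prod>a\<in>A. x powi f a) = x powi (\<Sum>a\<in>A. f a)" for x :: "'f::field"
  by (induction A rule: infinite_finite_induct) (auto simp: power_int_add)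

lemma moebius_inversion_prod:
  fixes \<phi> :: "nat \<Rightarrow> 'f::field"
  assumes n: "n > 0" and nz: "\<And>d. d dvd n \<Longrightarrow> \<phi> d \<noteq> 0"
  shows "(\<Prod>d | d dvd n. (\<Prod>e | e dvd d. \<phi> e) powi moebius (n div d)) = \<phi> n"
proof -
  let ?D = "{d. d dvd n}"
  have fin: "finite ?D" using n by simp
  have "(\<Prod>d\<in>?D. (\<Prod>e | e dvd d. \<phi> e) powi moebius (n div d))
      = (\<Prod>d\<in>?D. \<Prod>e\<in>?D. \<phi> e powi (if e dvd d then moebius (n div d) else 0))"
  proof (rule prod.cong[OF refl])
    fix d assume d: "d \<in> ?D"
    have "(\<Prod>e | e dvd d. \<phi> e) powi moebius (n div d) = (\<Prod>e | e dvd d. \<phi> e powi moebius (n div d))"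
      by (rule prod_power_int)
    also have "\<dots> = (\<Prod>e | e dvd d. \<phi> e powi (if e dvd d then moebius (n div d) else 0))"
      by (intro prod.cong) auto
    also have "\<dots> = (\<Prod>e\<in>?D. \<phi> e powi (if e dvd d then moebius (n div d) else 0))"
      using fin d by (intro prod.mono_neutral_left) (auto intro: dvd_trans)
    finally show "(\<Prod>e | e dvd d. \<phi> e) powi moebius (n div d)
      = (\<Prod>e\<in>?D. \<phi> e powi (if e dvd d then moebius (n div d) else 0))" .
  qed
  also have "\<dots> = (\<Prod>e\<in>?D. \<Prod>d\<in>?D. \<phi> e powi (if e dvd d then moebius (n div d) else 0))"
    by (rule prod.swap)
  also have "\<dots> = (\<Prod>e\<in>?D. if e = n then \<phi> e else 1)"
  proof (rule prod.cong[OF refl])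
    fix e assume e: "e \<in> ?D"
    have "(\<Prod>d\<in>?D. \<phi> e powi (if e dvd d then moebius (n div d) else 0))
      = \<phi> e powi (\<Sum>d\<in>?D. if e dvd d then moebius (n div d) else 0)"
      using nz e by (intro power_int_sum) auto
    also have "(\<Sum>d\<in>?D. if e dvd d then moebius (n div d) else 0) = (\<Sum>d | d dvd n \<and> e dvd d. moebius (n div d))"
      using fin by (intro sum.mono_neutral_cong_right) auto
    also have "\<dots> = (\<Sum>k | k dvd n div e. moebius k)"
    proof (rule sum.reindex_bij_witness[of _ "\<lambda>k. n div k" "\<lambda>d. n div d"])
      fix d assume d: "d \<in> {d. d dvd n \<and> e dvd d}"
      then obtain u where u: "n = d * u" by auto
      from d obtain v where v: "d = e * v" by auto
      have pos: "d > 0" "u > 0" "v > 0" "e > 0" using n u v by (auto intro: Nat.gr0I)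
      show "n div (n div d) = d" using u pos by simp
      show "n div d \<in> {k. k dvd n div e}" using u v pos by (simp add: mult.assoc)
      show "moebius (n div d) = moebius (n div d)" ..
    next
      fix k assume "k \<in> {k. k dvd n div e}"
      then obtain w where w: "n div e = k * w" by auto
      hence nn: "n = e * (k * w)" using e by (metis dvd_mult_div_cancel mem_Collect_eq)
      hence pos: "e > 0" "k > 0" "w > 0" using n by (auto intro: Nat.gr0I)
      have nk: "n div k = e * w" using nn pos by (simp add: mult.left_commute)
      show "n div k \<in> {d. d dvd n \<and> e dvd d}" unfolding nk using nn by (simp add: mult.left_commute)
      show "n div (n div k) = k" unfolding nk using nn pos by (simp add: mult.commute mult.left_commute)
    qed
    also have "\<dots> = (if e = n then 1 else 0)"
    proof (cases "e = n")
      case True thus ?thesis using n moebius_1 by simp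
    next
      case False
      from e obtain w where w: "n = e * w" by auto
      hence "w > 1" "e > 0" using False n by (auto intro!: Nat.gr0I Suc_lessI)
      thus ?thesis using sum_moebius_divisors[of w] False w by simp
    qed
    finally show "(\<Prod>d\<in>?D. \<phi> e powi (if e dvd d then moebius (n div d) else 0)) = (if e = n then \<phi> e else 1)"
      by simp
  qed
  also have "\<dots> = \<phi> n" using fin by (simp add: prod.delta)
  finally show ?thesis .
qed

section \<open>Separable polynomials\<close>

lemma prod_linear_dvd:
  fixes p :: "'a::field poly"
  assumes "finite A" "\<And>a. a \<in> A \<Longrightarrow> poly p a = 0"
  shows "(\<Prod>a\<in>A. [:-a, 1:]) dvd p"
  using assms
proof (induction A arbitrary: p rule: finite_induct)
  case (insert a A)
  then have "[:-a, 1:] dvd p" by (simp only: poly_eq_0_iff_dvd insertI1)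
  then obtain q where q: "p = [:-a, 1:] * q" ..
  have "poly q b = 0" if "b \<in> A" for b
    using insert.prems[of b] insert.hyps that by (auto simp: q)
  hence "(\<Prod>a\<in>A. [:-a, 1:]) dvd q" by (rule insert.IH)
  thus ?case using insert.hyps unfolding q by (simp add: mult_dvd_mono del: mult_pCons_left)
qed auto

lemma monic_separable_eq_prod:
  fixes p :: "'a::alg_closed_field poly"
  assumes p: "lead_coeff p = 1" and sep: "\<And>a. poly p a = 0 \<Longrightarrow> poly (pderiv p) a \<noteq> 0"
  shows "p = (\<Prod>a | poly p a = 0. [:-a, 1:])"
proof -
  have p0: "p \<noteq> 0" using p by auto
  have fin: "finite {a. poly p a = 0}" by (rule poly_roots_finite[OF p0])
  obtain s where s: "p = (\<Prod>a | poly p a = 0. [:-a, 1:]) * s"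
    using prod_linear_dvd[OF fin, of p] unfolding dvd_def by auto
  have "degree s = 0"
  proof (rule ccontr)
    assume "degree s \<noteq> 0"
    then obtain c where c: "poly s c = 0" using alg_closed_imp_poly_has_root[of s] by auto
    hence c': "poly p c = 0" by (subst s) simp
    have "poly (pderiv p) c = 0"
      by (subst s) (use c c' fin in \<open>simp add: pderiv_mult poly_prod prod_zero_iff\<close>)
    with sep[OF c'] show False by simp
  qed
  then obtain k where k: "s = [:k:]" by (rule degree_eq_zeroE)
  have "lead_coeff (\<Prod>a | poly p a = 0. [:-a, 1:]) = 1" by (simp add: lead_coeff_prod)
  moreover have "lead_coeff p = lead_coeff (\<Prod>a | poly p a = 0. [:-a, 1:]) * lead_coeff s"
    using arg_cong[OF s, of "\<lambda>q. lead_coeff q"] by (simp only: lead_coeff_mult)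
  ultimately have "k = 1" using p k by simp
  with k s show ?thesis by simp
qed

section \<open>Factorisation by exact order\<close>

text \<open>A common pattern: the roots of \<open>P\<^sub>n\<close> are the elements whose order divides \<open>n\<close>. Splitting them by
  exact order factors \<open>P\<^sub>n\<close>, and the factors have coefficients in the ring of coefficients of the
  \<open>P\<^sub>n\<close>, because division by a monic polynomial does not leave that ring. The pattern
  covers both the dynatomic and the cyclotomic polynomials.\<close>

locale order_graded_roots = inj_comm_ring_hom h for h :: "'u::idom \<Rightarrow> 'k::field" +
  fixes Fx :: "nat \<Rightarrow> 'k set" and P :: "nat \<Rightarrow> 'u poly"
  assumes Fx_gcd: "x \<in> Fx a \<Longrightarrow> x \<in> Fx b \<Longrightarrow> x \<in> Fx (gcd a b)"
    and Fx_dvd: "a dvd b \<Longrightarrow> Fx a \<subseteq> Fx b"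
    and Fx_finite: "n \<ge> 1 \<Longrightarrow> finite (Fx n)"
    and P_Fx: "n \<ge> 1 \<Longrightarrow> map_poly h (P n) = (\<Prod>x\<in>Fx n. [:-x, 1:])"
begin

definition Ex :: "nat \<Rightarrow> 'k set" where
  "Ex n = {x \<in> Fx n. \<forall>k. 0 < k \<and> k < n \<longrightarrow> x \<notin> Fx k}"

lemma Ex_Fx: "Ex n \<subseteq> Fx n" by (auto simp: Ex_def)

lemma Ex_dvd: assumes "x \<in> Ex d" "d \<ge> 1" "x \<in> Fx n" shows "d dvd n"
proof -
  have f: "x \<in> Fx (gcd d n)" using assms Ex_Fx by (intro Fx_gcd) auto
  have "gcd d n > 0" "gcd d n \<le> d" using assms(2) by (auto intro!: dvd_imp_le)
  moreover have "\<not> (0 < gcd d n \<and> gcd d n < d)"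
    using assms(1) f unfolding Ex_def by blast
  ultimately have "gcd d n = d" by simp
  thus ?thesis using gcd_dvd2[of d n] by simp
qed

lemma Fx_eq_Union: assumes "n \<ge> 1" shows "Fx n = (\<Union>d\<in>{d. d dvd n}. Ex d)"
proof (intro equalityI subsetI)
  fix x assume a: "x \<in> Fx n"
  define d where "d = (LEAST d. d > 0 \<and> x \<in> Fx d)"
  have d: "d > 0 \<and> x \<in> Fx d" unfolding d_def by (rule LeastI[of _ n]) (use a assms in auto)
  have "x \<notin> Fx k" if "0 < k" "k < d" for k using not_less_Least[of k "\<lambda>d. d > 0 \<and> x \<in> Fx d"] that
    by (auto simp: d_def)
  hence p: "x \<in> Ex d" using d by (auto simp: Ex_def)
  moreover have "d dvd n" using Ex_dvd[OF p _ a] d by simp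
  ultimately show "x \<in> (\<Union>d\<in>{d. d dvd n}. Ex d)" by auto
next
  fix x assume "x \<in> (\<Union>d\<in>{d. d dvd n}. Ex d)"
  then obtain d where "d dvd n" "x \<in> Ex d" by auto
  thus "x \<in> Fx n" using Fx_dvd[of d n] Ex_Fx[of d] by auto
qed

lemma finite_Ex: "n \<ge> 1 \<Longrightarrow> finite (Ex n)"
  using Fx_finite Ex_Fx finite_subset by blast

lemma Ex_disjoint: assumes "a \<ge> 1" "b \<ge> 1" "a \<noteq> b" shows "Ex a \<inter> Ex b = {}"
proof (rule ccontr)
  assume "\<not> ?thesis"
  then obtain x where x: "x \<in> Ex a" "x \<in> Ex b" by auto
  have "a dvd b" "b dvd a"
    using Ex_dvd[OF x(1) assms(1), of b] Ex_dvd[OF x(2) assms(2), of a] x Ex_Fx by auto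
  with assms show False by (auto dest: dvd_antisym)
qed

lemma map_poly_hom_prod': "map_poly h (prod f A) = (\<Prod>x\<in>A. map_poly h (f x))"
proof -
  interpret mp: map_poly_comm_ring_hom h ..
  show ?thesis by (rule mp.hom_prod)
qed

lemma exact_factor_exists:
  "n \<ge> 1 \<Longrightarrow> \<exists>Q. lead_coeff Q = 1 \<and> map_poly h Q = (\<Prod>\<alpha>\<in>Ex n. [:-\<alpha>, 1:])"
proof (induction n rule: less_induct)
  case (less n)
  interpret mp: map_poly_inj_comm_ring_hom h ..
  let ?D = "{d. d dvd n \<and> d \<noteq> n}"
  have fin: "finite {d. d dvd n}" using less.prems by simp
  hence finD: "finite ?D" by simp
  have D: "d < n" "d \<ge> 1" if "d \<in> ?D" for d
    using that less.prems dvd_imp_le[of d n] by (auto intro: Suc_leI Nat.gr0I)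
  hence "\<forall>d\<in>?D. \<exists>Q. lead_coeff Q = 1 \<and> map_poly h Q = (\<Prod>\<alpha>\<in>Ex d. [:-\<alpha>, 1:])"
    using less.IH by blast
  from bchoice[OF this] obtain Q where Q': "\<forall>d\<in>?D. lead_coeff (Q d) = 1 \<and> map_poly h (Q d) = (\<Prod>\<alpha>\<in>Ex d. [:-\<alpha>, 1:])" ..
  hence Q: "\<And>d. d \<in> ?D \<Longrightarrow> lead_coeff (Q d) = 1"
      "\<And>d. d \<in> ?D \<Longrightarrow> map_poly h (Q d) = (\<Prod>\<alpha>\<in>Ex d. [:-\<alpha>, 1:])"
    by auto
  have FU: "Fx n = (\<Union>d\<in>?D. Ex d) \<union> Ex n" using Fx_eq_Union[OF less.prems] less.prems by auto
  have "Ex d \<inter> Ex n = {}" if "d \<in> ?D" for d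
    using Ex_disjoint[of d n] D[OF that] less.prems by simp
  hence disj: "(\<Union>d\<in>?D. Ex d) \<inter> Ex n = {}" by blast
  have fPd: "\<forall>d\<in>?D. finite (Ex d)" using D finite_Ex by simp
  have finP: "finite (\<Union>d\<in>?D. Ex d)" "finite (Ex n)"
    using finD fPd finite_Ex[OF less.prems] by (auto intro: finite_UN_I)
  have "(\<Prod>\<alpha>\<in>Fx n. [:-\<alpha>, 1:]) = (\<Prod>\<alpha>\<in>(\<Union>d\<in>?D. Ex d). [:-\<alpha>, 1:]) * (\<Prod>\<alpha>\<in>Ex n. [:-\<alpha>, 1:])"
    unfolding FU by (rule prod.union_disjoint[OF finP disj])
  also have "(\<Prod>\<alpha>\<in>(\<Union>d\<in>?D. Ex d). [:-\<alpha>, 1:]) = (\<Prod>d\<in>?D. \<Prod>\<alpha>\<in>Ex d. [:-\<alpha>, 1:])"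
    using finD fPd D Ex_disjoint by (intro prod.UNION_disjoint) simp_all
  also have "\<dots> = map_poly h (\<Prod>d\<in>?D. Q d)" using Q by (simp add: map_poly_hom_prod')
  finally have eq: "map_poly h (P n) = map_poly h (\<Prod>d\<in>?D. Q d) * (\<Prod>\<alpha>\<in>Ex n. [:-\<alpha>, 1:])"
    using P_Fx[OF less.prems] by simp
  moreover have "lead_coeff (\<Prod>d\<in>?D. Q d) = 1" using Q by (simp add: lead_coeff_prod)
  ultimately obtain s where s: "map_poly h s = (\<Prod>\<alpha>\<in>Ex n. [:-\<alpha>, 1:])"
    using monic_quotient_descends by blast
  have "h (lead_coeff s) = lead_coeff (\<Prod>\<alpha>\<in>Ex n. [:-\<alpha>, 1:])" unfolding s[symmetric] by simp
  also have "\<dots> = 1" by (simp add: lead_coeff_prod)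
  finally have "lead_coeff s = 1" by simp
  with s show ?case by blast
qed

definition exact_factor :: "nat \<Rightarrow> 'u poly" where
  "exact_factor n = (SOME Q. lead_coeff Q = 1 \<and> map_poly h Q = (\<Prod>\<alpha>\<in>Ex n. [:-\<alpha>, 1:]))"

lemma exact_factor: assumes "n \<ge> 1" shows "lead_coeff (exact_factor n) = 1" "map_poly h (exact_factor n) = (\<Prod>\<alpha>\<in>Ex n. [:-\<alpha>, 1:])"
  using someI_ex[OF exact_factor_exists[OF assms]] unfolding exact_factor_def by auto

lemma P_eq_prod: assumes n: "n \<ge> 1" shows "P n = (\<Prod>d | d dvd n. exact_factor d)"
proof -
  interpret mp: map_poly_inj_comm_ring_hom h ..
  have fin: "finite {d. d dvd n}" using n by simp
  have pos: "d \<ge> 1" if "d dvd n" for d using that n by (auto intro: Suc_leI Nat.gr0I)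
  have "map_poly h (P n) = (\<Prod>\<alpha>\<in>(\<Union>d\<in>{d. d dvd n}. Ex d). [:-\<alpha>, 1:])"
    using P_Fx[OF n] Fx_eq_Union[OF n] by simp
  also have "\<dots> = (\<Prod>d | d dvd n. \<Prod>\<alpha>\<in>Ex d. [:-\<alpha>, 1:])"
    using fin pos finite_Ex Ex_disjoint by (intro prod.UNION_disjoint) simp_all
  also have "\<dots> = map_poly h (\<Prod>d | d dvd n. exact_factor d)" using exact_factor pos by (simp add: map_poly_hom_prod')
  finally show ?thesis by (simp only: mp.eq_iff)
qed


end

section \<open>Iterates\<close>

lemma emb_hom: "emb 0 = 0" "emb 1 = 1" "emb (x + y) = emb x + emb y" "emb (x * y) = emb x * emb y"
  by (simp_all add: emb_def of_int_poly_hom.hom_add of_int_poly_hom.hom_mult)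

lemma emb_0_imp: "emb x = 0 \<Longrightarrow> x = 0"
  by (simp add: emb_def)

interpretation emb: inj_idom_hom emb
  by unfold_locales (fact emb_hom emb_0_imp)+

interpretation embp: map_poly_inj_idom_hom emb ..

lemma pcompose_diff_dvd: "u - v dvd pcompose g u - pcompose g v" for u v :: "'a::comm_ring_1 poly"
proof (induction g)
  case (pCons a g)
  have "pcompose (pCons a g) u - pcompose (pCons a g) v
     = (u - v) * pcompose g u + v * (pcompose g u - pcompose g v)"
    by (simp add: pcompose_pCons algebra_simps)
  with pCons show ?case by simp
qed simp

lemma pcompose_X [simp]: "pcompose p (pCons 0 1) = p" for p :: "'a::comm_ring_1 poly"
  by (induction p) (auto simp: pcompose_pCons)

locale unicritical =
  fixes m :: nat
  assumes m2: "2 \<le> m"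
begin

abbreviation F where "F \<equiv> fc_iter m"
abbreviation \<Psi> where "\<Psi> \<equiv> Psi m"
abbreviation \<Phi> where "\<Phi> \<equiv> dynatomic m"

lemma F_0 [simp]: "F 0 = [:0, 1:]" by (simp add: fc_iter_def)
lemma F_Suc: "F (Suc k) = pcompose (fc m) (F k)" by (simp add: fc_iter_def)

lemma F_add: "F (a + b) = pcompose (F a) (F b)"
  by (induction a) (auto simp: F_Suc pcompose_assoc pcompose_pCons)

lemma degree_fc: "degree (fc m) = m" "lead_coeff (fc m) = 1"
proof -
  show d: "degree (fc m) = m" unfolding fc_def using m2
    by (subst degree_add_eq_left) (auto simp: degree_monom_eq)
  show "lead_coeff (fc m) = 1" unfolding d using m2 by (simp add: fc_def coeff_pCons split: nat.split)
qed

lemma degree_F: "degree (F k) = m ^ k" "lead_coeff (F k) = 1"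
proof (induction k)
  case (Suc k)
  { case 1 show ?case using Suc by (simp add: F_Suc degree_fc) }
  { case 2
    have "lead_coeff (pcompose (fc m) (F k)) = 1"
      using Suc m2 degree_fc by (subst lead_coeff_comp) auto
    thus ?case by (simp add: F_Suc) }
qed simp_all

lemma degree_Psi: assumes "n \<ge> 1" shows "degree (\<Psi> n) = m ^ n" "lead_coeff (\<Psi> n) = 1"
proof -
  have "1 < m ^ n" using m2 assms by (intro one_less_power) auto
  hence d: "degree (F n) > degree [:0, 1 :: int poly:]" using degree_F[of n] by simp
  have "\<Psi> n = F n + - [:0, 1:]" by (simp only: Psi_def diff_conv_add_uminus)
  moreover have "degree (F n + - [:0, 1:]) = degree (F n)"
    using d by (intro degree_add_eq_left) (simp only: degree_minus)
  ultimately show dP: "degree (\<Psi> n) = m ^ n" by (simp only: degree_F)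
  have "coeff [:0, 1 :: int poly:] (degree (F n)) = 0" using d by (intro coeff_eq_0)
  thus "lead_coeff (\<Psi> n) = 1" unfolding dP using degree_F[of n] by (simp add: Psi_def)
qed

lemma Psi_emb_nonzero: assumes "n \<ge> 1" shows "map_poly emb (\<Psi> n) \<noteq> 0"
  using emb.degree_map_poly_monic(2)[OF degree_Psi(2)[OF assms]] by auto

lemma Psi_add: "\<Psi> a dvd \<Psi> (b + a) - \<Psi> b"
  using pcompose_diff_dvd[of "F a" "[:0,1:]" "F b"] by (simp add: Psi_def F_add pcompose_idR)

lemma Psi_0 [simp]: "\<Psi> 0 = 0" by (simp add: Psi_def)

lemma Psi_add_ideal:
  assumes J: "is_ideal J" and a: "\<Psi> a \<in> J"
  shows "\<Psi> (b + a) \<in> J \<longleftrightarrow> \<Psi> b \<in> J"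
proof -
  obtain k where "\<Psi> (b + a) - \<Psi> b = \<Psi> a * k" using Psi_add[of a b] by (auto elim: dvdE)
  hence e: "\<Psi> (b + a) = \<Psi> b + \<Psi> a * k" "\<Psi> b = \<Psi> (b + a) - \<Psi> a * k" by (auto simp: algebra_simps)
  have k: "\<Psi> a * k \<in> J" using J a by (rule is_ideal_multr)
  show ?thesis
    using is_ideal_add[OF J _ k, of "\<Psi> b"] is_ideal_diff[OF J _ k, of "\<Psi> (b + a)"] unfolding e(1)[symmetric] e(2)[symmetric]
    by blast
qed

lemma Psi_mult_ideal:
  assumes J: "is_ideal J" and a: "\<Psi> a \<in> J"
  shows "\<Psi> (b + k * a) \<in> J \<longleftrightarrow> \<Psi> b \<in> J"
proof (induction k)
  case (Suc k)
  have "b + Suc k * a = (b + k * a) + a" by simp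
  thus ?case using Psi_add_ideal[OF J a, of "b + k * a"] Suc by metis
qed simp

lemma Psi_gcd_ideal:
  assumes J: "is_ideal J"
  shows "\<Psi> a \<in> J \<Longrightarrow> \<Psi> b \<in> J \<Longrightarrow> \<Psi> (gcd a b) \<in> J"
proof (induction a b rule: gcd_nat_induct)
  case (step a b)
  have "a mod b + (a div b) * b = a" by simp
  hence "\<Psi> (a mod b) \<in> J" using Psi_mult_ideal[OF J step(4), of "a mod b" "a div b"] step(3) by simp
  thus ?case using step by (simp add: gcd_red_nat[of a b])
qed simp

lemma Psi_dvd: "a dvd b \<Longrightarrow> \<Psi> a dvd \<Psi> b"
proof -
  assume "a dvd b" then obtain k where "b = a * k" ..
  hence b: "b = k * a" by simp
  have J: "is_ideal {x. \<Psi> a dvd x}" by (auto simp: is_ideal_def)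
  from Psi_mult_ideal[OF J, of a 0 k] b show ?thesis by simp
qed

lemma pderiv_F: "pderiv (F n) = (\<Prod>i<n. of_nat m * F i ^ (m - 1))"
proof (induction n)
  case (Suc n)
  have "pderiv (fc m) = monom (of_nat m) (m - 1)"
    by (simp add: fc_def pderiv_add pderiv_monom pderiv_pCons)
  also have "\<dots> = [:of_nat m:] * [:0, 1:] ^ (m - 1)" by (simp add: monom_altdef)
  also have "[:of_nat m:] = (of_nat m :: int poly poly)" by (simp only: of_nat_poly[where 'a = "int poly"])
  finally have "pderiv (fc m) = of_nat m * [:0, 1:] ^ (m - 1)" .
  thus ?case
    by (simp add: F_Suc pderiv_pcompose Suc pcompose_mult pcompose_hom.hom_power pcompose_pCons pcompose_hom.hom_of_nat mult.commute)
qed (simp add: pderiv_pCons)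

lemma pderiv_F_mult: "n \<ge> 1 \<Longrightarrow> of_nat m dvd pderiv (F n)"
  unfolding pderiv_F by (rule dvd_trans[OF _ dvd_prodI[of _ 0]]) auto

section \<open>Separability and cycles over the algebraic closure of $\mathbb{Q}(c)$\<close>

text \<open>A common root of \<open>\<Psi>\<close> and its derivative would give a monic common factor of positive
  degree, but the derivative is \<open>-1\<close> modulo \<open>m\<close>.\<close>

text \<open>A point with multiplier \<open>1\<close> would make the multiplier, a multiple of \<open>m\<close>, a unit modulo the primes dividing \<open>m\<close>;
  so all periodic points over \<open>\<rat>(c)\<close> are simple roots.\<close>

lemma multiplier_ne_1:
  assumes n: "n \<ge> 1" and root: "poly (map_poly emb (\<Psi> n)) \<beta> = 0"
  shows "poly (map_poly emb (pderiv (F n))) \<beta> \<noteq> 1"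
proof
  assume one: "poly (map_poly emb (pderiv (F n))) \<beta> = 1"
  let ?P = "\<Psi> n" and ?D = "pderiv (\<Psi> n)"
  have D: "?D = pderiv (F n) - 1" by (simp add: Psi_def pderiv_diff pderiv_pCons)
  have rootD: "poly (map_poly emb ?D) \<beta> = 0" using one by (simp add: D embp.hom_minus)
  note ne = Psi_emb_nonzero[OF n]
  have "[:-\<beta>, 1:] dvd gcd (map_poly emb ?P) (map_poly emb ?D)"
    using root rootD by (simp add: poly_eq_0_iff_dvd)
  moreover have "gcd (map_poly emb ?P) (map_poly emb ?D) \<noteq> 0" using ne by simp
  ultimately have "degree [:-\<beta>, 1:] \<le> degree (gcd (map_poly emb ?P) (map_poly emb ?D))"
    by (rule dvd_imp_degree_le)
  hence "resultant (map_poly emb ?P) (map_poly emb ?D) = 0" by (subst resultant_0_gcd) simp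
  hence "resultant ?P ?D = 0" by (simp add: emb.resultant_hom)
  hence dg: "degree (gcd ?P ?D) \<noteq> 0" by (simp add: resultant_0_gcd)
  define g where "g = gcd ?P ?D"
  obtain s where s: "?P = g * s" unfolding g_def by (meson dvdE gcd_dvd1)
  obtain e where e: "?D = g * e" unfolding g_def by (meson dvdE gcd_dvd2)
  have lc: "lead_coeff g * lead_coeff s = 1" using degree_Psi(2)[OF n] unfolding s lead_coeff_mult .
  define P where "P = smult (lead_coeff s) g"
  have ls: "lead_coeff s \<noteq> 0"
  proof
    assume "lead_coeff s = 0"
    with lc show False by (simp only: mult_zero_right zero_neq_one)
  qed
  have P: "lead_coeff P = 1" using lc ls by (simp add: P_def mult.commute)
  have dP: "degree P \<noteq> 0" using dg ls by (simp add: P_def g_def)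
  have e': "?D = P * smult (lead_coeff g) e"
    using e lc by (simp only: P_def mult_smult_left mult_smult_right smult_smult mult.commute[of "lead_coeff s"] smult_1_left)
  have "mmod P (-1) = -1"
    using dP by (intro mdiv_mmod_eqI[where Q = 0] P) (auto simp: coeff_1)
  moreover have "mmod P ?D = 0" unfolding e' by (rule mmod_multiple[OF P])
  ultimately have "mmod P (pderiv (F n)) = 1"
    using mmod_diff[OF P, of ?D "-1"] by (simp add: D)
  moreover have I: "is_ideal {q :: int poly. of_nat m dvd q}" by (auto simp: is_ideal_def)
  have "pderiv (F n) \<in> poly_ideal {q. of_nat m dvd q}"
  proof -
    obtain y where "pderiv (F n) = of_nat m * y" using pderiv_F_mult[OF n] by (auto elim: dvdE)
    thus ?thesis by (auto simp: poly_ideal_def of_nat_poly intro!: dvdI)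
  qed
  ultimately have "1 \<in> poly_ideal {q :: int poly. of_nat m dvd q}" using mmod_ideal[OF I P] by metis
  hence "of_nat m dvd (1 :: int poly)" by (auto simp: poly_ideal_def dest: spec[of _ 0])
  hence "of_nat m dvd (1 :: int)" by (simp add: of_nat_poly const_poly_dvd_1)
  thus False using m2 by simp
qed

definition fL :: "Qc_bar \<Rightarrow> Qc_bar" where "fL y = y ^ m + emb [:0, 1:]"

lemma poly_F: 
  assumes "comm_ring_hom h"
  shows "poly (map_poly h (F k)) y = ((\<lambda>y. y ^ m + h [:0, 1:]) ^^ k) y"
proof (induction k)
  interpret comm_ring_hom h by fact
  interpret mp: map_poly_comm_ring_hom h ..
  { case 0 show ?case by simp }
  { case (Suc k)
    have "map_poly h (fc m) = monom 1 m + [:h [:0,1:]:]" by (simp add: fc_def mp.hom_add)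
    thus ?case using Suc by (simp add: F_Suc map_poly_pcompose poly_pcompose poly_monom) }
qed

lemma poly_F_L: "poly (map_poly emb (F k)) y = (fL ^^ k) y"
proof -
  have "fL = (\<lambda>y. y ^ m + emb [:0, 1:])" by (simp add: fL_def fun_eq_iff)
  thus ?thesis using poly_F[OF emb.comm_ring_hom_axioms] by simp
qed

definition Fix :: "nat \<Rightarrow> Qc_bar set" where "Fix n = {\<alpha>. (fL ^^ n) \<alpha> = \<alpha>}"
lemma poly_Psi_L: "poly (map_poly emb (\<Psi> n)) \<alpha> = (fL ^^ n) \<alpha> - \<alpha>"
  by (simp add: Psi_def embp.hom_minus poly_F_L)

lemma Fix_iff: "\<alpha> \<in> Fix n \<longleftrightarrow> poly (map_poly emb (\<Psi> n)) \<alpha> = 0"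
  by (simp add: Fix_def poly_Psi_L)

lemma is_ideal_root: "comm_ring_hom h \<Longrightarrow> is_ideal {p. poly (map_poly h p) \<alpha> = 0}"
proof -
  assume "comm_ring_hom h" then interpret comm_ring_hom h .
  interpret mp: map_poly_comm_ring_hom h ..
  show ?thesis by (auto simp: is_ideal_def mp.hom_add mp.hom_mult)
qed

lemma Fix_gcd: "\<alpha> \<in> Fix a \<Longrightarrow> \<alpha> \<in> Fix b \<Longrightarrow> \<alpha> \<in> Fix (gcd a b)"
  using Psi_gcd_ideal[OF is_ideal_root[OF emb.comm_ring_hom_axioms, of \<alpha>], of a b] by (simp add: Fix_iff)

lemma Fix_dvd: assumes "a dvd b" shows "Fix a \<subseteq> Fix b"
proof
  obtain k where k: "\<Psi> b = \<Psi> a * k" using Psi_dvd[OF assms] ..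
  fix \<alpha> assume "\<alpha> \<in> Fix a"
  thus "\<alpha> \<in> Fix b" by (simp add: Fix_iff k embp.hom_mult)
qed

lemma finite_Fix: assumes "n \<ge> 1" shows "finite (Fix n)"
  using poly_roots_finite[OF Psi_emb_nonzero[OF assms]]
  by (rule finite_subset[rotated]) (auto simp: Fix_iff)

lemma Psi_L: assumes n: "n \<ge> 1" shows "map_poly emb (\<Psi> n) = (\<Prod>\<alpha>\<in>Fix n. [:-\<alpha>, 1:])"
proof -
  have "map_poly emb (\<Psi> n) = (\<Prod>\<alpha> | poly (map_poly emb (\<Psi> n)) \<alpha> = 0. [:-\<alpha>, 1:])"
  proof (rule monic_separable_eq_prod)
    show "lead_coeff (map_poly emb (\<Psi> n)) = 1"
      by (rule emb.degree_map_poly_monic(2)[OF degree_Psi(2)[OF n]])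
    fix \<alpha> assume r: "poly (map_poly emb (\<Psi> n)) \<alpha> = 0"
    have "map_poly emb (pderiv (\<Psi> n)) = map_poly emb (pderiv (F n)) - 1"
      by (simp add: Psi_def pderiv_diff pderiv_pCons embp.hom_minus)
    thus "poly (pderiv (map_poly emb (\<Psi> n))) \<alpha> \<noteq> 0"
      using multiplier_ne_1[OF n r] by (simp add: emb.map_poly_pderiv)
  qed
  thus ?thesis by (simp only: Fix_iff[symmetric] Collect_mem_eq)
qed

sublocale per: order_graded_roots emb Fix \<Psi>
  by unfold_locales (use Fix_gcd Fix_dvd finite_Fix Psi_L in auto)

abbreviation Per where "Per \<equiv> per.Ex"

lemma Per_iff: "\<alpha> \<in> Per n \<longleftrightarrow> (fL ^^ n) \<alpha> = \<alpha> \<and> (\<forall>k. 0 < k \<and> k < n \<longrightarrow> (fL ^^ k) \<alpha> \<noteq> \<alpha>)"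
  by (simp add: per.Ex_def Fix_def)

lemma dynatomic_eq_exact_factor: assumes n: "n \<ge> 1" shows "\<Phi> n = per.exact_factor n"
proof -
  have pos: "d \<ge> 1" if "d dvd n" for d using that n by (auto intro: Suc_leI Nat.gr0I)
  have nz: "to_fract (per.exact_factor d) \<noteq> 0" if "d dvd n" for d
  proof -
    have "per.exact_factor d \<noteq> 0" using per.exact_factor(1)[OF pos[OF that]] by (intro notI) simp
    thus ?thesis by simp
  qed
  have "(\<Prod>d | d dvd n. to_fract (\<Psi> d) powi moebius (n div d))
     = (\<Prod>d | d dvd n. (\<Prod>e | e dvd d. to_fract (per.exact_factor e)) powi moebius (n div d))"
    using per.P_eq_prod pos by (intro prod.cong) (auto simp: to_fract_hom.hom_prod)
  also have "\<dots> = to_fract (per.exact_factor n)" using n nz by (intro moebius_inversion_prod) auto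
  finally have e: "(\<Prod>d | d dvd n. to_fract (\<Psi> d) powi moebius (n div d)) = to_fract (per.exact_factor n)" .
  show ?thesis unfolding dynatomic_def e by (rule the_equality) auto
qed

lemma dynatomic_L: assumes "n \<ge> 1"
  shows "lead_coeff (\<Phi> n) = 1" "map_poly emb (\<Phi> n) = (\<Prod>\<alpha>\<in>Per n. [:-\<alpha>, 1:])"
  using per.exact_factor[OF assms] dynatomic_eq_exact_factor[OF assms] by auto

lemma Psi_eq_prod: assumes n: "n \<ge> 1" shows "\<Psi> n = (\<Prod>d | d dvd n. \<Phi> d)"
proof -
  have pos: "d \<ge> 1" if "d dvd n" for d using that n by (auto intro: Suc_leI Nat.gr0I)
  show ?thesis unfolding per.P_eq_prod[OF n] using pos dynatomic_eq_exact_factor by (intro prod.cong) auto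
qed

end

section \<open>Norms from the ring of functions on the dynatomic curve\<close>

lemma norm_det_set:
  fixes h :: "'d::comm_ring_1 \<Rightarrow> 'l::field"
  assumes h: "comm_ring_hom h" and P: "lead_coeff P = 1" and Z: "finite Z" "card Z = degree P"
    and root: "\<And>a. a \<in> Z \<Longrightarrow> poly (map_poly h P) a = 0"
  shows "h (det (mult_mat P g)) = (\<Prod>a\<in>Z. poly (map_poly h g) a)"
    and "map_poly h (char_poly (mult_mat P g)) = (\<Prod>a\<in>Z. [:- poly (map_poly h g) a, 1:])"
proof -
  obtain \<beta> where "bij_betw \<beta> {0..<card Z} Z" using ex_bij_betw_nat_finite[OF Z(1)] by auto
  hence b: "bij_betw \<beta> {..<degree P} Z" using Z(2) by (simp add: atLeast0LessThan)
  have r: "poly (map_poly h P) (\<beta> i) = 0" if "i < degree P" for i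
    using root b that by (auto simp: bij_betw_def)
  note N = norm_det[OF h P refl bij_betw_imp_inj_on[OF b] r]
  show "h (det (mult_mat P g)) = (\<Prod>a\<in>Z. poly (map_poly h g) a)"
    using N(1)[of g] prod.reindex_bij_betw[OF b, of "\<lambda>a. poly (map_poly h g) a"] by simp
  show "map_poly h (char_poly (mult_mat P g)) = (\<Prod>a\<in>Z. [:- poly (map_poly h g) a, 1:])"
    using N(2)[of g] prod.reindex_bij_betw[OF b, of "\<lambda>a. [:- poly (map_poly h g) a, 1:]"] by simp
qed

lemma degree_prod_linear: "finite A \<Longrightarrow> degree (\<Prod>a\<in>A. [:- a, 1:] :: 'a::idom poly) = card A"
  by (subst degree_prod_eq_sum_degree) auto

lemma lead_coeff_prod_linear: "lead_coeff (\<Prod>a\<in>A. [:- f a, 1:] :: 'a::idom poly) = 1"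
  by (simp add: lead_coeff_prod)

lemma normalize_prod: "normalize (\<Prod>x\<in>A. f x) = (\<Prod>x\<in>A. normalize (f x))"
  for f :: "_ \<Rightarrow> 'a::normalization_semidom_multiplicative"
  by (induction A rule: infinite_finite_induct) (auto simp: normalize_mult)

context unicritical begin

abbreviation evL :: "int poly poly \<Rightarrow> Qc_bar \<Rightarrow> Qc_bar" where
  "evL g \<alpha> \<equiv> poly (map_poly emb g) \<alpha>"

lemma evL_simps [simp]: "evL (a + b) \<alpha> = evL a \<alpha> + evL b \<alpha>" "evL (a - b) \<alpha> = evL a \<alpha> - evL b \<alpha>"
  "evL (a * b) \<alpha> = evL a \<alpha> * evL b \<alpha>" "evL 1 \<alpha> = 1" "evL 0 \<alpha> = 0" "evL (prod f A) \<alpha> = (\<Prod>x\<in>A. evL (f x) \<alpha>)"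
  "evL (a ^ k) \<alpha> = evL a \<alpha> ^ k" "evL (of_nat i) \<alpha> = of_nat i"
  by (simp_all add: embp.hom_add embp.hom_minus embp.hom_mult embp.hom_prod embp.hom_power embp.hom_of_nat poly_prod)

lemma evL_pcompose_F: "evL (pcompose g (F k)) \<alpha> = evL g ((fL ^^ k) \<alpha>)"
  by (simp add: emb.map_poly_pcompose poly_pcompose poly_F_L)

lemma evL_dynatomic: "n \<ge> 1 \<Longrightarrow> evL (\<Phi> n) \<alpha> = (\<Prod>\<beta>\<in>Per n. \<alpha> - \<beta>)"
  by (simp add: dynatomic_L poly_prod)

lemma root_dynatomic: "n \<ge> 1 \<Longrightarrow> evL (\<Phi> n) \<alpha> = 0 \<longleftrightarrow> \<alpha> \<in> Per n"
  by (auto simp: evL_dynatomic prod_zero_iff per.finite_Ex)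

lemma degree_dynatomic: "n \<ge> 1 \<Longrightarrow> degree (\<Phi> n) = card (Per n)"
  using degree_prod_linear[OF per.finite_Ex, of n] emb.degree_map_poly_hom[of "\<Phi> n"]
  by (simp add: dynatomic_L)

lemma dvd_dynatomic: assumes n: "n \<ge> 1" and z: "\<And>\<alpha>. \<alpha> \<in> Per n \<Longrightarrow> evL g \<alpha> = 0"
  shows "\<Phi> n dvd g"
proof -
  obtain r where "map_poly emb g = (\<Prod>\<alpha>\<in>Per n. [:-\<alpha>, 1:]) * r"
    using prod_linear_dvd[OF per.finite_Ex[OF n], of "map_poly emb g"] z unfolding dvd_def by auto
  then obtain s where "g = \<Phi> n * s"
    using emb.monic_quotient_descends[OF dynatomic_L(1)[OF n], of g r] dynatomic_L(2)[OF n] by auto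
  thus ?thesis by simp
qed

definition N :: "nat \<Rightarrow> int poly poly \<Rightarrow> int poly" where "N n g = det (mult_mat (\<Phi> n) g)"

lemma emb_N: assumes n: "n \<ge> 1" shows "emb (N n g) = (\<Prod>\<alpha>\<in>Per n. evL g \<alpha>)"
  unfolding N_def
  by (rule norm_det_set(1)[OF emb.comm_ring_hom_axioms dynatomic_L(1)[OF n] per.finite_Ex[OF n]])
     (simp_all add: degree_dynatomic[OF n] root_dynatomic[OF n])

lemma emb_char_poly: assumes n: "n \<ge> 1"
  shows "map_poly emb (char_poly (mult_mat (\<Phi> n) g)) = (\<Prod>\<alpha>\<in>Per n. [:- evL g \<alpha>, 1:])"
  by (rule norm_det_set(2)[OF emb.comm_ring_hom_axioms dynatomic_L(1)[OF n] per.finite_Ex[OF n]])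
     (simp_all add: degree_dynatomic[OF n] root_dynatomic[OF n])

lemma N_eqI: "n \<ge> 1 \<Longrightarrow> emb q = (\<Prod>\<alpha>\<in>Per n. evL g \<alpha>) \<Longrightarrow> N n g = q"
  by (metis emb_N emb.eq_iff)

lemma N_mult: "n \<ge> 1 \<Longrightarrow> N n (a * b) = N n a * N n b"
  by (rule N_eqI) (simp_all add: emb.hom_mult emb_N prod.distrib)

lemma N_1 [simp]: "n \<ge> 1 \<Longrightarrow> N n 1 = 1"
  by (rule N_eqI) simp_all

lemma N_power: "n \<ge> 1 \<Longrightarrow> N n (a ^ k) = N n a ^ k"
  by (rule N_eqI) (simp_all add: emb.hom_power emb_N prod_power_distrib)

lemma N_prod: "n \<ge> 1 \<Longrightarrow> N n (\<Prod>x\<in>A. f x) = (\<Prod>x\<in>A. N n (f x))"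
  by (induction A rule: infinite_finite_induct) (auto simp: N_mult)

lemma N_eq_0_iff: "n \<ge> 1 \<Longrightarrow> N n g = 0 \<longleftrightarrow> (\<exists>\<alpha>\<in>Per n. evL g \<alpha> = 0)"
  using emb_N[of n g] emb.hom_0_iff[of "N n g"] by (simp add: prod_zero_iff per.finite_Ex)

lemma N_cong: assumes n: "n \<ge> 1" and d: "\<Phi> n dvd a - b" shows "N n a = N n b"
proof (rule N_eqI[OF n])
  obtain k where k: "a - b = \<Phi> n * k" using d ..
  have "evL a \<alpha> = evL b \<alpha>" if "\<alpha> \<in> Per n" for \<alpha>
    using arg_cong[OF k, of "\<lambda>x. evL x \<alpha>"] root_dynatomic[OF n, of \<alpha>] that by simp
  thus "emb (N n b) = (\<Prod>\<alpha>\<in>Per n. evL a \<alpha>)" using emb_N[OF n, of b] by simp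
qed

lemma N_dvd: assumes n: "n \<ge> 1" and d: "\<Phi> n dvd b - a * k" shows "N n a dvd N n b"
  using N_cong[OF assms] N_mult[OF n] by simp

subsection \<open>The action of the map on the periodic points\<close>

lemma fL_funpow_comm: "(fL ^^ k) (fL x) = fL ((fL ^^ k) x)"
  by (simp add: funpow_swap1)

lemma fL_funpow_funpow: "(fL ^^ a) ((fL ^^ b) x) = (fL ^^ (a + b)) x"
  by (simp add: funpow_add)

lemma fL_Per: assumes n: "n \<ge> 1" and a: "\<alpha> \<in> Per n" shows "fL \<alpha> \<in> Per n"
  unfolding Per_iff
proof (intro conjI allI impI)
  have p: "(fL ^^ n) \<alpha> = \<alpha>" using a by (simp add: Per_iff)
  thus "(fL ^^ n) (fL \<alpha>) = fL \<alpha>" by (simp add: fL_funpow_comm)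
  fix k assume k: "0 < k \<and> k < n"
  show "(fL ^^ k) (fL \<alpha>) \<noteq> fL \<alpha>"
  proof
    assume e: "(fL ^^ k) (fL \<alpha>) = fL \<alpha>"
    have bk: "(fL ^^ (n - 1)) (fL \<alpha>) = \<alpha>"
      using p n funpow_Suc_right[of "n - 1" fL] by (simp add: comp_def fun_eq_iff)
    have "(fL ^^ k) \<alpha> = (fL ^^ k) ((fL ^^ (n - 1)) (fL \<alpha>))" by (simp only: bk)
    also have "\<dots> = (fL ^^ (n - 1)) ((fL ^^ k) (fL \<alpha>))"
      by (simp only: fL_funpow_funpow add.commute)
    also have "\<dots> = \<alpha>" by (simp only: e bk)
    finally show False using a k by (auto simp: Per_iff)
  qed
qed

lemma fL_bij: assumes n: "n \<ge> 1" shows "bij_betw fL (Per n) (Per n)"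
proof -
  have "inj_on fL (Per n)"
  proof (rule inj_onI)
    fix x y assume x: "x \<in> Per n" and y: "y \<in> Per n" and e: "fL x = fL y"
    have "(fL ^^ n) z = (fL ^^ (n - 1)) (fL z)" for z
      using n funpow_Suc_right[of "n - 1" fL] by (simp add: comp_def fun_eq_iff)
    with e have "(fL ^^ n) x = (fL ^^ n) y" by simp
    with x y show "x = y" by (simp add: Per_iff)
  qed
  moreover have "fL ` Per n \<subseteq> Per n" using fL_Per[OF n] by auto
  ultimately show ?thesis using endo_inj_surj[OF per.finite_Ex[OF n]] by (auto simp: bij_betw_def)
qed

lemma funpow_bij: assumes n: "n \<ge> 1" shows "bij_betw (fL ^^ k) (Per n) (Per n)"
proof (induction k)
  case 0 show ?case by (simp add: bij_betw_def inj_on_def)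
next
  case (Suc k) thus ?case using bij_betw_trans[OF Suc fL_bij[OF n]] by (simp add: comp_def)
qed

lemma funpow_Per: "n \<ge> 1 \<Longrightarrow> \<alpha> \<in> Per n \<Longrightarrow> (fL ^^ k) \<alpha> \<in> Per n"
  using funpow_bij[of n k] by (auto simp: bij_betw_def)

lemma N_shift: assumes n: "n \<ge> 1" shows "N n (pcompose g (F k)) = N n g"
proof (rule N_eqI[OF n])
  show "emb (N n g) = (\<Prod>\<alpha>\<in>Per n. evL (pcompose g (F k)) \<alpha>)"
    using prod.reindex_bij_betw[OF funpow_bij[OF n, of k], of "\<lambda>\<alpha>. evL g \<alpha>"]
    by (simp add: emb_N[OF n] evL_pcompose_F)
qed

lemma is_ideal_cong_multiples: "is_ideal {x. \<exists>a. p dvd x - a * q}" for p q :: "'a::comm_ring_1"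
  unfolding is_ideal_def
proof (safe)
  show "\<exists>a. p dvd 0 - a * q" by (rule exI[of _ 0]) simp
next
  fix x y a b assume "p dvd x - a * q" "p dvd y - b * q"
  hence "p dvd (x - a * q) + (y - b * q)" by (rule dvd_add)
  thus "\<exists>a. p dvd x + y - a * q" by (intro exI[of _ "a + b"]) (simp add: algebra_simps)
next
  fix x a r assume "p dvd x - a * q"
  hence "p dvd r * (x - a * q)" by (rule dvd_mult)
  thus "\<exists>a. p dvd r * x - a * q" by (intro exI[of _ "r * a"]) (simp add: algebra_simps)
qed

lemma dynatomic_dvd_Psi: "d \<ge> 1 \<Longrightarrow> \<Phi> d dvd \<Psi> d"
  by (rule dvd_dynatomic) (use per.Ex_Fx[of d] in \<open>auto simp flip: Fix_iff\<close>)

text \<open>At a point of period \<open>d\<close>, the difference of its iterates of index \<open>0\<close> and \<open>e\<close> depends only on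
  \<open>gcd e d\<close> up to units.\<close>

lemma N_Psi_gcd: assumes d: "d \<ge> 1" shows "normalize (N d (\<Psi> e)) = normalize (N d (\<Psi> (gcd e d)))"
proof (rule normalization_semidom_class.associatedI)
  let ?J = "{x. \<exists>a. \<Phi> d dvd x - a * \<Psi> e}"
  have "\<Psi> e \<in> ?J" by (auto intro!: exI[of _ 1])
  moreover have "\<Psi> d \<in> ?J" using dynatomic_dvd_Psi[OF d] by (auto intro!: exI[of _ 0])
  ultimately have "\<Psi> (gcd e d) \<in> ?J" by (rule Psi_gcd_ideal[OF is_ideal_cong_multiples])
  then obtain a where "\<Phi> d dvd \<Psi> (gcd e d) - a * \<Psi> e" by auto
  thus "N d (\<Psi> e) dvd N d (\<Psi> (gcd e d))" using N_dvd[OF d, of "\<Psi> (gcd e d)" "\<Psi> e" a] by (simp add: mult.commute)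
  obtain k where "\<Psi> e = \<Psi> (gcd e d) * k" using Psi_dvd[of "gcd e d" e] by (auto elim: dvdE)
  thus "N d (\<Psi> (gcd e d)) dvd N d (\<Psi> e)" using N_mult[OF d] by simp
qed

lemma N_Psi_nonzero: "d \<ge> 1 \<Longrightarrow> \<not> d dvd e \<Longrightarrow> N d (\<Psi> e) \<noteq> 0"
  by (auto simp: N_eq_0_iff Fix_iff[symmetric] dest: per.Ex_dvd)

text \<open>Points of incomparable periods \<open>d\<close> and \<open>e\<close> never collide: the common zeros of \<open>\<Psi>\<^sub>d\<close> and \<open>\<Psi>\<^sub>e\<close> have a period
  dividing the greatest common divisor.\<close>

lemma N_dynatomic_unit:
  assumes d: "d \<ge> 1" and e: "e \<ge> 1" and ed: "\<not> e dvd d" and de: "\<not> d dvd e"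
  shows "N d (\<Phi> e) dvd 1"
proof -
  let ?g = "gcd e d"
  have g: "?g \<ge> 1" using d by (simp add: Suc_leI)
  have "finite {k. k dvd e}" using e by simp
  moreover have "e \<notin> {k. k dvd ?g}" using ed by auto
  ultimately have "\<Phi> e * (\<Prod>k | k dvd ?g. \<Phi> k) dvd (\<Prod>k | k dvd e. \<Phi> k)"
  proof -
    assume fin: "finite {k. k dvd e}" and ni: "e \<notin> {k. k dvd ?g}"
    have sub: "insert e {k. k dvd ?g} \<subseteq> {k. k dvd e}" by auto
    have "finite {k. k dvd ?g}" using fin by (rule finite_subset[rotated]) auto
    hence "\<Phi> e * (\<Prod>k | k dvd ?g. \<Phi> k) = (\<Prod>k\<in>insert e {k. k dvd ?g}. \<Phi> k)" using ni by simp
    also have "\<dots> dvd (\<Prod>k | k dvd e. \<Phi> k)" by (rule prod_dvd_prod_subset[OF fin sub])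
    finally show ?thesis .
  qed
  hence "\<Phi> e * \<Psi> ?g dvd \<Psi> e" using Psi_eq_prod e g by simp
  then obtain k where "\<Psi> e = \<Phi> e * \<Psi> ?g * k" ..
  hence "N d (\<Phi> e) * N d (\<Psi> ?g) dvd N d (\<Psi> e)" using N_mult[OF d] by simp
  also have "N d (\<Psi> e) dvd N d (\<Psi> ?g)" using N_Psi_gcd[OF d, of e] by (simp add: normalization_semidom_class.associatedD2)
  finally have "N d (\<Phi> e) * N d (\<Psi> ?g) dvd 1 * N d (\<Psi> ?g)" by simp
  moreover have "N d (\<Psi> ?g) \<noteq> 0"
    using de d g by (intro N_Psi_nonzero) auto
  ultimately show ?thesis by (simp only: dvd_mult_cancel_right) simp
qed

subsection \<open>Multipliers\<close>

abbreviation lam :: "nat \<Rightarrow> int poly poly" where "lam n \<equiv> pderiv (F n)"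

lemma pderiv_Psi: "pderiv (\<Psi> n) = lam n - 1"
  by (simp add: Psi_def pderiv_diff pderiv_pCons)

lemma evL_F: "evL (F k) \<alpha> = (fL ^^ k) \<alpha>" by (rule poly_F_L)

lemma evL_lam: "evL (lam n) \<alpha> = (\<Prod>i<n. of_nat m * ((fL ^^ i) \<alpha>) ^ (m - 1))"
  by (simp add: pderiv_F evL_F)

lemma lam_add: "lam (a + b) = pcompose (lam a) (F b) * lam b"
  by (simp add: F_add pderiv_pcompose)

lemma evL_lam_mult: assumes "\<alpha> \<in> Fix d" shows "evL (lam (d * k)) \<alpha> = evL (lam d) \<alpha> ^ k"
proof (induction k)
  case (Suc k)
  have "evL (lam (d * k + d)) \<alpha> = evL (lam (d * k)) ((fL ^^ d) \<alpha>) * evL (lam d) \<alpha>"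
    by (simp only: lam_add evL_simps evL_pcompose_F)
  thus ?case using Suc assms by (simp add: Fix_def add.commute)
qed (simp add: pderiv_pCons)

lemma lam_shift: assumes "\<alpha> \<in> Fix n" shows "evL (lam n) ((fL ^^ k) \<alpha>) = evL (lam n) \<alpha>"
proof (induction k)
  case (Suc k)
  define \<beta> where "\<beta> = (fL ^^ k) \<alpha>"
  have "(fL ^^ n) \<beta> = (fL ^^ k) ((fL ^^ n) \<alpha>)"
    by (simp only: \<beta>_def fL_funpow_funpow add.commute)
  hence n: "(fL ^^ n) \<beta> = \<beta>" using assms by (simp add: \<beta>_def Fix_def)
  let ?g = "\<lambda>i. of_nat m * ((fL ^^ i) \<beta>) ^ (m - 1)"
  have "evL (lam n) (fL \<beta>) = (\<Prod>i<n. ?g (Suc i))"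
    by (simp add: evL_lam fL_funpow_comm)
  also have "\<dots> = (\<Prod>i<n. ?g i)"
  proof (cases n)
    case (Suc l)
    have "(\<Prod>i<Suc l. ?g (Suc i)) = (\<Prod>i<l. ?g (Suc i)) * ?g n" using Suc by simp
    also have "?g n = ?g 0" using n by simp
    also have "(\<Prod>i<l. ?g (Suc i)) * ?g 0 = (\<Prod>i<Suc l. ?g i)"
      by (subst prod.lessThan_Suc_shift) (simp add: mult.commute)
    finally show ?thesis using Suc by simp
  qed simp
  also have "\<dots> = evL (lam n) \<beta>" by (simp add: evL_lam)
  finally show ?case using Suc by (simp add: \<beta>_def)
qed simp

end

section \<open>Roots of powers of polynomials\<close>

lemma coeff_mult_top:
  fixes p q :: "'a::comm_ring_1 poly"
  assumes "degree p \<le> a" "degree q \<le> b"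
  shows "coeff (p * q) (a + b) = coeff p a * coeff q b"
proof -
  have "coeff (p * q) (a + b) = (\<Sum>i\<le>a + b. coeff p i * coeff q (a + b - i))" by (simp add: coeff_mult)
  also have "\<dots> = (\<Sum>i\<le>a + b. if i = a then coeff p a * coeff q b else 0)"
  proof (rule sum.cong[OF refl])
    fix i assume "i \<in> {..a + b}"
    show "coeff p i * coeff q (a + b - i) = (if i = a then coeff p a * coeff q b else 0)"
    proof (cases "i < a")
      case True
      hence "coeff q (a + b - i) = 0" using assms by (intro coeff_eq_0) simp
      with True show ?thesis by simp
    next
      case False
      show ?thesis
      proof (cases "i = a")
        case False
        with \<open>\<not> i < a\<close> have "coeff p i = 0" using assms by (intro coeff_eq_0) simp
        with False show ?thesis by simp
      qed simp
    qed
  qed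
  also have "\<dots> = coeff p a * coeff q b" by simp
  finally show ?thesis .
qed

text \<open>The coefficients of \<open>\<delta>\<close> are recovered one by one from those of \<open>\<delta>\<^sup>n\<close>, from the top: the next
  coefficient enters \<open>\<delta>\<^sup>n\<close> linearly, with factor \<open>n\<close>.\<close>

lemma monic_root_coeffs:
  fixes \<delta> :: "'l::field poly"
  assumes S: "subring_set S" and inv: "\<And>x. x \<in> S \<Longrightarrow> x / of_nat n \<in> S" and n0: "of_nat n \<noteq> (0 :: 'l)"
    and monic: "lead_coeff \<delta> = 1" and pow: "\<delta> ^ n \<in> poly_subring S"
  shows "\<delta> \<in> poly_subring S"
proof -
  define r where "r = degree \<delta>"
  note S' = subring_set_poly_subring[OF S]
  have n1: "n \<ge> 1" using n0 by (cases n) auto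
  have powS: "p ^ k \<in> poly_subring S" if "p \<in> poly_subring S" for p k
    using that S' by (induction k) (auto simp: subring_set_def)
  have "coeff \<delta> (r - j) \<in> S" if "j \<le> r" for j
    using that
  proof (induction j rule: less_induct)
    case (less j)
    show ?case
    proof (cases "j = 0")
      case True
      thus ?thesis using monic S by (simp add: r_def subring_set_def)
    next
      case False
      define \<delta>0 where "\<delta>0 = (\<Sum>i\<in>{r - j<..r}. monom (coeff \<delta> i) i)"
      define \<rho> where "\<rho> = \<delta> - \<delta>0"
      have c0: "coeff \<delta>0 i = (if r - j < i \<and> i \<le> r then coeff \<delta> i else 0)" for i
        by (auto simp: \<delta>0_def coeff_sum)
      have c0S: "\<delta>0 \<in> poly_subring S"
        unfolding poly_subring_def
      proof safe
        fix i
        show "coeff \<delta>0 i \<in> S"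
        proof (cases "r - j < i \<and> i \<le> r")
          case True
          hence "i = r - (r - i)" "r - i < j" by auto
          with less.IH[of "r - i"] True have "coeff \<delta> i \<in> S" by auto
          with True show ?thesis by (simp add: c0)
        next
          case False
          thus ?thesis using S by (auto simp: c0 subring_set_def)
        qed
      qed
      have d\<rho>: "degree \<rho> \<le> r - j"
      proof (rule degree_le, intro allI impI)
        fix i assume "r - j < i"
        thus "coeff \<rho> i = 0" by (auto simp: \<rho>_def c0 r_def coeff_eq_0)
      qed
      have d\<delta>: "degree \<delta> \<le> r" "degree \<delta>0 \<le> r"
        by (auto simp: r_def c0 intro!: degree_le)
      have l0: "coeff \<delta> r = 1" "coeff \<delta>0 r = 1" using monic False less.prems by (auto simp: r_def c0)
      have dp: "degree (p ^ k) \<le> r * k \<and> coeff (p ^ k) (r * k) = 1" if "degree p \<le> r" "coeff p r = 1" for p :: "'l poly" and k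
      proof (induction k)
        case (Suc k)
        have "degree (p * p ^ k) \<le> r + r * k"
          using Suc that(1) degree_mult_le[of p "p ^ k"] by linarith
        moreover have "coeff (p * p ^ k) (r + r * k) = 1"
          using coeff_mult_top[of p r "p ^ k" "r * k"] Suc that by simp
        ultimately show ?case by simp
      qed simp
      define T where "T = (\<Sum>i<n. \<delta> ^ i * \<delta>0 ^ (n - Suc i))"
      have dT: "degree T \<le> r * (n - 1)" "coeff T (r * (n - 1)) = of_nat n"
      proof -
        have t: "degree (\<delta> ^ i * \<delta>0 ^ (n - Suc i)) \<le> r * (n - 1) \<and> coeff (\<delta> ^ i * \<delta>0 ^ (n - Suc i)) (r * (n - 1)) = 1"
          if "i < n" for i
        proof -
          have e: "r * (n - 1) = r * i + r * (n - Suc i)"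
            using that by (simp flip: add_mult_distrib2)
          have "degree (\<delta> ^ i * \<delta>0 ^ (n - Suc i)) \<le> r * i + r * (n - Suc i)"
            using dp[OF d\<delta>(1) l0(1), of i] dp[OF d\<delta>(2) l0(2), of "n - Suc i"]
              degree_mult_le[of "\<delta> ^ i" "\<delta>0 ^ (n - Suc i)"] by linarith
          moreover have "coeff (\<delta> ^ i * \<delta>0 ^ (n - Suc i)) (r * i + r * (n - Suc i)) = 1"
            using dp[OF d\<delta>(1) l0(1), of i] dp[OF d\<delta>(2) l0(2), of "n - Suc i"] by (subst coeff_mult_top) auto
          ultimately show ?thesis unfolding e by blast
        qed
        show "degree T \<le> r * (n - 1)" unfolding T_def using t by (intro degree_sum_le) auto
        show "coeff T (r * (n - 1)) = of_nat n" unfolding T_def coeff_sum using t by simp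
      qed
      have "\<delta> ^ n - \<delta>0 ^ n = \<rho> * T"
        unfolding \<rho>_def T_def by (subst power_diff_sumr2) (simp add: mult.commute)
      moreover have "\<delta> ^ n - \<delta>0 ^ n \<in> poly_subring S"
        using pow powS[OF c0S, of n] S' by (auto simp: subring_set_def)
      ultimately have "coeff (\<rho> * T) ((r - j) + r * (n - 1)) \<in> S" by (simp add: poly_subring_def)
      hence "coeff \<rho> (r - j) * of_nat n \<in> S" using coeff_mult_top[OF d\<rho> dT(1)] dT(2) by simp
      hence "coeff \<rho> (r - j) \<in> S" using inv[of "coeff \<rho> (r - j) * of_nat n"] n0 by simp
      thus ?thesis by (simp add: \<rho>_def c0)
    qed
  qed
  note main = this
  show ?thesis unfolding poly_subring_def
  proof safe
    fix i show "coeff \<delta> i \<in> S"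
    proof (cases "i \<le> r")
      case True
      with main[of "r - i"] show ?thesis by simp
    next
      case False
      thus ?thesis using S by (simp add: r_def coeff_eq_0 subring_set_def)
    qed
  qed
qed

lemma common_denominator:
  fixes h :: "'u::idom \<Rightarrow> 'l::field"
  assumes "inj_comm_ring_hom h" and "\<And>i. \<exists>a b. b \<noteq> 0 \<and> coeff \<delta> i = h a / h b"
  shows "\<exists>q D. q \<noteq> 0 \<and> map_poly h D = smult (h q) \<delta>"
proof -
  interpret h: inj_comm_ring_hom h by fact
  interpret mp: map_poly_comm_ring_hom h ..
  have "\<exists>q D. q \<noteq> 0 \<and> (\<forall>i<k. h (coeff D i) = h q * coeff \<delta> i) \<and> degree D \<le> degree \<delta>" for k
  proof (induction k)
    case 0 show ?case by (intro exI[of _ 1] exI[of _ 0]) simp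
  next
    case (Suc k)
    then obtain q D where qD: "q \<noteq> 0" "\<forall>i<k. h (coeff D i) = h q * coeff \<delta> i" "degree D \<le> degree \<delta>" by blast
    obtain a b where ab: "b \<noteq> 0" "coeff \<delta> k = h a / h b" using assms(2) by blast
    show ?case
    proof (cases "k \<le> degree \<delta>")
      case True
      define D' where "D' = smult b D - monom (coeff (smult b D) k) k + monom (q * a) k"
      have c: "coeff D' i = (if i = k then q * a else b * coeff D i)" for i by (simp add: D'_def)
      show ?thesis
      proof (intro exI[of _ "q * b"] exI[of _ D'] conjI allI impI)
        show "q * b \<noteq> 0" using qD(1) ab(1) by simp
        show "degree D' \<le> degree \<delta>"
        proof (rule degree_le, intro allI impI)
          fix i assume i: "degree \<delta> < i"
          hence "coeff D i = 0" using qD(3) by (intro coeff_eq_0) linarith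
          thus "coeff D' i = 0" using i True by (simp add: c)
        qed
        fix i assume i: "i < Suc k"
        show "h (coeff D' i) = h (q * b) * coeff \<delta> i"
        proof (cases "i = k")
          case True
          have "h b \<noteq> 0" using ab(1) by simp
          with True show ?thesis by (simp add: c h.hom_mult ab(2))
        next
          case False
          hence e: "h (coeff D i) = h q * coeff \<delta> i" using qD(2) i by simp
          have "h (coeff D' i) = h b * h (coeff D i)" using False by (simp only: c if_False h.hom_mult)
          also have "\<dots> = h (q * b) * coeff \<delta> i" by (simp only: e h.hom_mult mult_ac)
          finally show ?thesis .
        qed
      qed
    next
      case False
      have "h (coeff D i) = h q * coeff \<delta> i" if "i < Suc k" for i
      proof (cases "i = k")
        case True
        have "coeff \<delta> i = 0" "coeff D i = 0" using False True qD(3) by (intro coeff_eq_0; linarith)+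
        thus ?thesis by simp
      next
        case False
        thus ?thesis using qD(2) that by simp
      qed
      thus ?thesis using qD(1,3) by blast
    qed
  qed
  from this[of "Suc (degree \<delta>)"] obtain q D where qD: "q \<noteq> 0" "\<forall>i<Suc (degree \<delta>). h (coeff D i) = h q * coeff \<delta> i" "degree D \<le> degree \<delta>"
    by blast
  have "map_poly h D = smult (h q) \<delta>"
  proof (rule poly_eqI)
    fix i show "coeff (map_poly h D) i = coeff (smult (h q) \<delta>) i"
    proof (cases "i \<le> degree \<delta>")
      case True
      thus ?thesis using qD(2) by simp
    next
      case False
      have "coeff \<delta> i = 0" "coeff D i = 0" using False qD(3) by (intro coeff_eq_0; linarith)+
      thus ?thesis by simp
    qed
  qed
  with qD(1) show ?thesis by blast
qed

text \<open>Gauss' lemma removes the denominators.\<close>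

text \<open>The coefficients of a root of a polynomial over \<open>\<int>[c]\<close> are determined recursively by its power, hence lie in
  \<open>\<rat>(c)\<close>; the lemma of Gauss then removes the denominators.\<close>

lemma monic_root_descends:
  fixes \<chi> :: "int poly poly"
  assumes n: "n \<ge> 1" and monic: "lead_coeff \<delta> = 1" and pow: "\<delta> ^ n = map_poly emb \<chi>"
  shows "\<exists>d. map_poly emb d = \<delta>"
proof -
  define S where "S = {x. \<exists>a b. b \<noteq> 0 \<and> x = emb a / emb b}"
  have SI: "emb a / emb b \<in> S" if "b \<noteq> 0" for a b
    unfolding S_def using that by blast
  have embS: "emb a \<in> S" for a
    using SI[OF one_neq_zero, of a] by (simp only: emb.hom_one div_by_1)
  have S: "subring_set S"
    unfolding subring_set_def
  proof (intro conjI ballI)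
    show "0 \<in> S" "1 \<in> S" using embS[of 0] embS[of 1] by (simp_all only: emb.hom_zero emb.hom_one)
    fix x y assume "x \<in> S" "y \<in> S"
    then obtain a b c d where xy: "b \<noteq> 0" "x = emb a / emb b" "d \<noteq> 0" "y = emb c / emb d"
      unfolding S_def by blast
    have bd: "b * d \<noteq> 0" using xy by simp
    have nz: "emb b \<noteq> 0" "emb d \<noteq> 0" using xy by simp_all
    have "x - y = emb (a * d - c * b) / emb (b * d)"
      unfolding xy emb.hom_mult emb.hom_minus by (rule diff_frac_eq[OF nz])
    thus "x - y \<in> S" using SI[OF bd] by (simp only:)
    have "x + y = emb (a * d + c * b) / emb (b * d)"
      unfolding xy emb.hom_mult emb.hom_add by (rule add_frac_eq[OF nz])
    thus "x + y \<in> S" using SI[OF bd] by (simp only:)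
    have "x * y = emb (a * c) / emb (b * d)"
      unfolding xy emb.hom_mult by (rule times_divide_times_eq)
    thus "x * y \<in> S" using SI[OF bd] by (simp only:)
  qed
  have nn: "of_nat n \<noteq> (0 :: int poly)" using n by simp
  hence n0: "of_nat n \<noteq> (0 :: Qc_bar)" using emb.hom_0_iff[of "of_nat n"] by (simp only: emb.hom_of_nat not_False_eq_True)
  have div: "x / of_nat n \<in> S" if x: "x \<in> S" for x
  proof -
    from x have "\<exists>a b. b \<noteq> 0 \<and> x = emb a / emb b" by (simp only: S_def mem_Collect_eq)
    then obtain a b where ab: "b \<noteq> 0" "x = emb a / emb b" by blast
    have "emb a / emb (b * of_nat n) \<in> S" using ab(1) nn by (intro SI) simp
    also have "emb a / emb (b * of_nat n) = x / of_nat n"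
      unfolding ab(2) emb.hom_mult emb.hom_of_nat by (rule divide_divide_eq_left[symmetric])
    finally show ?thesis .
  qed
  have powS: "\<delta> ^ n \<in> poly_subring S" using embS by (simp add: pow poly_subring_def)
  have "\<delta> \<in> poly_subring S" by (rule monic_root_coeffs[OF S div n0 monic powS])
  hence "coeff \<delta> i \<in> S" for i by (simp add: poly_subring_def)
  hence "\<exists>a b. b \<noteq> 0 \<and> coeff \<delta> i = emb a / emb b" for i unfolding S_def by blast
  from common_denominator[OF emb.inj_comm_ring_hom_axioms this]
  obtain q D where q: "q \<noteq> 0" and D: "map_poly emb D = smult (emb q) \<delta>" by blast
  have "map_poly emb (D ^ n) = map_poly emb (smult (q ^ n) \<chi>)"
  proof -
    have "map_poly emb (D ^ n) = smult (emb q) \<delta> ^ n" by (simp only: embp.hom_power D)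
    also have "\<dots> = smult (emb q ^ n) (map_poly emb \<chi>)" by (simp only: smult_power pow)
    finally show ?thesis by (simp only: emb.map_poly_hom_smult emb.hom_power)
  qed
  hence Dn: "D ^ n = smult (q ^ n) \<chi>" by (simp only: embp.eq_iff)
  have "lead_coeff (\<delta> ^ n) = 1" using monic by (simp only: lead_coeff_power power_one)
  hence "emb (lead_coeff \<chi>) = emb 1" by (simp only: pow emb.hom_lead_coeff emb.hom_one)
  hence lc: "lead_coeff \<chi> = 1" by (simp only: emb.eq_iff)
  have "content \<chi> dvd lead_coeff \<chi>" by (rule content_dvd_coeff)
  hence cchi: "content \<chi> dvd 1" by (simp only: lc)
  have cpow: "content (D ^ k) = content D ^ k" for k by (induction k) (simp_all only: power_0 power_Suc content_1 content_mult)
  have "content D ^ n = normalize (q ^ n) * content \<chi>"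
    unfolding cpow[symmetric] Dn by (rule content_smult)
  hence "normalize (q ^ n) dvd content D ^ n" by (simp only: dvd_triv_left)
  hence "q ^ n dvd content D ^ n" by (simp only: normalize_dvd_iff)
  moreover have "0 < n" using n by simp
  ultimately have "q dvd content D" using pow_divides_pow_iff[of n q "content D"] by blast
  hence "[:q:] dvd D" by (simp only: const_poly_dvd_iff_dvd_content)
  then obtain d where "D = [:q:] * d" ..
  hence "D = smult q d" by simp
  hence "smult (emb q) (map_poly emb d) = smult (emb q) \<delta>"
    using D by (simp only: emb.map_poly_hom_smult)
  hence "smult (inverse (emb q)) (smult (emb q) (map_poly emb d)) = smult (inverse (emb q)) (smult (emb q) \<delta>)"
    by (rule arg_cong)
  moreover have "inverse (emb q) * emb q = 1"
    by (rule left_inverse) (use q emb.hom_0_iff[of q] in blast)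
  ultimately have "map_poly emb d = \<delta>" by (simp only: smult_smult smult_1_left)
  thus ?thesis by blast
qed



section \<open>Resultants as products over roots\<close>

lemma resultant_distinct_roots:
  fixes p g :: "'l::field poly"
  assumes p: "lead_coeff p = 1" and Z: "finite Z" "card Z = degree p" and root: "\<And>a. a \<in> Z \<Longrightarrow> poly p a = 0"
  shows "resultant p g = (\<Prod>a\<in>Z. poly g a)"
proof -
  define M where "M = degree p"
  define n where "n = degree g"
  obtain \<zeta> where "bij_betw \<zeta> {0..<card Z} Z" using ex_bij_betw_nat_finite[OF Z(1)] by auto
  hence b: "bij_betw \<zeta> {..<M} Z" using Z(2) by (simp add: atLeast0LessThan M_def)
  have r: "poly p (\<zeta> i) = 0" if "i < M" for i using root b that by (auto simp: bij_betw_def)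
  define S where "S = sylvester_mat p g"
  have S: "S \<in> carrier_mat (n + M) (n + M)"
    using sylvester_carrier_mat[of p g] unfolding S_def M_def n_def by (simp only: add.commute)
  have Sij: "S $$ (i, j) = (if i < n then if i \<le> j \<and> j - i \<le> M then coeff p (M + i - j) else 0
      else if i - n \<le> j \<and> j \<le> i then coeff g (i - j) else 0)" if "i < n + M" "j < n + M" for i j
    using that unfolding S_def by (subst sylvester_index_mat) (simp_all add: M_def n_def add.commute)
  define B where "B = mat n M (\<lambda>(r, k). \<zeta> k ^ (M + n - 1 - r))"
  define V where "V = mat M M (\<lambda>(r, k). \<zeta> k ^ (M - 1 - r))"
  define A where "A = mat n n (\<lambda>(i, t). S $$ (i, t))"
  define C where "C = mat M n (\<lambda>(i, t). S $$ (n + i, t))"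
  define V' where "V' = mat M M (\<lambda>(r, k). \<zeta> k ^ (M - 1 - r) * poly g (\<zeta> k))"
  define D where "D = mat M M (\<lambda>(i, j). if i = j then poly g (\<zeta> i) else 0)"
  define W where "W = four_block_mat (1\<^sub>m n) B (0\<^sub>m M n) V"
  have carr: "B \<in> carrier_mat n M" "V \<in> carrier_mat M M" "A \<in> carrier_mat n n" "C \<in> carrier_mat M n" "V' \<in> carrier_mat M M"
    "D \<in> carrier_mat M M" "W \<in> carrier_mat (n + M) (n + M)"
    by (auto simp: B_def V_def A_def C_def V'_def D_def W_def)
  have Wij: "W $$ (r, c) = (if c < n then if r = c then 1 else 0 else \<zeta> (c - n) ^ (M + n - 1 - r))"
    if "r < n + M" "c < n + M" for r c
    using that by (auto simp: W_def B_def V_def)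
  have psum: "(\<Sum>r<n + M. S $$ (i, r) * x ^ (M + n - 1 - r)) = x ^ (n - 1 - i) * poly p x" if i: "i < n" for i x
  proof -
    have "(\<Sum>r<n + M. S $$ (i, r) * x ^ (M + n - 1 - r)) = (\<Sum>r\<in>{i..i + M}. coeff p (M + i - r) * x ^ (M + n - 1 - r))"
      using i by (intro sum.mono_neutral_cong_right) (auto simp: Sij)
    also have "\<dots> = (\<Sum>k\<le>M. coeff p k * x ^ (n - 1 - i + k))"
    proof (rule sum.reindex_bij_witness[of _ "\<lambda>k. M + i - k" "\<lambda>r. M + i - r"])
      fix a assume "a \<in> {i..i + M}"
      hence "n - 1 - i + (M + i - a) = M + n - 1 - a" using i by auto
      thus "coeff p (M + i - a) * x ^ (n - 1 - i + (M + i - a)) = coeff p (M + i - a) * x ^ (M + n - 1 - a)"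
        by simp
    qed auto
    also have "\<dots> = x ^ (n - 1 - i) * poly p x"
      by (simp add: poly_altdef M_def sum_distrib_left power_add mult_ac)
    finally show ?thesis .
  qed
  have gsum: "(\<Sum>r<n + M. S $$ (n + i, r) * x ^ (M + n - 1 - r)) = x ^ (M - 1 - i) * poly g x" if i: "i < M" for i x
  proof -
    have "(\<Sum>r<n + M. S $$ (n + i, r) * x ^ (M + n - 1 - r)) = (\<Sum>r\<in>{i..n + i}. coeff g (n + i - r) * x ^ (M + n - 1 - r))"
      using i by (intro sum.mono_neutral_cong_right) (auto simp: Sij)
    also have "\<dots> = (\<Sum>k\<le>n. coeff g k * x ^ (M - 1 - i + k))"
    proof (rule sum.reindex_bij_witness[of _ "\<lambda>k. n + i - k" "\<lambda>r. n + i - r"])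
      fix a assume "a \<in> {i..n + i}"
      hence "M - 1 - i + (n + i - a) = M + n - 1 - a" using i by auto
      thus "coeff g (n + i - a) * x ^ (M - 1 - i + (n + i - a)) = coeff g (n + i - a) * x ^ (M + n - 1 - a)"
        by simp
    qed auto
    also have "\<dots> = x ^ (M - 1 - i) * poly g x"
      by (simp add: poly_altdef n_def sum_distrib_left power_add mult_ac)
    finally show ?thesis .
  qed
  have SW: "S * W = four_block_mat A (0\<^sub>m n M) C V'"
  proof (rule eq_matI)
    fix i c assume "i < dim_row (four_block_mat A (0\<^sub>m n M) C V')" "c < dim_col (four_block_mat A (0\<^sub>m n M) C V')"
    hence ic: "i < n + M" "c < n + M" using carr by auto
    have "(S * W) $$ (i, c) = (\<Sum>r<n + M. S $$ (i, r) * W $$ (r, c))"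
      using ic S carr(7) by (simp add: scalar_prod_def atLeast0LessThan)
    also have "\<dots> = four_block_mat A (0\<^sub>m n M) C V' $$ (i, c)"
    proof (cases "c < n")
      case True
      have "(\<Sum>r<n + M. S $$ (i, r) * W $$ (r, c)) = (\<Sum>r<n + M. if r = c then S $$ (i, c) else 0)"
        using True ic by (intro sum.cong) (auto simp: Wij)
      also have "\<dots> = S $$ (i, c)" using ic by simp
      finally show ?thesis using True ic carr by (auto simp: A_def C_def)
    next
      case False
      have "(\<Sum>r<n + M. S $$ (i, r) * W $$ (r, c)) = (\<Sum>r<n + M. S $$ (i, r) * \<zeta> (c - n) ^ (M + n - 1 - r))"
        using False ic by (intro sum.cong) (auto simp: Wij)
      also have "\<dots> = (if i < n then 0 else \<zeta> (c - n) ^ (M - 1 - (i - n)) * poly g (\<zeta> (c - n)))"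
        using psum[of i "\<zeta> (c - n)"] gsum[of "i - n" "\<zeta> (c - n)"] r[of "c - n"] False ic by auto
      also have "\<dots> = four_block_mat A (0\<^sub>m n M) C V' $$ (i, c)"
        using False ic carr by (auto simp: V'_def)
      finally show ?thesis .
    qed
    finally show "(S * W) $$ (i, c) = four_block_mat A (0\<^sub>m n M) C V' $$ (i, c)" .
  qed (use S carr in auto)
  have "det A = 1"
  proof -
    have ut: "upper_triangular A" by (auto simp: A_def Sij)
    have "det A = prod_list (diag_mat A)" by (rule det_upper_triangular[OF ut carr(3)])
    also have "diag_mat A = map (\<lambda>_. 1) [0..<n]" using p by (auto simp: diag_mat_def A_def Sij M_def)
    finally show ?thesis by (simp add: prod.list_conv_set_nth)
  qed
  have "V' = V * D"
    by (rule eq_matI) (auto simp: V'_def V_def D_def scalar_prod_def if_distrib[of "\<lambda>x. _ * x"] cong: if_cong)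
  hence dV': "det V' = det V * det D" using det_mult carr by blast
  have "det D = (\<Prod>a\<in>Z. poly g a)"
  proof -
    have "det D = prod_list (diag_mat D)" by (rule det_upper_triangular[OF _ carr(6)]) (auto simp: D_def)
    also have "diag_mat D = map (\<lambda>i. poly g (\<zeta> i)) [0..<M]" by (auto simp: diag_mat_def D_def)
    finally show ?thesis using prod.reindex_bij_betw[OF b, of "\<lambda>a. poly g a"]
      by (simp add: prod.list_conv_set_nth atLeast0LessThan)
  qed
  moreover have "det V \<noteq> 0" unfolding V_def
  proof (rule vandermonde_nonzero)
    show "inj_on \<zeta> {..<M}" using b by (rule bij_betw_imp_inj_on)
    show "bij_betw (\<lambda>r. M - 1 - r) {..<M} {..<M}"
      by (rule bij_betwI[where g = "\<lambda>r. M - 1 - r"]) auto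
  qed
  moreover have "det S * det V = det A * det V'"
  proof -
    have "det W = det V" unfolding W_def
      by (subst det_four_block_mat_lower_left_zero[OF one_carrier_mat carr(1) refl carr(2)]) simp
    moreover have "det (S * W) = det A * det V'" unfolding SW
      by (rule det_four_block_mat_upper_right_zero[OF carr(3) refl carr(4) carr(5)])
    ultimately show ?thesis using det_mult[OF S carr(7)] by simp
  qed
  ultimately have "det S = (\<Prod>a\<in>Z. poly g a)" using \<open>det A = 1\<close> dV' by simp
  thus ?thesis by (simp add: S_def resultant_def)
qed



section \<open>Cyclotomic polynomials\<close>

interpretation cyc: order_graded_roots "of_int :: int \<Rightarrow> complex" "\<lambda>n. {z. z ^ n = 1}" "\<lambda>n. monom 1 n - 1"
proof
  fix z :: complex and a b
  show "z \<in> {z. z ^ a = 1} \<Longrightarrow> z \<in> {z. z ^ b = 1} \<Longrightarrow> z \<in> {z. z ^ gcd a b = 1}"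
  proof (induction a b rule: gcd_nat_induct)
    case (step a b)
    have "z ^ a = (z ^ b) ^ (a div b) * z ^ (a mod b)"
      by (simp flip: power_mult power_add)
    hence "z ^ (a mod b) = 1" using step by simp
    thus ?case using step by (simp add: gcd_red_nat[of a b])
  qed simp
next
  fix a b :: nat assume "a dvd b"
  then obtain k where "b = a * k" ..
  thus "{z :: complex. z ^ a = 1} \<subseteq> {z. z ^ b = 1}" by (auto simp: power_mult)
next
  fix n :: nat assume n: "n \<ge> 1"
  define p where "p = (monom 1 n - 1 :: complex poly)"
  have pz: "poly p z = z ^ n - 1" for z by (simp add: p_def poly_monom)
  have "p = monom 1 n + (-1)" by (simp add: p_def)
  hence d: "degree p = n" using n by (simp add: degree_add_eq_left degree_monom_eq del: add_uminus_conv_diff)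
  hence lc: "lead_coeff p = 1" using n by (simp add: p_def coeff_1)
  have p0: "p \<noteq> 0" using lc by auto
  from poly_roots_finite[OF p0] show "finite {z :: complex. z ^ n = 1}" by (simp add: pz)
  have "p = (\<Prod>a | poly p a = 0. [:-a, 1:])"
  proof (rule monic_separable_eq_prod[OF lc])
    fix a assume "poly p a = 0"
    hence a: "a ^ n = 1" by (simp add: pz)
    hence "a \<noteq> 0" using n by (auto simp: power_0_left)
    thus "poly (pderiv p) a \<noteq> 0" using n by (simp add: p_def pderiv_diff pderiv_monom poly_monom)
  qed
  moreover have "map_poly of_int (monom 1 n - 1 :: int poly) = p"
    by (simp add: p_def of_int_poly_hom.hom_minus)
  ultimately show "map_poly of_int (monom 1 n - 1 :: int poly) = (\<Prod>x\<in>{z. z ^ n = 1}. [:- x, 1 :: complex:])"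
    by (simp add: pz)
qed

lemma cyclotomic_eq: assumes "j \<ge> 1" shows "cyclotomic j = cyc.exact_factor j"
proof -
  have e: "{\<zeta> :: complex. \<zeta> ^ j = 1 \<and> (\<forall>k. 0 < k \<and> k < j \<longrightarrow> \<zeta> ^ k \<noteq> 1)} = cyc.Ex j"
    by (auto simp: cyc.Ex_def)
  show ?thesis unfolding cyclotomic_def e
  proof (rule the_equality)
    show "map_poly of_int (cyc.exact_factor j) = (\<Prod>\<zeta>\<in>cyc.Ex j. [:- \<zeta>, 1 :: complex:])"
      by (rule cyc.exact_factor(2)[OF assms])
    fix p assume "map_poly of_int p = (\<Prod>\<zeta>\<in>cyc.Ex j. [:- \<zeta>, 1 :: complex:])"
    hence "of_int_poly p = (of_int_poly (cyc.exact_factor j) :: complex poly)"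
      by (simp only: cyc.exact_factor(2)[OF assms])
    thus "p = cyc.exact_factor j" by (simp only: of_int_poly_hom.eq_iff)
  qed
qed

lemma cyclotomic_monic: "j \<ge> 1 \<Longrightarrow> lead_coeff (cyclotomic j) = 1"
  using cyc.exact_factor(1) cyclotomic_eq by simp

lemma prod_cyclotomic: assumes n: "n \<ge> 1" shows "monom 1 n - 1 = (\<Prod>d | d dvd n. cyclotomic d)"
proof -
  have "d \<ge> 1" if "d dvd n" for d using that n by (auto intro: Suc_leI Nat.gr0I)
  thus ?thesis unfolding cyc.P_eq_prod[OF n] using cyclotomic_eq by (intro prod.cong) auto
qed

section \<open>The multiplier polynomial\<close>

lemma emb_const: "emb [:a:] = of_int a"
proof -
  have "[:a:] = of_int a" by (simp add: of_int_poly)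
  thus ?thesis by (simp only: emb.hom_of_int)
qed

lemma of_int_poly_pCons:
  "map_poly of_int (pCons a q) = pCons (of_int a) (map_poly of_int q :: 'x::comm_ring_1 poly)"
  by (rule poly_eqI) (simp add: coeff_map_poly coeff_pCons split: nat.split)

lemma normalize_minus_eq: "normalize (- a) = normalize (a :: int poly)"
  by (rule normalization_semidom_class.associatedI) simp_all

lemma pm_prod: "(\<Prod>a\<in>A. \<Prod>b\<in>B. (f a - g b)) = (-1) ^ (card A * card B) * (\<Prod>b\<in>B. \<Prod>a\<in>A. (g b - f a))"
  for f :: "_ \<Rightarrow> 'a::comm_ring_1"
proof -
  have "(\<Prod>a\<in>A. \<Prod>b\<in>B. (f a - g b)) = (\<Prod>a\<in>A. \<Prod>b\<in>B. (-1) * (g b - f a))" by simp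
  also have "\<dots> = (-1) ^ (card A * card B) * (\<Prod>a\<in>A. \<Prod>b\<in>B. (g b - f a))"
    by (simp only: prod.distrib prod_constant power_mult mult.commute[of "card A"])
  finally show ?thesis by (subst prod.swap)
qed

context unicritical begin

lemma orbit_of_eq: "orbit_of m \<alpha> = range (\<lambda>k. (fL ^^ k) \<alpha>)"
  unfolding orbit_of_def by (auto simp: poly_F_L)

lemma cycles_eq: "n \<ge> 1 \<Longrightarrow> cycles m n = orbit_of m ` Per n"
  unfolding cycles_def by (simp add: root_dynatomic)

lemma orbit_eq_image: assumes n: "n \<ge> 1" and a: "\<alpha> \<in> Per n"
  shows "orbit_of m \<alpha> = (\<lambda>k. (fL ^^ k) \<alpha>) ` {..<n}"
proof -
  have "(fL ^^ n) \<alpha> = \<alpha>" using a by (simp add: Per_iff)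
  hence e: "(fL ^^ k) \<alpha> = (fL ^^ (k mod n)) \<alpha>" for k by (rule funpow_mod_eq[symmetric])
  have "(fL ^^ k) \<alpha> \<in> (\<lambda>k. (fL ^^ k) \<alpha>) ` {..<n}" for k
    using n by (subst e) (rule imageI, simp)
  thus ?thesis unfolding orbit_of_eq by auto
qed

lemma orbit_inj: assumes n: "n \<ge> 1" and a: "\<alpha> \<in> Per n" shows "inj_on (\<lambda>k. (fL ^^ k) \<alpha>) {..<n}"
proof -
  have neq: "(fL ^^ i) \<alpha> \<noteq> (fL ^^ j) \<alpha>" if "i < j" "j < n" for i j
  proof
    assume "(fL ^^ i) \<alpha> = (fL ^^ j) \<alpha>"
    hence "(fL ^^ (n - j)) ((fL ^^ i) \<alpha>) = (fL ^^ (n - j)) ((fL ^^ j) \<alpha>)" by simp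
    hence "(fL ^^ (n - j + i)) \<alpha> = (fL ^^ (n - j + j)) \<alpha>" by (simp only: fL_funpow_funpow)
    also have "n - j + j = n" using that by simp
    finally have "(fL ^^ (n - j + i)) \<alpha> = \<alpha>" using a by (simp add: Per_iff)
    moreover have "0 < n - j + i \<and> n - j + i < n" using that by auto
    ultimately show False using a by (simp add: Per_iff)
  qed
  show ?thesis
  proof (rule inj_onI)
    fix i j assume "i \<in> {..<n}" "j \<in> {..<n}" "(fL ^^ i) \<alpha> = (fL ^^ j) \<alpha>"
    thus "i = j" using neq[of i j] neq[of j i] by (cases i j rule: linorder_cases) auto
  qed
qed

lemma card_orbit: "n \<ge> 1 \<Longrightarrow> \<alpha> \<in> Per n \<Longrightarrow> card (orbit_of m \<alpha>) = n"
  by (simp add: orbit_eq_image card_image orbit_inj)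

lemma orbit_subset: "n \<ge> 1 \<Longrightarrow> \<alpha> \<in> Per n \<Longrightarrow> orbit_of m \<alpha> \<subseteq> Per n"
  unfolding orbit_of_eq using funpow_Per by auto

lemma orbit_self: "\<alpha> \<in> orbit_of m \<alpha>"
  unfolding orbit_of_eq by (rule range_eqI[of _ _ 0]) simp

lemma orbit_mono: "\<beta> \<in> orbit_of m \<alpha> \<Longrightarrow> orbit_of m \<beta> \<subseteq> orbit_of m \<alpha>"
  unfolding orbit_of_eq by (auto simp: fL_funpow_funpow)

lemma orbit_eq: assumes n: "n \<ge> 1" and a: "\<alpha> \<in> Per n" and b: "\<beta> \<in> orbit_of m \<alpha>"
  shows "orbit_of m \<beta> = orbit_of m \<alpha>"
proof (rule card_subset_eq)
  show "finite (orbit_of m \<alpha>)" using orbit_eq_image[OF n a] by simp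
  show "orbit_of m \<beta> \<subseteq> orbit_of m \<alpha>" by (rule orbit_mono[OF b])
  have "\<beta> \<in> Per n" using orbit_subset[OF n a] b by blast
  thus "card (orbit_of m \<beta>) = card (orbit_of m \<alpha>)" using card_orbit[OF n] a by simp
qed

lemma cycle_card: "n \<ge> 1 \<Longrightarrow> C \<in> cycles m n \<Longrightarrow> card C = n"
  by (auto simp: cycles_eq card_orbit)

lemma cycle_finite: "n \<ge> 1 \<Longrightarrow> C \<in> cycles m n \<Longrightarrow> finite C"
  by (auto simp: cycles_eq orbit_eq_image)

lemma finite_cycles: "n \<ge> 1 \<Longrightarrow> finite (cycles m n)"
  by (simp add: cycles_eq per.finite_Ex)

lemma cycle_eqI: assumes n: "n \<ge> 1" and C: "C \<in> cycles m n" and a: "\<alpha> \<in> C"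
  shows "C = orbit_of m \<alpha>" "\<alpha> \<in> Per n"
proof -
  obtain \<beta> where b: "\<beta> \<in> Per n" "C = orbit_of m \<beta>" using C by (auto simp: cycles_eq[OF n])
  show "C = orbit_of m \<alpha>" using orbit_eq[OF n b(1)] a b(2) by simp
  show "\<alpha> \<in> Per n" using orbit_subset[OF n b(1)] a b(2) by blast
qed

lemma Union_cycles: assumes n: "n \<ge> 1" shows "\<Union>(cycles m n) = Per n"
proof
  show "\<Union>(cycles m n) \<subseteq> Per n" using cycle_eqI(2)[OF n] by blast
  show "Per n \<subseteq> \<Union>(cycles m n)" unfolding cycles_eq[OF n] using orbit_self by blast
qed

lemma cycles_disjoint: assumes n: "n \<ge> 1" and "C \<in> cycles m n" "C' \<in> cycles m n" "C \<noteq> C'" shows "C \<inter> C' = {}"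
proof (rule ccontr)
  assume "C \<inter> C' \<noteq> {}"
  then obtain \<alpha> where "\<alpha> \<in> C" "\<alpha> \<in> C'" by blast
  with cycle_eqI(1)[OF n] assms show False by metis
qed

lemma prod_cycles: assumes n: "n \<ge> 1" shows "(\<Prod>\<alpha>\<in>Per n. g \<alpha>) = (\<Prod>C\<in>cycles m n. \<Prod>\<alpha>\<in>C. g \<alpha>)"
proof -
  have "(\<Prod>\<alpha>\<in>\<Union>(cycles m n). g \<alpha>) = (prod \<circ> prod) g (cycles m n)"
    using cycle_finite[OF n] cycles_disjoint[OF n] by (intro prod.Union_disjoint) blast+
  thus ?thesis by (simp add: Union_cycles[OF n])
qed

definition rep :: "Qc_bar set \<Rightarrow> Qc_bar" where "rep C = (SOME \<alpha>. \<alpha> \<in> C)"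

lemma rep_in: assumes n: "n \<ge> 1" and C: "C \<in> cycles m n" shows "rep C \<in> C" "rep C \<in> Per n"
proof -
  have "C \<noteq> {}" using cycle_card[OF n C] n by auto
  thus "rep C \<in> C" unfolding rep_def by (simp add: some_in_eq)
  thus "rep C \<in> Per n" by (rule cycle_eqI(2)[OF n C])
qed

lemma prod_Per_invariant:
  fixes g :: "Qc_bar \<Rightarrow> 'c::comm_ring_1"
  assumes n: "n \<ge> 1" and inv: "\<And>\<alpha> k. \<alpha> \<in> Per n \<Longrightarrow> g ((fL ^^ k) \<alpha>) = g \<alpha>"
  shows "(\<Prod>\<alpha>\<in>Per n. g \<alpha>) = (\<Prod>C\<in>cycles m n. g (rep C)) ^ n"
proof -
  have "(\<Prod>\<alpha>\<in>Per n. g \<alpha>) = (\<Prod>C\<in>cycles m n. \<Prod>\<alpha>\<in>C. g \<alpha>)" by (rule prod_cycles[OF n])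
  also have "\<dots> = (\<Prod>C\<in>cycles m n. g (rep C) ^ n)"
  proof (rule prod.cong[OF refl])
    fix C assume C: "C \<in> cycles m n"
    have "g \<alpha> = g (rep C)" if "\<alpha> \<in> C" for \<alpha>
    proof -
      have "\<alpha> \<in> orbit_of m (rep C)" using cycle_eqI(1)[OF n C rep_in(1)[OF n C]] that by simp
      then obtain k where "\<alpha> = (fL ^^ k) (rep C)" by (auto simp: orbit_of_eq)
      thus ?thesis using inv[OF rep_in(2)[OF n C]] by simp
    qed
    hence "(\<Prod>\<alpha>\<in>C. g \<alpha>) = (\<Prod>\<alpha>\<in>C. g (rep C))" by (rule prod.cong[OF refl])
    thus "(\<Prod>\<alpha>\<in>C. g \<alpha>) = g (rep C) ^ n" using cycle_card[OF n C] by simp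
  qed
  also have "\<dots> = (\<Prod>C\<in>cycles m n. g (rep C)) ^ n" by (simp add: prod_power_distrib)
  finally show ?thesis .
qed

lemma lam_invariant: "\<alpha> \<in> Per n \<Longrightarrow> evL (lam n) ((fL ^^ k) \<alpha>) = evL (lam n) \<alpha>"
  using lam_shift per.Ex_Fx by blast

definition lamC :: "nat \<Rightarrow> Qc_bar set \<Rightarrow> Qc_bar" where "lamC n C = evL (lam n) (rep C)"

lemma multiplier_eq: "multiplier m n (SOME \<alpha>. \<alpha> \<in> C) = lamC n C"
  by (simp add: multiplier_def lamC_def rep_def emb.map_poly_pderiv)

lemma delta_L: assumes n: "n \<ge> 1" shows "map_poly emb (delta m n) = (\<Prod>C\<in>cycles m n. [:- lamC n C, 1:])"
proof -
  define dl where "dl = (\<Prod>C\<in>cycles m n. [:- lamC n C, 1:])"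
  have "dl ^ n = (\<Prod>\<alpha>\<in>Per n. [:- evL (lam n) \<alpha>, 1:])"
    unfolding dl_def lamC_def
    by (rule prod_Per_invariant[OF n, of "\<lambda>\<alpha>. [:- evL (lam n) \<alpha>, 1:]", symmetric]) (simp only: lam_invariant)
  also have "\<dots> = map_poly emb (char_poly (mult_mat (\<Phi> n) (lam n)))" by (rule emb_char_poly[OF n, symmetric])
  finally obtain d where d: "map_poly emb d = dl"
    using monic_root_descends[OF n] lead_coeff_prod_linear[of "lamC n" "cycles m n"] unfolding dl_def by blast
  show ?thesis unfolding delta_def multiplier_eq dl_def[symmetric]
  proof (rule theI2[where a = d])
    show "map_poly emb d = dl" by fact
    fix x assume "map_poly emb x = dl"
    hence "map_poly emb x = map_poly emb d" using d by simp
    thus "x = d" by (simp only: embp.eq_iff)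
  qed
qed

lemma emb_delta_1: assumes n: "n \<ge> 1" shows "emb (poly (delta m n) 1) = (\<Prod>C\<in>cycles m n. 1 - lamC n C)"
proof -
  have "emb (poly (delta m n) 1) = poly (map_poly emb (delta m n)) (emb 1)" by (simp only: emb.poly_map_poly)
  thus ?thesis by (simp add: delta_L[OF n] poly_prod)
qed

lemma delta_1_power: assumes n: "n \<ge> 1" shows "poly (delta m n) 1 ^ n = N n (1 - lam n)"
proof (rule N_eqI[OF n, symmetric])
  have "(\<Prod>\<alpha>\<in>Per n. evL (1 - lam n) \<alpha>) = (\<Prod>C\<in>cycles m n. evL (1 - lam n) (rep C)) ^ n"
    by (rule prod_Per_invariant[OF n]) (simp only: evL_simps lam_invariant)
  thus "emb (poly (delta m n) 1 ^ n) = (\<Prod>\<alpha>\<in>Per n. evL (1 - lam n) \<alpha>)"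
    by (simp add: emb.hom_power emb_delta_1[OF n] lamC_def)
qed

text \<open>Cayley--Hamilton for the multiplier, as a function on the quotient curve.\<close>

lemma delta_lam: assumes n: "n \<ge> 1" shows "\<Phi> n dvd pcompose (delta m n) (lam n)"
proof (rule dvd_dynatomic[OF n])
  fix \<alpha> assume a: "\<alpha> \<in> Per n"
  hence C: "orbit_of m \<alpha> \<in> cycles m n" by (simp add: cycles_eq[OF n])
  have "rep (orbit_of m \<alpha>) \<in> orbit_of m \<alpha>" by (rule rep_in(1)[OF n C])
  then obtain k where "rep (orbit_of m \<alpha>) = (fL ^^ k) \<alpha>" by (auto simp: orbit_of_eq)
  hence l: "lamC n (orbit_of m \<alpha>) = evL (lam n) \<alpha>" by (simp add: lamC_def lam_invariant[OF a])
  have "evL (pcompose (delta m n) (lam n)) \<alpha> = (\<Prod>C\<in>cycles m n. evL (lam n) \<alpha> - lamC n C)"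
    by (simp add: emb.map_poly_pcompose poly_pcompose delta_L[OF n] poly_prod)
  also have "\<dots> = 0"
    by (rule prod_zero[OF finite_cycles[OF n]], rule bexI[OF _ C]) (simp add: l)
  finally show "evL (pcompose (delta m n) (lam n)) \<alpha> = 0" .
qed

section \<open>Resultants of dynatomic polynomials\<close>

abbreviation cycv :: "nat \<Rightarrow> 'a::comm_ring_1 \<Rightarrow> 'a" where
  "cycv k y \<equiv> poly (map_poly of_int (cyclotomic k)) y"

lemma of_int_monom_minus: "map_poly of_int (monom 1 k - 1 :: int poly) = (monom 1 k - 1 :: 'a::comm_ring_1 poly)"
  by (rule poly_eqI) (simp add: coeff_map_poly coeff_1)

lemma prod_cycv: "k \<ge> 1 \<Longrightarrow> (\<Prod>j | j dvd k. cycv j y) = y ^ k - (1 :: 'a::comm_ring_1)"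
proof -
  assume k: "k \<ge> 1"
  have "map_poly of_int (\<Prod>j | j dvd k. cyclotomic j) = (\<Prod>j | j dvd k. map_poly of_int (cyclotomic j) :: 'a poly)"
    by (rule of_int_poly_hom.hom_prod)
  hence "(\<Prod>j | j dvd k. map_poly of_int (cyclotomic j) :: 'a poly) = monom 1 k - 1"
    by (simp add: prod_cyclotomic[OF k, symmetric] of_int_monom_minus)
  from arg_cong[OF this, of "\<lambda>p. poly p y"] show ?thesis by (simp add: poly_prod poly_monom)
qed

lemma cycv_1: "cycv 1 y = y - 1"
  using prod_cycv[of 1 y] by simp

lemma cyc_roots:
  assumes k: "k \<ge> 1"
  defines "p \<equiv> (map_poly of_int (cyclotomic k) :: Qc_bar poly)"
  shows "lead_coeff p = 1" "finite {a. poly p a = 0}" "card {a. poly p a = 0} = degree p"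
    "p = (\<Prod>a | poly p a = 0. [:- a, 1:])"
proof -
  have oi: "comm_ring_hom (of_int :: int \<Rightarrow> Qc_bar)" by unfold_locales auto
  show lc: "lead_coeff p = 1" unfolding p_def by (rule comm_ring_hom.degree_map_poly_monic(2)[OF oi cyclotomic_monic[OF k]])
  hence p0: "p \<noteq> 0" by auto
  show fin: "finite {a. poly p a = 0}" by (rule poly_roots_finite[OF p0])
  have "finite {j. j dvd k}" using k by simp
  hence "cyclotomic k dvd (\<Prod>j | j dvd k. cyclotomic j)" by (intro dvd_prodI) auto
  hence "cyclotomic k dvd monom 1 k - 1" by (simp add: prod_cyclotomic[OF k])
  then obtain s where s: "monom 1 k - 1 = cyclotomic k * s" ..
  have "map_poly of_int (cyclotomic k * s) = p * (map_poly of_int s :: Qc_bar poly)"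
    unfolding p_def by (rule of_int_poly_hom.hom_mult)
  hence s': "monom 1 k - 1 = p * (map_poly of_int s :: Qc_bar poly)" by (simp add: s[symmetric] of_int_monom_minus)
  show e: "p = (\<Prod>a | poly p a = 0. [:- a, 1:])"
  proof (rule monic_separable_eq_prod[OF lc])
    fix a assume a: "poly p a = 0"
    have ak: "a ^ k = 1" using arg_cong[OF s', of "\<lambda>q. poly q a"] a by (simp add: poly_monom)
    hence a0: "a \<noteq> 0" using k by (auto simp: power_0_left)
    have "poly (pderiv (monom 1 k - 1)) a = of_nat k * a ^ (k - 1)"
      by (simp add: pderiv_diff pderiv_monom poly_monom)
    moreover have "of_nat k * a ^ (k - 1) \<noteq> 0"
    proof -
      have "emb (of_nat k) \<noteq> 0" using k emb.hom_0_iff[of "of_nat k"] by simp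
      hence "(of_nat k :: Qc_bar) \<noteq> 0" by (simp only: emb.hom_of_nat not_False_eq_True)
      thus ?thesis using a0 by simp
    qed
    moreover have "poly (pderiv (p * map_poly of_int s)) a = poly (pderiv p) a * poly (map_poly of_int s) a"
      using a by (simp add: pderiv_mult)
    ultimately show "poly (pderiv p) a \<noteq> 0" using s' by (metis mult_zero_left)
  qed
  show "card {a. poly p a = 0} = degree p"
    using degree_prod_linear[OF fin] e by metis
qed

lemma emb_Delta_prop:
  assumes n: "n \<ge> 1" and d: "d dvd n"
  obtains D where "normalize D = normalize (Delta_prop m n d)" "emb D = (\<Prod>C\<in>cycles m d. cycv (n div d) (lamC d C))"
proof -
  define k where "k = n div d"
  have pos: "d \<ge> 1" "k \<ge> 1" using n d by (auto simp: k_def intro!: Suc_leI Nat.gr0I elim!: dvdE)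
  define p where "p = (map_poly of_int (cyclotomic k) :: Qc_bar poly)"
  define Z where "Z = {a. poly p a = 0}"
  note c = cyc_roots[OF pos(2), folded p_def, folded Z_def]
  have mp: "map_poly emb (map_poly (\<lambda>a. [:a:]) (cyclotomic k)) = p"
    by (rule poly_eqI) (simp add: p_def coeff_map_poly emb_const)
  have "emb (Delta_prop m n d) = resultant p (map_poly emb (delta m d))"
    unfolding Delta_prop_def k_def[symmetric] mp[symmetric] by (rule emb.resultant_hom[symmetric])
  also have "\<dots> = (\<Prod>a\<in>Z. poly (map_poly emb (delta m d)) a)"
    by (rule resultant_distinct_roots[OF c(1-3)]) (simp add: Z_def)
  also have "\<dots> = (\<Prod>a\<in>Z. \<Prod>C\<in>cycles m d. a - lamC d C)"
    by (simp add: delta_L[OF pos(1)] poly_prod)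
  also have "\<dots> = (-1) ^ (card Z * card (cycles m d)) * (\<Prod>C\<in>cycles m d. \<Prod>a\<in>Z. lamC d C - a)"
    by (rule pm_prod)
  also have "(\<Prod>C\<in>cycles m d. \<Prod>a\<in>Z. lamC d C - a) = (\<Prod>C\<in>cycles m d. cycv k (lamC d C))"
  proof (rule prod.cong[OF refl])
    fix C
    have "poly p (lamC d C) = poly (\<Prod>a\<in>Z. [:- a, 1:]) (lamC d C)" using c(4) by simp
    thus "(\<Prod>a\<in>Z. lamC d C - a) = cycv k (lamC d C)" by (simp add: p_def poly_prod)
  qed
  finally have e: "emb (Delta_prop m n d) = (-1) ^ (card Z * card (cycles m d)) * (\<Prod>C\<in>cycles m d. cycv k (lamC d C))" .
  show ?thesis
  proof (cases "even (card Z * card (cycles m d))")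
    case True
    thus ?thesis using e by (intro that[of "Delta_prop m n d"]) (simp_all add: k_def)
  next
    case False
    thus ?thesis using e by (intro that[of "- Delta_prop m n d"]) (simp_all add: k_def normalize_minus_eq emb.hom_uminus)
  qed
qed

definition cyR :: "nat \<Rightarrow> nat \<Rightarrow> int poly poly" where "cyR k d = cycv k (lam d)"

lemma evL_of_int_poly: "evL (poly (map_poly of_int q) u) \<alpha> = poly (map_poly of_int q) (evL u \<alpha>)"
proof (induction q)
  case (pCons a q)
  have "evL (of_int a) \<alpha> = of_int a" by (simp add: embp.hom_of_int)
  moreover have "map_poly of_int (pCons a q) = (pCons (of_int a) (map_poly of_int q) :: int poly poly poly)"
    "map_poly of_int (pCons a q) = (pCons (of_int a) (map_poly of_int q) :: Qc_bar poly)"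
    by (rule of_int_poly_pCons)+
  ultimately show ?case by (simp only: poly_pCons evL_simps pCons.IH)
qed simp

lemma evL_cyR: "evL (cyR k d) \<alpha> = cycv k (evL (lam d) \<alpha>)"
  unfolding cyR_def by (rule evL_of_int_poly)

lemma N_cyR: assumes n: "n \<ge> 1" and d: "d dvd n"
  shows "normalize (N d (cyR (n div d) d)) = normalize (Delta_prop m n d) ^ d"
proof -
  have d1: "d \<ge> 1" using n d by (auto intro!: Suc_leI Nat.gr0I)
  obtain D where D: "normalize D = normalize (Delta_prop m n d)" "emb D = (\<Prod>C\<in>cycles m d. cycv (n div d) (lamC d C))"
    using emb_Delta_prop[OF assms] .
  have "N d (cyR (n div d) d) = D ^ d"
  proof (rule N_eqI[OF d1])
    have "(\<Prod>\<alpha>\<in>Per d. cycv (n div d) (evL (lam d) \<alpha>)) = (\<Prod>C\<in>cycles m d. cycv (n div d) (evL (lam d) (rep C))) ^ d"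
      by (rule prod_Per_invariant[OF d1]) (simp only: lam_invariant)
    thus "emb (D ^ d) = (\<Prod>\<alpha>\<in>Per d. evL (cyR (n div d) d) \<alpha>)"
      by (simp only: emb.hom_power D(2) lamC_def evL_cyR)
  qed
  thus ?thesis using D(1) by (simp add: normalize_power)
qed

text \<open>At a point \<open>\<beta>\<close> of period \<open>d\<close> with multiplier \<open>\<lambda>\<close>, the quotient of \<open>\<Psi>\<close> of index \<open>dk\<close> by that of
  index \<open>d\<close> takes the value \<open>(\<lambda>\<^sup>k - 1) / (\<lambda> - 1)\<close>, by differentiation. Its dynatomic factors of index not
  divisible by \<open>d\<close> are units there, so those of index \<open>dj\<close> are matched with the cyclotomic factors.\<close>

lemma N_dynatomic_cyR:
  assumes d: "d \<ge> 1"
  shows "k \<ge> 2 \<Longrightarrow> normalize (N d (\<Phi> (d * k))) = normalize (N d (cyR k d))"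
proof (induction k rule: less_induct)
  case (less k)
  define n where "n = d * k"
  have n: "n \<ge> 1" using d less.prems by (simp add: n_def Suc_leI)
  define E where "E = {e. e dvd n \<and> \<not> e dvd d}"
  define J where "J = {j. j dvd k \<and> j \<noteq> 1}"
  define G where "G = (\<Prod>e\<in>E. \<Phi> e)"
  have fin: "finite {e. e dvd n}" "finite {j. j dvd k}" using n less.prems by auto
  have finE: "finite E" and finJ: "finite J"
    using fin by (auto simp: E_def J_def elim: finite_subset[rotated])
  have "{e. e dvd n} = {e. e dvd d} \<union> E" by (auto simp: E_def n_def)
  moreover have "finite {e. e dvd d}" using d by simp
  moreover have "{e. e dvd d} \<inter> E = {}" by (auto simp: E_def)
  ultimately have PG: "\<Psi> n = \<Psi> d * G"
    unfolding Psi_eq_prod[OF n] Psi_eq_prod[OF d] G_def using finE by (simp add: prod.union_disjoint)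
  have val: "evL G \<beta> = (\<Prod>j\<in>J. cycv j (evL (lam d) \<beta>))" "evL G \<beta> \<noteq> 0" if b: "\<beta> \<in> Per d" for \<beta>
  proof -
    define l where "l = evL (lam d) \<beta>"
    have bF: "\<beta> \<in> Fix d" "\<beta> \<in> Fix n" using per.Ex_Fx[of d] Fix_dvd[of d n] b by (auto simp: n_def)
    hence z: "evL (\<Psi> d) \<beta> = 0" by (simp add: Fix_iff)
    have l1: "l \<noteq> 1" using multiplier_ne_1[OF d] bF(1) by (simp add: l_def Fix_iff)
    have "evL (lam n) \<beta> \<noteq> 1"
      by (rule multiplier_ne_1[OF n]) (use bF(2) in \<open>simp only: Fix_iff\<close>)
    hence lk1: "l ^ k \<noteq> 1" using evL_lam_mult[OF bF(1), of k] by (simp only: l_def n_def not_False_eq_True)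
    have "pderiv (\<Psi> n) = \<Psi> d * pderiv G + G * pderiv (\<Psi> d)" unfolding PG by (rule pderiv_mult)
    hence "evL (pderiv (\<Psi> n)) \<beta> = evL G \<beta> * evL (pderiv (\<Psi> d)) \<beta>" by (simp only: evL_simps z mult_zero_left add_0)
    hence e: "l ^ k - 1 = evL G \<beta> * (l - 1)"
      using evL_lam_mult[OF bF(1), of k] by (simp only: pderiv_Psi evL_simps n_def l_def)
    with lk1 show "evL G \<beta> \<noteq> 0" by auto
    have "{j. j dvd k} = insert 1 J" using less.prems by (auto simp: J_def)
    hence "(\<Prod>j | j dvd k. cycv j l) = cycv 1 l * (\<Prod>j\<in>J. cycv j l)" using finJ by (simp add: J_def)
    hence "l ^ k - 1 = (l - 1) * (\<Prod>j\<in>J. cycv j l)"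
      using prod_cycv[of k l] less.prems by (simp only: cycv_1)
    hence "evL G \<beta> * (l - 1) = (\<Prod>j\<in>J. cycv j l) * (l - 1)" using e by (simp only: mult.commute)
    thus "evL G \<beta> = (\<Prod>j\<in>J. cycv j (evL (lam d) \<beta>))" using l1 by (simp add: l_def)
  qed
  have NG0: "N d G \<noteq> 0" using val(2) by (simp add: N_eq_0_iff[OF d])
  have "N d G = N d (\<Prod>j\<in>J. cyR j d)"
    by (rule N_eqI[OF d]) (simp add: emb_N[OF d] evL_cyR val(1))
  hence NG: "N d G = (\<Prod>j\<in>J. N d (cyR j d))" by (simp only: N_prod[OF d])
  define E2 where "E2 = {e\<in>E. \<not> d dvd e}"
  have EJ: "E = (*) d ` J \<union> E2" "(*) d ` J \<inter> E2 = {}"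
    using d by (auto simp: E_def E2_def J_def n_def elim!: dvdE)
  have unit: "normalize (N d (\<Phi> e)) = 1" if "e \<in> E2" for e
  proof -
    have "e \<ge> 1" using that n by (auto simp: E2_def E_def intro!: Suc_leI Nat.gr0I)
    hence "N d (\<Phi> e) dvd 1" using that d by (intro N_dynatomic_unit) (auto simp: E2_def E_def)
    thus ?thesis by (rule is_unit_normalize)
  qed
  have "(\<Prod>j\<in>J. normalize (N d (cyR j d))) = normalize (N d G)" by (simp only: NG normalize_prod)
  also have "N d G = (\<Prod>e\<in>E. N d (\<Phi> e))" unfolding G_def by (rule N_prod[OF d])
  also have "normalize \<dots> = (\<Prod>e\<in>E. normalize (N d (\<Phi> e)))" by (rule normalize_prod)
  also have "\<dots> = (\<Prod>e\<in>(*) d ` J. normalize (N d (\<Phi> e))) * (\<Prod>e\<in>E2. normalize (N d (\<Phi> e)))"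
    unfolding EJ(1) using finJ finE EJ(2) by (intro prod.union_disjoint) (auto simp: E2_def)
  also have "(\<Prod>e\<in>E2. normalize (N d (\<Phi> e))) = 1" using unit by (intro prod.neutral) auto
  also have "(\<Prod>e\<in>(*) d ` J. normalize (N d (\<Phi> e))) = (\<Prod>j\<in>J. normalize (N d (\<Phi> (d * j))))"
    using d by (subst prod.reindex) (auto simp: inj_on_def)
  finally have eq: "(\<Prod>j\<in>J. normalize (N d (cyR j d))) = (\<Prod>j\<in>J. normalize (N d (\<Phi> (d * j))))" by simp
  define J' where "J' = J - {k}"
  have J: "J = insert k J'" "k \<notin> J'" "finite J'" using less.prems finJ by (auto simp: J'_def J_def)
  have "normalize (N d (\<Phi> (d * j))) = normalize (N d (cyR j d))" if "j \<in> J'" for j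
  proof -
    have "j dvd k" "j \<noteq> 1" "j \<noteq> k" using that by (auto simp: J'_def J_def)
    moreover have "j \<noteq> 0" using \<open>j dvd k\<close> less.prems by (intro notI) simp
    ultimately have "j < k" "j \<ge> 2" using less.prems dvd_imp_le[of j k] by auto
    thus ?thesis by (rule less.IH)
  qed
  hence "(\<Prod>j\<in>J'. normalize (N d (\<Phi> (d * j)))) = (\<Prod>j\<in>J'. normalize (N d (cyR j d)))" by (rule prod.cong[OF refl])
  hence "normalize (N d (cyR k d)) * (\<Prod>j\<in>J'. normalize (N d (cyR j d)))
      = normalize (N d (\<Phi> (d * k))) * (\<Prod>j\<in>J'. normalize (N d (cyR j d)))"
    using eq J by simp
  moreover have "(\<Prod>j\<in>J'. normalize (N d (cyR j d))) \<noteq> 0"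
    using NG0 J unfolding NG by (simp add: prod_zero_iff)
  ultimately show ?case by simp
qed

lemma N_dynatomic_swap: assumes n: "n \<ge> 1" and d: "d \<ge> 1"
  shows "normalize (N n (\<Phi> d)) = normalize (N d (\<Phi> n))"
proof -
  have "emb (N n (\<Phi> d)) = (-1) ^ (card (Per n) * card (Per d)) * emb (N d (\<Phi> n))"
    by (simp only: emb_N[OF n] emb_N[OF d] evL_dynatomic[OF n] evL_dynatomic[OF d] pm_prod[of "\<lambda>x. x" "\<lambda>x. x" "Per d" "Per n"])
  also have "\<dots> = emb ((-1) ^ (card (Per n) * card (Per d)) * N d (\<Phi> n))"
    by (simp only: emb.hom_mult emb.hom_power emb.hom_uminus emb.hom_one)
  finally have "N n (\<Phi> d) = (-1) ^ (card (Per n) * card (Per d)) * N d (\<Phi> n)" by (simp only: emb.eq_iff)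
  thus ?thesis by (cases "even (card (Per n) * card (Per d))") (simp_all add: normalize_minus_eq)
qed

lemma N_dynatomic_Delta: assumes n: "n \<ge> 1" and d: "d dvd n" "d \<noteq> n"
  shows "normalize (N n (\<Phi> d)) = normalize (Delta_prop m n d) ^ d"
proof -
  obtain k where k: "n = d * k" using d(1) ..
  have "d \<noteq> 0" using k n by (intro notI) simp
  hence d1: "d \<ge> 1" by simp
  have "k \<noteq> 0" using k n by (intro notI) simp
  moreover have "k \<noteq> 1" using k d(2) by (intro notI) simp
  ultimately have k2: "k \<ge> 2" by simp
  have "normalize (N n (\<Phi> d)) = normalize (N d (\<Phi> (d * k)))" unfolding k[symmetric] by (rule N_dynatomic_swap[OF n d1])
  also have "\<dots> = normalize (N d (cyR (n div d) d))" using N_dynatomic_cyR[OF d1 k2] k d1 by simp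
  also have "\<dots> = normalize (Delta_prop m n d) ^ d" by (rule N_cyR[OF n d(1)])
  finally show ?thesis .
qed

end

section \<open>Cycle polynomials and the discriminant of the quotient curve\<close>

text \<open>\<open>lift g\<close> is the polynomial \<open>g\<close> in a new variable \<open>Y\<close>, over the ring in which the old variable lives.\<close>

definition lift :: "'a::comm_ring_1 poly \<Rightarrow> 'a poly poly" where "lift g = map_poly (\<lambda>a. [:a:]) g"

lemma const_hom: "comm_ring_hom (\<lambda>a :: 'a::comm_ring_1. [:a:])"
  by unfold_locales (auto simp: one_pCons)

lemma poly_lift: "poly (lift g) u = pcompose g u"
  by (simp add: lift_def pcompose_altdef)

lemma coeff_lift [simp]: "coeff (lift g) i = [:coeff g i:]" by (simp add: lift_def coeff_map_poly)

lemma lift_mult: "lift (a * b) = lift a * lift b"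
proof -
  interpret c: comm_ring_hom "\<lambda>a :: 'a. [:a:]" by (rule const_hom)
  interpret m: map_poly_comm_ring_hom "\<lambda>a :: 'a. [:a:]" ..
  show ?thesis unfolding lift_def by (rule m.hom_mult)
qed

lemma lift_add: "lift (a + b) = lift a + lift b" by (rule poly_eqI) simp
lemma lift_pderiv: "pderiv (lift g) = lift (pderiv g)"
proof (rule poly_eqI)
  fix i
  have "of_nat (Suc i) = ([:of_nat (Suc i):] :: 'a poly)" by (rule of_nat_poly)
  thus "coeff (pderiv (lift g)) i = coeff (lift (pderiv g)) i" by (simp only: coeff_pderiv coeff_lift) simp
qed

lemma poly_lift_X: "poly (lift g) [:0, 1:] = g"
  by (simp only: poly_lift pcompose_idR)

lemma pderiv_poly_ideal: "is_ideal I \<Longrightarrow> f \<in> poly_ideal I \<Longrightarrow> pderiv f \<in> poly_ideal I"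
  unfolding poly_ideal_def by (auto simp: coeff_pderiv intro: is_ideal_multl)

text \<open>A polynomial of degree less than \<open>k\<close> with \<open>k\<close> zeros modulo an ideal vanishes modulo the ideal, when the
  differences of the zeros may be cancelled.\<close>

lemma vanish_mod_ideal:
  assumes I: "is_ideal I"
  shows "(\<And>i. i \<ge> k \<Longrightarrow> coeff R i = 0) \<Longrightarrow> (\<And>i. i < k \<Longrightarrow> poly R (y i) \<in> I) \<Longrightarrow>
    (\<And>i j a. i < j \<Longrightarrow> j < k \<Longrightarrow> (y i - y j) * a \<in> I \<Longrightarrow> a \<in> I) \<Longrightarrow> R \<in> poly_ideal I"
proof (induction k arbitrary: R)
  case 0
  hence "R = 0" by (intro poly_eqI) simp
  thus ?case using is_ideal_zero[OF is_ideal_poly_ideal[OF I]] by simp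
next
  case (Suc k)
  note I' = is_ideal_poly_ideal[OF I]
  define S where "S = synthetic_div R (y k)"
  define r where "r = poly R (y k)"
  have r: "r \<in> I" using Suc.prems(2)[of k] by (simp add: r_def)
  have R: "R = [:- y k, 1:] * S + [:r:]"
    unfolding S_def r_def by (rule synthetic_div_correct'[symmetric])
  have degR: "degree R \<le> k" using Suc.prems(1) by (intro degree_le) auto
  have "S \<in> poly_ideal I"
  proof (rule Suc.IH)
    fix i assume "i \<ge> k"
    show "coeff S i = 0"
    proof (cases "degree R = 0")
      case True
      hence "S = 0" by (simp add: S_def synthetic_div_eq_0_iff)
      thus ?thesis by simp
    next
      case False
      have "degree S = degree R - 1" unfolding S_def by (rule degree_synthetic_div)
      hence "degree S < i" using False degR \<open>i \<ge> k\<close> by simp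
      thus ?thesis by (rule coeff_eq_0)
    qed
  next
    fix i assume i: "i < k"
    have "(y i - y k) * poly S (y i) = poly R (y i) - r" by (subst R) (simp add: algebra_simps)
    also have "\<dots> \<in> I" using Suc.prems(2)[of i] i r I by (auto intro: is_ideal_diff)
    finally show "poly S (y i) \<in> I" using Suc.prems(3)[of i k] i by simp
  next
    fix i j a assume "i < j" "j < k" "(y i - y j) * a \<in> I"
    thus "a \<in> I" using Suc.prems(3)[of i j a] by simp
  qed
  thus ?case using R I' r const_poly_ideal[OF I r] is_ideal_multl[OF I', of S] is_ideal_add[OF I'] by metis
qed

context unicritical begin

definition RI :: "int \<Rightarrow> nat \<Rightarrow> int poly poly set" where
  "RI q n = {x. \<exists>a. \<Phi> n dvd x - a * of_int q}"

lemma is_ideal_RI: "is_ideal (RI q n)"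
  unfolding RI_def by (rule is_ideal_cong_multiples)

lemma RI_dvd: "\<Phi> n dvd x \<Longrightarrow> x \<in> RI q n"
  unfolding RI_def by (auto intro!: exI[of _ 0])

lemma RI_0: "x \<in> RI 0 n \<longleftrightarrow> \<Phi> n dvd x" by (simp add: RI_def)

lemma RI_q: "of_int q \<in> RI q n"
  unfolding RI_def by (auto intro!: exI[of _ 1])

text \<open>The norm of \<open>s\<close> is a multiple of \<open>s\<close> on the curve.\<close>

lemma N_multiple: assumes n: "n \<ge> 1" shows "\<exists>b. \<Phi> n dvd [:N n s:] - s * b"
proof -
  define \<chi> where "\<chi> = char_poly (mult_mat (\<Phi> n) s)"
  have chiL: "map_poly emb \<chi> = (\<Prod>\<alpha>\<in>Per n. [:- evL s \<alpha>, 1:])" unfolding \<chi>_def by (rule emb_char_poly[OF n])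
  have d: "\<Phi> n dvd pcompose \<chi> s"
  proof (rule dvd_dynatomic[OF n])
    fix \<alpha> assume a: "\<alpha> \<in> Per n"
    have "evL (pcompose \<chi> s) \<alpha> = (\<Prod>\<beta>\<in>Per n. evL s \<alpha> - evL s \<beta>)"
      by (simp add: emb.map_poly_pcompose poly_pcompose chiL poly_prod)
    also have "\<dots> = 0" by (rule prod_zero[OF per.finite_Ex[OF n]], rule bexI[OF _ a]) simp
    finally show "evL (pcompose \<chi> s) \<alpha> = 0" .
  qed
  obtain a \<chi>1 where c: "\<chi> = pCons a \<chi>1" by (cases \<chi>)
  have pc: "pcompose \<chi> s = [:a:] + s * pcompose \<chi>1 s" by (simp add: c pcompose_pCons)
  have "emb a = emb (coeff \<chi> 0)" by (simp add: c)
  also have "\<dots> = coeff (map_poly emb \<chi>) 0" by simp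
  also have "\<dots> = poly (\<Prod>\<alpha>\<in>Per n. [:- evL s \<alpha>, 1:]) 0" unfolding chiL by (rule poly_0_coeff_0[symmetric])
  also have "\<dots> = (\<Prod>\<alpha>\<in>Per n. (-1) * evL s \<alpha>)" unfolding poly_prod by (rule prod.cong[OF refl]) simp
  also have "\<dots> = (-1) ^ card (Per n) * emb (N n s)"
    by (simp only: prod.distrib prod_constant emb_N[OF n])
  also have "\<dots> = emb ((-1) ^ card (Per n) * N n s)"
    by (simp only: emb.hom_mult emb.hom_power emb.hom_uminus emb.hom_one)
  finally have a: "a = (-1) ^ card (Per n) * N n s" by (simp only: emb.eq_iff)
  show ?thesis
  proof (cases "even (card (Per n))")
    case True
    thus ?thesis using d pc a by (intro exI[of _ "- pcompose \<chi>1 s"]) simp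
  next
    case False
    have "\<Phi> n dvd - pcompose \<chi> s" using d by simp
    also have "- pcompose \<chi> s = [:N n s:] - s * pcompose \<chi>1 s" using False pc a by simp
    finally show ?thesis by blast
  qed
qed

text \<open>A function whose norm is not divisible by \<open>q\<close> is not a zero divisor modulo \<open>q\<close>.\<close>

lemma nonzerodivisor:
  assumes n: "n \<ge> 1" and q: "q = 0 \<or> prime q" and s: "\<not> [:q:] dvd N n s" and a: "s * a \<in> RI q n"
  shows "a \<in> RI q n"
proof -
  note I = is_ideal_RI[of q n]
  note lc = dynatomic_L(1)[OF n]
  obtain b where b: "\<Phi> n dvd [:N n s:] - s * b" using N_multiple[OF n] by blast
  define r where "r = mmod (\<Phi> n) a"
  have ar: "a = \<Phi> n * mdiv (\<Phi> n) a + r" unfolding r_def by (rule mdiv_mmod(1)[OF lc])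
  have rd: "coeff r i = 0" if "i \<ge> degree (\<Phi> n)" for i unfolding r_def by (rule mdiv_mmod(2)[OF lc that])
  have "r = a - \<Phi> n * mdiv (\<Phi> n) a" using ar by (simp only: diff_eq_eq add.commute)
  hence "s * r = s * a - \<Phi> n * (s * mdiv (\<Phi> n) a)" by (simp only: right_diff_distrib mult.left_commute[of s])
  moreover have "\<Phi> n * (s * mdiv (\<Phi> n) a) \<in> RI q n" by (intro RI_dvd dvd_triv_left)
  ultimately have sr: "s * r \<in> RI q n" using is_ideal_diff[OF I a] by (simp only:)
  have "[:N n s:] * r = ([:N n s:] - s * b) * r + b * (s * r)" by (simp add: algebra_simps)
  also have "\<dots> \<in> RI q n"
    by (rule is_ideal_add[OF I RI_dvd[OF dvd_mult2[OF b]] is_ideal_multl[OF I sr]])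
  finally obtain u where u: "\<Phi> n dvd [:N n s:] * r - u * of_int q" by (auto simp: RI_def)
  define v where "v = mmod (\<Phi> n) u"
  have oq: "of_int q = [:[:q:]:]" by (simp add: of_int_poly)
  have "mmod (\<Phi> n) ([:N n s:] * r - u * of_int q) = 0"
    using u mmod_multiple[OF lc] by (auto elim: dvdE)
  moreover have "mmod (\<Phi> n) ([:N n s:] * r) = [:N n s:] * r"
    by (rule mdiv_mmod_eqI(2)[OF lc, where Q = 0]) (auto simp: rd)
  moreover have "mmod (\<Phi> n) (u * of_int q) = v * of_int q"
    using mmod_smult[OF lc, of "[:q:]" u] by (simp add: v_def oq)
  ultimately have e: "[:N n s:] * r = v * of_int q" by (simp add: mmod_diff[OF lc])
  have "[:q:] dvd coeff r i" for i
  proof -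
    have "N n s * coeff r i = coeff v i * [:q:]"
      using arg_cong[OF e, of "\<lambda>p. coeff p i"] by (simp add: oq)
    hence dv: "[:q:] dvd N n s * coeff r i" by (rule ssubst) (rule dvd_triv_right)
    from q show ?thesis
    proof
      assume "q = 0"
      with dv s show ?thesis by simp
    next
      assume "prime q"
      hence "prime_elem [:q:]" by (intro lift_prime_elem_poly prime_imp_prime_elem)
      with dv s show ?thesis by (simp add: prime_elem_dvd_mult_iff)
    qed
  qed
  hence "[:[:q:]:] dvd r" by (simp add: const_poly_dvd_iff)
  then obtain w where "r = [:[:q:]:] * w" by (rule dvdE)
  hence "r = w * of_int q" by (simp only: oq mult.commute)
  hence "r \<in> RI q n" using is_ideal_multl[OF I RI_q] by simp
  moreover have "\<Phi> n * mdiv (\<Phi> n) a \<in> RI q n" by (intro RI_dvd dvd_triv_left)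
  ultimately show ?thesis by (subst ar) (rule is_ideal_add[OF I])
qed

definition V :: "nat \<Rightarrow> int poly poly" where "V n = (\<Prod>d | d dvd n \<and> d \<noteq> n. \<Phi> d)"

lemma Psi_V: assumes n: "n \<ge> 1" shows "\<Psi> n = \<Phi> n * V n"
proof -
  have "finite {d. d dvd n}" using n by simp
  hence "finite {d. d dvd n \<and> d \<noteq> n}" by (rule finite_subset[rotated]) auto
  moreover have "{d. d dvd n} = insert n {d. d dvd n \<and> d \<noteq> n}" by auto
  ultimately show ?thesis unfolding V_def Psi_eq_prod[OF n] by simp
qed

lemma Psi_dvd_V: assumes n: "n \<ge> 1" and g: "g dvd n" "g \<noteq> n" shows "\<Psi> g dvd V n"
proof -
  have g1: "g \<ge> 1" using n g by (auto intro!: Suc_leI Nat.gr0I)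
  have "finite {d. d dvd n}" using n by simp
  hence fin: "finite {d. d dvd n \<and> d \<noteq> n}" by (rule finite_subset[rotated]) auto
  have "{d. d dvd g} \<subseteq> {d. d dvd n \<and> d \<noteq> n}" using g by (auto intro: dvd_trans dest: dvd_antisym)
  from prod_dvd_prod_subset[OF fin this] show ?thesis unfolding V_def Psi_eq_prod[OF g1] .
qed

lemma N_uminus: assumes n: "n \<ge> 1" shows "normalize (N n (- a)) = normalize (N n a)"
proof -
  have "N n (-1) * N n (-1) = 1" using N_mult[OF n, of "-1" "-1"] n by simp
  hence "N n (-1) dvd 1" by (metis dvd_triv_left)
  hence "normalize (N n (-1)) = 1" by (rule is_unit_normalize)
  thus ?thesis using N_mult[OF n, of "-1" a] by (simp add: normalize_mult)
qed

lemma N_pderiv_Psi: assumes n: "n \<ge> 1"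
  shows "normalize (poly (delta m n) 1) ^ n = normalize (N n (pderiv (\<Phi> n))) * normalize (N n (V n))"
proof -
  have "\<Phi> n dvd pderiv (\<Psi> n) - pderiv (\<Phi> n) * V n" by (simp add: Psi_V[OF n] pderiv_mult)
  hence "N n (pderiv (\<Psi> n)) = N n (pderiv (\<Phi> n)) * N n (V n)" using N_cong[OF n] N_mult[OF n] by simp
  moreover have "pderiv (\<Psi> n) = - (1 - lam n)" by (simp add: pderiv_Psi)
  ultimately have "normalize (N n (1 - lam n)) = normalize (N n (pderiv (\<Phi> n))) * normalize (N n (V n))"
    using N_uminus[OF n, of "1 - lam n"] by (simp only: normalize_mult)
  thus ?thesis by (simp add: delta_1_power[OF n, symmetric] normalize_power)
qed

lemma delta_1_nonzero: assumes n: "n \<ge> 1" shows "poly (delta m n) 1 \<noteq> 0"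
proof
  assume "poly (delta m n) 1 = 0"
  hence "N n (1 - lam n) = 0 ^ n" using delta_1_power[OF n] by simp
  hence "N n (1 - lam n) = 0" using n by (simp add: power_0_left)
  hence "\<exists>\<alpha>\<in>Per n. evL (1 - lam n) \<alpha> = 0" by (rule N_eq_0_iff[OF n, THEN iffD1])
  then obtain \<alpha> where a: "\<alpha> \<in> Per n" "evL (1 - lam n) \<alpha> = 0" by (rule bexE)
  have "evL (lam n) \<alpha> \<noteq> 1"
    by (rule multiplier_ne_1[OF n]) (use a(1) per.Ex_Fx[of n] in \<open>auto simp flip: Fix_iff\<close>)
  with a(2) show False by (simp only: evL_simps right_minus_eq) (metis)
qed

definition ok :: "int \<Rightarrow> nat \<Rightarrow> bool" where
  "ok q n \<longleftrightarrow> n \<ge> 1 \<and> (q = 0 \<or> prime q) \<and> \<not> [:q:] dvd poly (delta m n) 1"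

lemma ok_0: "n \<ge> 1 \<Longrightarrow> ok 0 n" using delta_1_nonzero by (simp add: ok_def)

lemma ok_power: assumes "ok q n" "[:q:] dvd poly (delta m n) 1 ^ k" shows False
proof -
  from assms(1) have "q = 0 \<or> prime q" by (simp add: ok_def)
  thus False
  proof
    assume "q = 0"
    with assms delta_1_nonzero show False by (simp add: ok_def)
  next
    assume "prime q"
    hence "prime_elem [:q:]" by (intro lift_prime_elem_poly prime_imp_prime_elem)
    with assms show False by (auto simp: ok_def dest: prime_elem_dvd_power)
  qed
qed

lemma N_F_diff:
  assumes n: "n \<ge> 1" and ij: "i < j" "j < n"
  shows "N n (F j - F i) dvd poly (delta m n) 1 ^ n"
proof -
  have "F j - F i = pcompose (\<Psi> (j - i)) (F i)"
    using F_add[of "j - i" i] ij by (simp add: Psi_def pcompose_diff pcompose_pCons)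
  hence "N n (F j - F i) = N n (\<Psi> (j - i))" by (simp add: N_shift[OF n])
  hence "normalize (N n (F j - F i)) = normalize (N n (\<Psi> (gcd (j - i) n)))" using N_Psi_gcd[OF n] by simp
  moreover have "gcd (j - i) n \<noteq> n"
  proof
    assume "gcd (j - i) n = n"
    hence "n dvd j - i" by (metis gcd_dvd1)
    hence "n \<le> j - i" using ij by (intro dvd_imp_le) auto
    thus False using ij by simp
  qed
  hence "\<Psi> (gcd (j - i) n) dvd V n" by (intro Psi_dvd_V[OF n]) auto
  hence "N n (\<Psi> (gcd (j - i) n)) dvd N n (V n)" using N_mult[OF n] by (auto elim!: dvdE)
  ultimately have "N n (F j - F i) dvd N n (V n)" by (metis normalize_dvd_iff)
  also have "\<dots> dvd normalize (poly (delta m n) 1) ^ n" unfolding N_pderiv_Psi[OF n] by simp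
  also have "\<dots> dvd poly (delta m n) 1 ^ n" by (simp flip: normalize_power)
  finally show ?thesis .
qed

lemma F_diff_cancel:
  assumes ok: "ok q n" and ij: "i < j" "j < n" and a: "(F i - F j) * a \<in> RI q n"
  shows "a \<in> RI q n"
proof (rule nonzerodivisor)
  show n: "n \<ge> 1" "q = 0 \<or> prime q" using ok by (auto simp: ok_def)
  show "\<not> [:q:] dvd N n (F j - F i)" using N_F_diff[OF n(1) ij] ok_power[OF ok] dvd_trans by blast
  show "(F j - F i) * a \<in> RI q n" using is_ideal_uminus[OF is_ideal_RI a] by (simp add: algebra_simps)
qed

definition CP :: "nat \<Rightarrow> int poly poly poly" where "CP n = (\<Prod>i<n. [:- F i, 1:])"
definition QP :: "nat \<Rightarrow> int poly poly poly" where "QP n = mdiv (CP n) (lift (\<Phi> n))"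
definition gP :: "nat \<Rightarrow> int poly poly" where "gP n = poly (QP n) [:0, 1:]"

lemma CP_monic: "lead_coeff (CP n) = 1" and CP_degree: "degree (CP n) = n"
  unfolding CP_def by (simp add: lead_coeff_prod, subst degree_prod_eq_sum_degree) auto

lemma poly_CP_F: "i < n \<Longrightarrow> poly (CP n) (F i) = 0"
  unfolding CP_def by (auto simp: poly_prod intro!: prod_zero)

lemma dynatomic_dvd_shift: assumes n: "n \<ge> 1" shows "\<Phi> n dvd pcompose (\<Phi> n) (F k)"
  by (rule dvd_dynatomic[OF n]) (simp add: evL_pcompose_F root_dynatomic[OF n] funpow_Per[OF n])

lemma rem_CP_ideal:
  assumes ok: "ok q n" and H: "\<And>i. i < n \<Longrightarrow> poly H (F i) \<in> RI q n"
  shows "mmod (CP n) H \<in> poly_ideal (RI q n)"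
proof (rule vanish_mod_ideal[OF is_ideal_RI, of n _ F])
  fix i assume "i \<ge> n"
  thus "coeff (mmod (CP n) H) i = 0" using mdiv_mmod(2)[OF CP_monic] by (simp add: CP_degree)
next
  fix i assume i: "i < n"
  have "poly H (F i) = poly (CP n * mdiv (CP n) H + mmod (CP n) H) (F i)"
    using mdiv_mmod(1)[OF CP_monic] by metis
  thus "poly (mmod (CP n) H) (F i) \<in> RI q n" using H[OF i] by (simp add: poly_CP_F[OF i])
next
  fix i j a assume "i < j" "j < n" "(F i - F j) * a \<in> RI q n"
  thus "a \<in> RI q n" by (rule F_diff_cancel[OF ok])
qed

lemma dynatomic_factor:
  assumes ok: "ok q n"
  shows "lift (\<Phi> n) - CP n * QP n \<in> poly_ideal (RI q n)"
proof -
  have n: "n \<ge> 1" using ok by (simp add: ok_def)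
  have "mmod (CP n) (lift (\<Phi> n)) \<in> poly_ideal (RI q n)"
    by (rule rem_CP_ideal[OF ok]) (simp add: poly_lift RI_dvd dynatomic_dvd_shift[OF n])
  moreover have "lift (\<Phi> n) - CP n * QP n = mmod (CP n) (lift (\<Phi> n))"
    using mdiv_mmod(1)[OF CP_monic, of "lift (\<Phi> n)" n] by (simp add: QP_def algebra_simps)
  ultimately show ?thesis by simp
qed

text \<open>The derivative of the dynatomic polynomial is the product of the different of the cover of the quotient curve
  and of \<open>gP\<close>.\<close>

lemma pderiv_dynatomic_factor: assumes n: "n \<ge> 1"
  shows "\<Phi> n dvd pderiv (\<Phi> n) - (\<Prod>i\<in>{1..<n}. [:0, 1:] - F i) * gP n"
proof -
  let ?X = "[:0, 1 :: int poly:]"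
  define R where "R = lift (\<Phi> n) - CP n * QP n"
  have R: "R \<in> poly_ideal (RI 0 n)" unfolding R_def by (rule dynatomic_factor[OF ok_0[OF n]])
  define C' where "C' = (\<Prod>i\<in>{1..<n}. [:- F i, 1:])"
  have "{..<n} = insert 0 {1..<n}" using n by auto
  hence C: "CP n = [:- ?X, 1:] * C'" by (simp add: CP_def C'_def)
  have C0: "poly (CP n) ?X = 0" using poly_CP_F[of 0 n] n by simp
  have "pderiv (CP n) = [:- ?X, 1:] * pderiv C' + C' * pderiv [:- ?X, 1:]" unfolding C by (rule pderiv_mult)
  hence C1: "poly (pderiv (CP n)) ?X = (\<Prod>i\<in>{1..<n}. ?X - F i)"
    by (simp add: C'_def poly_prod pderiv_pCons del: mult_pCons_left)
  have "lift (\<Phi> n) = CP n * QP n + R" by (simp add: R_def)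
  hence "lift (pderiv (\<Phi> n)) = pderiv (CP n * QP n + R)" by (simp flip: lift_pderiv)
  hence "lift (pderiv (\<Phi> n)) = CP n * pderiv (QP n) + QP n * pderiv (CP n) + pderiv R"
    by (simp only: pderiv_add pderiv_mult)
  from arg_cong[OF this, of "\<lambda>p. poly p ?X"]
  have "pderiv (\<Phi> n) = gP n * (\<Prod>i\<in>{1..<n}. ?X - F i) + poly (pderiv R) ?X"
    by (simp only: poly_lift_X poly_add poly_mult C0 C1 gP_def mult_zero_left add_0)
  moreover have "poly (pderiv R) ?X \<in> RI 0 n"
    by (intro poly_poly_ideal[OF is_ideal_RI] pderiv_poly_ideal[OF is_ideal_RI] R)
  ultimately show ?thesis by (simp add: RI_0 mult.commute)
qed

lemma prod_gcd_regroup: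
  fixes h :: "nat \<Rightarrow> 'a::comm_monoid_mult"
  assumes n: "n \<ge> 1"
  shows "(\<Prod>i\<in>{1..<n}. \<Prod>d | d dvd gcd i n. h d) = (\<Prod>d | d dvd n \<and> d \<noteq> n. h d ^ (n div d - 1))"
proof -
  let ?D = "{d. d dvd n \<and> d \<noteq> n}"
  have "finite {d. d dvd n}" using n by simp
  hence fin: "finite ?D" by (rule finite_subset[rotated]) auto
  have "(\<Prod>i\<in>{1..<n}. \<Prod>d | d dvd gcd i n. h d) = (\<Prod>i\<in>{1..<n}. \<Prod>d\<in>?D. if d dvd i then h d else 1)"
  proof (rule prod.cong[OF refl])
    fix i assume i: "i \<in> {1..<n}"
    have "{d. d dvd gcd i n} = {d \<in> ?D. d dvd i}"
    proof -
      have "\<not> n dvd i" using i by (auto dest: dvd_imp_le)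
      thus ?thesis by auto
    qed
    thus "(\<Prod>d | d dvd gcd i n. h d) = (\<Prod>d\<in>?D. if d dvd i then h d else 1)"
      using prod.inter_filter[OF fin] by (simp only:)
  qed
  also have "\<dots> = (\<Prod>d\<in>?D. \<Prod>i\<in>{1..<n}. if d dvd i then h d else 1)" by (rule prod.swap)
  also have "\<dots> = (\<Prod>d\<in>?D. h d ^ (n div d - 1))"
  proof (rule prod.cong[OF refl])
    fix d assume d: "d \<in> ?D"
    then obtain k where k: "n = d * k" by (auto elim: dvdE)
    have d0: "d > 0" using k n by (intro Nat.gr0I notI) simp
    have "(\<Prod>i\<in>{1..<n}. if d dvd i then h d else 1) = (\<Prod>i\<in>{i\<in>{1..<n}. d dvd i}. h d)"
      by (rule prod.inter_filter[symmetric]) simp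
    also have "{i\<in>{1..<n}. d dvd i} = (*) d ` {1..<k}"
      using d0 by (auto simp: k elim!: dvdE)
    also have "(\<Prod>i\<in>(*) d ` {1..<k}. h d) = h d ^ (k - 1)"
      using d0 by (simp add: card_image inj_on_def)
    finally show "(\<Prod>i\<in>{1..<n}. if d dvd i then h d else 1) = h d ^ (n div d - 1)"
      using d0 by (simp add: k)
  qed
  finally show ?thesis .
qed

lemma normalize_delta_1_power: assumes n: "n \<ge> 1"
  shows "normalize (poly (delta m n) 1) ^ n =
    normalize (N n (gP n)) * normalize (\<Prod>d | d dvd n \<and> d \<noteq> n. Delta_prop m n d) ^ n"
proof -
  let ?D = "{d. d dvd n \<and> d \<noteq> n}"
  let ?h = "\<lambda>d. normalize (N n (\<Phi> d))"
  have "N n (pderiv (\<Phi> n)) = (\<Prod>i\<in>{1..<n}. N n ([:0, 1:] - F i)) * N n (gP n)"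
    using N_cong[OF n pderiv_dynatomic_factor[OF n]] by (simp only: N_mult[OF n] N_prod[OF n])
  moreover have "normalize (N n ([:0, 1:] - F i)) = (\<Prod>d | d dvd gcd i n. ?h d)" if "i \<in> {1..<n}" for i
  proof -
    have g: "gcd i n \<ge> 1" using n by (simp add: Suc_leI)
    have "[:0, 1:] - F i = - \<Psi> i" by (simp add: Psi_def)
    hence "normalize (N n ([:0, 1:] - F i)) = normalize (N n (\<Psi> i))" by (simp only: N_uminus[OF n])
    also have "\<dots> = normalize (N n (\<Psi> (gcd i n)))" by (rule N_Psi_gcd[OF n])
    finally show ?thesis by (simp only: Psi_eq_prod[OF g] N_prod[OF n] normalize_prod)
  qed
  ultimately have "normalize (N n (pderiv (\<Phi> n))) = (\<Prod>d\<in>?D. ?h d ^ (n div d - 1)) * normalize (N n (gP n))"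
    using prod_gcd_regroup[OF n, of ?h] by (simp add: normalize_mult normalize_prod)
  moreover have "normalize (N n (V n)) = (\<Prod>d\<in>?D. ?h d)" by (simp only: V_def N_prod[OF n] normalize_prod)
  ultimately have "normalize (poly (delta m n) 1) ^ n = normalize (N n (gP n)) * (\<Prod>d\<in>?D. ?h d ^ (n div d - 1) * ?h d)"
    unfolding N_pderiv_Psi[OF n] by (simp only: prod.distrib mult_ac)
  also have "(\<Prod>d\<in>?D. ?h d ^ (n div d - 1) * ?h d) = (\<Prod>d\<in>?D. normalize (Delta_prop m n d) ^ n)"
  proof (rule prod.cong[OF refl])
    fix d assume d: "d \<in> ?D"
    then obtain k where k: "n = d * k" by (auto elim: dvdE)
    have k0: "k \<noteq> 0" "d \<noteq> 0" using k n by (auto intro!: notI)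
    have "?h d ^ (n div d - 1) * ?h d = ?h d ^ k" using k k0 by (cases k) simp_all
    also have "\<dots> = (normalize (Delta_prop m n d) ^ d) ^ k" using N_dynatomic_Delta[OF n, of d] d by simp
    finally show "?h d ^ (n div d - 1) * ?h d = normalize (Delta_prop m n d) ^ n" by (simp only: k power_mult)
  qed
  also have "\<dots> = normalize (\<Prod>d\<in>?D. Delta_prop m n d) ^ n" by (simp only: prod_power_distrib[symmetric] normalize_prod)
  finally show ?thesis .
qed

lemma Delta_prim: assumes n: "n \<ge> 1"
  shows "poly (delta m n) 1 = Delta_prim m n * (\<Prod>d | d dvd n \<and> d \<noteq> n. Delta_prop m n d)"
    and "normalize (Delta_prim m n) ^ n = normalize (N n (gP n))"
proof -
  define T where "T = (\<Prod>d | d dvd n \<and> d \<noteq> n. Delta_prop m n d)"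
  let ?\<delta> = "poly (delta m n) 1"
  note e = normalize_delta_1_power[OF n, folded T_def]
  have "normalize T ^ n dvd normalize ?\<delta> ^ n" by (simp add: e)
  hence "T dvd ?\<delta>" using n by simp
  then obtain u where "?\<delta> = T * u" by (rule dvdE)
  hence u: "?\<delta> = u * T" by (simp only: mult.commute)
  have T0: "T \<noteq> 0" using u delta_1_nonzero[OF n] by auto
  have D: "Delta_prim m n = u"
    unfolding Delta_prim_def T_def[symmetric] by (rule the_equality) (use u T0 in auto)
  show "?\<delta> = Delta_prim m n * (\<Prod>d | d dvd n \<and> d \<noteq> n. Delta_prop m n d)"
    unfolding D T_def[symmetric] by (rule u)
  have "normalize u ^ n * normalize T ^ n = normalize (N n (gP n)) * normalize T ^ n"
    using e by (simp only: u normalize_mult power_mult_distrib)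
  moreover have "normalize T ^ n \<noteq> 0" using T0 by simp
  ultimately show "normalize (Delta_prim m n) ^ n = normalize (N n (gP n))" unfolding D using mult_right_cancel by blast
qed

end

section \<open>The leading coefficient of the multiplier polynomial\<close>

lemma poly_over_power_tendsto:
  fixes p :: "real poly"
  assumes "degree p \<le> d"
  shows "(\<lambda>k. poly p (real k) / real k ^ d) \<longlonglongrightarrow> coeff p d"
proof -
  have term_lim: "(\<lambda>k. coeff p i * (real k ^ i / real k ^ d)) \<longlonglongrightarrow> (if i = d then coeff p i else 0)" if "i \<in> {..d}" for i
  proof (cases "i = d")
    case True
    have "eventually (\<lambda>k. coeff p i * (real k ^ i / real k ^ d) = coeff p i) sequentially"
      using eventually_gt_at_top[of 0] by eventually_elim (simp add: True)
    thus ?thesis using True by (simp add: tendsto_eventually)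
  next
    case False
    have ev: "eventually (\<lambda>k. coeff p i * (inverse (real k)) ^ (d - i) = coeff p i * (real k ^ i / real k ^ d)) sequentially"
      using eventually_gt_at_top[of 0]
    proof eventually_elim
      case (elim k)
      have "real k ^ d = real k ^ i * real k ^ (d - i)" using that by (simp flip: power_add)
      thus ?case using elim by (simp add: power_inverse divide_inverse)
    qed
    have "(\<lambda>k. coeff p i * (inverse (real k)) ^ (d - i)) \<longlonglongrightarrow> coeff p i * 0 ^ (d - i)"
      by (intro tendsto_intros lim_inverse_n)
    hence "(\<lambda>k. coeff p i * (inverse (real k)) ^ (d - i)) \<longlonglongrightarrow> 0" using False that by (simp add: power_0_left)
    from Lim_transform_eventually[OF this ev] show ?thesis using False by simp
  qed
  have "(\<lambda>k. \<Sum>i\<le>d. coeff p i * (real k ^ i / real k ^ d)) \<longlonglongrightarrow> (\<Sum>i\<le>d. if i = d then coeff p i else 0)"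
    by (intro tendsto_sum term_lim)
  also have "(\<Sum>i\<le>d. if i = d then coeff p i else 0) = coeff p d" by simp
  also have "(\<lambda>k. \<Sum>i\<le>d. coeff p i * (real k ^ i / real k ^ d)) = (\<lambda>k. poly p (real k) / real k ^ d)"
  proof
    fix k
    have "poly p (real k) = (\<Sum>i<Suc d. coeff p i * real k ^ i)"
      by (rule poly_as_sum_lt(1)) (use assms in \<open>auto intro: coeff_eq_0\<close>)
    thus "(\<Sum>i\<le>d. coeff p i * (real k ^ i / real k ^ d)) = poly p (real k) / real k ^ d"
      by (simp only: lessThan_Suc_atMost sum_divide_distrib times_divide_eq_right)
  qed
  finally show ?thesis .
qed

lemma lead_coeff_eq_of_ratio_tendsto_1:
  fixes p q :: "real poly"
  assumes lim: "(\<lambda>k. poly p (real k) / poly q (real k)) \<longlonglongrightarrow> 1"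
    and nz: "eventually (\<lambda>k. poly q (real k) \<noteq> 0) sequentially" and q: "q \<noteq> 0"
  shows "lead_coeff p = lead_coeff q"
proof -
  define d where "d = max (degree p) (degree q)"
  have "(\<lambda>k. (poly p (real k) / poly q (real k)) * (poly q (real k) / real k ^ d)) \<longlonglongrightarrow> 1 * coeff q d"
    by (intro tendsto_mult lim poly_over_power_tendsto) (simp add: d_def)
  moreover have "eventually (\<lambda>k. (poly p (real k) / poly q (real k)) * (poly q (real k) / real k ^ d) = poly p (real k) / real k ^ d) sequentially"
    using nz by eventually_elim simp
  ultimately have "(\<lambda>k. poly p (real k) / real k ^ d) \<longlonglongrightarrow> 1 * coeff q d" by (rule Lim_transform_eventually)
  moreover have "(\<lambda>k. poly p (real k) / real k ^ d) \<longlonglongrightarrow> coeff p d" by (rule poly_over_power_tendsto) (simp add: d_def)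
  ultimately have e: "coeff p d = coeff q d" using LIMSEQ_unique by fastforce
  show ?thesis
  proof (cases "degree p = d")
    case True
    show ?thesis
    proof (cases "degree q = d")
      case False
      hence "coeff q d = 0" by (intro coeff_eq_0) (simp add: d_def split: if_splits)
      hence "p = 0" using e True by (metis leading_coeff_0_iff)
      hence "degree q = d" using True by (simp add: d_def)
      thus ?thesis using False by simp
    qed (use e True in simp)
  next
    case False
    hence dq: "degree q = d" "degree p < d" by (auto simp: d_def max_def split: if_splits)
    hence "coeff p d = 0" by (intro coeff_eq_0)
    hence "q = 0" using e dq by (metis leading_coeff_0_iff)
    thus ?thesis using q by simp
  qed
qed

text \<open>A periodic orbit of \<open>y \<mapsto> y\<^sup>m + c\<close> with \<open>c\<close> large stays away from \<open>0\<close>: the point of the orbit that is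
  largest in absolute value is smaller than \<open>c / 2\<close>, for otherwise its image would be larger still.\<close>

lemma periodic_orbit_large:
  fixes z :: "nat \<Rightarrow> complex" and c :: real
  assumes m: "m \<ge> 2" and n: "n \<ge> 1" and c: "c \<ge> 8"
    and step: "\<And>i. z (Suc i) = z i ^ m + of_real c" and per: "z n = z 0"
  shows "i < n \<Longrightarrow> norm (z i) ^ m \<ge> c / 2"
proof -
  have "Max ((\<lambda>i. norm (z i)) ` {..n}) \<in> (\<lambda>i. norm (z i)) ` {..n}" by (intro Max_in) auto
  then obtain i0 where i0': "i0 \<le> n" "Max ((\<lambda>i. norm (z i)) ` {..n}) = norm (z i0)"
    by (rule imageE) simp
  have max: "norm (z j) \<le> norm (z i0)" if "j \<le> n" for j unfolding i0'(2)[symmetric] by (intro Max_ge) (use that in auto)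
  define i1 where "i1 = (if i0 = n then 0 else i0)"
  have i1: "i1 < n" "z i1 = z i0" using i0'(1) n per by (auto simp: i1_def)
  define M where "M = norm (z i0)"
  have M0: "M \<ge> 0" by (simp add: M_def)
  have "z i1 ^ m = z (Suc i1) - of_real c" using step[of i1] by simp
  hence "norm (z i1 ^ m) \<le> norm (z (Suc i1)) + norm (of_real c :: complex)" by (metis norm_triangle_ineq4)
  moreover have "norm (z (Suc i1)) \<le> M" unfolding M_def using i1 by (intro max) simp
  moreover have "norm (of_real c :: complex) = c" using c by simp
  ultimately have Mm: "M ^ m \<le> M + c" by (simp add: norm_power i1(2) M_def)
  have Mc: "M < c / 2"
  proof (rule ccontr)
    assume "\<not> M < c / 2"
    hence Mge: "M \<ge> c / 2" by simp
    have "M * M = M ^ 2" by (simp add: power2_eq_square)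
    also have "\<dots> \<le> M ^ m" using m Mge c by (intro power_increasing) auto
    also have "\<dots> \<le> 3 * M" using Mm Mge by linarith
    finally have "M \<le> 3" using Mge c by (simp add: mult_le_cancel_right)
    thus False using Mge c by linarith
  qed
  assume i: "i < n"
  have "of_real c = z (Suc i) - z i ^ m" using step[of i] by simp
  hence "norm (of_real c :: complex) \<le> norm (z (Suc i)) + norm (z i ^ m)" by (metis norm_triangle_ineq4)
  moreover have "norm (z (Suc i)) \<le> M" unfolding M_def using i by (intro max) simp
  moreover have "norm (of_real c :: complex) = c" using c by simp
  ultimately show "norm (z i) ^ m \<ge> c / 2" using Mc by (simp add: norm_power)
qed

lemma norm_multiplier_large:
  fixes z :: "nat \<Rightarrow> complex" and c :: real
  assumes m: "m \<ge> 2" and n: "n \<ge> 1" and c: "c \<ge> 8"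
    and step: "\<And>i. z (Suc i) = z i ^ m + of_real c" and per: "z n = z 0"
  shows "norm (\<Prod>i<n. of_nat m * z i ^ (m - 1)) \<ge> sqrt (c / 2)"
proof -
  have s1: "sqrt (c / 2) \<ge> 1" using c by (simp add: real_le_rsqrt)
  have f: "norm (of_nat m * z i ^ (m - 1)) \<ge> sqrt (c / 2)" if i: "i < n" for i
  proof -
    let ?w = "norm (z i)"
    have w: "?w ^ m \<ge> c / 2" by (rule periodic_orbit_large[OF m n c step per i])
    have w1: "?w \<ge> 1"
    proof (rule ccontr)
      assume "\<not> ?w \<ge> 1"
      hence "?w ^ m \<le> 1" by (intro power_le_one) auto
      thus False using w c by linarith
    qed
    have "c / 2 \<le> ?w ^ (2 * (m - 1))" using w power_increasing[OF _ w1, of m "2 * (m - 1)"] m by linarith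
    also have "\<dots> = (?w ^ (m - 1)) ^ 2" by (simp only: mult.commute[of 2] power_mult)
    finally have "sqrt (c / 2) \<le> 1 * ?w ^ (m - 1)" by (simp add: real_le_lsqrt)
    also have "1 * ?w ^ (m - 1) \<le> of_nat m * ?w ^ (m - 1)" using m by (intro mult_right_mono) auto
    finally show ?thesis by (simp add: norm_mult norm_power)
  qed
  have "sqrt (c / 2) = sqrt (c / 2) ^ 1" by simp
  also have "\<dots> \<le> sqrt (c / 2) ^ n" using s1 n by (intro power_increasing) auto
  also have "\<dots> = (\<Prod>i<n. sqrt (c / 2))" by simp
  also have "\<dots> \<le> (\<Prod>i<n. norm (of_nat m * z i ^ (m - 1)))" using s1 f by (intro prod_mono) auto
  also have "\<dots> = norm (\<Prod>i<n. of_nat m * z i ^ (m - 1))" by (rule prod_norm)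
  finally show ?thesis .
qed

lemma map_poly_pderiv_hom:
  fixes h :: "'a::idom \<Rightarrow> 'b::idom"
  assumes "comm_ring_hom h"
  shows "map_poly h (pderiv p) = pderiv (map_poly h p)"
proof -
  interpret h: comm_ring_hom h by fact
  show ?thesis
    by (rule poly_eqI) (simp add: coeff_map_poly coeff_pderiv h.hom_mult h.hom_of_nat del: of_nat_Suc)
qed

lemma norm_prod_minus_1_le:
  fixes f :: "_ \<Rightarrow> complex"
  assumes "finite A"
  shows "norm ((\<Prod>a\<in>A. 1 + f a) - 1) \<le> (\<Prod>a\<in>A. 1 + norm (f a)) - 1"
  using assms
proof (induction A)
  case (insert x A)
  let ?P = "\<Prod>a\<in>A. 1 + f a" and ?Q = "\<Prod>a\<in>A. 1 + norm (f a)"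
  have "norm ?P \<le> ?Q" unfolding prod_norm[symmetric] by (intro prod_mono) (auto intro: norm_triangle_le)
  hence "norm (f x) * norm ?P \<le> norm (f x) * ?Q" by (intro mult_left_mono) auto
  moreover have "(1 + f x) * ?P - 1 = (?P - 1) + f x * ?P" by (simp add: algebra_simps)
  hence "norm ((1 + f x) * ?P - 1) \<le> norm (?P - 1) + norm (f x) * norm ?P"
    using norm_triangle_ineq[of "?P - 1" "f x * ?P"] by (simp only: norm_mult)
  ultimately have "norm ((1 + f x) * ?P - 1) \<le> (1 + norm (f x)) * ?Q - 1" using insert.IH by (simp add: distrib_right)
  thus ?case using insert.hyps by simp
qed simp

lemma spec_hom: "comm_ring_hom (\<lambda>q. of_int (poly q c) :: 'a::comm_ring_1)"
  by unfold_locales simp_all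

context unicritical begin

lemma N_specialise:
  fixes k :: nat
  assumes n: "n \<ge> 1" and k: "k \<ge> 8"
  defines "h \<equiv> (\<lambda>q. of_int (poly q (int k)) :: complex)"
  shows "\<exists>Z. finite Z \<and> card Z = degree (\<Phi> n) \<and> (\<forall>z\<in>Z. norm (poly (map_poly h (lam n)) z) \<ge> sqrt (real k / 2)) \<and>
    (\<forall>g. h (N n g) = (\<Prod>z\<in>Z. poly (map_poly h g) z))"
proof -
  have h: "comm_ring_hom h" unfolding h_def by (rule spec_hom)
  interpret h: comm_ring_hom h by (rule h)
  interpret hp: map_poly_comm_ring_hom h ..
  note lc = dynatomic_L(1)[OF n]
  define p where "p = map_poly h (\<Phi> n)"
  define Z where "Z = {z. poly p z = 0}"
  have hX: "h (pCons 0 1) = of_nat k" by (simp add: h_def poly_pCons)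
  have big: "norm (poly (map_poly h (lam n)) z) \<ge> sqrt (real k / 2)" if z: "poly p z = 0" for z
  proof -
    let ?z = "\<lambda>i. poly (map_poly h (F i)) z"
    have zi: "?z i = ((\<lambda>y. y ^ m + h [:0, 1:]) ^^ i) z" for i by (rule poly_F[OF h])
    have "poly (map_poly h (\<Psi> n)) z = 0"
      using z by (simp add: Psi_V[OF n] hp.hom_mult p_def)
    hence "?z n = ?z 0" by (simp add: Psi_def hp.hom_minus)
    moreover have "?z (Suc i) = ?z i ^ m + of_real (real k)" for i by (simp add: zi hX)
    ultimately have "norm (\<Prod>i<n. of_nat m * ?z i ^ (m - 1)) \<ge> sqrt (real k / 2)"
      by (intro norm_multiplier_large[OF m2 n]) (use k in auto)
    also have "(\<Prod>i<n. of_nat m * ?z i ^ (m - 1)) = poly (map_poly h (lam n)) z"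
      by (simp add: pderiv_F hp.hom_prod hp.hom_mult hp.hom_power hp.hom_of_nat poly_prod)
    finally show ?thesis .
  qed
  have sep: "poly (pderiv p) z \<noteq> 0" if z: "poly p z = 0" for z
  proof
    assume d: "poly (pderiv p) z = 0"
    have "lam n - 1 = pderiv (\<Phi> n) * V n + \<Phi> n * pderiv (V n)"
      unfolding pderiv_Psi[symmetric] Psi_V[OF n] pderiv_mult by (simp only: mult_ac add_ac)
    from arg_cong[OF this, of "\<lambda>q. poly (map_poly h q) z"]
    have "poly (map_poly h (lam n)) z - 1 = 0"
      using d z by (simp add: hp.hom_minus hp.hom_add hp.hom_mult p_def map_poly_pderiv_hom[OF h])
    hence "poly (map_poly h (lam n)) z = 1" by simp
    hence "sqrt (real k / 2) \<le> 1" using big[OF z] by simp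
    thus False using k by (simp add: real_sqrt_le_1_iff)
  qed
  have pl: "lead_coeff p = 1" "degree p = degree (\<Phi> n)"
    unfolding p_def using h.degree_map_poly_monic[OF lc] by auto
  have p0: "p \<noteq> 0" using pl(1) by auto
  have fin: "finite Z" unfolding Z_def by (rule poly_roots_finite[OF p0])
  have "p = (\<Prod>a\<in>Z. [:- a, 1:])" unfolding Z_def by (rule monic_separable_eq_prod[OF pl(1) sep])
  hence "degree p = card Z" using degree_prod_linear[OF fin] by simp
  hence cZ: "card Z = degree (\<Phi> n)" using pl(2) by simp
  have "h (N n g) = (\<Prod>z\<in>Z. poly (map_poly h g) z)" for g
    unfolding N_def by (rule norm_det_set(1)[OF h lc fin cZ]) (simp add: Z_def p_def)
  thus ?thesis using fin cZ big by (intro exI[of _ Z]) (auto simp: Z_def)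
qed

text \<open>As \<open>c\<close> tends to infinity, all multipliers tend to infinity, hence \<open>1 - \<lambda>\<close> and \<open>- \<lambda>\<close> have the same
  leading term.\<close>

lemma lead_coeff_N_1_lam: assumes n: "n \<ge> 1" shows "lead_coeff (N n (1 - lam n)) = lead_coeff (N n (- lam n))"
proof -
  let ?K = "degree (\<Phi> n)"
  define P where "P = map_poly real_of_int (N n (1 - lam n))"
  define Q where "Q = map_poly real_of_int (N n (- lam n))"
  have PQ: "poly P (real k) = of_int (poly (N n (1 - lam n)) (int k))" "poly Q (real k) = of_int (poly (N n (- lam n)) (int k))" for k
    unfolding P_def Q_def of_int_hom.poly_map_poly[symmetric] by simp_all
  have key: "poly Q (real k) \<noteq> 0 \<and> \<bar>poly P (real k) / poly Q (real k) - 1\<bar> \<le> (1 + 1 / sqrt (real k / 2)) ^ ?K - 1"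
    if k: "k \<ge> 8" for k
  proof -
    define h where "h = (\<lambda>q. of_int (poly q (int k)) :: complex)"
    have h: "comm_ring_hom h" unfolding h_def by (rule spec_hom)
    interpret h: comm_ring_hom h by (rule h)
    interpret hp: map_poly_comm_ring_hom h ..
    obtain Z where Z: "finite Z" "card Z = ?K" "\<forall>z\<in>Z. norm (poly (map_poly h (lam n)) z) \<ge> sqrt (real k / 2)"
      "\<forall>g. h (N n g) = (\<Prod>z\<in>Z. poly (map_poly h g) z)"
      using N_specialise[OF n k] unfolding h_def by blast
    let ?l = "\<lambda>z. poly (map_poly h (lam n)) z"
    define s where "s = sqrt (real k / 2)"
    have s0: "s > 0" using k by (simp add: s_def)
    have l0: "?l z \<noteq> 0" if "z \<in> Z" for z
    proof
      assume "?l z = 0"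
      moreover have "norm (?l z) \<ge> s" using Z(3) that by (simp add: s_def)
      ultimately show False using s0 by simp
    qed
    have hP: "h (N n (1 - lam n)) = (\<Prod>z\<in>Z. 1 - ?l z)" using Z(4) by (simp add: hp.hom_minus)
    have hQ: "h (N n (- lam n)) = (\<Prod>z\<in>Z. - ?l z)" using Z(4) by (simp add: hp.hom_uminus)
    have Q0: "h (N n (- lam n)) \<noteq> 0" unfolding hQ using l0 Z(1) by simp
    have "h (N n (1 - lam n)) / h (N n (- lam n)) = (\<Prod>z\<in>Z. (1 - ?l z) / (- ?l z))" unfolding hP hQ by (rule prod_dividef[symmetric])
    also have "\<dots> = (\<Prod>z\<in>Z. 1 + (- 1 / ?l z))" by (rule prod.cong[OF refl]) (use l0 in \<open>simp add: field_simps\<close>)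
    finally have ratio: "h (N n (1 - lam n)) / h (N n (- lam n)) = (\<Prod>z\<in>Z. 1 + (- 1 / ?l z))" .
    have "norm (h (N n (1 - lam n)) / h (N n (- lam n)) - 1) \<le> (\<Prod>z\<in>Z. 1 + norm (- 1 / ?l z)) - 1"
      unfolding ratio by (rule norm_prod_minus_1_le[OF Z(1)])
    also have "(\<Prod>z\<in>Z. 1 + norm (- 1 / ?l z)) \<le> (\<Prod>z\<in>Z. 1 + 1 / s)"
    proof (rule prod_mono)
      fix z assume "z \<in> Z"
      hence "norm (?l z) \<ge> s" using Z(3) by (simp add: s_def)
      hence "1 / norm (?l z) \<le> 1 / s" using s0 by (intro divide_left_mono) (auto intro!: mult_pos_pos)
      thus "0 \<le> 1 + norm (- 1 / ?l z) \<and> 1 + norm (- 1 / ?l z) \<le> 1 + 1 / s" by (simp add: norm_divide)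
    qed
    also have "(\<Prod>z\<in>Z. 1 + 1 / s) = (1 + 1 / s) ^ ?K" by (simp add: Z(2))
    finally have n1: "norm (h (N n (1 - lam n)) / h (N n (- lam n)) - 1) \<le> (1 + 1 / s) ^ ?K - 1" by simp
    have "h (N n (1 - lam n)) / h (N n (- lam n)) - 1 = complex_of_real (poly P (real k) / poly Q (real k) - 1)"
      by (simp add: h_def PQ)
    hence "\<bar>poly P (real k) / poly Q (real k) - 1\<bar> \<le> (1 + 1 / s) ^ ?K - 1" using n1 by (simp only: norm_of_real)
    moreover have "poly Q (real k) \<noteq> 0" using Q0 by (simp add: h_def PQ)
    ultimately show ?thesis unfolding s_def by blast
  qed
  have ev: "eventually (\<lambda>k. poly Q (real k) \<noteq> 0) sequentially"
    using eventually_ge_at_top[of 8] by eventually_elim (use key in blast)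
  have half: "filterlim (\<lambda>k. real k / 2) at_top sequentially"
    using filterlim_tendsto_pos_mult_at_top[OF tendsto_const _ filterlim_real_sequentially, of "1 / 2"] by simp
  have "filterlim (\<lambda>k. sqrt (real k / 2)) at_top sequentially"
    by (rule filterlim_compose[OF sqrt_at_top half])
  hence "(\<lambda>k. 1 / sqrt (real k / 2)) \<longlonglongrightarrow> 0" by (rule tendsto_divide_0[OF tendsto_const filterlim_at_top_imp_at_infinity])
  hence "(\<lambda>k. (1 + 1 / sqrt (real k / 2)) ^ ?K - 1) \<longlonglongrightarrow> (1 + 0) ^ ?K - 1" by (intro tendsto_intros)
  hence lim0: "(\<lambda>k. (1 + 1 / sqrt (real k / 2)) ^ ?K - 1) \<longlonglongrightarrow> 0" by simp
  have "(\<lambda>k. poly P (real k) / poly Q (real k) - 1) \<longlonglongrightarrow> 0"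
  proof (rule tendsto_rabs_zero_cancel, rule tendsto_sandwich[OF _ _ tendsto_const lim0])
    show "eventually (\<lambda>k. 0 \<le> \<bar>poly P (real k) / poly Q (real k) - 1\<bar>) sequentially" by simp
    show "eventually (\<lambda>k. \<bar>poly P (real k) / poly Q (real k) - 1\<bar> \<le> (1 + 1 / sqrt (real k / 2)) ^ ?K - 1) sequentially"
      using eventually_ge_at_top[of 8] by eventually_elim (use key in blast)
  qed
  hence lim: "(\<lambda>k. poly P (real k) / poly Q (real k)) \<longlonglongrightarrow> 1" by (rule LIM_zero_cancel)
  have "Q \<noteq> 0" using key[of 8] by auto
  from lead_coeff_eq_of_ratio_tendsto_1[OF lim ev this]
  show ?thesis by (simp add: P_def Q_def)
qed

lemma lead_coeff_F_0: "k \<ge> 1 \<Longrightarrow> lead_coeff (poly (F k) 0) = 1 \<and> degree (poly (F k) 0) \<ge> 1"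
proof (induction k rule: nat_induct_at_least)
  case base
  show ?case using m2 by (simp add: F_Suc[of 0, simplified] fc_def poly_monom power_0_left)
next
  case (Suc k)
  let ?g = "poly (F k) 0"
  have e: "poly (F (Suc k)) 0 = ?g ^ m + [:0, 1:]" by (simp add: F_Suc fc_def poly_pcompose poly_monom)
  have d: "degree (?g ^ m) = m * degree ?g" by (rule Polynomial.degree_power_eq) (use Suc.IH in \<open>auto simp del: leading_coeff_0_iff\<close>)
  have "m * 1 \<le> m * degree ?g" using Suc.IH by (intro mult_le_mono2) simp
  moreover have "degree [:0, 1 :: int:] = 1" by simp
  ultimately have d2: "degree [:0, 1 :: int:] < degree (?g ^ m)" unfolding d using m2 by linarith
  have "lead_coeff (?g ^ m) = 1" using Suc by (simp add: lead_coeff_power)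
  thus ?case unfolding e using d2 by (simp add: degree_add_eq_left coeff_eq_0)
qed

lemma abs_lead_coeff_N_X: assumes n: "n \<ge> 1" shows "\<bar>lead_coeff (N n [:0, 1:])\<bar> = 1"
proof -
  let ?q = "poly (\<Phi> n) 0"
  have "emb ?q = evL (\<Phi> n) 0" using emb.poly_map_poly[of "\<Phi> n" 0] by simp
  also have "\<dots> = (\<Prod>\<beta>\<in>Per n. 0 - \<beta>)" by (rule evL_dynatomic[OF n])
  also have "\<dots> = (\<Prod>\<beta>\<in>Per n. evL (- [:0, 1:]) \<beta>)" by (rule prod.cong[OF refl]) (simp add: embp.hom_uminus)
  finally have "N n (- [:0, 1:]) = ?q" by (rule N_eqI[OF n])
  hence "normalize (N n [:0, 1:]) = normalize ?q" using N_uminus[OF n, of "[:0, 1:]"] by simp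
  hence "N n [:0, 1:] dvd ?q" by (rule associatedD1)
  also have "?q dvd poly (\<Psi> n) 0" by (simp add: Psi_V[OF n])
  also have "poly (\<Psi> n) 0 = poly (F n) 0" by (simp add: Psi_def)
  finally obtain r where "poly (F n) 0 = N n [:0, 1:] * r" by (rule dvdE)
  hence "lead_coeff (N n [:0, 1:]) * lead_coeff r = 1" using lead_coeff_F_0[OF n] by (simp add: lead_coeff_mult)
  thus ?thesis unfolding zmult_eq_1_iff by auto
qed

lemma abs_lead_coeff_N_lam: assumes n: "n \<ge> 1" shows "\<exists>K. \<bar>lead_coeff (N n (lam n))\<bar> = int m ^ K"
proof -
  have Nm: "N n (of_nat m) = of_nat m ^ card (Per n)"
    by (rule N_eqI[OF n]) (simp only: emb.hom_power emb.hom_of_nat evL_simps prod_constant)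
  have NF: "N n (F i) = N n [:0, 1:]" for i using N_shift[OF n, of "[:0, 1:]" i] by simp
  have "N n (lam n) = (\<Prod>i<n. of_nat m ^ card (Per n) * N n [:0, 1:] ^ (m - 1))"
    unfolding pderiv_F by (simp only: N_prod[OF n] N_mult[OF n] N_power[OF n] Nm NF)
  hence "N n (lam n) = (of_nat m ^ card (Per n) * N n [:0, 1:] ^ (m - 1)) ^ n" by simp
  moreover have "lead_coeff (of_nat m :: int poly) = int m" by (simp add: of_nat_poly)
  ultimately have "\<bar>lead_coeff (N n (lam n))\<bar> = (int m ^ card (Per n)) ^ n"
    by (simp only: lead_coeff_mult lead_coeff_power abs_mult power_abs abs_lead_coeff_N_X[OF n]) simp
  also have "\<dots> = int m ^ (card (Per n) * n)" by (rule power_mult[symmetric])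
  finally show ?thesis by (rule exI)
qed

lemma lead_coeff_dvd: "a dvd b \<Longrightarrow> lead_coeff a dvd lead_coeff b" for a b :: "'a::idom poly"
  by (erule dvdE, erule ssubst) (unfold lead_coeff_mult, rule dvd_triv_left)

lemma lead_coeff_delta_1: assumes n: "n \<ge> 1" and q: "prime q" "\<not> q dvd int m"
  shows "\<not> q dvd lead_coeff (poly (delta m n) 1)"
proof
  assume d: "q dvd lead_coeff (poly (delta m n) 1)"
  hence "q dvd lead_coeff (poly (delta m n) 1) ^ n" by (rule dvd_trans) (rule dvd_power, use n in simp)
  also have "\<dots> = lead_coeff (N n (- lam n))"
    using lead_coeff_N_1_lam[OF n] by (simp add: delta_1_power[OF n, symmetric] lead_coeff_power)
  also have "lead_coeff (N n (- lam n)) dvd lead_coeff (N n (lam n))"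
    by (intro lead_coeff_dvd associatedD1[OF N_uminus[OF n]])
  finally have "q dvd \<bar>lead_coeff (N n (lam n))\<bar>" by simp
  moreover obtain K where "\<bar>lead_coeff (N n (lam n))\<bar> = int m ^ K" using abs_lead_coeff_N_lam[OF n] by blast
  ultimately have "q dvd int m ^ K" by (simp only:)
  thus False using q(2) prime_dvd_power[OF q(1)] by blast
qed

lemma lead_coeff_Delta_prim: assumes n: "n \<ge> 1" and q: "prime q" "\<not> q dvd int m"
  shows "\<not> q dvd lead_coeff (Delta_prim m n)"
proof -
  have "lead_coeff (Delta_prim m n) dvd lead_coeff (poly (delta m n) 1)"
    unfolding Delta_prim(1)[OF n] by (intro lead_coeff_dvd dvd_triv_left)
  thus ?thesis using lead_coeff_delta_1[OF assms] dvd_trans by blast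
qed

lemma ok_prime: assumes n: "n \<ge> 1" and q: "prime q" "\<not> q dvd int m" shows "ok q n"
proof -
  have "\<not> [:q:] dvd poly (delta m n) 1" using lead_coeff_delta_1[OF assms] by (auto simp: const_poly_dvd_iff)
  thus ?thesis using n q by (simp add: ok_def)
qed

end

section \<open>Norms that vanish to high order, and discriminants\<close>

lemma sum_split_at: "(\<Sum>l<p + q. f l) = (\<Sum>l<p. f l) + (\<Sum>l<q. f (p + l))"
  for f :: "nat \<Rightarrow> 'a::comm_monoid_add" and p q :: nat
  by (induction q) (simp_all add: ac_simps)

lemma mmod_sum: "lead_coeff P = 1 \<Longrightarrow> mmod P (\<Sum>j<k. f j) = (\<Sum>j<k. mmod P (f j))" for k :: nat
proof (induction k)
  case 0
  show ?case using mmod_multiple[OF 0, of 0] by simp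
qed (simp add: mmod_add)

lemma mult_mat_row:
  fixes \<Phi> g b :: "'a::comm_ring_1 poly"
  assumes lc: "lead_coeff \<Phi> = 1" and b: "\<And>i. i \<ge> degree \<Phi> \<Longrightarrow> coeff b i = 0"
  shows "(\<Sum>j<degree \<Phi>. coeff b j * coeff (mmod \<Phi> (monom 1 j * g)) l) = coeff (mmod \<Phi> (b * g)) l"
proof -
  have "mmod \<Phi> (b * g) = mmod \<Phi> (\<Sum>j<degree \<Phi>. smult (coeff b j) (monom 1 j * g))"
  proof -
    have "b = (\<Sum>j<degree \<Phi>. monom (coeff b j) j)" by (rule poly_as_sum_lt(2)[OF b])
    hence "b * g = (\<Sum>j<degree \<Phi>. monom (coeff b j) j) * g" by (rule arg_cong)
    also have "\<dots> = (\<Sum>j<degree \<Phi>. smult (coeff b j) (monom 1 j * g))"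
      unfolding sum_distrib_right
    proof (rule sum.cong[OF refl])
      fix j show "monom (coeff b j) j * g = smult (coeff b j) (monom 1 j * g)"
        by (simp add: smult_monom mult_smult_left[symmetric] del: mult_smult_left)
    qed
    finally show ?thesis by (rule arg_cong)
  qed
  also have "\<dots> = (\<Sum>j<degree \<Phi>. smult (coeff b j) (mmod \<Phi> (monom 1 j * g)))"
    by (simp only: mmod_sum[OF lc] mmod_smult[OF lc])
  finally show ?thesis by (simp add: coeff_sum)
qed

lemma det_triangular_rows:
  fixes w :: "nat \<Rightarrow> 'a::comm_ring_1 poly"
  assumes "\<And>k l. k < l \<Longrightarrow> l < N \<Longrightarrow> coeff (w k) l = 0"
  shows "det (mat N N (\<lambda>(k, l). coeff (w k) l)) = (\<Prod>k<N. coeff (w k) k)"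
proof -
  have "det (mat N N (\<lambda>(k, l). coeff (w k) l)) = prod_list (diag_mat (mat N N (\<lambda>(k, l). coeff (w k) l)))"
    by (rule det_lower_triangular[of N]) (use assms in auto)
  also have "\<dots> = (\<Prod>k<N. coeff (w k) k)"
    unfolding prod_list_diag_prod by (simp add: atLeast0LessThan)
  finally show ?thesis .
qed

lemma prod_blocks: "2 * n \<le> N \<Longrightarrow> (\<Prod>k<N. if k < n then a else if k < 2 * n then b else 1) = (a * b) ^ n"
  for a b :: "'a::comm_ring_1"
proof -
  assume N: "2 * n \<le> N"
  have A: "{k \<in> {..<N}. k < n} = {..<n}" "{k \<in> {..<N}. n \<le> k \<and> k < 2 * n} = {n..<2 * n}" using N by auto
  have "(\<Prod>k<N. if k < n then a else if k < 2 * n then b else 1) =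
      (\<Prod>k<N. (if k < n then a else 1) * (if n \<le> k \<and> k < 2 * n then b else 1))" by (rule prod.cong) auto
  also have "\<dots> = (\<Prod>k\<in>{k \<in> {..<N}. k < n}. a) * (\<Prod>k\<in>{k \<in> {..<N}. n \<le> k \<and> k < 2 * n}. b)"
    unfolding prod.distrib prod.inter_filter[OF finite_lessThan] by simp
  also have "\<dots> = a ^ n * b ^ n" unfolding A by simp
  finally show ?thesis by (simp add: power_mult_distrib)
qed

text \<open>If \<open>\<Phi>\<close> lies in the square of the ideal \<open>(P, t)\<close> and \<open>g\<close> in the ideal itself, then multiplication by \<open>g\<close> maps
  the lattice \<open>(P, t) / \<Phi>\<close> into the lattice \<open>(P, t)\<^sup>2 / \<Phi>\<close>. Both have triangular bases, of determinants \<open>t\<^sup>n\<close> and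
  \<open>t\<^sup>3\<^sup>n\<close>, and the norm of \<open>g\<close> is divisible by the quotient.\<close>

lemma norm_vanishing_order:
  fixes t :: "'d::idom"
  assumes t: "t \<noteq> 0" and lc: "lead_coeff \<Phi> = 1" and P: "lead_coeff P = 1" and n: "n = degree P" and le: "2 * n \<le> degree \<Phi>"
    and Phi: "\<Phi> = P * P * a + smult t (P * b) + smult (t * t) e" and g: "g = P * h + smult t k0"
  shows "t ^ (2 * n) dvd det (mult_mat \<Phi> g)"
proof -
  let ?N = "degree \<Phi>"
  let ?M = "mult_mat \<Phi> g"
  define b1 where "b1 k = (if k < n then monom t k else if k < 2 * n then P * monom 1 (k - n) else P * P * monom 1 (k - 2 * n))" for k
  define b2 where "b2 k = (if k < n then monom (t * t) k else if k < 2 * n then smult t (P * monom 1 (k - n)) else P * P * monom 1 (k - 2 * n))" for k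
  define E1 where "E1 = mat ?N ?N (\<lambda>(k, l). coeff (b1 k) l)"
  define E2 where "E2 = mat ?N ?N (\<lambda>(k, l). coeff (b2 k) l)"
  have P0: "P \<noteq> 0" using P by auto
  have PPl: "lead_coeff (P * P) = 1" by (simp add: lead_coeff_mult P)
  have PPd: "degree (P * P) = 2 * n" using P0 by (simp add: degree_mult_eq n)
  have m0: "monom (1 :: 'd) j \<noteq> 0" for j by simp
  have dm: "degree (Q * monom 1 j) = degree Q + j \<and> coeff (Q * monom 1 j) (degree Q + j) = 1"
    if Q: "lead_coeff Q = 1" for Q :: "'d poly" and j
  proof -
    have "Q \<noteq> 0" using Q by auto
    hence "degree (Q * monom 1 j) = degree Q + j" using degree_mult_eq[OF _ m0] by (simp add: degree_monom_eq)
    moreover have "lead_coeff (Q * monom 1 j) = 1" by (simp only: lead_coeff_mult Q lead_coeff_monom mult_1_left)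
    ultimately show ?thesis by simp
  qed
  have dP: "degree (P * monom 1 j) = n + j" "coeff (P * monom 1 j) (n + j) = 1" for j
    using dm[OF P] unfolding n by blast+
  have dPP: "degree (P * P * monom 1 j) = 2 * n + j" "coeff (P * P * monom 1 j) (2 * n + j) = 1" for j
    using dm[OF PPl] unfolding PPd by blast+
  have b1_up: "coeff (b1 k) l = 0" if "k < l" for k l
    using that dP[of "k - n"] dPP[of "k - 2 * n"] by (auto simp: b1_def intro!: coeff_eq_0)
  have b2_up: "coeff (b2 k) l = 0" if "k < l" for k l
    using that dP[of "k - n"] dPP[of "k - 2 * n"] by (auto simp: b2_def intro!: coeff_eq_0)
  have b1_diag: "coeff (b1 k) k = (if k < n then t else if k < 2 * n then 1 else 1)" for k
    using dP(2)[of "k - n"] dPP(2)[of "k - 2 * n"] unfolding b1_def by (cases "k < n"; cases "k < 2 * n") simp_all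
  have b2_diag: "coeff (b2 k) k = (if k < n then t * t else if k < 2 * n then t else 1)" for k
    using dP(2)[of "k - n"] dPP(2)[of "k - 2 * n"] unfolding b2_def by (cases "k < n"; cases "k < 2 * n") simp_all
  have det1: "det E1 = t ^ n"
    unfolding E1_def using det_triangular_rows[of ?N b1] b1_up by (simp add: b1_diag prod_blocks[OF le, of t 1, simplified])
  have "det E2 = (\<Prod>k<?N. coeff (b2 k) k)" unfolding E2_def using det_triangular_rows[of ?N b2] b2_up by simp
  hence det2: "det E2 = (t * t * t) ^ n" unfolding b2_diag by (simp only: prod_blocks[OF le])
  have rep: "\<exists>c. H = (\<Sum>l<?N. smult (c l) (b2 l))"
    if Hd: "\<And>i. i \<ge> ?N \<Longrightarrow> coeff H i = 0" and H: "H = P * P * a' + smult t (P * b') + smult (t * t) e'" for H a' b' e'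
  proof -
    define e0 where "e0 = mmod P e'"
    define b'' where "b'' = b' + smult t (mdiv P e')"
    define b0 where "b0 = mmod P b''"
    define a0 where "a0 = a' + smult t (mdiv P b'')"
    have E: "e' = P * mdiv P e' + e0" unfolding e0_def by (rule mdiv_mmod(1)[OF P])
    have B: "b'' = P * mdiv P b'' + b0" unfolding b0_def by (rule mdiv_mmod(1)[OF P])
    have ed: "coeff e0 i = 0" if "i \<ge> n" for i unfolding e0_def using mdiv_mmod(2)[OF P] that by (simp add: n)
    have bd: "coeff b0 i = 0" if "i \<ge> n" for i unfolding b0_def using mdiv_mmod(2)[OF P] that by (simp add: n)
    have "H = P * P * a' + smult t (P * b') + smult (t * t) (P * mdiv P e' + e0)" unfolding H by (simp only: E[symmetric])
    also have "\<dots> = P * P * a' + smult t (P * b'') + smult (t * t) e0"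
      by (simp add: b''_def algebra_simps smult_add_right)
    also have "\<dots> = P * P * a' + smult t (P * (P * mdiv P b'' + b0)) + smult (t * t) e0" by (simp only: B[symmetric])
    also have "\<dots> = P * P * a0 + smult t (P * b0) + smult (t * t) e0"
      by (simp add: a0_def algebra_simps smult_add_right)
    finally have H': "H = P * P * a0 + smult t (P * b0) + smult (t * t) e0" .
    have ad: "coeff a0 i = 0" if i: "i \<ge> ?N - 2 * n" for i
    proof (cases "a0 = 0")
      case False
      have low: "coeff (P * b0) i = 0" if "i \<ge> 2 * n" for i
      proof (cases "b0 = 0")
        case False
        hence "degree b0 < n" using bd[of "degree b0"] by (meson leading_coeff_0_iff not_le)
        hence "degree (P * b0) < i" using False P0 that by (simp add: degree_mult_eq n)
        thus ?thesis by (rule coeff_eq_0)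
      qed simp
      have "coeff a0 i = 0" if "degree a0 \<ge> ?N - 2 * n"
      proof -
        let ?j = "2 * n + degree a0"
        have j: "?j \<ge> ?N" using that le by linarith
        have "degree (P * P * a0) = ?j" using False P0 PPd degree_mult_eq[of "P * P" a0] by simp
        hence "coeff (P * P * a0) ?j = lead_coeff a0" using lead_coeff_mult[of "P * P" a0] PPl by simp
        moreover have "coeff (P * b0) ?j = 0" by (rule low) simp
        moreover have "coeff e0 ?j = 0" using ed by simp
        ultimately have "coeff H ?j = lead_coeff a0" unfolding H' by simp
        hence "lead_coeff a0 = 0" using Hd[OF j] by simp
        thus ?thesis using False by simp
      qed
      thus ?thesis using i by (cases "degree a0 \<ge> ?N - 2 * n") (auto intro: coeff_eq_0)
    qed simp
    define c where "c l = (if l < n then coeff e0 l else if l < 2 * n then coeff b0 (l - n) else coeff a0 (l - 2 * n))" for l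
    have N3: "?N = n + (n + (?N - 2 * n))" using le by simp
    have "(\<Sum>l<?N. smult (c l) (b2 l)) = (\<Sum>l<n. smult (c l) (b2 l)) + ((\<Sum>l<n. smult (c (n + l)) (b2 (n + l))) +
        (\<Sum>l<?N - 2 * n. smult (c (n + (n + l))) (b2 (n + (n + l)))))"
      by (subst N3) (simp only: sum_split_at)
    also have "(\<Sum>l<n. smult (c l) (b2 l)) = smult (t * t) (\<Sum>l<n. monom (coeff e0 l) l)"
      unfolding smult_sum2 by (rule sum.cong[OF refl]) (simp add: c_def b2_def smult_monom mult.commute)
    also have "(\<Sum>l<n. monom (coeff e0 l) l) = e0" by (rule poly_as_sum_lt(2)[OF ed, symmetric])
    also have "(\<Sum>l<n. smult (c (n + l)) (b2 (n + l))) = smult t (P * (\<Sum>l<n. monom (coeff b0 l) l))"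
      unfolding smult_sum2 sum_distrib_left
    proof (rule sum.cong[OF refl])
      fix l assume "l \<in> {..<n}"
      thus "smult (c (n + l)) (b2 (n + l)) = smult t (P * monom (coeff b0 l) l)"
        using mult_smult_right[of P "coeff b0 l" "monom 1 l"] by (simp add: c_def b2_def smult_monom mult.commute)
    qed
    also have "(\<Sum>l<n. monom (coeff b0 l) l) = b0" by (rule poly_as_sum_lt(2)[OF bd, symmetric])
    also have "(\<Sum>l<?N - 2 * n. smult (c (n + (n + l))) (b2 (n + (n + l)))) = P * P * (\<Sum>l<?N - 2 * n. monom (coeff a0 l) l)"
      unfolding sum_distrib_left
    proof (rule sum.cong[OF refl])
      fix l
      show "smult (c (n + (n + l))) (b2 (n + (n + l))) = P * P * monom (coeff a0 l) l"
        using mult_smult_right[of "P * P" "coeff a0 l" "monom 1 l"] by (simp add: c_def b2_def smult_monom)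
    qed
    also have "(\<Sum>l<?N - 2 * n. monom (coeff a0 l) l) = a0" by (rule poly_as_sum_lt(2)[OF ad, symmetric])
    finally have "H = (\<Sum>l<?N. smult (c l) (b2 l))" unfolding H' by (simp only: ac_simps)
    thus ?thesis by blast
  qed
  have ex: "\<exists>c. mmod \<Phi> (b1 k * g) = (\<Sum>l<?N. smult (c l) (b2 l))" for k
  proof -
    obtain u v where uv: "b1 k = P * u + smult t v"
    proof (cases "k < n")
      case True
      thus ?thesis using that[of 0 "monom 1 k"] by (simp add: b1_def smult_monom)
    next
      case False
      show ?thesis
      proof (cases "k < 2 * n")
        case True
        thus ?thesis using that[of "monom 1 (k - n)" 0] False by (simp add: b1_def)
      next
        case F2: False
        have "b1 k = P * (P * monom 1 (k - 2 * n)) + smult t 0" using False F2 by (simp add: b1_def mult.assoc del: mult_monom)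
        thus ?thesis by (rule that)
      qed
    qed
    define q where "q = mdiv \<Phi> (b1 k * g)"
    have "mmod \<Phi> (b1 k * g) = b1 k * g - \<Phi> * q"
      using mdiv_mmod(1)[OF lc, of "b1 k * g"] unfolding q_def by (simp only: eq_diff_eq add.commute)
    also have "\<dots> = P * P * (u * h - a * q) + smult t (P * (u * k0 + v * h - b * q)) + smult (t * t) (v * k0 - e * q)"
      unfolding uv Phi g by (simp add: algebra_simps smult_add_right smult_diff_right)
    finally have H: "mmod \<Phi> (b1 k * g) = P * P * (u * h - a * q) + smult t (P * (u * k0 + v * h - b * q)) + smult (t * t) (v * k0 - e * q)" .
    show ?thesis by (rule rep[OF _ H]) (rule mdiv_mmod(2)[OF lc])
  qed
  then obtain c where c: "mmod \<Phi> (b1 k * g) = (\<Sum>l<?N. smult (c k l) (b2 l))" for k by metis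
  define C where "C = mat ?N ?N (\<lambda>(k, l). c k l)"
  have eq: "E1 * ?M = C * E2"
  proof (rule eq_matI)
    fix i j assume "i < dim_row (C * E2)" "j < dim_col (C * E2)"
    hence ij: "i < ?N" "j < ?N" by (simp_all add: C_def E2_def)
    have "(E1 * ?M) $$ (i, j) = (\<Sum>l<?N. coeff (b1 i) l * coeff (mmod \<Phi> (monom 1 l * g)) j)"
      using ij by (simp add: E1_def mult_mat_def scalar_prod_def atLeast0LessThan)
    also have "\<dots> = coeff (mmod \<Phi> (b1 i * g)) j"
      by (rule mult_mat_row[OF lc]) (use ij b1_up in auto)
    also have "\<dots> = (\<Sum>l<?N. c i l * coeff (b2 l) j)" unfolding c by (simp add: coeff_sum)
    also have "\<dots> = (C * E2) $$ (i, j)"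
      using ij by (simp add: C_def E2_def scalar_prod_def atLeast0LessThan)
    finally show "(E1 * ?M) $$ (i, j) = (C * E2) $$ (i, j)" .
  qed (simp_all add: C_def E1_def E2_def mult_mat_def)
  have car: "E1 \<in> carrier_mat ?N ?N" "E2 \<in> carrier_mat ?N ?N" "C \<in> carrier_mat ?N ?N" "?M \<in> carrier_mat ?N ?N"
    by (simp_all add: E1_def E2_def C_def)
  have "det E1 * det ?M = det C * det E2"
    using arg_cong[OF eq, of det] by (simp only: det_mult[OF car(1,4)] det_mult[OF car(3,2)])
  hence "t ^ n * det ?M = t ^ n * (det C * t ^ (2 * n))"
    unfolding det1 det2 by (simp add: power_mult_distrib power_mult power2_eq_square ac_simps)
  hence "det ?M = det C * t ^ (2 * n)" using t by simp
  thus ?thesis by simp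
qed

lemma mult_mat_hom:
  fixes h :: "'a::comm_ring_1 \<Rightarrow> 'b::comm_ring_1"
  assumes h: "comm_ring_hom h" and P: "lead_coeff P = 1"
  shows "map_mat h (mult_mat P g) = mult_mat (map_poly h P) (map_poly h g)"
proof -
  interpret h: comm_ring_hom h by (rule h)
  interpret hp: map_poly_comm_ring_hom h ..
  note Ph = h.degree_map_poly_monic[OF P]
  have "mmod (map_poly h P) (map_poly h G) = map_poly h (mmod P G)" for G
  proof (rule mdiv_mmod_eqI(2)[OF Ph(2)])
    show "map_poly h G = map_poly h P * map_poly h (mdiv P G) + map_poly h (mmod P G)"
      unfolding hp.hom_mult[symmetric] hp.hom_add[symmetric] by (rule arg_cong[OF mdiv_mmod(1)[OF P]])
    show "coeff (map_poly h (mmod P G)) i = 0" if "i \<ge> degree (map_poly h P)" for i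
      using mdiv_mmod(2)[OF P] that by (simp add: Ph(1))
  qed
  note e = this
  have m: "map_poly h (monom 1 j * g) = monom 1 j * map_poly h g" for j
    by (simp add: hp.hom_mult)
  have "coeff (mmod (map_poly h P) (monom 1 j * map_poly h g)) l = h (coeff (mmod P (monom 1 j * g)) l)" for j l
    by (simp only: m[symmetric] e h.coeff_map_poly_hom)
  thus ?thesis by (intro eq_matI) (simp_all add: mult_mat_def Ph(1))
qed

lemma lead_coeff_dvd_resultant_pderiv:
  fixes D :: "int poly"
  assumes "degree D \<ge> 1"
  shows "lead_coeff D dvd resultant D (pderiv D)"
proof -
  let ?A = "sylvester_mat D (pderiv D)" and ?m = "degree D" and ?k = "degree (pderiv D)"
  have A: "?A \<in> carrier_mat (?m + ?k) (?m + ?k)" by (rule sylvester_carrier_mat)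
  have k: "?k = ?m - 1" by (rule degree_pderiv)
  have "lead_coeff D dvd ?A $$ (i, 0)" if i: "i < ?m + ?k" for i
  proof -
    have "lead_coeff (pderiv D) = of_nat (Suc ?k) * coeff D ?m" using assms by (simp add: coeff_pderiv k)
    hence "lead_coeff D dvd lead_coeff (pderiv D)" by simp
    moreover have "0 < ?m + ?k" using assms by simp
    ultimately show ?thesis using sylvester_index_mat[OF i, of 0] by auto
  qed
  hence "lead_coeff D dvd det ?A"
    using laplace_expansion_column[OF A, of 0] assms by (auto intro!: dvd_sum dvd_mult2)
  thus ?thesis by (simp add: resultant_def)
qed

lemma resultant_common_root:
  fixes h :: "int \<Rightarrow> 'k::field" and p q :: "int poly"
  assumes h: "comm_ring_hom h" and pos: "degree p + degree q \<ge> 1"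
    and p: "poly (map_poly h p) c = 0" and q: "poly (map_poly h q) c = 0"
  shows "h (resultant p q) = 0"
proof -
  interpret h: comm_ring_hom h by (rule h)
  let ?S = "sylvester_mat p q" and ?s = "degree p + degree q"
  let ?A = "map_mat h ?S"
  have S: "?S \<in> carrier_mat ?s ?s" by (rule sylvester_carrier_mat)
  define v where "v = vec ?s (\<lambda>j. c ^ (?s - 1 - j))"
  have gen: "(\<Sum>j<?s. h (coeff (monom 1 (Suc i) * r) (?s - j)) * c ^ (?s - 1 - j)) = 0"
    if r: "poly (map_poly h r) c = 0" and d: "degree r + i < ?s" for r i
  proof -
    have "(\<Sum>j<?s. h (coeff (monom 1 (Suc i) * r) (?s - j)) * c ^ (?s - 1 - j)) =
        (\<Sum>j<?s. h (coeff (monom 1 i * r) (?s - 1 - j)) * c ^ (?s - 1 - j))"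
      by (rule sum.cong[OF refl]) (auto simp: coeff_monom_mult)
    also have "\<dots> = (\<Sum>j<?s. h (coeff (monom 1 i * r) j) * c ^ j)"
      by (rule sum.reindex_bij_witness[of _ "\<lambda>j. ?s - 1 - j" "\<lambda>j. ?s - 1 - j"]) auto
    also have "\<dots> = poly (map_poly h (monom 1 i * r)) c"
    proof (subst poly_as_sum_lt(1))
      show "coeff (map_poly h (monom 1 i * r)) j = 0" if "j \<ge> ?s" for j
        using that d by (auto simp: coeff_monom_mult intro!: arg_cong[of _ 0 h, simplified] coeff_eq_0)
    qed simp
    also have "map_poly h (monom 1 i * r) = monom 1 i * map_poly h r"
      by (rule poly_eqI) (simp add: coeff_monom_mult)
    finally show ?thesis using r by simp
  qed
  have "?A *\<^sub>v v = 0\<^sub>v ?s"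
  proof (rule eq_vecI)
    fix i assume "i < dim_vec (0\<^sub>v ?s)"
    hence i: "i < ?s" by simp
    have "(?A *\<^sub>v v) $ i = (\<Sum>j<?s. h (?S $$ (i, j)) * c ^ (?s - 1 - j))"
      using i by (simp add: v_def scalar_prod_def atLeast0LessThan)
    also have "\<dots> = 0"
    proof (cases "i < degree q")
      case True
      have "(\<Sum>j<?s. h (?S $$ (i, j)) * c ^ (?s - 1 - j)) =
          (\<Sum>j<?s. h (coeff (monom 1 (Suc (degree q - i - 1)) * p) (?s - j)) * c ^ (?s - 1 - j))"
      proof (rule sum.cong[OF refl])
        fix j assume "j \<in> {..<?s}"
        moreover have "Suc (degree q - i - 1) = degree q - i" using True by simp
        ultimately show "h (?S $$ (i, j)) * c ^ (?s - 1 - j) = h (coeff (monom 1 (Suc (degree q - i - 1)) * p) (?s - j)) * c ^ (?s - 1 - j)"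
          using sylvester_index_mat2[OF i, of j] True by simp
      qed
      thus ?thesis using gen[OF p, of "degree q - i - 1"] True by simp
    next
      case False
      have "(\<Sum>j<?s. h (?S $$ (i, j)) * c ^ (?s - 1 - j)) =
          (\<Sum>j<?s. h (coeff (monom 1 (Suc (?s - i - 1)) * q) (?s - j)) * c ^ (?s - 1 - j))"
      proof (rule sum.cong[OF refl])
        fix j assume "j \<in> {..<?s}"
        moreover have "Suc (?s - i - 1) = ?s - i" using i by simp
        ultimately show "h (?S $$ (i, j)) * c ^ (?s - 1 - j) = h (coeff (monom 1 (Suc (?s - i - 1)) * q) (?s - j)) * c ^ (?s - 1 - j)"
          using sylvester_index_mat2[OF i, of j] False by simp
      qed
      thus ?thesis using gen[OF q, of "?s - i - 1"] False i by simp
    qed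
    finally show "(?A *\<^sub>v v) $ i = 0\<^sub>v ?s $ i" using i by simp
  qed simp
  moreover have "v \<noteq> 0\<^sub>v ?s"
  proof
    assume "v = 0\<^sub>v ?s"
    hence "v $ (?s - 1) = 0\<^sub>v ?s $ (?s - 1)" by simp
    moreover have "v $ (?s - 1) = c ^ (?s - 1 - (?s - 1))" unfolding v_def using pos by (intro index_vec) simp
    hence "v $ (?s - 1) = 1" by (simp only: diff_self_eq_0 power_0)
    ultimately show False using pos by simp
  qed
  moreover have "v \<in> carrier_vec ?s" "?A \<in> carrier_mat ?s ?s" using S by (simp_all add: v_def)
  ultimately have "det ?A = 0" using det_0_iff_vec_prod_zero by blast
  thus ?thesis by (simp add: resultant_def)
qed

lemma of_int_eq_0_imp_dvd:
  assumes p: "prime p" and K: "of_int p = (0 :: 'k::field)" and a: "of_int a = (0 :: 'k)"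
  shows "p dvd a"
proof (rule ccontr)
  assume "\<not> p dvd a"
  hence "coprime p a" using p prime_imp_coprime by blast
  then obtain u v where "u * p + v * a = 1" using bezout_int[of p a] by (auto simp: coprime_iff_gcd_eq_1)
  from arg_cong[OF this, of "of_int :: int \<Rightarrow> 'k"] show False using K a by simp
qed

text \<open>A double root modulo a prime not dividing the leading coefficient makes the prime divide the discriminant.\<close>

lemma double_root_dvd_discriminant:
  fixes D :: "int poly" and c :: "'k::field"
  assumes p: "prime p" and K: "of_int p = (0 :: 'k)" and lc: "\<not> p dvd lead_coeff D"
    and d: "[:- c, 1:] ^ 2 dvd map_poly of_int D"
  shows "p dvd discriminant D"
proof -
  have hom: "comm_ring_hom (of_int :: int \<Rightarrow> 'k)" by unfold_locales simp_all
  let ?D = "map_poly of_int D :: 'k poly"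
  obtain r where "?D = [:- c, 1:] ^ 2 * r" using d by (rule dvdE)
  hence r: "?D = [:- c, 1:] * ([:- c, 1:] * r)" by (simp only: power2_eq_square mult.assoc)
  have D0: "poly ?D c = 0" unfolding r by simp
  have "poly (pderiv ?D) c = 0" unfolding r pderiv_mult by (simp add: pderiv_pCons)
  hence D1: "poly (map_poly of_int (pderiv D)) c = 0" by (simp only: map_poly_pderiv_hom[OF hom])
  show ?thesis
  proof (cases "degree D = 0")
    case True
    then obtain a where a: "D = [:a:]" by (rule degree_eq_zeroE)
    hence "of_int a = (0 :: 'k)" using D0 by (simp add: of_int_poly_pCons)
    hence "p dvd a" by (rule of_int_eq_0_imp_dvd[OF p K])
    thus ?thesis using lc a by simp
  next
    case False
    have "of_int (resultant D (pderiv D)) = (0 :: 'k)"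
      by (rule resultant_common_root[OF hom _ D0 D1]) (use False in simp)
    hence "p dvd resultant D (pderiv D)" by (rule of_int_eq_0_imp_dvd[OF p K])
    moreover obtain s where s: "resultant D (pderiv D) = lead_coeff D * s"
      using lead_coeff_dvd_resultant_pderiv[of D] False by (auto elim: dvdE)
    ultimately have "p dvd s" using lc p by (simp add: prime_dvd_mult_iff)
    moreover have "lead_coeff D \<noteq> 0" using lc by auto
    hence "resultant D (pderiv D) div lead_coeff D = s" by (simp add: s)
    ultimately show ?thesis using False by (simp add: discriminant_def)
  qed
qed


text \<open>The Taylor expansion of order two in the coefficient variable.\<close>

lemma taylor2_poly:
  fixes q :: "'a::idom poly"
  shows "\<exists>r. q = [:poly q c:] + [:- c, 1:] * [:poly (pderiv q) c:] + [:- c, 1:] * [:- c, 1:] * r"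
proof -
  define s where "s = synthetic_div q c"
  define r where "r = synthetic_div s c"
  have q: "q = [:- c, 1:] * s + [:poly q c:]" unfolding s_def by (rule synthetic_div_correct'[symmetric])
  have s: "s = [:- c, 1:] * r + [:poly s c:]" unfolding r_def by (rule synthetic_div_correct'[symmetric])
  have "pderiv q = pderiv ([:- c, 1:] * s + [:poly q c:])" using q by (rule arg_cong)
  hence "poly (pderiv q) c = poly s c" by (simp add: pderiv_add pderiv_mult pderiv_pCons del: mult_pCons_left)
  moreover have "q = [:- c, 1:] * ([:- c, 1:] * r + [:poly s c:]) + [:poly q c:]" using q s by simp
  ultimately have "q = [:poly q c:] + [:- c, 1:] * [:poly (pderiv q) c:] + [:- c, 1:] * [:- c, 1:] * r"
    by (simp only: distrib_left ac_simps)
  thus ?thesis ..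
qed

lemma taylor2:
  fixes H :: "'a::idom poly poly"
  shows "\<exists>e. H = lift (map_poly (\<lambda>q. poly q c) H) + smult [:- c, 1:] (lift (map_poly (\<lambda>q. poly (pderiv q) c) H)) +
    smult ([:- c, 1:] * [:- c, 1:]) e"
proof -
  obtain r where r: "\<And>q. q = [:poly q c:] + [:- c, 1:] * [:poly (pderiv q) c:] + [:- c, 1:] * [:- c, 1:] * r q"
    using taylor2_poly[of _ c] by metis
  define r0 where "r0 q = (if q = 0 then 0 else r q)" for q
  have r0: "q = [:poly q c:] + [:- c, 1:] * [:poly (pderiv q) c:] + [:- c, 1:] * [:- c, 1:] * r0 q" for q
    using r[of q] by (cases "q = 0") (simp_all add: r0_def del: mult_pCons_left)
  have "H = lift (map_poly (\<lambda>q. poly q c) H) + smult [:- c, 1:] (lift (map_poly (\<lambda>q. poly (pderiv q) c) H)) +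
    smult ([:- c, 1:] * [:- c, 1:]) (map_poly r0 H)"
  proof (rule poly_eqI)
    fix i
    have "coeff (map_poly r0 H) i = r0 (coeff H i)" by (rule coeff_map_poly) (simp add: r0_def)
    moreover have "coeff (map_poly (\<lambda>q. poly q c) H) i = poly (coeff H i) c" by (rule coeff_map_poly) simp
    moreover have "coeff (map_poly (\<lambda>q. poly (pderiv q) c) H) i = poly (pderiv (coeff H i)) c" by (rule coeff_map_poly) simp
    ultimately show "coeff H i = coeff (lift (map_poly (\<lambda>q. poly q c) H) +
        smult [:- c, 1:] (lift (map_poly (\<lambda>q. poly (pderiv q) c) H)) + smult ([:- c, 1:] * [:- c, 1:]) (map_poly r0 H)) i"
      unfolding coeff_add coeff_smult coeff_lift using r0[of "coeff H i"] by (simp only:)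
  qed
  thus ?thesis ..
qed

lemma linear_power_root:
  fixes q :: "'a::idom poly"
  assumes n: "n \<ge> 1" and d: "[:- c, 1:] ^ (2 * n) dvd q ^ n"
  shows "[:- c, 1:] ^ 2 dvd q"
proof -
  let ?t = "[:- c, 1:]"
  have t0: "?t \<noteq> 0" by simp
  have root: "?t dvd s" if "?t dvd s ^ n" for s
    using that n unfolding poly_eq_0_iff_dvd[symmetric] poly_power by simp
  have "?t dvd ?t ^ (2 * n)" using n by (intro dvd_power) simp
  hence "?t dvd q" by (rule root[OF dvd_trans[OF _ d]])
  then obtain s where s: "q = ?t * s" by (rule dvdE)
  have "q ^ n = ?t ^ n * s ^ n" unfolding s by (rule power_mult_distrib)
  moreover have "?t ^ (2 * n) = ?t ^ n * ?t ^ n" unfolding mult_2 by (rule power_add)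
  ultimately have "?t ^ n * ?t ^ n dvd ?t ^ n * s ^ n" using d by (simp only:)
  moreover have "?t ^ n \<noteq> 0" using t0 by (rule power_not_zero)
  ultimately have "?t ^ n dvd s ^ n" using dvd_mult_cancel_left by blast
  moreover have "?t dvd ?t ^ n" using n by (intro dvd_power) simp
  ultimately have "?t dvd s" by - (rule root, rule dvd_trans)
  thus ?thesis unfolding s power2_eq_square by (intro mult_dvd_mono dvd_refl)
qed

section \<open>Derivatives with respect to the parameter\<close>

abbreviation dc :: "'a::idom poly poly \<Rightarrow> 'a poly poly" where "dc \<equiv> map_poly pderiv"

lemma coeff_dc: "coeff (dc g) i = pderiv (coeff g i)" by (simp add: coeff_map_poly)

lemma dc_add: "dc (a + b) = dc a + dc b" by (rule poly_eqI) (simp add: coeff_dc pderiv_add)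

lemma dc_mult: "dc (a * b) = dc a * b + a * dc b"
  by (rule poly_eqI) (simp add: coeff_dc coeff_mult pderiv_sum pderiv_mult sum.distrib add.commute mult.commute[of "coeff b _" "pderiv _"])

lemma dc_const: "dc [:a:] = [:pderiv a:]" by (rule poly_eqI) (simp add: coeff_dc coeff_pCons split: nat.split)

lemma dc_pcompose: "dc (pcompose g u) = pcompose (dc g) u + pcompose (pderiv g) u * dc u"
proof (induction g)
  case (pCons a g)
  have "dc (pCons a g) = pCons (pderiv a) (dc g)" by (rule poly_eqI) (simp add: coeff_dc coeff_pCons split: nat.split)
  thus ?case
    by (simp add: pcompose_pCons dc_add dc_mult dc_const pCons.IH pderiv_pCons pcompose_add algebra_simps)
qed simp

lemma pcompose_const_arg: "pcompose g [:a:] = [:poly g a:]"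
  by (induction g) (simp_all add: pcompose_pCons mult.commute)

lemma comm_ring_hom_map_poly: "comm_ring_hom h \<Longrightarrow> comm_ring_hom (map_poly h)"
proof -
  assume "comm_ring_hom h"
  then interpret h: comm_ring_hom h .
  interpret m: map_poly_comm_ring_hom h ..
  show ?thesis by (rule m.comm_ring_hom_axioms)
qed

section \<open>Singular points force a multiple root\<close>

locale residue_point = unicritical m for m :: nat +
  fixes p :: int and n :: nat and x0 c0 :: "'k::field"
  assumes n1: "n \<ge> 1" and prime_p: "prime p" and p_m: "\<not> p dvd int m" and char_p: "of_int p = (0 :: 'k)"
begin

definition \<kappa> :: "int poly \<Rightarrow> 'k poly" where "\<kappa> = map_poly of_int"
definition hc :: "int poly \<Rightarrow> 'k" where "hc q = poly (\<kappa> q) c0"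

lemma kappa_hom: "comm_ring_hom \<kappa>"
  unfolding \<kappa>_def by (rule comm_ring_hom_map_poly) (unfold_locales, simp_all)

lemma hc_hom: "comm_ring_hom hc"
proof -
  interpret k: comm_ring_hom \<kappa> by (rule kappa_hom)
  show ?thesis by unfold_locales (simp_all add: hc_def k.hom_add k.hom_mult)
qed

sublocale hc: comm_ring_hom hc by (rule hc_hom)
sublocale bar: map_poly_comm_ring_hom hc ..

abbreviation bar :: "int poly poly \<Rightarrow> 'k poly" where "bar \<equiv> map_poly hc"
definition ev :: "int poly poly \<Rightarrow> 'k" where "ev g = poly (bar g) x0"

lemma ev_hom: "comm_ring_hom ev"
  by unfold_locales (simp_all add: ev_def bar.hom_add bar.hom_mult)

sublocale ev: comm_ring_hom ev by (rule ev_hom)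
sublocale evY: map_poly_comm_ring_hom ev ..

lemma ev_const: "ev [:q:] = hc q"
proof -
  have "bar [:q:] = [:hc q:]" by (rule poly_eqI) (simp add: coeff_pCons split: nat.split)
  thus ?thesis by (simp add: ev_def)
qed

lemma hc_pderiv: "hc (pderiv q) = poly (pderiv (\<kappa> q)) c0"
  unfolding hc_def \<kappa>_def by (subst map_poly_pderiv_hom) (unfold_locales, simp_all)

lemma ok_p: "ok p n" by (rule ok_prime[OF n1 prime_p p_m])

lemma ev_pcompose: "ev (pcompose g u) = poly (bar g) (ev u)"
  by (simp add: ev_def hc.map_poly_pcompose poly_pcompose)

text \<open>The vanishing of \<open>\<Phi>\<^sub>n\<close> to second order along \<open>P = 0\<close> in the fibre over \<open>c\<^sub>0\<close> makes norms of functions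
  vanishing along \<open>P = 0\<close> vanish to high order at \<open>c\<^sub>0\<close>.\<close>

lemma norm_order:
  assumes P: "lead_coeff P = 1" and PP: "P * P dvd bar (\<Phi> n)" and Pc: "P dvd bar (dc (\<Phi> n))" and Pg: "P dvd bar g"
  shows "[:- c0, 1:] ^ (2 * degree P) dvd \<kappa> (N n g)"
proof -
  let ?t = "[:- c0, 1:]"
  interpret k: comm_ring_hom \<kappa> by (rule kappa_hom)
  interpret kk: map_poly_comm_ring_hom \<kappa> ..
  note lc = dynatomic_L(1)[OF n1]
  define \<Phi>' where "\<Phi>' = map_poly \<kappa> (\<Phi> n)"
  define g' where "g' = map_poly \<kappa> g"
  have lc': "lead_coeff \<Phi>' = 1" "degree \<Phi>' = degree (\<Phi> n)" unfolding \<Phi>'_def using k.degree_map_poly_monic[OF lc] by auto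
  have red: "map_poly (\<lambda>q. poly q c0) (map_poly \<kappa> G) = bar G" for G
    by (rule poly_eqI) (simp add: coeff_map_poly hc_def)
  have redc: "map_poly (\<lambda>q. poly (pderiv q) c0) (map_poly \<kappa> G) = bar (dc G)" for G
    by (rule poly_eqI) (simp add: coeff_map_poly hc_pderiv)
  obtain e where e: "\<Phi>' = lift (bar (\<Phi> n)) + smult ?t (lift (bar (dc (\<Phi> n)))) + smult (?t * ?t) e"
    using taylor2[of \<Phi>' c0] unfolding \<Phi>'_def red redc by blast
  obtain e' where e': "g' = lift (bar g) + smult ?t (lift (bar (dc g))) + smult (?t * ?t) e'"
    using taylor2[of g' c0] unfolding g'_def red redc by blast
  obtain a where a: "bar (\<Phi> n) = P * P * a" using PP by (rule dvdE)
  obtain b where b: "bar (dc (\<Phi> n)) = P * b" using Pc by (rule dvdE)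
  obtain h where h: "bar g = P * h" using Pg by (rule dvdE)
  have eP: "\<Phi>' = lift P * lift P * lift a + smult ?t (lift P * lift b) + smult (?t * ?t) e"
    using e by (simp only: a b lift_mult)
  have eg: "g' = lift P * lift h + smult ?t (lift (bar (dc g)) + smult ?t e')"
    using e' by (simp only: h lift_mult smult_add_right smult_smult add.assoc)
  have lP: "lead_coeff (lift P) = 1" "degree (lift P) = degree P"
    unfolding lift_def using comm_ring_hom.degree_map_poly_monic[OF const_hom P] by auto
  have le: "2 * degree P \<le> degree \<Phi>'"
  proof -
    have bl: "lead_coeff (bar (\<Phi> n)) = 1" "degree (bar (\<Phi> n)) = degree (\<Phi> n)" using hc.degree_map_poly_monic[OF lc] by auto
    hence "bar (\<Phi> n) \<noteq> 0" by (metis leading_coeff_0_iff zero_neq_one)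
    hence "degree (P * P) \<le> degree (bar (\<Phi> n))" using PP by (intro dvd_imp_degree_le)
    moreover have "P \<noteq> 0" using P by auto
    ultimately show ?thesis using bl(2) lc'(2) by (simp add: degree_mult_eq)
  qed
  have "?t ^ (2 * degree P) dvd det (mult_mat \<Phi>' g')"
    by (rule norm_vanishing_order[OF _ lc'(1) lP(1) lP(2)[symmetric] le eP eg]) simp
  also have "det (mult_mat \<Phi>' g') = \<kappa> (N n g)"
    unfolding N_def \<Phi>'_def g'_def mult_mat_hom[OF kappa_hom lc, symmetric] by (rule k.hom_det)
  finally show ?thesis .
qed

lemma ev_RI: assumes z: "ev (\<Phi> n) = 0" and g: "g \<in> RI p n" shows "ev g = 0"
proof -
  obtain a where "\<Phi> n dvd g - a * of_int p" using g by (auto simp: RI_def)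
  then obtain b where "g - a * of_int p = \<Phi> n * b" by (rule dvdE)
  hence "g = \<Phi> n * b + a * of_int p" by (simp add: algebra_simps)
  thus ?thesis using z char_p by (simp add: ev.hom_add ev.hom_mult ev.hom_of_int)
qed

lemma ev_poly_ideal_RI: "ev (\<Phi> n) = 0 \<Longrightarrow> f \<in> poly_ideal (RI p n) \<Longrightarrow> map_poly ev f = 0"
  by (rule poly_eqI) (simp add: ev_RI poly_ideal_coeff)

lemma singular_point_F:
  assumes z: "ev (\<Phi> n) = 0" "ev (pderiv (\<Phi> n)) = 0" "ev (dc (\<Phi> n)) = 0" and k: "k < n"
  shows "poly (bar (\<Phi> n)) (ev (F k)) = 0" "poly (pderiv (bar (\<Phi> n))) (ev (F k)) = 0" "poly (bar (dc (\<Phi> n))) (ev (F k)) = 0"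
proof -
  obtain H where H: "pcompose (\<Phi> n) (F k) = \<Phi> n * H" using dynatomic_dvd_shift[OF n1, of k] by (rule dvdE)
  show r0: "poly (bar (\<Phi> n)) (ev (F k)) = 0"
    using arg_cong[OF H, of ev] z(1) by (simp add: ev_pcompose ev.hom_mult)
  have "lam n - 1 = pderiv (\<Phi> n) * V n + \<Phi> n * pderiv (V n)"
    unfolding pderiv_Psi[symmetric] Psi_V[OF n1] pderiv_mult by (simp only: mult_ac add_ac)
  from arg_cong[OF this, of ev] have l1: "ev (lam n) = 1"
    using z by (simp add: ev.hom_add ev.hom_mult ev.hom_minus)
  have "lam k dvd lam n" unfolding pderiv_F using k by (intro prod_dvd_prod_subset) auto
  hence l0: "ev (lam k) \<noteq> 0" using l1 by (auto elim!: dvdE simp: ev.hom_mult)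
  have "pcompose (pderiv (\<Phi> n)) (F k) * lam k = pderiv (pcompose (\<Phi> n) (F k))" by (simp add: pderiv_pcompose)
  also have "\<dots> = pderiv (\<Phi> n) * H + \<Phi> n * pderiv H" unfolding H pderiv_mult by (simp only: ac_simps)
  finally have "ev (pcompose (pderiv (\<Phi> n)) (F k)) * ev (lam k) = 0"
    using z by (simp flip: ev.hom_mult) (simp add: ev.hom_add ev.hom_mult)
  hence r1: "poly (bar (pderiv (\<Phi> n))) (ev (F k)) = 0" using l0 by (simp add: ev_pcompose)
  thus "poly (pderiv (bar (\<Phi> n))) (ev (F k)) = 0" by (simp add: map_poly_pderiv_hom[OF hc_hom])
  have "pcompose (dc (\<Phi> n)) (F k) + pcompose (pderiv (\<Phi> n)) (F k) * dc (F k) = dc (\<Phi> n) * H + \<Phi> n * dc H"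
    unfolding dc_pcompose[symmetric] dc_mult[symmetric] H ..
  from arg_cong[OF this, of ev] show "poly (bar (dc (\<Phi> n))) (ev (F k)) = 0"
    using z r1 by (simp add: ev.hom_add ev.hom_mult ev_pcompose)
qed

lemma double_root_of_derivatives:
  assumes "ev [:q:] = 0" "ev (dc [:q:]) = 0"
  shows "[:- c0, 1:] ^ 2 dvd \<kappa> q"
proof -
  obtain r where r: "\<kappa> q = [:poly (\<kappa> q) c0:] + [:- c0, 1:] * [:poly (pderiv (\<kappa> q)) c0:] + [:- c0, 1:] * [:- c0, 1:] * r"
    using taylor2_poly[of "\<kappa> q" c0] by blast
  have z: "poly (\<kappa> q) c0 = 0" "poly (pderiv (\<kappa> q)) c0 = 0"
    using assms by (simp_all add: ev_const dc_const hc_pderiv) (simp add: hc_def)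
  have "\<kappa> q = [:- c0, 1:] * [:- c0, 1:] * r" using r unfolding z by (simp del: mult_pCons_left)
  thus ?thesis unfolding power2_eq_square by (rule dvdI)
qed

text \<open>At a singular point where \<open>V\<^sub>n\<close> vanishes, \<open>\<delta>\<^sub>n(1,c)\<close> is a combination of \<open>\<Phi>\<^sub>n\<close> and of \<open>\<Phi>\<^sub>n' V\<^sub>n + \<Phi>\<^sub>n V\<^sub>n'\<close>, both
  of which vanish there together with their derivatives in \<open>c\<close>.\<close>

lemma delta_double_root_smaller_period:
  assumes z: "ev (\<Phi> n) = 0" "ev (pderiv (\<Phi> n)) = 0" "ev (dc (\<Phi> n)) = 0" and v: "ev (V n) = 0"
  shows "[:- c0, 1:] ^ 2 dvd \<kappa> (poly (delta m n) 1)"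
proof (rule double_root_of_derivatives)
  let ?u = "lam n - 1" and ?d = "[:poly (delta m n) 1:]"
  have u: "?u = pderiv (\<Phi> n) * V n + \<Phi> n * pderiv (V n)"
    unfolding pderiv_Psi[symmetric] Psi_V[OF n1] pderiv_mult by (simp only: mult_ac add_ac)
  obtain h where h: "pcompose (delta m n) (lam n) = \<Phi> n * h" using delta_lam[OF n1] by (rule dvdE)
  have "pcompose (delta m n) [:1:] = ?d" by (rule pcompose_const_arg)
  moreover have "lam n - [:1:] dvd pcompose (delta m n) (lam n) - pcompose (delta m n) [:1:]" by (rule pcompose_diff_dvd)
  moreover have "[:1:] = (1 :: int poly poly)" by (rule pCons_one)
  ultimately have "?u dvd \<Phi> n * h - ?d" by (simp only: h)
  then obtain q where "\<Phi> n * h - ?d = ?u * q" by (rule dvdE)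
  hence d: "?d = \<Phi> n * h + ?u * (- q)" by (simp add: algebra_simps)
  have u0: "ev ?u = 0" unfolding u using z v by (simp add: ev.hom_add ev.hom_mult)
  have uc: "ev (dc ?u) = 0" unfolding u dc_add dc_mult using z v by (simp add: ev.hom_add ev.hom_mult)
  show "ev ?d = 0" unfolding d using z u0 by (simp only: ev.hom_add ev.hom_mult mult_zero_left add_0)
  show "ev (dc ?d) = 0" unfolding d dc_add dc_mult using z u0 uc
    by (simp only: ev.hom_add ev.hom_mult mult_zero_left add_0)
qed

lemma delta_double_root_exact_period:
  assumes z: "ev (\<Phi> n) = 0" "ev (pderiv (\<Phi> n)) = 0" "ev (dc (\<Phi> n)) = 0" and v: "ev (V n) \<noteq> 0"
  shows "[:- c0, 1:] ^ 2 dvd \<kappa> (poly (delta m n) 1)"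
proof -
  let ?x = "\<lambda>i. ev (F i)"
  have Fadd: "?x (a + b) = poly (bar (F a)) (?x b)" for a b unfolding F_add ev_pcompose ..
  have Psi0: "ev (\<Psi> n) = 0" unfolding Psi_V[OF n1] using z by (simp add: ev.hom_mult)
  have xn: "?x n = ?x 0" using Psi0 by (simp add: Psi_def ev.hom_minus)
  have I: "is_ideal {g. ev g = 0}" by (auto simp: is_ideal_def ev.hom_add ev.hom_mult)
  have ne: "?x i \<noteq> ?x j" if "i < j" "j < n" for i j
  proof
    assume e: "?x i = ?x j"
    have "?x (n - j + i) = ?x (n - j + j)" unfolding Fadd e ..
    also have "n - j + j = n" using that by simp
    finally have "?x (n - j + i) = ?x 0" using xn by simp
    hence "\<Psi> (n - j + i) \<in> {g. ev g = 0}" by (simp add: Psi_def ev.hom_minus)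
    hence g: "ev (\<Psi> (gcd (n - j + i) n)) = 0" using Psi_gcd_ideal[OF I] Psi0 by blast
    have "gcd (n - j + i) n \<noteq> n"
    proof
      assume "gcd (n - j + i) n = n"
      hence "n dvd n - j + i" by (metis gcd_dvd1)
      hence "n \<le> n - j + i" using that by (intro dvd_imp_le) auto
      thus False using that by simp
    qed
    hence "\<Psi> (gcd (n - j + i) n) dvd V n" by (intro Psi_dvd_V[OF n1]) auto
    thus False using g v by (auto elim!: dvdE simp: ev.hom_mult)
  qed
  have inj: "inj_on ?x {..<n}"
  proof (rule inj_onI)
    fix i j assume "i \<in> {..<n}" "j \<in> {..<n}" "?x i = ?x j"
    thus "i = j" using ne[of i j] ne[of j i] by (cases i j rule: linorder_cases) auto
  qed
  define Z where "Z = ?x ` {..<n}"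
  have Z: "finite Z" "card Z = n" unfolding Z_def using card_image[OF inj] by auto
  define P where "P = (\<Prod>a\<in>Z. [:- a, 1:])"
  have P: "lead_coeff P = 1" "degree P = n" unfolding P_def using lead_coeff_prod_linear[of "\<lambda>x. x" Z] degree_prod_linear[OF Z(1)] Z(2) by auto
  have zz: "poly (bar (\<Phi> n)) a = 0" "poly (pderiv (bar (\<Phi> n))) a = 0" "poly (bar (dc (\<Phi> n))) a = 0" if "a \<in> Z" for a
    using that singular_point_F[OF z] unfolding Z_def by auto
  have "P dvd bar (\<Phi> n)" unfolding P_def by (rule prod_linear_dvd[OF Z(1) zz(1)])
  then obtain Q where Q: "bar (\<Phi> n) = P * Q" by (rule dvdE)
  have "poly Q a = 0" if a: "a \<in> Z" for a
  proof -
    define P' where "P' = (\<Prod>b\<in>Z - {a}. [:- b, 1:])"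
    have "P = [:- a, 1:] * P'" unfolding P_def P'_def by (rule prod.remove[OF Z(1) a])
    hence e: "bar (\<Phi> n) = [:- a, 1:] * (P' * Q)" unfolding Q by (simp only: mult.assoc)
    have "poly (pderiv (bar (\<Phi> n))) a = poly (P' * Q) a"
      unfolding e pderiv_mult by (simp add: pderiv_pCons del: mult_pCons_left)
    hence "poly P' a * poly Q a = 0" using zz(2)[OF a] by simp
    moreover have "poly P' a \<noteq> 0" unfolding P'_def poly_prod using Z(1) by auto
    ultimately show ?thesis by simp
  qed
  hence "P dvd Q" unfolding P_def by (rule prod_linear_dvd[OF Z(1)])
  hence PP: "P * P dvd bar (\<Phi> n)" unfolding Q by (rule mult_dvd_mono[OF dvd_refl])
  have Pc: "P dvd bar (dc (\<Phi> n))" unfolding P_def by (rule prod_linear_dvd[OF Z(1) zz(3)])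
  have Pg: "P dvd bar (1 - lam n)" unfolding P_def
  proof (rule prod_linear_dvd[OF Z(1)])
    fix a assume a: "a \<in> Z"
    have "1 - lam n = - (pderiv (\<Phi> n) * V n + \<Phi> n * pderiv (V n))"
      using pderiv_Psi[of n] unfolding Psi_V[OF n1] pderiv_mult by (simp add: algebra_simps)
    thus "poly (bar (1 - lam n)) a = 0"
      using zz(1,2)[OF a] by (simp add: bar.hom_minus bar.hom_uminus bar.hom_add bar.hom_mult map_poly_pderiv_hom[OF hc_hom])
  qed
  interpret k: comm_ring_hom \<kappa> by (rule kappa_hom)
  have "[:- c0, 1:] ^ (2 * n) dvd \<kappa> (N n (1 - lam n))" using norm_order[OF P(1) PP Pc Pg] unfolding P(2) .
  also have "\<kappa> (N n (1 - lam n)) = \<kappa> (poly (delta m n) 1) ^ n"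
    unfolding delta_1_power[OF n1, symmetric] by (rule k.hom_power)
  finally show ?thesis by (rule linear_power_root[OF n1])
qed

theorem singular_point_dvd_disc_delta:
  assumes z: "ev (\<Phi> n) = 0" "ev (pderiv (\<Phi> n)) = 0" "ev (dc (\<Phi> n)) = 0"
  shows "p dvd disc_delta m n"
proof -
  have "[:- c0, 1:] ^ 2 dvd \<kappa> (poly (delta m n) 1)"
    using delta_double_root_smaller_period[OF z] delta_double_root_exact_period[OF z] by blast
  thus ?thesis unfolding disc_delta_def \<kappa>_def
    by (rule double_root_dvd_discriminant[OF prime_p char_p lead_coeff_delta_1[OF n1 prime_p p_m]])
qed

end

context unicritical begin

text \<open>Functions on the curve that are invariant modulo \<open>q\<close>.\<close>

definition Inv :: "int \<Rightarrow> nat \<Rightarrow> int poly poly set" where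
  "Inv q n = {g. pcompose g (fc m) - g \<in> RI q n}"

lemma fc_eq_F: "fc m = F 1" using F_Suc[of 0] by simp

lemma RI_shift: assumes n: "n \<ge> 1" and g: "g \<in> RI q n" shows "pcompose g (F k) \<in> RI q n"
proof -
  obtain a where "\<Phi> n dvd g - a * of_int q" using g by (auto simp: RI_def)
  then obtain b where "g - a * of_int q = \<Phi> n * b" by (rule dvdE)
  hence "g = \<Phi> n * b + a * [:of_int q:]" by (simp add: algebra_simps of_int_poly)
  hence "pcompose g (F k) = pcompose (\<Phi> n) (F k) * pcompose b (F k) + pcompose a (F k) * of_int q"
    by (simp add: pcompose_add pcompose_mult pcompose_const pcompose_smult of_int_poly)
  also have "\<dots> \<in> RI q n"
    by (intro is_ideal_add[OF is_ideal_RI] is_ideal_multl[OF is_ideal_RI RI_q]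
      is_ideal_multr[OF is_ideal_RI RI_dvd[OF dynatomic_dvd_shift[OF n]]])
  finally show ?thesis .
qed

lemma subring_Inv: "subring_set (Inv q n)"
proof -
  note I = is_ideal_RI[of q n]
  have "a * b \<in> Inv q n" if "a \<in> Inv q n" "b \<in> Inv q n" for a b
  proof -
    let ?s = "\<lambda>g. pcompose g (fc m)"
    have "?s (a * b) - a * b = (?s a - a) * ?s b + a * (?s b - b)" by (simp add: pcompose_mult algebra_simps)
    moreover have "(?s a - a) * ?s b \<in> RI q n" by (rule is_ideal_multr[OF I]) (use that in \<open>simp add: Inv_def\<close>)
    moreover have "a * (?s b - b) \<in> RI q n" by (rule is_ideal_multl[OF I]) (use that in \<open>simp add: Inv_def\<close>)
    ultimately show ?thesis using is_ideal_add[OF I] by (simp only: Inv_def mem_Collect_eq)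
  qed
  moreover have "a - b \<in> Inv q n" if "a \<in> Inv q n" "b \<in> Inv q n" for a b
    using is_ideal_diff[OF I, of "pcompose a (fc m) - a" "pcompose b (fc m) - b"] that
    by (simp add: Inv_def pcompose_diff algebra_simps)
  moreover have "a + b \<in> Inv q n" if "a \<in> Inv q n" "b \<in> Inv q n" for a b
    using is_ideal_add[OF I, of "pcompose a (fc m) - a" "pcompose b (fc m) - b"] that
    by (simp add: Inv_def pcompose_add algebra_simps)
  ultimately show ?thesis using is_ideal_zero[OF I] by (auto simp: subring_set_def Inv_def)
qed

lemma const_Inv: "[:a:] \<in> Inv q n"
  using is_ideal_zero[OF is_ideal_RI] by (simp add: Inv_def)

lemma RI_Inv: "n \<ge> 1 \<Longrightarrow> RI q n \<subseteq> Inv q n"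
  using RI_shift[of n _ q 1] by (auto simp: Inv_def fc_eq_F intro: is_ideal_diff[OF is_ideal_RI])

lemma Inv_F: assumes n: "n \<ge> 1" and g: "g \<in> Inv q n" shows "pcompose g (F k) - g \<in> RI q n"
proof (induction k)
  case 0
  show ?case using is_ideal_zero[OF is_ideal_RI] by simp
next
  case (Suc k)
  have "pcompose g (F (Suc k)) - g = pcompose (pcompose g (fc m) - g) (F k) + (pcompose g (F k) - g)"
    by (simp add: F_Suc pcompose_diff pcompose_assoc)
  also have "\<dots> \<in> RI q n" using g by (intro is_ideal_add[OF is_ideal_RI] Suc RI_shift[OF n]) (simp add: Inv_def)
  finally show ?case .
qed

text \<open>The map \<open>\<sigma>\<close> permutes the factors of the cycle polynomial, up to replacing \<open>f\<^sup>n(x)\<close> by \<open>x\<close>.\<close>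

lemma CP_Inv: assumes n: "n \<ge> 1" shows "CP n \<in> poly_subring (Inv q n)"
proof -
  let ?s = "map_poly (\<lambda>g. pcompose g (fc m))"
  have hom: "comm_ring_hom (\<lambda>g :: int poly poly. pcompose g (fc m))"
    by unfold_locales (simp_all add: pcompose_add pcompose_mult)
  interpret s: comm_ring_hom "\<lambda>g :: int poly poly. pcompose g (fc m)" by (rule hom)
  interpret sp: map_poly_comm_ring_hom "\<lambda>g :: int poly poly. pcompose g (fc m)" ..
  obtain k where k: "n = Suc k" using n by (cases n) auto
  have lin: "?s [:- F i, 1:] = [:- F (Suc i), 1:]" for i
  proof -
    have "pcompose (F i) (fc m) = F (Suc i)" using F_add[of i 1] by (simp add: fc_eq_F)
    thus ?thesis by (simp add: pcompose_uminus)
  qed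
  let ?C = "\<Prod>i<k. [:- F (Suc i), 1:]"
  have "?s (CP n) = (\<Prod>i<n. [:- F (Suc i), 1:])" unfolding CP_def sp.hom_prod lin ..
  also have "\<dots> = ?C * [:- F n, 1:]" unfolding k by (rule prod.lessThan_Suc)
  finally have a: "?s (CP n) = ?C * [:- F n, 1:]" .
  have b: "CP n = [:- F 0, 1:] * ?C" unfolding CP_def k by (rule prod.lessThan_Suc_shift)
  have alg: "A - B = C * (Y - Z)" if "A = C * Y" "B = Z * C" for A B C Y Z :: "int poly poly poly"
    using that by (simp only: right_diff_distrib mult.commute)
  have "?s (CP n) - CP n = ?C * ([:- F n, 1:] - [:- F 0, 1:])" by (rule alg[OF a b])
  also have "[:- F n, 1:] - [:- F 0, 1:] = [:- \<Psi> n:]" by (simp add: Psi_def)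
  finally have "?s (CP n) - CP n = ?C * [:- \<Psi> n:]" .
  moreover have "\<Phi> n dvd - \<Psi> n" using dynatomic_dvd_Psi[OF n] by simp
  hence "[:- \<Psi> n:] \<in> poly_ideal (RI q n)" by (intro const_poly_ideal[OF is_ideal_RI] RI_dvd)
  ultimately have "?s (CP n) - CP n \<in> poly_ideal (RI q n)"
    using is_ideal_multl[OF is_ideal_poly_ideal[OF is_ideal_RI]] by (simp only:)
  thus ?thesis by (auto simp: poly_ideal_def poly_subring_def Inv_def)
qed

lemma lift_Inv: "lift g \<in> poly_subring (Inv q n)" if "\<And>i. [:coeff g i:] \<in> Inv q n"
  using that by (simp add: poly_subring_def)

lemma QP_Inv: assumes n: "n \<ge> 1" shows "QP n \<in> poly_subring (Inv q n)"
  unfolding QP_def by (intro mmod_subring subring_Inv CP_monic CP_Inv[OF n] lift_Inv const_Inv)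

text \<open>The coefficients of these two remainders are functions on the quotient curve. They have a common zero with \<open>p\<close>
  and \<open>\<Phi>\<^sub>n\<close> exactly where, in the fibre, \<open>\<Phi>\<^sub>n\<close> is divisible by the square of the cycle polynomial and its derivative
  in \<open>c\<close> by the cycle polynomial.\<close>

definition rP :: "nat \<Rightarrow> int poly poly poly" where "rP n = mmod (CP n) (QP n)"
definition \<phi>P :: "nat \<Rightarrow> int poly poly poly" where "\<phi>P n = mmod (CP n) (lift (dc (\<Phi> n)))"

lemma rP_Inv: "n \<ge> 1 \<Longrightarrow> rP n \<in> poly_subring (Inv q n)"
  unfolding rP_def by (intro mmod_subring subring_Inv CP_monic CP_Inv QP_Inv)

lemma phiP_Inv: "n \<ge> 1 \<Longrightarrow> \<phi>P n \<in> poly_subring (Inv q n)"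
  unfolding \<phi>P_def by (intro mmod_subring subring_Inv CP_monic CP_Inv lift_Inv const_Inv)

end

context residue_point begin

lemma evY_lift: "map_poly ev (lift g) = bar g"
  by (rule poly_eqI) (simp add: coeff_map_poly ev_const)

lemma bar_poly_X_cong:
  "(\<And>l. P dvd bar (coeff Q l) - [:ev (coeff Q l):]) \<Longrightarrow> P dvd bar (poly Q [:0, 1:]) - map_poly ev Q"
proof (induction Q)
  case (pCons a Q)
  have X: "bar [:0, 1:] = [:0, 1:]" by (rule poly_eqI) (simp add: coeff_pCons split: nat.split)
  have a: "P dvd bar a - [:ev a:]" using pCons.prems[of 0] by simp
  have "P dvd bar (coeff Q l) - [:ev (coeff Q l):]" for l using pCons.prems[of "Suc l"] by simp
  hence IH: "P dvd bar (poly Q [:0, 1:]) - map_poly ev Q" by (rule pCons.IH)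
  have b: "bar (poly (pCons a Q) [:0, 1:]) = bar a + [:0, 1:] * bar (poly Q [:0, 1:])"
    unfolding poly_pCons bar.hom_add bar.hom_mult X ..
  have e: "map_poly ev (pCons a Q) = [:ev a:] + [:0, 1:] * map_poly ev Q"
    by (rule poly_eqI) (simp add: coeff_pCons split: nat.split)
  have "bar (poly (pCons a Q) [:0, 1:]) - map_poly ev (pCons a Q) =
      (bar a - [:ev a:]) + [:0, 1:] * (bar (poly Q [:0, 1:]) - map_poly ev Q)"
    unfolding b e by (simp only: right_diff_distrib add_diff_add)
  also have "P dvd \<dots>" by (rule dvd_add[OF a dvd_mult[OF IH]])
  finally show ?case .
qed simp

theorem singular_point_dvd_disc_Delta_prim:
  assumes z: "ev (\<Phi> n) = 0" and r: "\<And>i. ev (coeff (rP n) i) = 0" and f: "\<And>i. ev (coeff (\<phi>P n) i) = 0"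
  shows "p dvd disc_Delta_prim m n"
proof -
  let ?e = "map_poly ev"
  define P where "P = ?e (CP n)"
  have P: "lead_coeff P = 1" "degree P = n"
    unfolding P_def using ev.degree_map_poly_monic[OF CP_monic[of n]] by (auto simp: CP_degree)
  have "?e (QP n) = P * ?e (mdiv (CP n) (QP n)) + ?e (rP n)"
    unfolding P_def rP_def evY.hom_mult[symmetric] evY.hom_add[symmetric] by (rule arg_cong[OF mdiv_mmod(1)[OF CP_monic]])
  moreover have "?e (rP n) = 0" by (rule poly_eqI) (simp add: r)
  ultimately have PQ: "P dvd ?e (QP n)" by simp
  have "?e (lift (dc (\<Phi> n))) = P * ?e (mdiv (CP n) (lift (dc (\<Phi> n)))) + ?e (\<phi>P n)"
    unfolding P_def \<phi>P_def evY.hom_mult[symmetric] evY.hom_add[symmetric] by (rule arg_cong[OF mdiv_mmod(1)[OF CP_monic]])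
  moreover have "?e (\<phi>P n) = 0" by (rule poly_eqI) (simp add: f)
  ultimately have Pc: "P dvd bar (dc (\<Phi> n))" by (simp add: evY_lift)
  have "?e (lift (\<Phi> n) - CP n * QP n) = 0" by (rule ev_poly_ideal_RI[OF z dynatomic_factor[OF ok_p]])
  hence "bar (\<Phi> n) = P * ?e (QP n)" by (simp add: evY.hom_minus evY.hom_mult evY_lift P_def)
  hence PP: "P * P dvd bar (\<Phi> n)" using PQ by (simp add: mult_dvd_mono)
  have ql: "P dvd bar (coeff (QP n) l) - [:ev (coeff (QP n) l):]" for l
  proof -
    let ?q = "coeff (QP n) l"
    let ?H = "lift ?q - [:?q:]"
    have "?q \<in> Inv p n" using QP_Inv[OF n1] by (simp add: poly_subring_def)
    hence "mmod (CP n) ?H \<in> poly_ideal (RI p n)"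
      by (intro rem_CP_ideal[OF ok_p]) (simp add: poly_lift Inv_F[OF n1])
    hence "?e (mmod (CP n) ?H) = 0" by (rule ev_poly_ideal_RI[OF z])
    moreover have "?e ?H = P * ?e (mdiv (CP n) ?H) + ?e (mmod (CP n) ?H)"
      unfolding P_def evY.hom_mult[symmetric] evY.hom_add[symmetric] by (rule arg_cong[OF mdiv_mmod(1)[OF CP_monic]])
    ultimately have d: "P dvd ?e ?H" by simp
    have "?e [:?q:] = [:ev ?q:]" by (rule poly_eqI) (simp add: coeff_pCons split: nat.split)
    hence "?e ?H = bar ?q - [:ev ?q:]" by (simp only: evY.hom_minus evY_lift)
    with d show ?thesis by (simp only:)
  qed
  have "P dvd bar (gP n) - ?e (QP n)" unfolding gP_def by (rule bar_poly_X_cong[OF ql])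
  hence "P dvd (bar (gP n) - ?e (QP n)) + ?e (QP n)" using PQ by (rule dvd_add)
  hence Pg: "P dvd bar (gP n)" by (simp only: diff_add_cancel)
  interpret k: comm_ring_hom \<kappa> by (rule kappa_hom)
  have "[:- c0, 1:] ^ (2 * n) dvd \<kappa> (N n (gP n))" using norm_order[OF P(1) PP Pc Pg] unfolding P(2) .
  also have "\<kappa> (N n (gP n)) dvd \<kappa> (Delta_prim m n) ^ n"
  proof -
  have "N n (gP n) dvd Delta_prim m n ^ n"
    by (rule associatedD2) (simp only: normalize_power Delta_prim(2)[OF n1])
  then obtain s where "Delta_prim m n ^ n = N n (gP n) * s" by (rule dvdE)
  from arg_cong[OF this, of \<kappa>] have "\<kappa> (Delta_prim m n) ^ n = \<kappa> (N n (gP n)) * \<kappa> s"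
    unfolding k.hom_power k.hom_mult .
  thus ?thesis by (rule dvdI)
  qed
  finally have "[:- c0, 1:] ^ 2 dvd \<kappa> (Delta_prim m n)" by (rule linear_power_root[OF n1])
  thus ?thesis unfolding disc_Delta_prim_def \<kappa>_def
    by (rule double_root_dvd_discriminant[OF prime_p char_p lead_coeff_Delta_prim[OF n1 prime_p p_m]])
qed

end

section \<open>Residue fields\<close>

definition field_ideal :: "'a::comm_ring_1 set \<Rightarrow> bool" where
  "field_ideal M \<longleftrightarrow> is_ideal M \<and> 1 \<notin> M \<and> (\<forall>a. a \<notin> M \<longrightarrow> (\<exists>b. a * b - 1 \<in> M))"

lemma is_ideal_Union_chain:
  assumes ne: "C \<noteq> {}" and ch: "\<And>W Y. W \<in> C \<Longrightarrow> Y \<in> C \<Longrightarrow> W \<subseteq> Y \<or> Y \<subseteq> W" and I: "\<And>W. W \<in> C \<Longrightarrow> is_ideal W"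
  shows "is_ideal (\<Union>C)"
  unfolding is_ideal_def
proof (intro conjI ballI allI)
  show "0 \<in> \<Union>C" using ne is_ideal_zero[OF I] by blast
next
  fix a b assume "a \<in> \<Union>C" "b \<in> \<Union>C"
  then obtain W Y where WY: "W \<in> C" "a \<in> W" "Y \<in> C" "b \<in> Y" by blast
  from ch[OF WY(1,3)] show "a + b \<in> \<Union>C"
  proof
    assume "W \<subseteq> Y"
    hence "a + b \<in> Y" using is_ideal_add[OF I[OF WY(3)], of a b] WY by blast
    thus ?thesis using WY by blast
  next
    assume "Y \<subseteq> W"
    hence "a + b \<in> W" using is_ideal_add[OF I[OF WY(1)], of a b] WY by blast
    thus ?thesis using WY by blast
  qed
next
  fix a r assume "a \<in> \<Union>C"
  thus "r * a \<in> \<Union>C" using is_ideal_multl[OF I] by blast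
qed

lemma field_ideal_exists:
  assumes J: "is_ideal J" and one: "1 \<notin> J"
  shows "\<exists>M. field_ideal M \<and> J \<subseteq> M"
proof -
  define A where "A = {I. is_ideal I \<and> J \<subseteq> I \<and> 1 \<notin> I}"
  have "\<exists>M\<in>A. \<forall>W\<in>A. M \<subseteq> W \<longrightarrow> W = M"
  proof (rule subset_Zorn_nonempty)
    show "A \<noteq> {}" using J one by (auto simp: A_def)
    fix C assume C: "C \<noteq> {}" "subset.chain A C"
    have sub: "C \<subseteq> A" using C(2) by (simp add: subset.chain_def)
    have "is_ideal (\<Union>C)"
      by (rule is_ideal_Union_chain[OF C(1)]) (use C(2) sub in \<open>auto simp: subset_chain_def A_def\<close>)
    moreover have "J \<subseteq> \<Union>C" using C(1) sub by (auto simp: A_def)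
    moreover have "1 \<notin> \<Union>C" using sub by (auto simp: A_def)
    ultimately show "\<Union>C \<in> A" by (simp add: A_def)
  qed
  then obtain M where M: "is_ideal M" "J \<subseteq> M" "1 \<notin> M" and max: "\<And>W. W \<in> A \<Longrightarrow> M \<subseteq> W \<Longrightarrow> W = M"
    by (auto simp: A_def)
  have "\<exists>b. a * b - 1 \<in> M" if a: "a \<notin> M" for a
  proof -
    define W where "W = {x. \<exists>u b. u \<in> M \<and> x = u + a * b}"
    have Xin: "u + a * b \<in> W" if "u \<in> M" for u b using that by (auto simp: W_def)
    have "is_ideal W"
      unfolding is_ideal_def
    proof (intro conjI ballI allI)
      show "0 \<in> W" using Xin[OF is_ideal_zero[OF M(1)], of 0] by simp
      fix x assume "x \<in> W"
      then obtain u b where x: "u \<in> M" "x = u + a * b" by (auto simp: W_def)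
      {
        fix y assume "y \<in> W"
        then obtain v c where y: "v \<in> M" "y = v + a * c" by (auto simp: W_def)
        have "x + y = (u + v) + a * (b + c)" by (simp add: x y algebra_simps)
        thus "x + y \<in> W" using Xin[OF is_ideal_add[OF M(1) x(1) y(1)]] by simp
      }
      fix r
      have "r * x = r * u + a * (r * b)" by (simp add: x algebra_simps)
      thus "r * x \<in> W" using Xin[OF is_ideal_multl[OF M(1) x(1)]] by simp
    qed
    moreover have MW: "M \<subseteq> W" using Xin[of _ 0] by auto
    moreover have "a \<in> W" using Xin[OF is_ideal_zero[OF M(1)], of 1] by simp
    ultimately have "1 \<in> W" using max[of W] a M by (auto simp: A_def)
    then obtain u b where "u \<in> M" "1 = u + a * b" by (auto simp: W_def)
    hence "a * b - 1 = - u" by (simp add: algebra_simps)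
    hence "a * b - 1 \<in> M" using is_ideal_uminus[OF M(1) \<open>u \<in> M\<close>] by simp
    thus ?thesis by (rule exI)
  qed
  thus ?thesis using M by (auto simp: field_ideal_def)
qed

text \<open>A type cannot depend on an ideal that is given inside a proof. The type below is the residue field of one
  fixed maximal ideal, which is chosen to be a singular point of one of the curves that violates the divisibility of
  the discriminant, if such a point exists; then it suffices to refute this single point.\<close>

definition bad_ideal :: "int poly poly set \<Rightarrow> bool" where
  "bad_ideal M \<longleftrightarrow> (\<exists>m n p. 2 \<le> m \<and> 1 \<le> n \<and> prime p \<and> \<not> p dvd int m \<and> of_int p \<in> M \<and> dynatomic m n \<in> M \<and>
     (pderiv (dynatomic m n) \<in> M \<and> dc (dynatomic m n) \<in> M \<and> \<not> p dvd disc_delta m n \<or>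
      (\<forall>i. coeff (unicritical.rP m n) i \<in> M \<and> coeff (unicritical.\<phi>P m n) i \<in> M) \<and> \<not> p dvd disc_Delta_prim m n))"

definition chosen_ideal :: "int poly poly set" where
  "chosen_ideal = (SOME M. field_ideal M \<and> ((\<exists>M'. field_ideal M' \<and> bad_ideal M') \<longrightarrow> bad_ideal M))"

lemma chosen_ideal: "field_ideal chosen_ideal" "field_ideal M \<Longrightarrow> bad_ideal M \<Longrightarrow> bad_ideal chosen_ideal"
proof -
  have "\<exists>M :: int poly poly set. field_ideal M"
    using field_ideal_exists[of "{0 :: int poly poly}"] by (auto simp: is_ideal_def)
  hence "\<exists>M. field_ideal M \<and> ((\<exists>M'. field_ideal M' \<and> bad_ideal M') \<longrightarrow> bad_ideal M)" by blast
  from someI_ex[OF this] show "field_ideal chosen_ideal" "field_ideal M \<Longrightarrow> bad_ideal M \<Longrightarrow> bad_ideal chosen_ideal"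
    unfolding chosen_ideal_def by blast+
qed

lemma chosen_is_ideal: "is_ideal chosen_ideal" using chosen_ideal(1) by (simp add: field_ideal_def)

definition chosen_rel :: "int poly poly \<Rightarrow> int poly poly \<Rightarrow> bool" where "chosen_rel a b \<longleftrightarrow> a - b \<in> chosen_ideal"

lemma equivp_chosen_rel: "equivp chosen_rel"
proof (rule equivpI)
  show "reflp chosen_rel" by (rule reflpI) (simp add: chosen_rel_def is_ideal_zero[OF chosen_is_ideal])
  show "symp chosen_rel"
  proof (rule sympI)
    fix a b assume "chosen_rel a b"
    thus "chosen_rel b a" using is_ideal_uminus[OF chosen_is_ideal, of "a - b"] by (simp add: chosen_rel_def)
  qed
  show "transp chosen_rel"
  proof (rule transpI)
    fix a b c assume "chosen_rel a b" "chosen_rel b c"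
    thus "chosen_rel a c" using is_ideal_add[OF chosen_is_ideal, of "a - b" "b - c"] by (simp add: chosen_rel_def)
  qed
qed

quotient_type resfield = "int poly poly" / chosen_rel by (rule equivp_chosen_rel)

definition chosen_inv :: "int poly poly \<Rightarrow> int poly poly" where
  "chosen_inv a = (if a \<in> chosen_ideal then 0 else (SOME b. a * b - 1 \<in> chosen_ideal))"

lemma chosen_inv: "a \<notin> chosen_ideal \<Longrightarrow> a * chosen_inv a - 1 \<in> chosen_ideal"
  using chosen_ideal(1) someI_ex[of "\<lambda>b. a * b - 1 \<in> chosen_ideal"] by (simp add: field_ideal_def chosen_inv_def)

instantiation resfield :: field
begin

lift_definition zero_resfield :: resfield is 0 .
lift_definition one_resfield :: resfield is 1 .

lift_definition plus_resfield :: "resfield \<Rightarrow> resfield \<Rightarrow> resfield" is "(+)"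
proof -
  fix a b c d :: "int poly poly" assume "chosen_rel a b" "chosen_rel c d"
  thus "chosen_rel (a + c) (b + d)"
    using is_ideal_add[OF chosen_is_ideal, of "a - b" "c - d"] by (simp add: chosen_rel_def algebra_simps)
qed

lift_definition minus_resfield :: "resfield \<Rightarrow> resfield \<Rightarrow> resfield" is "(-)"
proof -
  fix a b c d :: "int poly poly" assume "chosen_rel a b" "chosen_rel c d"
  thus "chosen_rel (a - c) (b - d)"
    using is_ideal_diff[OF chosen_is_ideal, of "a - b" "c - d"] by (simp add: chosen_rel_def algebra_simps)
qed

lift_definition uminus_resfield :: "resfield \<Rightarrow> resfield" is "uminus"
proof -
  fix a b :: "int poly poly" assume "chosen_rel a b"
  thus "chosen_rel (- a) (- b)" using is_ideal_uminus[OF chosen_is_ideal, of "a - b"] by (simp add: chosen_rel_def)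
qed

lift_definition times_resfield :: "resfield \<Rightarrow> resfield \<Rightarrow> resfield" is "(*)"
proof -
  fix a b c d :: "int poly poly" assume "chosen_rel a b" "chosen_rel c d"
  hence "(a - b) * c + b * (c - d) \<in> chosen_ideal"
    by (intro is_ideal_add[OF chosen_is_ideal] is_ideal_multl[OF chosen_is_ideal] is_ideal_multr[OF chosen_is_ideal])
      (simp_all add: chosen_rel_def)
  thus "chosen_rel (a * c) (b * d)" by (simp add: chosen_rel_def algebra_simps)
qed

lift_definition inverse_resfield :: "resfield \<Rightarrow> resfield" is chosen_inv
proof -
  fix a b assume r: "chosen_rel a b"
  note I = chosen_is_ideal
  have ab: "a \<in> chosen_ideal \<longleftrightarrow> b \<in> chosen_ideal"
    using r is_ideal_add[OF I, of "a - b" b] is_ideal_diff[OF I, of a "a - b"] by (auto simp: chosen_rel_def)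
  show "chosen_rel (chosen_inv a) (chosen_inv b)"
  proof (cases "a \<in> chosen_ideal")
    case True
    thus ?thesis using ab is_ideal_zero[OF I] by (simp add: chosen_inv_def chosen_rel_def)
  next
    case False
    let ?x = "chosen_inv a" and ?y = "chosen_inv b"
    have x: "a * ?x - 1 \<in> chosen_ideal" and y: "b * ?y - 1 \<in> chosen_ideal" using chosen_inv False ab by auto
    have "?x - ?y = (a * ?x - 1) * ?y - (b * ?y - 1) * ?x - (a - b) * ?x * ?y" by (simp add: algebra_simps)
    also have "\<dots> \<in> chosen_ideal"
      by (rule is_ideal_diff[OF I is_ideal_diff[OF I is_ideal_multr[OF I x] is_ideal_multr[OF I y]]
        is_ideal_multr[OF I is_ideal_multr[OF I r[unfolded chosen_rel_def]]]])
    finally show ?thesis by (simp add: chosen_rel_def)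
  qed
qed

definition divide_resfield :: "resfield \<Rightarrow> resfield \<Rightarrow> resfield" where "divide_resfield a b = a * inverse b"

instance
proof
  fix a b c :: resfield
  have refl: "chosen_rel x x" for x using equivp_chosen_rel by (rule equivp_reflp)
  have eqI: "x = y \<Longrightarrow> chosen_rel x y" for x y using refl by simp
  show "a + b + c = a + (b + c)" by transfer (rule eqI, simp)
  show "a + b = b + a" by transfer (rule eqI, simp)
  show "0 + a = a" by transfer (rule eqI, simp)
  show "- a + a = 0" by transfer (rule eqI, simp)
  show "a - b = a + - b" by transfer (rule eqI, simp)
  show "a * b * c = a * (b * c)" by transfer (rule eqI, simp add: mult.assoc)
  show "a * b = b * a" by transfer (rule eqI, simp add: mult.commute)
  show "1 * a = a" by transfer (rule eqI, simp)
  show "(a + b) * c = a * c + b * c" by transfer (rule eqI, simp add: algebra_simps)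
  show "(0 :: resfield) \<noteq> 1"
  proof (transfer, simp add: chosen_rel_def)
    show "- 1 \<notin> chosen_ideal"
      using is_ideal_uminus[OF chosen_is_ideal, of "- 1"] chosen_ideal(1) by (auto simp: field_ideal_def)
  qed
  show "a \<noteq> 0 \<Longrightarrow> inverse a * a = 1"
    by transfer (use chosen_inv in \<open>simp add: chosen_rel_def mult.commute\<close>)
  show "a div b = a * inverse b" by (rule divide_resfield_def)
  show "inverse (0 :: resfield) = 0"
    by transfer (simp add: chosen_inv_def is_ideal_zero[OF chosen_is_ideal] refl)
qed

end

lemma abs_resfield_hom: "comm_ring_hom abs_resfield"
  by unfold_locales (simp_all add: plus_resfield.abs_eq times_resfield.abs_eq zero_resfield.abs_eq one_resfield.abs_eq)

lemma abs_resfield_0: "abs_resfield a = 0 \<longleftrightarrow> a \<in> chosen_ideal"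
  unfolding zero_resfield.abs_eq[symmetric]
  by (simp add: zero_resfield_def resfield.abs_eq_iff chosen_rel_def)

text \<open>A ring homomorphism on polynomials is evaluation at the images of the variables.\<close>

lemma hom_eq_eval:
  fixes h :: "int poly poly \<Rightarrow> 'k::comm_ring_1"
  assumes h: "comm_ring_hom h"
  shows "h g = poly (map_poly (\<lambda>q. poly (map_poly of_int q) (h [:[:0, 1:]:])) g) (h [:0, 1:])"
proof -
  interpret h: comm_ring_hom h by (rule h)
  define \<gamma> where "\<gamma> q = poly (map_poly of_int q) (h [:[:0, 1:]:])" for q :: "int poly"
  have c: "h [:q:] = \<gamma> q" for q
  proof (induction q)
    case 0
    show ?case by (simp add: \<gamma>_def)
  next
    case (pCons a q)
    have "[:pCons a q:] = of_int a + [:[:0, 1:]:] * [:q:]" by (simp add: of_int_poly)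
    hence "h [:pCons a q:] = of_int a + h [:[:0, 1:]:] * h [:q:]" by (simp only: h.hom_add h.hom_mult h.hom_of_int)
    thus ?case by (simp add: pCons.IH \<gamma>_def of_int_poly_pCons)
  qed
  have "h g = poly (map_poly \<gamma> g) (h [:0, 1:])"
  proof (induction g)
    case 0
    show ?case by simp
  next
    case (pCons q g)
    have "pCons q g = [:q:] + [:0, 1:] * g" by simp
    hence "h (pCons q g) = h [:q:] + h [:0, 1:] * h g" by (simp only: h.hom_add h.hom_mult)
    moreover have "map_poly \<gamma> (pCons q g) = pCons (\<gamma> q) (map_poly \<gamma> g)"
      by (rule poly_eqI) (simp add: coeff_map_poly \<gamma>_def coeff_pCons split: nat.split)
    ultimately show ?case by (simp add: pCons.IH c)
  qed
  thus ?thesis by (simp only: \<gamma>_def[abs_def])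
qed

lemma no_bad_ideal: "field_ideal M \<Longrightarrow> \<not> bad_ideal M"
proof
  assume "field_ideal M" "bad_ideal M"
  hence "bad_ideal chosen_ideal" by (rule chosen_ideal(2))
  then obtain m n p where mnp: "2 \<le> m" "1 \<le> n" "prime p" "\<not> p dvd int m" "of_int p \<in> chosen_ideal" "dynatomic m n \<in> chosen_ideal"
    and bad: "pderiv (dynatomic m n) \<in> chosen_ideal \<and> dc (dynatomic m n) \<in> chosen_ideal \<and> \<not> p dvd disc_delta m n \<or>
      (\<forall>i. coeff (unicritical.rP m n) i \<in> chosen_ideal \<and> coeff (unicritical.\<phi>P m n) i \<in> chosen_ideal) \<and> \<not> p dvd disc_Delta_prim m n"
    unfolding bad_ideal_def by blast
  interpret a: comm_ring_hom abs_resfield by (rule abs_resfield_hom)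
  interpret residue_point m p n "abs_resfield [:0, 1:]" "abs_resfield [:[:0, 1:]:]"
  proof
    show "of_int p = (0 :: resfield)" using mnp(5) by (simp only: a.hom_of_int[symmetric] abs_resfield_0)
  qed (use mnp in auto)
  have e: "ev g = abs_resfield g" for g
    unfolding ev_def hc_def[abs_def] \<kappa>_def using hom_eq_eval[OF abs_resfield_hom, of g] by (simp only:)
  have z: "ev g = 0 \<longleftrightarrow> g \<in> chosen_ideal" for g by (simp only: e abs_resfield_0)
  from bad show False
  proof
    assume "pderiv (dynatomic m n) \<in> chosen_ideal \<and> dc (dynatomic m n) \<in> chosen_ideal \<and> \<not> p dvd disc_delta m n"
    thus False using singular_point_dvd_disc_delta[unfolded z] mnp(6) by blast
  next
    assume "(\<forall>i. coeff (rP n) i \<in> chosen_ideal \<and> coeff (\<phi>P n) i \<in> chosen_ideal) \<and> \<not> p dvd disc_Delta_prim m n"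
    thus False using singular_point_dvd_disc_Delta_prim[unfolded z] mnp(6) by blast
  qed
qed

context unicritical begin

lemma is_ideal_plus_principal: "is_ideal J \<Longrightarrow> is_ideal {x. \<exists>u\<in>J. \<exists>b. x = u + b * s}" for s :: "'a::comm_ring_1"
  unfolding is_ideal_def
proof (intro conjI ballI allI, goal_cases)
  case 1 thus ?case by (auto intro!: bexI[of _ 0] exI[of _ 0])
next
  case (2 x y)
  then obtain u b v c where *: "u \<in> J" "x = u + b * s" "v \<in> J" "y = v + c * s" by blast
  hence "x + y = (u + v) + (b + c) * s" "u + v \<in> J" using 2 by (auto simp: algebra_simps)
  thus ?case by blast
next
  case (3 x r)
  then obtain u b where *: "u \<in> J" "x = u + b * s" by blast
  hence "r * x = r * u + (r * b) * s" "r * u \<in> J" using 3 by (auto simp: algebra_simps)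
  thus ?case by blast
qed

lemma Y1_partials_unit:
  assumes n: "n \<ge> 1" and p: "prime p" "\<not> p dvd int m" and D: "\<not> p dvd disc_delta m n"
  shows "\<exists>a b. pderiv (\<Phi> n) * a + dc (\<Phi> n) * b - 1 \<in> RI p n"
proof (rule ccontr)
  assume no: "\<not> ?thesis"
  note I = is_ideal_RI[of p n]
  define J where "J = {x. \<exists>u\<in>{x. \<exists>u\<in>RI p n. \<exists>b. x = u + b * pderiv (\<Phi> n)}. \<exists>b. x = u + b * dc (\<Phi> n)}"
  have J: "is_ideal J" unfolding J_def by (intro is_ideal_plus_principal I)
  have Jin: "u + a * pderiv (\<Phi> n) + b * dc (\<Phi> n) \<in> J" if "u \<in> RI p n" for u a b using that unfolding J_def by blast
  have "1 \<notin> J"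
  proof
    assume "1 \<in> J"
    then obtain u a b where u: "u \<in> RI p n" "1 = u + a * pderiv (\<Phi> n) + b * dc (\<Phi> n)" unfolding J_def by blast
    have "pderiv (\<Phi> n) * a + dc (\<Phi> n) * b - 1 = - u" by (subst u(2)) (simp add: algebra_simps)
    hence "pderiv (\<Phi> n) * a + dc (\<Phi> n) * b - 1 \<in> RI p n" using is_ideal_uminus[OF I u(1)] by simp
    thus False using no by blast
  qed
  then obtain M where M: "field_ideal M" "J \<subseteq> M" using field_ideal_exists[OF J] by blast
  have "of_int p \<in> J" using Jin[OF RI_q, of 0 0] by simp
  moreover have "\<Phi> n \<in> J" using Jin[OF RI_dvd[OF dvd_refl], of 0 0] by simp
  moreover have "pderiv (\<Phi> n) \<in> J" "dc (\<Phi> n) \<in> J" using Jin[OF is_ideal_zero[OF I], of 1 0] Jin[OF is_ideal_zero[OF I], of 0 1] by auto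
  ultimately have "bad_ideal M" unfolding bad_ideal_def using m2 n p D M(2)
    by (intro exI[of _ m] exI[of _ n] exI[of _ p]) auto
  thus False using no_bad_ideal[OF M(1)] by blast
qed

lemma Y0_weights_unit:
  assumes n: "n \<ge> 1" and p: "prime p" "\<not> p dvd int m" and D: "\<not> p dvd disc_Delta_prim m n"
  shows "\<exists>y z. (\<Sum>i<n. coeff (rP n) i * y i + coeff (\<phi>P n) i * z i) - 1 \<in> RI p n"
proof (rule ccontr)
  assume no: "\<not> ?thesis"
  note I = is_ideal_RI[of p n]
  let ?S = "\<lambda>y z. \<Sum>i<n. coeff (rP n) i * y i + coeff (\<phi>P n) i * z i"
  define J where "J = {x. \<exists>u y z. u \<in> RI p n \<and> x = u + ?S y z}"
  have Jin: "u + ?S y z \<in> J" if "u \<in> RI p n" for u y z using that by (auto simp: J_def)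
  have J: "is_ideal J"
    unfolding is_ideal_def
  proof (intro conjI ballI allI)
    show "0 \<in> J" using Jin[OF is_ideal_zero[OF I], of "\<lambda>_. 0" "\<lambda>_. 0"] by simp
    fix x assume "x \<in> J"
    then obtain u y z where x: "u \<in> RI p n" "x = u + ?S y z" by (auto simp: J_def)
    {
      fix x' assume "x' \<in> J"
      then obtain u' y' z' where x': "u' \<in> RI p n" "x' = u' + ?S y' z'" by (auto simp: J_def)
      have "?S y z + ?S y' z' = ?S (\<lambda>i. y i + y' i) (\<lambda>i. z i + z' i)"
        unfolding sum.distrib[symmetric] by (intro sum.cong[OF refl]) (simp add: algebra_simps)
      hence "x + x' = (u + u') + ?S (\<lambda>i. y i + y' i) (\<lambda>i. z i + z' i)" unfolding x(2) x'(2) by (simp only: ac_simps)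
      thus "x + x' \<in> J" using Jin[OF is_ideal_add[OF I x(1) x'(1)]] by simp
    }
    fix r
    have "r * ?S y z = ?S (\<lambda>i. r * y i) (\<lambda>i. r * z i)"
      unfolding sum_distrib_left by (intro sum.cong[OF refl]) (simp add: algebra_simps)
    hence "r * x = r * u + ?S (\<lambda>i. r * y i) (\<lambda>i. r * z i)" unfolding x(2) by (simp only: distrib_left)
    thus "r * x \<in> J" using Jin[OF is_ideal_multl[OF I x(1)]] by simp
  qed
  have "1 \<notin> J"
  proof
    assume "1 \<in> J"
    then obtain u y z where u: "u \<in> RI p n" "1 = u + ?S y z" by (auto simp: J_def)
    have "?S y z - 1 = ?S y z - (u + ?S y z)" by (rule arg_cong[OF u(2)])
    hence "?S y z - 1 = - u" by simp
    hence "?S y z - 1 \<in> RI p n" using is_ideal_uminus[OF I u(1)] by simp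
    thus False using no by blast
  qed
  then obtain M where M: "field_ideal M" "J \<subseteq> M" using field_ideal_exists[OF J] by blast
  have z0: "?S (\<lambda>_. 0) (\<lambda>_. 0) = 0" by simp
  have "of_int p \<in> J" using Jin[OF RI_q, of "\<lambda>_. 0" "\<lambda>_. 0"] by (simp only: z0 add_0_right)
  moreover have "\<Phi> n \<in> J" using Jin[OF RI_dvd[OF dvd_refl], of "\<lambda>_. 0" "\<lambda>_. 0"] by (simp only: z0 add_0_right)
  moreover have "coeff (rP n) i \<in> J \<and> coeff (\<phi>P n) i \<in> J" for i
  proof (cases "i < n")
    case True
    have mult_if: "x * (if j = i then 1 else 0) = (if j = i then x else 0)" for x :: "int poly poly" and j by simp
    have "?S (\<lambda>j. if j = i then 1 else 0) (\<lambda>_. 0) = coeff (rP n) i" "?S (\<lambda>_. 0) (\<lambda>j. if j = i then 1 else 0) = coeff (\<phi>P n) i"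
      by (simp_all only: mult_if mult_zero_right add_0_right add_0_left) (simp_all add: True)
    thus ?thesis using Jin[OF is_ideal_zero[OF I], of "\<lambda>j. if j = i then 1 else 0" "\<lambda>_. 0"]
      Jin[OF is_ideal_zero[OF I], of "\<lambda>_. 0" "\<lambda>j. if j = i then 1 else 0"] by (simp only: add_0_left simp_thms)
  next
    case False
    hence "coeff (rP n) i = 0" "coeff (\<phi>P n) i = 0"
      unfolding rP_def \<phi>P_def by (simp_all add: mdiv_mmod(2)[OF CP_monic] CP_degree)
    thus ?thesis using is_ideal_zero[OF J] by simp
  qed
  ultimately have "bad_ideal M" unfolding bad_ideal_def using m2 n p D M(2)
    by (intro exI[of _ m] exI[of _ n] exI[of _ p]) auto
  thus False using no_bad_ideal[OF M(1)] by blast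
qed

end

section \<open>Lifting homomorphisms over ideals of square zero\<close>

context unicritical begin

definition trace0 :: "nat \<Rightarrow> int poly poly \<Rightarrow> int poly poly" where
  "trace0 n g = coeff (mmod (CP n) (lift g)) 0"

lemma lift_diff_const_Inv:
  assumes ok: "ok q n" and a: "a \<in> Inv q n"
  shows "mmod (CP n) ((lift a - [:a:]) * G) \<in> poly_ideal (RI q n)"
proof (rule rem_CP_ideal[OF ok])
  have n: "n \<ge> 1" using ok by (simp add: ok_def)
  fix i assume "i < n"
  have "(pcompose a (F i) - a) * poly G (F i) \<in> RI q n" by (rule is_ideal_multr[OF is_ideal_RI Inv_F[OF n a]])
  thus "poly ((lift a - [:a:]) * G) (F i) \<in> RI q n" by (simp add: poly_lift)
qed

lemma trace0:
  assumes ok: "ok q n"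
  shows "trace0 n g \<in> Inv q n" "a \<in> Inv q n \<Longrightarrow> trace0 n (a * g) - a * trace0 n g \<in> RI q n"
    "trace0 n (g + h) = trace0 n g + trace0 n h" "trace0 n 1 = 1" "g \<in> RI q n \<Longrightarrow> trace0 n g \<in> RI q n"
proof -
  have n: "n \<ge> 1" using ok by (simp add: ok_def)
  have "mmod (CP n) (lift g) \<in> poly_subring (Inv q n)"
    by (intro mmod_subring subring_Inv CP_monic CP_Inv[OF n] lift_Inv const_Inv)
  thus "trace0 n g \<in> Inv q n" by (simp add: trace0_def poly_subring_def)
  show "trace0 n (g + h) = trace0 n g + trace0 n h" by (simp add: trace0_def lift_add mmod_add[OF CP_monic])
  have "lift (1 :: int poly poly) = 1"
    by (rule poly_eqI) (simp only: coeff_lift coeff_1, simp add: pCons_one)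
  moreover have "mmod (CP n) 1 = 1"
    by (rule mdiv_mmod_eqI(2)[OF CP_monic, where Q = 0]) (use n in \<open>simp_all add: CP_degree coeff_1\<close>)
  ultimately show "trace0 n 1 = 1" by (simp add: trace0_def)
  show "trace0 n g \<in> RI q n" if g: "g \<in> RI q n"
  proof -
    have "mmod (CP n) (lift g) \<in> poly_ideal (RI q n)"
      by (rule rem_CP_ideal[OF ok]) (simp add: poly_lift RI_shift[OF n g])
    thus ?thesis by (simp add: trace0_def poly_ideal_coeff)
  qed
  show "trace0 n (a * g) - a * trace0 n g \<in> RI q n" if a: "a \<in> Inv q n"
  proof -
    have "lift (a * g) = (lift a - [:a:]) * lift g + smult a (lift g)"
      unfolding lift_mult by (simp add: left_diff_distrib)
    hence "mmod (CP n) (lift (a * g)) = mmod (CP n) ((lift a - [:a:]) * lift g) + smult a (mmod (CP n) (lift g))"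
      by (simp only: mmod_add[OF CP_monic] mmod_smult[OF CP_monic])
    hence "trace0 n (a * g) - a * trace0 n g = coeff (mmod (CP n) ((lift a - [:a:]) * lift g)) 0"
      by (simp add: trace0_def)
    also have "\<dots> \<in> RI q n" by (rule poly_ideal_coeff[OF lift_diff_const_Inv[OF ok a]])
    finally show ?thesis .
  qed
qed

text \<open>The unit ideal is generated already by combinations with invariant coefficients: \<open>trace0\<close> is linear over the
  invariants and fixes \<open>1\<close>.\<close>

lemma Y0_weights_unit_Inv:
  assumes n: "n \<ge> 1" and p: "prime p" "\<not> p dvd int m" and D: "\<not> p dvd disc_Delta_prim m n"
  shows "\<exists>y z. (\<forall>i. y i \<in> Inv p n \<and> z i \<in> Inv p n) \<and>
    (\<Sum>i<n. coeff (rP n) i * y i + coeff (\<phi>P n) i * z i) - 1 \<in> RI p n"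
proof -
  note I = is_ideal_RI[of p n]
  have ok: "ok p n" by (rule ok_prime[OF n p])
  note t = trace0[OF ok]
  obtain y z where yz: "(\<Sum>i<n. coeff (rP n) i * y i + coeff (\<phi>P n) i * z i) - 1 \<in> RI p n"
    using Y0_weights_unit[OF n p D] by blast
  define f where "f i = coeff (rP n) i * y i + coeff (\<phi>P n) i * z i" for i
  define g where "g i = coeff (rP n) i * trace0 n (y i) + coeff (\<phi>P n) i * trace0 n (z i)" for i
  have t_sum: "trace0 n (\<Sum>i<k. f i) = (\<Sum>i<k. trace0 n (f i))" for k
  proof (induction k)
    case 0
    have "trace0 n 0 + trace0 n 0 = trace0 n 0" using t(3)[of 0 0] by simp
    thus ?case by simp
  qed (simp add: t(3))
  have inv: "coeff (rP n) i \<in> Inv p n" "coeff (\<phi>P n) i \<in> Inv p n" for i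
    using rP_Inv[OF n] phiP_Inv[OF n] by (auto simp: poly_subring_def)
  have "g i - trace0 n (f i) \<in> RI p n" for i
  proof -
    have "(- (trace0 n (coeff (rP n) i * y i) - coeff (rP n) i * trace0 n (y i))) +
        (- (trace0 n (coeff (\<phi>P n) i * z i) - coeff (\<phi>P n) i * trace0 n (z i))) \<in> RI p n"
      by (intro is_ideal_add[OF I] is_ideal_uminus[OF I] t(2) inv)
    thus ?thesis by (simp add: f_def g_def t(3) algebra_simps)
  qed
  hence "(\<Sum>i<n. g i - trace0 n (f i)) \<in> RI p n" by (intro is_ideal_sum[OF I])
  hence a: "(\<Sum>i<n. g i) - trace0 n (\<Sum>i<n. f i) \<in> RI p n" by (simp only: t_sum sum_subtractf)
  have "trace0 n ((\<Sum>i<n. f i) - 1) \<in> RI p n" using yz by (intro t(5)) (simp only: f_def)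
  moreover have "trace0 n ((\<Sum>i<n. f i) - 1) + 1 = trace0 n (\<Sum>i<n. f i)"
    using t(3)[of "(\<Sum>i<n. f i) - 1" 1] t(4) by simp
  ultimately have "trace0 n (\<Sum>i<n. f i) - 1 \<in> RI p n" by (metis add_diff_cancel_right')
  from is_ideal_add[OF I a this] have "(\<Sum>i<n. g i) - 1 \<in> RI p n" by simp
  thus ?thesis using t(1) unfolding g_def
    by (intro exI[of _ "\<lambda>i. trace0 n (y i)"] exI[of _ "\<lambda>i. trace0 n (z i)"]) blast
qed

end

lemma eval_hom: assumes "comm_ring_hom K" shows "comm_ring_hom (\<lambda>q. poly (K q) c)"
proof -
  interpret K: comm_ring_hom K by fact
  show ?thesis by unfold_locales (simp_all add: K.hom_add K.hom_mult)
qed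

lemma smult_conv: "smult c f = [:c:] * f" and const_prod: "[:c * d:] = [:c:] * [:d:]" and const_sum: "[:c + d:] = [:c:] + [:d:]"
  for c d :: "'a::comm_ring_1"
  by simp_all

lemma diff_telescope: "(x - y) + (y - z) = x - z" for x y z :: "'a::ab_group_add"
  by simp

text \<open>A homomorphism modulo \<open>J\<close> from the ring of functions \<open>U / (p, \<Phi>\<^sub>n)\<close> is to be lifted modulo \<open>N\<close>, where \<open>J\<^sup>2 \<subseteq> N\<close>.
  A map \<open>s\<close> of weight \<open>w\<close> in the sense of \<open>tw\<close> is \<open>w\<close> times such a lift up to first order; maps of this kind
  can be added and scaled, and one of weight \<open>1\<close> yields a lift.\<close>

locale square_zero = unicritical m for m :: nat +
  fixes p :: int and n :: nat and U :: "int poly poly set" and N J :: "'t::comm_ring_1 set" and \<phi> :: "int poly poly \<Rightarrow> 't"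
  assumes n1: "n \<ge> 1" and ok_p: "ok p n"
    and N: "is_ideal N" and J: "is_ideal J" and NJ: "N \<subseteq> J" and JJ: "x \<in> J \<Longrightarrow> y \<in> J \<Longrightarrow> x * y \<in> N" and pN: "of_int p \<in> N"
    and U: "subring_set U" and RI_U: "RI p n \<subseteq> U"
    and phi_add: "a \<in> U \<Longrightarrow> b \<in> U \<Longrightarrow> \<phi> (a + b) - (\<phi> a + \<phi> b) \<in> J"
    and phi_mult: "a \<in> U \<Longrightarrow> b \<in> U \<Longrightarrow> \<phi> (a * b) - \<phi> a * \<phi> b \<in> J"
    and phi_0: "\<phi> 0 = 0" and phi_1: "\<phi> 1 = 1" and phi_RI: "a \<in> RI p n \<Longrightarrow> \<phi> a \<in> J"
begin

definition tw :: "'t \<Rightarrow> (int poly poly \<Rightarrow> 't) \<Rightarrow> bool" where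
  "tw w s \<longleftrightarrow> (\<forall>a\<in>U. \<forall>b\<in>U. s (a + b) - s a - s b \<in> N) \<and> (\<forall>a\<in>U. s a - w * \<phi> a \<in> J) \<and>
    (\<forall>a\<in>U. \<forall>b\<in>U. s (a * b) - (\<phi> a * s b + \<phi> b * s a - \<phi> a * \<phi> b * s 1) \<in> N) \<and> (\<forall>a\<in>RI p n. s a \<in> N)"

lemma U_1: "1 \<in> U" using U by (simp add: subring_set_def)

lemma tw_zero: "tw 0 (\<lambda>a. 0)"
  using is_ideal_zero[OF N] is_ideal_zero[OF J] by (simp add: tw_def)

lemma tw_add: assumes "tw w s" "tw w' s'" shows "tw (w + w') (\<lambda>a. s a + s' a)"
  unfolding tw_def
proof (intro conjI ballI)
  fix a b assume ab: "a \<in> U" "b \<in> U"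
  have "(s (a + b) - s a - s b) + (s' (a + b) - s' a - s' b) \<in> N" using assms ab by (intro is_ideal_add[OF N]) (auto simp: tw_def)
  thus "s (a + b) + s' (a + b) - (s a + s' a) - (s b + s' b) \<in> N" by (simp add: algebra_simps)
  have "(s (a * b) - (\<phi> a * s b + \<phi> b * s a - \<phi> a * \<phi> b * s 1)) + (s' (a * b) - (\<phi> a * s' b + \<phi> b * s' a - \<phi> a * \<phi> b * s' 1)) \<in> N"
    using assms ab by (intro is_ideal_add[OF N]) (auto simp: tw_def)
  thus "s (a * b) + s' (a * b) - (\<phi> a * (s b + s' b) + \<phi> b * (s a + s' a) - \<phi> a * \<phi> b * (s 1 + s' 1)) \<in> N" by (simp add: algebra_simps)
next
  fix a assume a: "a \<in> U"
  have "(s a - w * \<phi> a) + (s' a - w' * \<phi> a) \<in> J" using assms a by (intro is_ideal_add[OF J]) (auto simp: tw_def)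
  thus "s a + s' a - (w + w') * \<phi> a \<in> J" by (simp add: algebra_simps)
next
  fix a assume a: "a \<in> RI p n"
  show "s a + s' a \<in> N" using assms a by (intro is_ideal_add[OF N]) (auto simp: tw_def)
qed

lemma tw_scale: assumes "tw w s" shows "tw (y * w) (\<lambda>a. y * s a)"
  unfolding tw_def
proof (intro conjI ballI)
  fix a b assume ab: "a \<in> U" "b \<in> U"
  have "y * (s (a + b) - s a - s b) \<in> N" using assms ab by (intro is_ideal_multl[OF N]) (auto simp: tw_def)
  thus "y * s (a + b) - y * s a - y * s b \<in> N" by (simp add: algebra_simps)
  have "y * (s (a * b) - (\<phi> a * s b + \<phi> b * s a - \<phi> a * \<phi> b * s 1)) \<in> N"
    using assms ab by (intro is_ideal_multl[OF N]) (auto simp: tw_def)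
  thus "y * s (a * b) - (\<phi> a * (y * s b) + \<phi> b * (y * s a) - \<phi> a * \<phi> b * (y * s 1)) \<in> N" by (simp add: algebra_simps)
next
  fix a assume a: "a \<in> U"
  have "y * (s a - w * \<phi> a) \<in> J" using assms a by (intro is_ideal_multl[OF J]) (auto simp: tw_def)
  thus "y * s a - (y * w) * \<phi> a \<in> J" by (simp add: algebra_simps)
next
  fix a assume a: "a \<in> RI p n"
  show "y * s a \<in> N" using assms a by (intro is_ideal_multl[OF N]) (auto simp: tw_def)
qed

lemma tw_sum: "(\<And>i. tw (w i) (s i)) \<Longrightarrow> tw (\<Sum>i<k. w i) (\<lambda>a. \<Sum>i<k. s i a)" for k :: nat
proof (induction k)
  case (Suc k)
  thus ?case using tw_add[of "\<Sum>i<k. w i" "\<lambda>a. \<Sum>i<k. s i a" "w k" "s k"] by simp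
qed (simp add: tw_zero)

definition lifts :: "(int poly poly \<Rightarrow> 't) \<Rightarrow> bool" where
  "lifts \<psi> \<longleftrightarrow> (\<forall>a\<in>U. \<forall>b\<in>U. \<psi> (a + b) - (\<psi> a + \<psi> b) \<in> N) \<and> (\<forall>a\<in>U. \<forall>b\<in>U. \<psi> (a * b) - \<psi> a * \<psi> b \<in> N) \<and>
    \<psi> 1 - 1 \<in> N \<and> (\<forall>a\<in>RI p n. \<psi> a \<in> N) \<and> (\<forall>a\<in>U. \<psi> a - \<phi> a \<in> J)"

lemma tw_lift:
  assumes s: "tw w s" and w: "w - 1 \<in> J"
  shows "lifts (\<lambda>a. (2 - s 1) * s a)"
  unfolding lifts_def
proof (intro conjI ballI)
  define \<beta> where "\<beta> = 1 - s 1"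
  have s1: "s 1 = 1 - \<beta>" by (simp add: \<beta>_def)
  have sJ: "s a - w * \<phi> a \<in> J" if "a \<in> U" for a using s that by (simp add: tw_def)
  have "- (s 1 - w * \<phi> 1) - (w - 1) \<in> J" by (intro is_ideal_diff[OF J] is_ideal_uminus[OF J] sJ U_1 w)
  hence \<beta>: "\<beta> \<in> J" by (simp add: phi_1 \<beta>_def)
  have ex: "s a - \<phi> a \<in> J" if a: "a \<in> U" for a
  proof -
    have "(s a - w * \<phi> a) + (w - 1) * \<phi> a \<in> J" by (intro is_ideal_add[OF J] sJ a is_ideal_multr[OF J] w)
    thus ?thesis by (simp add: algebra_simps)
  qed
  show "(2 - s 1) * s a - \<phi> a \<in> J" if a: "a \<in> U" for a
  proof -
    have "(s a - \<phi> a) + \<beta> * s a \<in> J" by (intro is_ideal_add[OF J] ex a is_ideal_multr[OF J] \<beta>)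
    thus ?thesis by (simp add: s1 algebra_simps)
  qed
  have "- (\<beta> * \<beta>) \<in> N" by (intro is_ideal_uminus[OF N] JJ \<beta>)
  thus "(2 - s 1) * s 1 - 1 \<in> N" by (simp add: s1 algebra_simps)
  show "(2 - s 1) * s a \<in> N" if "a \<in> RI p n" for a using s that by (intro is_ideal_multl[OF N]) (auto simp: tw_def)
  fix a b assume ab: "a \<in> U" "b \<in> U"
  have "(2 - s 1) * (s (a + b) - s a - s b) \<in> N" using s ab by (intro is_ideal_multl[OF N]) (auto simp: tw_def)
  thus "(2 - s 1) * s (a + b) - ((2 - s 1) * s a + (2 - s 1) * s b) \<in> N" by (simp add: algebra_simps)
  define x where "x = s a - \<phi> a"
  define y where "y = s b - \<phi> b"
  have xy: "x \<in> J" "y \<in> J" using ex ab by (auto simp: x_def y_def)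
  have sab: "s a = \<phi> a + x" "s b = \<phi> b + y" by (simp_all add: x_def y_def)
  define E where "E = s (a * b) - (\<phi> a * s b + \<phi> b * s a - \<phi> a * \<phi> b * s 1)"
  have E: "E \<in> N" using s ab by (auto simp: tw_def E_def)
  have sm: "s (a * b) = E + (\<phi> a * s b + \<phi> b * s a - \<phi> a * \<phi> b * s 1)" by (simp add: E_def)
  have "(2 - s 1) * s (a * b) - ((2 - s 1) * s a) * ((2 - s 1) * s b) =
      (2 - s 1) * E + (2 - s 1) * - (x * y + (\<beta> * y) * \<phi> a + (\<beta> * x) * \<phi> b + (\<beta> * x) * y)"
    unfolding sm s1 sab by (simp add: algebra_simps)
  also have "\<dots> \<in> N"
    by (intro is_ideal_add[OF N] is_ideal_multl[OF N E] is_ideal_multl[OF N] is_ideal_uminus[OF N] JJ xy \<beta>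
      is_ideal_multr[OF N JJ[OF \<beta> xy(2)]] is_ideal_multr[OF N JJ[OF \<beta> xy(1)]])
  finally show "(2 - s 1) * s (a * b) - ((2 - s 1) * s a) * ((2 - s 1) * s b) \<in> N" .
qed

lemma RI_decomp: "a \<in> RI p n \<Longrightarrow> \<exists>b d. a = \<Phi> n * b + of_int p * d"
proof -
  assume "a \<in> RI p n"
  then obtain d where "\<Phi> n dvd a - d * of_int p" by (auto simp: RI_def)
  then obtain b where "a - d * of_int p = \<Phi> n * b" by (rule dvdE)
  hence "a = \<Phi> n * b + of_int p * d" by (simp add: algebra_simps)
  thus ?thesis by blast
qed

text \<open>Every derivation \<open>D\<close> of \<open>\<int>[x,c]\<close> gives a map of weight \<open>D \<Phi>\<^sub>n\<close>.\<close>

lemma tw_derivation: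
  assumes e: "comm_ring_hom \<phi>"
    and D: "\<And>a b. D (a + b) = D a + D b" "\<And>a b. D (a * b) = D a * b + a * D b" "D (of_int p) = 0"
  shows "tw (\<phi> (D (\<Phi> n))) (\<lambda>a. \<phi> (D (\<Phi> n) * a - D a * \<Phi> n))"
proof -
  interpret e: comm_ring_hom \<phi> by (rule e)
  have D1: "D 1 = 0" using D(2)[of 1 1] by simp
  have j: "\<phi> (\<Phi> n) \<in> J" by (rule phi_RI) (rule RI_dvd, simp)
  show ?thesis
    unfolding tw_def
  proof (intro conjI ballI)
    fix a b
    have "\<phi> (D (\<Phi> n) * (a + b) - D (a + b) * \<Phi> n) - \<phi> (D (\<Phi> n) * a - D a * \<Phi> n) - \<phi> (D (\<Phi> n) * b - D b * \<Phi> n) = 0"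
      unfolding e.hom_minus[symmetric] D(1) by (simp add: algebra_simps)
    thus "\<phi> (D (\<Phi> n) * (a + b) - D (a + b) * \<Phi> n) - \<phi> (D (\<Phi> n) * a - D a * \<Phi> n) - \<phi> (D (\<Phi> n) * b - D b * \<Phi> n) \<in> N"
      using is_ideal_zero[OF N] by simp
    have "\<phi> (D (\<Phi> n) * (a * b) - D (a * b) * \<Phi> n) - (\<phi> a * \<phi> (D (\<Phi> n) * b - D b * \<Phi> n) + \<phi> b * \<phi> (D (\<Phi> n) * a - D a * \<Phi> n) -
      \<phi> a * \<phi> b * \<phi> (D (\<Phi> n) * 1 - D 1 * \<Phi> n)) = 0"
      by (simp add: D D1 e.hom_minus e.hom_mult e.hom_add algebra_simps)
    thus "\<phi> (D (\<Phi> n) * (a * b) - D (a * b) * \<Phi> n) - (\<phi> a * \<phi> (D (\<Phi> n) * b - D b * \<Phi> n) + \<phi> b * \<phi> (D (\<Phi> n) * a - D a * \<Phi> n) -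
      \<phi> a * \<phi> b * \<phi> (D (\<Phi> n) * 1 - D 1 * \<Phi> n)) \<in> N" using is_ideal_zero[OF N] by simp
  next
    fix a
    have "\<phi> (D (\<Phi> n) * a - D a * \<Phi> n) - \<phi> (D (\<Phi> n)) * \<phi> a = - (\<phi> (D a) * \<phi> (\<Phi> n))"
      by (simp add: e.hom_minus e.hom_mult)
    thus "\<phi> (D (\<Phi> n) * a - D a * \<Phi> n) - \<phi> (D (\<Phi> n)) * \<phi> a \<in> J"
      using is_ideal_uminus[OF J is_ideal_multl[OF J j]] by simp
  next
    fix a assume "a \<in> RI p n"
    then obtain b d where a: "a = \<Phi> n * b + of_int p * d" using RI_decomp by blast
    have "D (\<Phi> n) * a - D a * \<Phi> n = of_int p * (D (\<Phi> n) * d - D d * \<Phi> n) - \<Phi> n * \<Phi> n * D b"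
      unfolding a D by (simp add: algebra_simps)
    hence "\<phi> (D (\<Phi> n) * a - D a * \<Phi> n) = of_int p * \<phi> (D (\<Phi> n) * d - D d * \<Phi> n) - \<phi> (\<Phi> n) * \<phi> (\<Phi> n) * \<phi> (D b)"
      by (simp only: e.hom_minus e.hom_mult e.hom_of_int)
    also have "\<dots> \<in> N" by (rule is_ideal_diff[OF N is_ideal_multr[OF N pN] is_ideal_multr[OF N JJ[OF j j]]])
    finally show "\<phi> (D (\<Phi> n) * a - D a * \<Phi> n) \<in> N" .
  qed
qed

lemma Y1_lift:
  assumes e: "comm_ring_hom \<phi>" and UU: "U = UNIV"
    and unit: "pderiv (\<Phi> n) * y + dc (\<Phi> n) * z - 1 \<in> RI p n"
  shows "\<exists>\<psi>. lifts \<psi>"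
proof -
  interpret e: comm_ring_hom \<phi> by (rule e)
  have oi: "(of_int p :: int poly poly) = [:[:p:]:]" by (simp add: of_int_poly)
  have t1: "tw (\<phi> (pderiv (\<Phi> n))) (\<lambda>a. \<phi> (pderiv (\<Phi> n) * a - pderiv a * \<Phi> n))"
    by (rule tw_derivation[OF e]) (simp_all add: pderiv_add pderiv_mult oi pderiv_pCons mult.commute add.commute)
  have t2: "tw (\<phi> (dc (\<Phi> n))) (\<lambda>a. \<phi> (dc (\<Phi> n) * a - dc a * \<Phi> n))"
    by (rule tw_derivation[OF e]) (simp_all add: dc_add dc_mult oi dc_const pderiv_pCons)
  note t = tw_add[OF tw_scale[OF t1, of "\<phi> y"] tw_scale[OF t2, of "\<phi> z"]]
  have "\<phi> y * \<phi> (pderiv (\<Phi> n)) + \<phi> z * \<phi> (dc (\<Phi> n)) - 1 = \<phi> (pderiv (\<Phi> n) * y + dc (\<Phi> n) * z - 1)"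
    by (simp add: e.hom_add e.hom_mult e.hom_minus mult.commute)
  also have "\<dots> \<in> J" by (rule phi_RI[OF unit])
  finally show ?thesis using tw_lift[OF t] by blast
qed

end

locale square_zero_inv = square_zero m p n U N J \<phi> for m :: nat and p :: int and n :: nat and U :: "int poly poly set"
    and N J :: "'t::comm_ring_1 set" and \<phi> :: "int poly poly \<Rightarrow> 't" +
  assumes U_Inv: "U = Inv p n"
begin

lemmas RI_Inv0 = RI_U[unfolded U_Inv]
lemmas phi_add_Inv = phi_add[unfolded U_Inv]
lemmas phi_mult_Inv = phi_mult[unfolded U_Inv]
lemmas Inv_1 = U_1[unfolded U_Inv]

abbreviation "UY \<equiv> poly_subring (Inv p n)"
abbreviation "IY \<equiv> poly_ideal (RI p n)"
abbreviation "JX \<equiv> poly_ideal J"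
abbreviation "NX \<equiv> poly_ideal N"

lemmas UY = subring_set_poly_subring[OF subring_Inv]
lemmas JX = is_ideal_poly_ideal[OF J]
lemmas NX = is_ideal_poly_ideal[OF N]
lemmas IY = is_ideal_poly_ideal[OF is_ideal_RI[of p n]]

lemma JXJX: assumes "f \<in> JX" "g \<in> JX" shows "f * g \<in> NX"
  using assms unfolding poly_ideal_def by (auto simp: coeff_mult intro!: is_ideal_sum[OF N] JJ)

lemma U_closed: "a \<in> Inv p n \<Longrightarrow> b \<in> Inv p n \<Longrightarrow> a + b \<in> Inv p n \<and> a - b \<in> Inv p n \<and> a * b \<in> Inv p n" "0 \<in> Inv p n"
  using subring_Inv[of p n] by (auto simp: subring_set_def)

lemma UY_closed: "f \<in> UY \<Longrightarrow> g \<in> UY \<Longrightarrow> f + g \<in> UY \<and> f - g \<in> UY \<and> f * g \<in> UY"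
  using UY by (auto simp: subring_set_def)

lemma phi_sum: "(\<And>i. f i \<in> Inv p n) \<Longrightarrow> \<phi> (\<Sum>i<k. f i) - (\<Sum>i<k. \<phi> (f i)) \<in> J" for k :: nat
proof (induction k)
  case 0
  show ?case using is_ideal_zero[OF J] by (simp add: phi_0)
next
  case (Suc k)
  have "\<phi> ((\<Sum>i<k. f i) + f k) - (\<phi> (\<Sum>i<k. f i) + \<phi> (f k)) \<in> J"
    by (intro phi_add_Inv subring_set_sum[OF subring_Inv] Suc.prems)
  from is_ideal_add[OF J this Suc.IH[OF Suc.prems]] show ?case by (simp add: algebra_simps)
qed

definition \<gamma> :: "int poly \<Rightarrow> 't" where "\<gamma> q = poly (map_poly of_int q) (\<phi> [:[:0, 1:]:])"
definition \<alpha> :: "int poly poly \<Rightarrow> 't poly" where "\<alpha> = map_poly \<gamma>"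
definition st :: "int poly poly poly \<Rightarrow> 't poly" where "st = map_poly \<phi>"

lemma gamma_hom: "comm_ring_hom \<gamma>"
proof -
  have "comm_ring_hom (of_int :: int \<Rightarrow> 't)" by unfold_locales simp_all
  from eval_hom[OF comm_ring_hom_map_poly[OF this]] show ?thesis unfolding \<gamma>_def[abs_def] .
qed

sublocale \<alpha>: comm_ring_hom \<alpha> unfolding \<alpha>_def by (rule comm_ring_hom_map_poly[OF gamma_hom])

lemma coeff_st: "coeff (st G) i = \<phi> (coeff G i)" by (simp add: st_def coeff_map_poly phi_0)

lemma coeff_alpha: "coeff (\<alpha> a) i = \<gamma> (coeff a i)"
  unfolding \<alpha>_def by (rule coeff_map_poly) (simp add: \<gamma>_def)

lemma phi_of_nat: "\<phi> (of_nat k) - of_nat k \<in> J \<and> of_nat k \<in> Inv p n"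
proof (induction k)
  case 0
  show ?case using is_ideal_zero[OF J] U_closed(2) by (simp add: phi_0)
next
  case (Suc k)
  have "(\<phi> (of_nat k + 1) - (\<phi> (of_nat k) + \<phi> 1)) + (\<phi> (of_nat k) - of_nat k) \<in> J"
    using Suc Inv_1 by (intro is_ideal_add[OF J] phi_add_Inv) auto
  thus ?case using Suc Inv_1 U_closed(1)[of "of_nat k" 1] by (simp add: phi_1 algebra_simps)
qed

lemma phi_of_int: "\<phi> (of_int z) - of_int z \<in> J"
proof (cases z rule: int_cases2)
  case (nonneg k)
  thus ?thesis using phi_of_nat[of k] by simp
next
  case (nonpos k)
  have "- of_nat k = (0 :: int poly poly) - of_nat k" by simp
  hence m: "- of_nat k \<in> Inv p n" using U_closed(1)[OF U_closed(2), of "of_nat k"] phi_of_nat[of k] by simp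
  have "\<phi> (- of_nat k + of_nat k) - (\<phi> (- of_nat k) + \<phi> (of_nat k)) \<in> J"
    using m phi_of_nat[of k] by (intro phi_add_Inv) auto
  hence "- (\<phi> (- of_nat k + of_nat k) - (\<phi> (- of_nat k) + \<phi> (of_nat k))) - (\<phi> (of_nat k) - of_nat k) \<in> J"
    using phi_of_nat[of k] is_ideal_diff[OF J is_ideal_uminus[OF J]] by blast
  thus ?thesis using nonpos by (simp add: phi_0)
qed

lemma phi_const: "\<phi> [:q:] - \<gamma> q \<in> J"
proof (induction q)
  case 0
  show ?case using is_ideal_zero[OF J] by (simp add: phi_0 \<gamma>_def)
next
  case (pCons a q)
  let ?c = "[:[:0, 1:]:] :: int poly poly"
  have e: "[:pCons a q:] = of_int a + ?c * [:q:]" by (simp add: of_int_poly)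
  have oi: "of_int a \<in> Inv p n" using const_Inv[of "[:a:]"] by (simp add: of_int_poly)
  have cq: "?c * [:q:] \<in> Inv p n" using U_closed(1)[OF const_Inv const_Inv, of "[:0, 1:]" q] by blast
  have g: "\<gamma> (pCons a q) = of_int a + \<phi> ?c * \<gamma> q" by (simp add: \<gamma>_def of_int_poly_pCons)
  have "(\<phi> (of_int a + ?c * [:q:]) - (\<phi> (of_int a) + \<phi> (?c * [:q:]))) + (\<phi> (of_int a) - of_int a) +
      (\<phi> (?c * [:q:]) - \<phi> ?c * \<phi> [:q:]) + \<phi> ?c * (\<phi> [:q:] - \<gamma> q) \<in> J"
    by (intro is_ideal_add[OF J] phi_add_Inv phi_mult_Inv phi_of_int oi cq const_Inv is_ideal_multl[OF J pCons.IH])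
  thus ?case unfolding e g by (simp add: algebra_simps)
qed

lemma st_lift: "st (lift a) - \<alpha> a \<in> JX"
  unfolding poly_ideal_def by (simp add: coeff_st coeff_alpha phi_const)

lemma st_add: "f \<in> UY \<Longrightarrow> g \<in> UY \<Longrightarrow> st (f + g) - (st f + st g) \<in> JX"
  unfolding poly_ideal_def poly_subring_def by (simp add: coeff_st phi_add_Inv)

lemma st_mult: assumes "f \<in> UY" "g \<in> UY" shows "st (f * g) - st f * st g \<in> JX"
  unfolding poly_ideal_def
proof (intro CollectI allI)
  fix i
  have fg: "coeff f k \<in> Inv p n" "coeff g k \<in> Inv p n" for k using assms by (auto simp: poly_subring_def)
  define t where "t k = coeff f k * coeff g (i - k)" for k
  have t: "t k \<in> Inv p n" for k unfolding t_def using U_closed(1) fg by blast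
  have "(\<phi> (\<Sum>k<Suc i. t k) - (\<Sum>k<Suc i. \<phi> (t k))) + (\<Sum>k<Suc i. \<phi> (t k) - \<phi> (coeff f k) * \<phi> (coeff g (i - k))) \<in> J"
    unfolding t_def by (intro is_ideal_add[OF J] phi_sum is_ideal_sum[OF J] phi_mult_Inv fg) (use t t_def in simp)
  hence "\<phi> (\<Sum>k<Suc i. t k) - (\<Sum>k<Suc i. \<phi> (coeff f k) * \<phi> (coeff g (i - k))) \<in> J"
    by (simp only: sum_subtractf diff_telescope)
  thus "coeff (st (f * g) - st f * st g) i \<in> J"
    by (simp only: coeff_diff coeff_st coeff_mult lessThan_Suc_atMost t_def)
qed

lemma IY_UY: "f \<in> IY \<Longrightarrow> f \<in> UY" using RI_Inv0 by (auto simp: poly_ideal_def poly_subring_def)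

lemma st_IY: "f \<in> IY \<Longrightarrow> st f \<in> JX" unfolding poly_ideal_def by (simp add: coeff_st phi_RI)

lemma st_cong: assumes "f \<in> UY" "g \<in> UY" "f - g \<in> IY" shows "st f - st g \<in> JX"
proof -
  have "(st (g + (f - g)) - (st g + st (f - g))) + st (f - g) \<in> JX"
    by (rule is_ideal_add[OF JX st_add[OF assms(2) IY_UY[OF assms(3)]] st_IY[OF assms(3)]])
  thus ?thesis by (simp add: algebra_simps)
qed

definition P where "P = st (CP n)"
definition Q where "Q = st (QP n)"
definition j where "j = \<alpha> (\<Phi> n) - P * Q"
definition H :: "int poly poly \<Rightarrow> int poly poly poly" where "H a = mdiv (CP n) (lift a - [:a:])"

lemma P_monic: "degree P = n" "lead_coeff P = 1"
proof -
  have c: "coeff P n = 1" using CP_monic[of n] by (simp add: P_def coeff_st CP_degree phi_1)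
  have "degree P \<le> n" by (rule degree_le) (simp add: P_def coeff_st coeff_eq_0 CP_degree phi_0)
  moreover have "n \<le> degree P" by (rule le_degree) (simp add: c)
  ultimately show "degree P = n" by simp
  thus "lead_coeff P = 1" using c by simp
qed

lemmas CPU = CP_Inv[OF n1, of p]
lemmas QPU = QP_Inv[OF n1, of p]

lemma lift_UY: "lift a \<in> UY" by (rule lift_Inv) (rule const_Inv)

lemma const_UY: "a \<in> Inv p n \<Longrightarrow> [:a:] \<in> UY"
  using U_closed(2) by (auto simp: poly_subring_def coeff_pCons split: nat.split)

lemma st_const: "st [:a:] = [:\<phi> a:]" by (rule poly_eqI) (simp add: coeff_st coeff_pCons phi_0 split: nat.split)

lemma j_JX: "j \<in> JX"
proof -
  have d: "lift (\<Phi> n) - CP n * QP n \<in> IY" by (rule dynatomic_factor[OF ok_p])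
  have CQ: "CP n * QP n \<in> UY" using UY_closed CPU QPU by blast
  have "(st (lift (\<Phi> n)) - st (CP n * QP n)) - (st (lift (\<Phi> n)) - \<alpha> (\<Phi> n)) + (st (CP n * QP n) - st (CP n) * st (QP n)) \<in> JX"
    by (rule is_ideal_add[OF JX is_ideal_diff[OF JX st_cong[OF lift_UY CQ d] st_lift] st_mult[OF CPU QPU]])
  thus ?thesis by (simp add: j_def P_def Q_def algebra_simps)
qed

lemma H_UY: "a \<in> Inv p n \<Longrightarrow> H a \<in> UY"
  unfolding H_def using UY_closed[OF lift_UY const_UY] by (intro mmod_subring subring_Inv CP_monic CPU) blast

lemma H_eq: assumes a: "a \<in> Inv p n" shows "lift a - [:a:] - CP n * H a \<in> IY"
proof -
  have "mmod (CP n) (lift a - [:a:]) \<in> IY" using lift_diff_const_Inv[OF ok_p a, of 1] by simp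
  moreover have "lift a - [:a:] - CP n * H a = mmod (CP n) (lift a - [:a:])"
    unfolding H_def using mdiv_mmod(1)[OF CP_monic, of "lift a - [:a:]" n] by (simp only: diff_eq_eq add.commute)
  ultimately show ?thesis by simp
qed

lemma H_eqI:
  assumes a: "a \<in> Inv p n" and G: "G \<in> UY" and e: "lift a - [:a:] - CP n * G \<in> IY"
  shows "st (H a) - st G \<in> JX"
proof (rule st_cong[OF H_UY[OF a] G])
  have "(lift a - [:a:] - CP n * G) - (lift a - [:a:] - CP n * H a) \<in> IY" by (intro is_ideal_diff[OF IY] e H_eq a)
  hence "CP n * (H a - G) \<in> IY" by (simp add: algebra_simps)
  thus "H a - G \<in> IY" by (rule monic_mult_poly_ideal[OF is_ideal_RI CP_monic])
qed

text \<open>The value of \<open>a\<close> at the generic point of the cycle differs from \<open>a\<close> by a multiple of \<open>P\<close>.\<close>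

lemma alpha_decomp: assumes a: "a \<in> Inv p n" shows "\<alpha> a - [:\<phi> a:] - P * st (H a) \<in> JX"
proof -
  let ?G = "[:a:] + CP n * H a"
  have CH: "CP n * H a \<in> UY" using UY_closed CPU H_UY[OF a] by blast
  have "lift a - ?G \<in> IY" using H_eq[OF a] by (simp add: algebra_simps)
  hence c: "st (lift a) - st ?G \<in> JX" using UY_closed[OF const_UY[OF a] CH] st_cong[OF lift_UY] by blast
  have "(st (lift a) - st ?G) - (st (lift a) - \<alpha> a) + (st ?G - (st [:a:] + st (CP n * H a))) + (st (CP n * H a) - st (CP n) * st (H a)) \<in> JX"
    by (rule is_ideal_add[OF JX is_ideal_add[OF JX is_ideal_diff[OF JX c st_lift] st_add[OF const_UY[OF a] CH]]
      st_mult[OF CPU H_UY[OF a]]])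
  thus ?thesis by (simp add: st_const P_def algebra_simps)
qed

definition modP :: "'t set \<Rightarrow> 't poly set" where "modP K = {f. \<exists>h. f - P * h \<in> poly_ideal K}"

lemma modP_mmod: assumes K: "is_ideal K" and f: "f \<in> modP K" shows "coeff (mmod P f) i \<in> K"
proof -
  obtain h where h: "f - P * h \<in> poly_ideal K" using f by (auto simp: modP_def)
  have "mmod P (f - P * h) \<in> poly_ideal K" by (rule mmod_ideal[OF K P_monic(2) h])
  moreover have "mmod P (f - P * h) = mmod P f" by (simp add: mmod_diff[OF P_monic(2)] mmod_multiple[OF P_monic(2)])
  ultimately show ?thesis by (simp add: poly_ideal_coeff)
qed

lemma tw_coeff:
  assumes 1: "\<And>a b. a \<in> Inv p n \<Longrightarrow> b \<in> Inv p n \<Longrightarrow> S (a + b) - S a - S b \<in> modP N"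
    and 2: "\<And>a. a \<in> Inv p n \<Longrightarrow> S a - smult (\<phi> a) W \<in> modP J"
    and 3: "\<And>a b. a \<in> Inv p n \<Longrightarrow> b \<in> Inv p n \<Longrightarrow>
      S (a * b) - (smult (\<phi> a) (S b) + smult (\<phi> b) (S a) - smult (\<phi> a * \<phi> b) (S 1)) \<in> modP N"
    and 4: "\<And>a. a \<in> RI p n \<Longrightarrow> S a \<in> modP N"
  shows "tw (coeff (mmod P W) i) (\<lambda>a. coeff (mmod P (S a)) i)"
proof -
  note mm = mmod_diff[OF P_monic(2)] mmod_add[OF P_monic(2)] mmod_smult[OF P_monic(2)] coeff_diff coeff_add coeff_smult
  show ?thesis
    unfolding tw_def unfolding U_Inv
  proof (intro conjI ballI)
    fix a b assume ab: "a \<in> Inv p n" "b \<in> Inv p n"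
    show "coeff (mmod P (S (a + b))) i - coeff (mmod P (S a)) i - coeff (mmod P (S b)) i \<in> N"
      using modP_mmod[OF N 1[OF ab], of i] by (simp only: mm)
    show "coeff (mmod P (S (a * b))) i - (\<phi> a * coeff (mmod P (S b)) i + \<phi> b * coeff (mmod P (S a)) i -
        \<phi> a * \<phi> b * coeff (mmod P (S 1)) i) \<in> N"
      using modP_mmod[OF N 3[OF ab], of i] by (simp only: mm)
  next
    fix a assume a: "a \<in> Inv p n"
    have "coeff (mmod P (S a)) i - \<phi> a * coeff (mmod P W) i \<in> J" using modP_mmod[OF J 2[OF a], of i] by (simp only: mm)
    thus "coeff (mmod P (S a)) i - coeff (mmod P W) i * \<phi> a \<in> J" by (simp only: mult.commute)
  next
    fix a assume a: "a \<in> RI p n"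
    show "coeff (mmod P (S a)) i \<in> N" by (rule modP_mmod[OF N 4[OF a]])
  qed
qed

lemma tw_cycle: "tw (coeff (mmod P Q) i) (\<lambda>a. coeff (mmod P (Q * \<alpha> a - st (H a) * j)) i)"
proof (rule tw_coeff)
  fix a b assume ab: "a \<in> Inv p n" "b \<in> Inv p n"
  have ab': "a + b \<in> Inv p n" "a * b \<in> Inv p n" using U_closed(1)[OF ab] by auto
  note HU = H_UY[OF ab(1)] H_UY[OF ab(2)]
  have Hsum: "H a + H b \<in> UY" using UY_closed HU by blast
  have "(lift a - [:a:] - CP n * H a) + (lift b - [:b:] - CP n * H b) \<in> IY" by (intro is_ideal_add[OF IY] H_eq ab)
  moreover have "(lift a - [:a:] - CP n * H a) + (lift b - [:b:] - CP n * H b) = lift (a + b) - [:a + b:] - CP n * (H a + H b)"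
    unfolding lift_add const_sum by (simp only: algebra_simps)
  ultimately have "lift (a + b) - [:a + b:] - CP n * (H a + H b) \<in> IY" by (simp only:)
  hence h: "st (H (a + b)) - st (H a + H b) \<in> JX" by (rule H_eqI[OF ab'(1) Hsum])
  define \<epsilon>1 where "\<epsilon>1 = st (H (a + b)) - (st (H a) + st (H b))"
  have \<epsilon>1: "\<epsilon>1 \<in> JX" using is_ideal_add[OF JX h st_add[OF HU]] unfolding diff_telescope \<epsilon>1_def .
  have alg1: "Q * (A + B) - (u + v + e) * j - (Q * A - u * j) - (Q * B - v * j) = - (e * j)" for A B u v e
    by (simp add: algebra_simps)
  have Hs: "st (H (a + b)) = st (H a) + st (H b) + \<epsilon>1" by (simp add: \<epsilon>1_def)
  have "- (\<epsilon>1 * j) \<in> NX" by (rule is_ideal_uminus[OF NX JXJX[OF \<epsilon>1 j_JX]])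
  hence "Q * \<alpha> (a + b) - st (H (a + b)) * j - (Q * \<alpha> a - st (H a) * j) - (Q * \<alpha> b - st (H b) * j) \<in> NX"
    unfolding \<alpha>.hom_add Hs alg1 .
  thus "Q * \<alpha> (a + b) - st (H (a + b)) * j - (Q * \<alpha> a - st (H a) * j) - (Q * \<alpha> b - st (H b) * j) \<in> modP N"
    unfolding modP_def by (intro CollectI exI[of _ 0]) (simp only: mult_zero_right diff_zero)
  have G1: "H a * lift b \<in> UY" "[:a:] * H b \<in> UY" using UY_closed HU lift_UY const_UY[OF ab(1)] by blast+
  have G: "H a * lift b + [:a:] * H b \<in> UY" using UY_closed G1 by blast
  have "(lift a - [:a:] - CP n * H a) * lift b + [:a:] * (lift b - [:b:] - CP n * H b) \<in> IY"
    by (intro is_ideal_add[OF IY] is_ideal_multr[OF IY] is_ideal_multl[OF IY] H_eq ab)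
  moreover have "(lift a - [:a:] - CP n * H a) * lift b + [:a:] * (lift b - [:b:] - CP n * H b) =
      lift (a * b) - [:a * b:] - CP n * (H a * lift b + [:a:] * H b)"
    unfolding lift_mult const_prod by (simp add: algebra_simps del: mult_pCons_left mult_pCons_right)
  ultimately have e: "lift (a * b) - [:a * b:] - CP n * (H a * lift b + [:a:] * H b) \<in> IY" by (simp only:)
  have h2: "st (H (a * b)) - st (H a * lift b + [:a:] * H b) \<in> JX" by (rule H_eqI[OF ab'(2) G e])
  have "(st (H (a * b)) - st (H a * lift b + [:a:] * H b)) + (st (H a * lift b + [:a:] * H b) - (st (H a * lift b) + st ([:a:] * H b))) +
      (st (H a * lift b) - st (H a) * st (lift b)) + (st ([:a:] * H b) - st [:a:] * st (H b)) + st (H a) * (st (lift b) - \<alpha> b) \<in> JX"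
    by (rule is_ideal_add[OF JX is_ideal_add[OF JX is_ideal_add[OF JX is_ideal_add[OF JX h2 st_add[OF G1]]
      st_mult[OF HU(1) lift_UY]] st_mult[OF const_UY[OF ab(1)] HU(2)]] is_ideal_multl[OF JX st_lift]])
  moreover define \<epsilon> where "\<epsilon> = st (H (a * b)) - (st (H a) * \<alpha> b + [:\<phi> a:] * st (H b))"
  moreover have alg2: "(h - g) + (g - (g1 + g2)) + (g1 - u * l) + (g2 - c * v) + u * (l - B) = h - (u * B + c * v)"
    for h g g1 g2 u v l c B :: "'t poly" by (simp add: algebra_simps)
  ultimately have \<epsilon>: "\<epsilon> \<in> JX" by (simp only: st_const)
  have Hab: "st (H (a * b)) = st (H a) * \<alpha> b + [:\<phi> a:] * st (H b) + \<epsilon>" by (simp add: \<epsilon>_def)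
  define x where "x = \<alpha> a - [:\<phi> a:] - P * st (H a)"
  define y where "y = \<alpha> b - [:\<phi> b:] - P * st (H b)"
  have xy: "x \<in> JX" "y \<in> JX" unfolding x_def y_def by (intro alpha_decomp ab)+
  have A: "\<alpha> a = [:\<phi> a:] + P * st (H a) + x" and B: "\<alpha> b = [:\<phi> b:] + P * st (H b) + y" by (simp_all add: x_def y_def)
  have l1: "lift (1 :: int poly poly) = 1" by (rule poly_eqI) (simp only: coeff_lift coeff_1, simp add: pCons_one)
  have "lift 1 - [:1:] - CP n * 0 \<in> IY" using is_ideal_zero[OF IY] by (simp add: l1 pCons_one)
  moreover have "0 \<in> UY" using UY by (simp add: subring_set_def)
  ultimately have "st (H 1) - st 0 \<in> JX" by (intro H_eqI Inv_1)
  hence \<eta>: "st (H 1) \<in> JX" by (simp add: st_def)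
  define a' b' where "a' = [:\<phi> a:]" and "b' = [:\<phi> b:]"
  have alg: "Q * ((a' + P * u + x) * (b' + P * v + y)) - (u * (b' + P * v + y) + a' * v + \<epsilon>) * j -
      (a' * (Q * (b' + P * v + y) - v * j) + b' * (Q * (a' + P * u + x) - u * j) - a' * b' * (Q * 1 - t * j)) -
      P * (Q * u * (P * v + y) + Q * x * v - u * v * j) = Q * (x * y) - u * (y * j) - \<epsilon> * j - (a' * b') * (t * j)" for u v t
    by (simp add: algebra_simps)
  let ?S = "\<lambda>a. Q * \<alpha> a - st (H a) * j"
  have "?S (a * b) - (a' * ?S b + b' * ?S a - a' * b' * ?S 1) - P * (Q * st (H a) * (P * st (H b) + y) + Q * x * st (H b) - st (H a) * st (H b) * j) =
      Q * (x * y) - st (H a) * (y * j) - \<epsilon> * j - (a' * b') * (st (H 1) * j)"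
    using alg[of "st (H a)" "st (H b)" "st (H 1)"] unfolding \<alpha>.hom_mult \<alpha>.hom_one Hab A B a'_def[symmetric] b'_def[symmetric] .
  also have "\<dots> \<in> NX"
    by (rule is_ideal_diff[OF NX is_ideal_diff[OF NX is_ideal_diff[OF NX
      is_ideal_multl[OF NX JXJX[OF xy]] is_ideal_multl[OF NX JXJX[OF xy(2) j_JX]]] JXJX[OF \<epsilon> j_JX]]
      is_ideal_multl[OF NX JXJX[OF \<eta> j_JX]]])
  finally have "?S (a * b) - (a' * ?S b + b' * ?S a - a' * b' * ?S 1) \<in> modP N" unfolding modP_def by blast
  thus "?S (a * b) - (smult (\<phi> a) (?S b) + smult (\<phi> b) (?S a) - smult (\<phi> a * \<phi> b) (?S 1)) \<in> modP N"
    unfolding smult_conv const_prod a'_def b'_def .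
next
  fix a assume a: "a \<in> Inv p n"
  have "Q * (\<alpha> a - [:\<phi> a:] - P * st (H a)) - st (H a) * j \<in> JX"
    by (rule is_ideal_diff[OF JX is_ideal_multl[OF JX alpha_decomp[OF a]] is_ideal_multl[OF JX j_JX]])
  moreover have "Q * (\<alpha> a - [:\<phi> a:] - P * st (H a)) - st (H a) * j = Q * \<alpha> a - st (H a) * j - smult (\<phi> a) Q - P * (Q * st (H a))"
    unfolding smult_conv by (simp only: algebra_simps)
  ultimately show "Q * \<alpha> a - st (H a) * j - smult (\<phi> a) Q \<in> modP J" unfolding modP_def by auto
next
  fix a assume aI: "a \<in> RI p n"
  hence a: "a \<in> Inv p n" using RI_Inv0 by blast
  obtain b d where bd: "a = \<Phi> n * b + of_int p * d" using RI_decomp[OF aI] by blast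
  have QU: "QP n * lift b \<in> UY" using UY_closed QPU lift_UY by blast
  have lp: "lift (of_int p * d) = [:of_int p:] * lift d"
    by (rule poly_eqI) (simp add: of_int_poly)
  have "[:of_int p:] \<in> IY" "[:a:] \<in> IY" by (intro const_poly_ideal[OF is_ideal_RI] RI_q aI)+
  hence "(lift (\<Phi> n) - CP n * QP n) * lift b + [:of_int p:] * lift d - [:a:] \<in> IY"
    using is_ideal_diff[OF IY is_ideal_add[OF IY is_ideal_multr[OF IY dynatomic_factor[OF ok_p]] is_ideal_multr[OF IY]]]
    by blast
  moreover have "(lift (\<Phi> n) - CP n * QP n) * lift b + [:of_int p:] * lift d - [:a:] = lift a - [:a:] - CP n * (QP n * lift b)"
    unfolding bd lift_add lift_mult[of "\<Phi> n"] lp by (simp only: algebra_simps)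
  ultimately have e: "lift a - [:a:] - CP n * (QP n * lift b) \<in> IY" by (simp only:)
  have "(st (H a) - st (QP n * lift b)) + (st (QP n * lift b) - st (QP n) * st (lift b)) + st (QP n) * (st (lift b) - \<alpha> b) \<in> JX"
    by (rule is_ideal_add[OF JX is_ideal_add[OF JX H_eqI[OF a QU e] st_mult[OF QPU lift_UY]] is_ideal_multl[OF JX st_lift]])
  moreover define \<epsilon> where "\<epsilon> = st (H a) - Q * \<alpha> b"
  moreover have "(h - g) + (g - u * l) + u * (l - B) = h - u * B" for h g u l B :: "'t poly" by (simp add: algebra_simps)
  ultimately have \<epsilon>: "\<epsilon> \<in> JX" by (simp only: Q_def)
  have Ha: "st (H a) = Q * \<alpha> b + \<epsilon>" by (simp add: \<epsilon>_def)
  have al: "\<alpha> a = (P * Q + j) * \<alpha> b + of_int p * \<alpha> d" unfolding bd by (simp add: \<alpha>.hom_add \<alpha>.hom_mult \<alpha>.hom_of_int j_def)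
  have pX: "of_int p \<in> NX" using const_poly_ideal[OF N pN] by (simp add: of_int_poly)
  have "Q * \<alpha> a - st (H a) * j - P * (Q * Q * \<alpha> b) = of_int p * (Q * \<alpha> d) - \<epsilon> * j" unfolding Ha al by (simp add: algebra_simps)
  also have "\<dots> \<in> NX" by (rule is_ideal_diff[OF NX is_ideal_multr[OF NX pX] JXJX[OF \<epsilon> j_JX]])
  finally show "Q * \<alpha> a - st (H a) * j \<in> modP N" unfolding modP_def by blast
qed

lemma tw_dc: "tw (coeff (mmod P (\<alpha> (dc (\<Phi> n)))) i) (\<lambda>a. coeff (mmod P (\<alpha> (dc (\<Phi> n)) * \<alpha> a - \<alpha> (dc a) * j)) i)"
proof (rule tw_coeff)
  let ?c = "\<alpha> (dc (\<Phi> n))"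
  let ?S = "\<lambda>a. ?c * \<alpha> a - \<alpha> (dc a) * j"
  fix a b assume ab: "a \<in> Inv p n" "b \<in> Inv p n"
  have "?S (a + b) - ?S a - ?S b = 0" by (simp add: dc_add \<alpha>.hom_add algebra_simps)
  thus "?S (a + b) - ?S a - ?S b \<in> modP N" using is_ideal_zero[OF NX] unfolding modP_def by (intro CollectI exI[of _ 0]) simp
  define x where "x = \<alpha> a - [:\<phi> a:] - P * st (H a)"
  define y where "y = \<alpha> b - [:\<phi> b:] - P * st (H b)"
  have xy: "x \<in> JX" "y \<in> JX" unfolding x_def y_def by (intro alpha_decomp ab)+
  have A: "\<alpha> a = [:\<phi> a:] + P * st (H a) + x" and B: "\<alpha> b = [:\<phi> b:] + P * st (H b) + y" by (simp_all add: x_def y_def)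
  define a' b' where "a' = [:\<phi> a:]" and "b' = [:\<phi> b:]"
  have alg: "c * ((a' + P * u + x) * (b' + P * v + y)) - (e * (b' + P * v + y) + (a' + P * u + x) * f) * j -
      (a' * (c * (b' + P * v + y) - f * j) + b' * (c * (a' + P * u + x) - e * j) - a' * b' * (c * 1 - 0 * j)) -
      P * (c * u * (P * v + y) + c * x * v - (e * v + u * f) * j) = c * (x * y) - e * (y * j) - f * (x * j)" for u v c e f
    by (simp add: algebra_simps)
  have d1: "\<alpha> (dc 1) = 0" using dc_const[of "1 :: int poly"] by (simp add: pCons_one)
  have "?S (a * b) - (a' * ?S b + b' * ?S a - a' * b' * ?S 1) -
      P * (?c * st (H a) * (P * st (H b) + y) + ?c * x * st (H b) - (\<alpha> (dc a) * st (H b) + st (H a) * \<alpha> (dc b)) * j) =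
      ?c * (x * y) - \<alpha> (dc a) * (y * j) - \<alpha> (dc b) * (x * j)"
    using alg[of ?c "st (H a)" "st (H b)" "\<alpha> (dc a)" "\<alpha> (dc b)"]
    unfolding dc_mult \<alpha>.hom_mult \<alpha>.hom_add \<alpha>.hom_one d1 A B a'_def[symmetric] b'_def[symmetric] .
  also have "\<dots> \<in> NX"
    by (rule is_ideal_diff[OF NX is_ideal_diff[OF NX is_ideal_multl[OF NX JXJX[OF xy]]
      is_ideal_multl[OF NX JXJX[OF xy(2) j_JX]]] is_ideal_multl[OF NX JXJX[OF xy(1) j_JX]]])
  finally have "?S (a * b) - (a' * ?S b + b' * ?S a - a' * b' * ?S 1) \<in> modP N" unfolding modP_def by blast
  thus "?S (a * b) - (smult (\<phi> a) (?S b) + smult (\<phi> b) (?S a) - smult (\<phi> a * \<phi> b) (?S 1)) \<in> modP N"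
    unfolding smult_conv const_prod a'_def b'_def .
next
  let ?c = "\<alpha> (dc (\<Phi> n))"
  fix a assume a: "a \<in> Inv p n"
  have "?c * (\<alpha> a - [:\<phi> a:] - P * st (H a)) - \<alpha> (dc a) * j \<in> JX"
    by (rule is_ideal_diff[OF JX is_ideal_multl[OF JX alpha_decomp[OF a]] is_ideal_multl[OF JX j_JX]])
  moreover have "?c * (\<alpha> a - [:\<phi> a:] - P * st (H a)) - \<alpha> (dc a) * j = ?c * \<alpha> a - \<alpha> (dc a) * j - smult (\<phi> a) ?c - P * (?c * st (H a))"
    unfolding smult_conv by (simp only: algebra_simps)
  ultimately show "?c * \<alpha> a - \<alpha> (dc a) * j - smult (\<phi> a) ?c \<in> modP J" unfolding modP_def by auto
next
  let ?c = "\<alpha> (dc (\<Phi> n))"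
  fix a assume aI: "a \<in> RI p n"
  obtain b d where bd: "a = \<Phi> n * b + of_int p * d" using RI_decomp[OF aI] by blast
  have op: "(of_int p :: int poly poly) = [:[:p:]:]" by (simp add: of_int_poly)
  have dp: "dc (of_int p :: int poly poly) = 0" unfolding op dc_const by (simp add: pderiv_pCons)
  have al: "\<alpha> a = (P * Q + j) * \<alpha> b + of_int p * \<alpha> d" unfolding bd by (simp add: \<alpha>.hom_add \<alpha>.hom_mult \<alpha>.hom_of_int j_def)
  have ald: "\<alpha> (dc a) = ?c * \<alpha> b + (P * Q + j) * \<alpha> (dc b) + of_int p * \<alpha> (dc d)"
    unfolding bd dc_add dc_mult dp by (simp add: \<alpha>.hom_add \<alpha>.hom_mult \<alpha>.hom_of_int j_def)
  have pX: "of_int p \<in> NX" using const_poly_ideal[OF N pN] by (simp add: of_int_poly)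
  have "?c * \<alpha> a - \<alpha> (dc a) * j - P * (?c * Q * \<alpha> b - Q * \<alpha> (dc b) * j) =
      of_int p * (?c * \<alpha> d - \<alpha> (dc d) * j) - j * j * \<alpha> (dc b)"
    unfolding al ald by (simp add: algebra_simps)
  also have "\<dots> \<in> NX" by (rule is_ideal_diff[OF NX is_ideal_multr[OF NX pX] is_ideal_multr[OF NX JXJX[OF j_JX j_JX]]])
  finally show "?c * \<alpha> a - \<alpha> (dc a) * j \<in> modP N" unfolding modP_def by blast
qed

lemma mmod_st: assumes G: "G \<in> UY" shows "mmod P (st G) - st (mmod (CP n) G) \<in> JX"
proof -
  let ?D = "mdiv (CP n) G" and ?R = "mmod (CP n) G"
  have DR: "?D \<in> UY" "?R \<in> UY" by (intro mmod_subring subring_Inv CP_monic CPU G)+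
  have CD: "CP n * ?D \<in> UY" using UY_closed CPU DR by blast
  have "(st (CP n * ?D + ?R) - (st (CP n * ?D) + st ?R)) + (st (CP n * ?D) - st (CP n) * st ?D) \<in> JX"
    by (rule is_ideal_add[OF JX st_add[OF CD DR(2)] st_mult[OF CPU DR(1)]])
  moreover have "(g - (u + v)) + (u - w) = g - (w + v)" for g u v w :: "'t poly" by (simp add: algebra_simps)
  ultimately have "st (CP n * ?D + ?R) - (P * st ?D + st ?R) \<in> JX" by (simp only: P_def)
  hence "st G - (P * st ?D + st ?R) \<in> JX" unfolding mdiv_mmod(1)[OF CP_monic, symmetric] .
  hence "mmod P (st G - (P * st ?D + st ?R)) \<in> JX" by (rule mmod_ideal[OF J P_monic(2)])
  moreover have "mmod P (P * st ?D + st ?R) = st ?R"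
    by (rule mdiv_mmod_eqI(2)[OF P_monic(2) refl])
      (simp add: coeff_st P_monic mdiv_mmod(2)[OF CP_monic] CP_degree phi_0)
  ultimately show ?thesis by (simp only: mmod_diff[OF P_monic(2)])
qed

lemma Y0_lift:
  assumes yz: "\<And>i. y i \<in> Inv p n" "\<And>i. z i \<in> Inv p n"
    and unit: "(\<Sum>i<n. coeff (rP n) i * y i + coeff (\<phi>P n) i * z i) - 1 \<in> RI p n"
  shows "\<exists>\<psi>. lifts \<psi>"
proof -
  let ?w1 = "\<lambda>i. coeff (mmod P Q) i" and ?w2 = "\<lambda>i. coeff (mmod P (\<alpha> (dc (\<Phi> n)))) i"
  let ?r = "\<lambda>i. coeff (rP n) i" and ?f = "\<lambda>i. coeff (\<phi>P n) i"
  have w1: "?w1 i - \<phi> (?r i) \<in> J" for i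
    using poly_ideal_coeff[OF mmod_st[OF QPU], of i] by (simp add: Q_def rP_def coeff_st)
  have w2: "?w2 i - \<phi> (?f i) \<in> J" for i
  proof -
    have "mmod P (st (lift (dc (\<Phi> n))) - \<alpha> (dc (\<Phi> n))) \<in> JX" by (rule mmod_ideal[OF J P_monic(2) st_lift])
    hence "(mmod P (st (lift (dc (\<Phi> n)))) - st (\<phi>P n)) - (mmod P (st (lift (dc (\<Phi> n)))) - mmod P (\<alpha> (dc (\<Phi> n)))) \<in> JX"
      unfolding \<phi>P_def mmod_diff[OF P_monic(2)] using is_ideal_diff[OF JX mmod_st[OF lift_UY]] by blast
    hence "mmod P (\<alpha> (dc (\<Phi> n))) - st (\<phi>P n) \<in> JX" by simp
    from poly_ideal_coeff[OF this, of i] show ?thesis by (simp add: coeff_st)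
  qed
  note t = tw_sum[OF tw_add[OF tw_scale[OF tw_cycle] tw_scale[OF tw_dc]],
      of "\<lambda>i. \<phi> (y i)" "\<lambda>i. i" "\<lambda>i. \<phi> (z i)" "\<lambda>i. i" n]
  have rf: "?r i \<in> Inv p n" "?f i \<in> Inv p n" for i
    using rP_Inv[OF n1, of p] phiP_Inv[OF n1, of p] by (auto simp: poly_subring_def)
  define g where "g i = ?r i * y i + ?f i * z i" for i
  have prods: "?r i * y i \<in> Inv p n" "?f i * z i \<in> Inv p n" for i using U_closed(1) rf yz by blast+
  have g: "g i \<in> Inv p n" for i unfolding g_def using U_closed(1) prods by blast
  have gi: "(\<phi> (y i) * ?w1 i + \<phi> (z i) * ?w2 i) - \<phi> (g i) \<in> J" for i
  proof -
    have "\<phi> (y i) * (?w1 i - \<phi> (?r i)) + \<phi> (z i) * (?w2 i - \<phi> (?f i)) - (\<phi> (?r i * y i) - \<phi> (?r i) * \<phi> (y i)) -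
        (\<phi> (?f i * z i) - \<phi> (?f i) * \<phi> (z i)) - (\<phi> (?r i * y i + ?f i * z i) - (\<phi> (?r i * y i) + \<phi> (?f i * z i))) \<in> J"
      by (rule is_ideal_diff[OF J is_ideal_diff[OF J is_ideal_diff[OF J is_ideal_add[OF J
        is_ideal_multl[OF J w1] is_ideal_multl[OF J w2]] phi_mult_Inv[OF rf(1) yz(1)]] phi_mult_Inv[OF rf(2) yz(2)]]
        phi_add_Inv[OF prods(1) prods(2)]])
    thus ?thesis by (simp add: g_def algebra_simps)
  qed
  have sU: "(\<Sum>i<n. g i) \<in> Inv p n" by (rule subring_set_sum[OF subring_Inv g])
  have u: "(\<Sum>i<n. g i) - 1 \<in> RI p n" using unit by (simp only: g_def)
  have "\<phi> (((\<Sum>i<n. g i) - 1) + 1) - (\<phi> ((\<Sum>i<n. g i) - 1) + \<phi> 1) \<in> J"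
    using RI_Inv0 u Inv_1 by (intro phi_add_Inv) auto
  from is_ideal_add[OF J this phi_RI[OF u]]
  have "(\<phi> (((\<Sum>i<n. g i) - 1) + 1) - (\<phi> ((\<Sum>i<n. g i) - 1) + \<phi> 1)) + \<phi> ((\<Sum>i<n. g i) - 1) \<in> J" .
  hence p1: "\<phi> (\<Sum>i<n. g i) - 1 \<in> J" by (simp add: phi_1)
  define A where "A = (\<Sum>i<n. \<phi> (y i) * ?w1 i + \<phi> (z i) * ?w2 i)"
  define B where "B = (\<Sum>i<n. \<phi> (g i))"
  have "A - B \<in> J" unfolding A_def B_def sum_subtractf[symmetric] by (rule is_ideal_sum[OF J gi])
  moreover have "\<phi> (\<Sum>i<n. g i) - B \<in> J" unfolding B_def by (rule phi_sum[OF g])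
  ultimately have "(A - B) - (\<phi> (\<Sum>i<n. g i) - B) + (\<phi> (\<Sum>i<n. g i) - 1) \<in> J"
    using p1 is_ideal_add[OF J is_ideal_diff[OF J]] by blast
  hence w: "(\<Sum>i<n. \<phi> (y i) * ?w1 i + \<phi> (z i) * ?w2 i) - 1 \<in> J" unfolding A_def[symmetric] by simp
  show ?thesis using tw_lift[OF t w] by blast
qed

end

section \<open>Coordinate rings\<close>

lemma Zxc_simps: "carrier Zxc = UNIV" "a \<otimes>\<^bsub>Zxc\<^esub> b = a * b" "a \<oplus>\<^bsub>Zxc\<^esub> b = a + b" "\<one>\<^bsub>Zxc\<^esub> = 1" "\<zero>\<^bsub>Zxc\<^esub> = 0"
  by (simp_all add: ring_of_type_algebra_def)

lemma Zxc_cring: "cring Zxc" by (rule cring_from_type_algebra)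

lemma ideal_Zxc: assumes I: "is_ideal I" shows "ideal I Zxc"
proof -
  interpret Z: cring Zxc by (rule Zxc_cring)
  have inv: "\<ominus>\<^bsub>Zxc\<^esub> a = - a" for a by (rule Z.minus_equality) (simp_all add: Zxc_simps)
  show ?thesis
  proof (rule idealI[OF Z.ring_axioms])
    show "subgroup I (add_monoid Zxc)"
      by (rule Z.add.subgroupI)
        (use is_ideal_zero[OF I] is_ideal_uminus[OF I] is_ideal_add[OF I] in \<open>auto simp: Zxc_simps inv\<close>)
  qed (use is_ideal_multl[OF I] is_ideal_multr[OF I] in \<open>auto simp: Zxc_simps\<close>)
qed

lemma int_poly_poly_induct_subring:
  assumes G: "subring_set G" and x: "[:0, 1:] \<in> G" and c: "[:[:0, 1:]:] \<in> G"
  shows "(g :: int poly poly) \<in> G"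
proof -
  have G': "a \<in> G \<Longrightarrow> b \<in> G \<Longrightarrow> a + b \<in> G" "a \<in> G \<Longrightarrow> b \<in> G \<Longrightarrow> a - b \<in> G" "a \<in> G \<Longrightarrow> b \<in> G \<Longrightarrow> a * b \<in> G" "0 \<in> G" "1 \<in> G" for a b
    using G by (auto simp: subring_set_def)
  have nat: "of_nat k \<in> G" for k by (induction k) (simp_all add: G')
  have int: "of_int z \<in> G" for z
  proof (cases z rule: int_cases2)
    case (nonpos k)
    thus ?thesis using G'(2)[OF G'(4) nat[of k]] by simp
  qed (simp add: nat)
  have q: "[:q:] \<in> G" for q :: "int poly"
  proof (induction q)
    case 0
    show ?case using G'(4) by simp
  next
    case (pCons a q)
    have "[:pCons a q:] = of_int a + [:[:0, 1:]:] * [:q:]" by (simp add: of_int_poly)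
    thus ?case using G'(1)[OF int G'(3)[OF c pCons.IH]] by simp
  qed
  show ?thesis
  proof (induction g)
    case 0
    show ?case by (rule G'(4))
  next
    case (pCons a g)
    have "pCons a g = [:a:] + [:0, 1:] * g" by simp
    thus ?case using G'(1)[OF q G'(3)[OF x pCons.IH]] by simp
  qed
qed

text \<open>The subring of the ring of functions on \<open>Y\<^sub>1(n)\<close> over \<open>\<int>/p\<close> that consists of the classes of \<open>U\<close>; both curves arise
  in this way, with \<open>U\<close> everything or the invariants.\<close>

locale coordinate_ring = unicritical m for m :: nat +
  fixes p n :: nat and U :: "int poly poly set"
  assumes n1: "n \<ge> 1" and U: "subring_set U" and RI_U: "RI (int p) n \<subseteq> U"
begin

lemma Y1_ideal_eq: "Y1_ideal m n p = RI (int p) n"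
proof -
  interpret Z: cring Zxc by (rule Zxc_cring)
  note I = is_ideal_RI[of "int p" n]
  have p: "of_nat p \<in> RI (int p) n" using RI_q[of "int p" n] by simp
  have "Y1_ideal m n p \<subseteq> RI (int p) n"
    unfolding Y1_ideal_def by (rule Z.genideal_minimal[OF ideal_Zxc[OF I]]) (use p RI_dvd in auto)
  moreover have "RI (int p) n \<subseteq> Y1_ideal m n p"
  proof
    fix a assume "a \<in> RI (int p) n"
    then obtain d where "\<Phi> n dvd a - d * of_int (int p)" by (auto simp: RI_def)
    then obtain b where "a - d * of_int (int p) = \<Phi> n * b" by (rule dvdE)
    hence a: "a = b * \<Phi> n + d * of_nat p" by (simp add: algebra_simps)
    interpret Y: ideal "Y1_ideal m n p" Zxc unfolding Y1_ideal_def by (rule Z.genideal_ideal) (simp add: Zxc_simps)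
    have g: "{of_nat p, \<Phi> n} \<subseteq> Y1_ideal m n p" unfolding Y1_ideal_def by (rule Z.genideal_self) (simp add: Zxc_simps)
    have "b \<otimes>\<^bsub>Zxc\<^esub> \<Phi> n \<oplus>\<^bsub>Zxc\<^esub> d \<otimes>\<^bsub>Zxc\<^esub> of_nat p \<in> Y1_ideal m n p"
      by (rule Y.a_closed; rule Y.I_l_closed) (use g in \<open>auto simp: Zxc_simps\<close>)
    thus "a \<in> Y1_ideal m n p" by (simp add: a Zxc_simps)
  qed
  ultimately show ?thesis by blast
qed

definition cs :: "int poly poly \<Rightarrow> int poly poly set" where "cs g = Y1_ideal m n p +>\<^bsub>Zxc\<^esub> g"

lemma cs_eq: "cs g = {i + g | i. i \<in> RI (int p) n}"
  unfolding cs_def a_r_coset_def' Y1_ideal_eq by (auto simp: Zxc_simps)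

lemma cs_eq_iff: "cs a = cs b \<longleftrightarrow> a - b \<in> RI (int p) n"
proof
  note I = is_ideal_RI[of "int p" n]
  assume "cs a = cs b"
  hence "0 + a \<in> cs b" using is_ideal_zero[OF I] by (auto simp: cs_eq)
  thus "a - b \<in> RI (int p) n" by (auto simp: cs_eq)
next
  note I = is_ideal_RI[of "int p" n]
  assume d: "a - b \<in> RI (int p) n"
  show "cs a = cs b"
  proof (intro equalityI subsetI)
    fix x assume "x \<in> cs a"
    then obtain i where i: "i \<in> RI (int p) n" "x = i + a" by (auto simp: cs_eq)
    have "x = (i + (a - b)) + b" by (simp add: i)
    thus "x \<in> cs b" unfolding cs_eq using is_ideal_add[OF I i(1) d] by blast
  next
    fix x assume "x \<in> cs b"
    then obtain i where i: "i \<in> RI (int p) n" "x = i + b" by (auto simp: cs_eq)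
    have "x = (i - (a - b)) + a" by (simp add: i)
    thus "x \<in> cs a" unfolding cs_eq using is_ideal_diff[OF I i(1) d] by blast
  qed
qed

definition A :: "int poly poly set ring" where "A = (Y1_ring m n p)\<lparr>carrier := cs ` U\<rparr>"

lemma A_carrier: "carrier A = cs ` U" by (simp add: A_def)

lemma A_simps: "cs a \<oplus>\<^bsub>A\<^esub> cs b = cs (a + b)" "cs a \<otimes>\<^bsub>A\<^esub> cs b = cs (a * b)" "\<one>\<^bsub>A\<^esub> = cs 1" "\<zero>\<^bsub>A\<^esub> = cs 0"
proof -
  interpret Y: ideal "Y1_ideal m n p" Zxc unfolding Y1_ideal_eq by (rule ideal_Zxc[OF is_ideal_RI])
  note h = Y.rcos_ring_hom
  show "cs a \<oplus>\<^bsub>A\<^esub> cs b = cs (a + b)" using ring_hom_add[OF h, of a b] by (simp add: A_def Y1_ring_def cs_def Zxc_simps)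
  show "cs a \<otimes>\<^bsub>A\<^esub> cs b = cs (a * b)" using ring_hom_mult[OF h, of a b] by (simp add: A_def Y1_ring_def cs_def Zxc_simps)
  show "\<one>\<^bsub>A\<^esub> = cs 1" using ring_hom_one[OF h] by (simp add: A_def Y1_ring_def cs_def Zxc_simps)
  have "\<zero>\<^bsub>A\<^esub> = Y1_ideal m n p" by (simp add: A_def Y1_ring_def FactRing_def)
  thus "\<zero>\<^bsub>A\<^esub> = cs 0" by (simp add: cs_eq Y1_ideal_eq)
qed

lemma U_closed: "a \<in> U \<Longrightarrow> b \<in> U \<Longrightarrow> a + b \<in> U" "a \<in> U \<Longrightarrow> b \<in> U \<Longrightarrow> a - b \<in> U" "a \<in> U \<Longrightarrow> b \<in> U \<Longrightarrow> a * b \<in> U" "0 \<in> U" "1 \<in> U"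
  using U by (auto simp: subring_set_def)

lemma U_uminus: "a \<in> U \<Longrightarrow> - a \<in> U" using U_closed(2)[OF U_closed(4)] by fastforce

lemma A_cring: "cring A"
proof (rule cringI)
  show "abelian_group A"
  proof (rule abelian_groupI)
    fix x assume "x \<in> carrier A"
    then obtain a where a: "a \<in> U" "x = cs a" by (auto simp: A_carrier)
    show "\<exists>y\<in>carrier A. y \<oplus>\<^bsub>A\<^esub> x = \<zero>\<^bsub>A\<^esub>"
      by (rule bexI[of _ "cs (- a)"]) (use a U_uminus in \<open>auto simp: A_carrier A_simps\<close>)
  qed (auto simp: A_carrier A_simps ac_simps intro!: imageI U_closed)
  show "Group.comm_monoid A"
    by (rule comm_monoidI) (auto simp: A_carrier A_simps ac_simps intro!: imageI U_closed)
qed (auto simp: A_carrier A_simps algebra_simps)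

lemma A_of_nat: "[k] \<cdot>\<^bsub>A\<^esub> \<one>\<^bsub>A\<^esub> = cs (of_nat k)"
proof -
  interpret A: cring A by (rule A_cring)
  show ?thesis by (induction k) (simp_all add: A_simps add.commute)
qed

lemma A_Fp: "Fp_algebra p A"
proof -
  have "of_nat p - 0 \<in> RI (int p) n" using RI_q[of "int p" n] by simp
  hence "cs (of_nat p) = cs 0" by (simp only: cs_eq_iff)
  thus ?thesis using A_cring by (simp add: Fp_algebra_def A_of_nat) (simp add: A_simps)
qed

lemma A_finitely_generated:
  assumes fin: "finite S" and SU: "S \<subseteq> U"
    and gen: "\<And>G. subring_set G \<Longrightarrow> S \<subseteq> G \<Longrightarrow> RI (int p) n \<subseteq> G \<Longrightarrow> U \<subseteq> G"
  shows "\<exists>S. finite S \<and> S \<subseteq> carrier A \<and> generate_ring A S = carrier A"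
proof (intro exI conjI)
  interpret A: cring A by (rule A_cring)
  show "finite (cs ` S)" using fin by simp
  show SA: "cs ` S \<subseteq> carrier A" using SU by (auto simp: A_carrier)
  define G where "G = {g \<in> U. cs g \<in> generate_ring A (cs ` S)}"
  have G1: "1 \<in> G" using generate_ring.one[of A "cs ` S"] U_closed by (simp add: G_def A_simps)
  have Gadd: "a + b \<in> G" if "a \<in> G" "b \<in> G" for a b
    using that generate_ring.eng_add[of "cs a" A "cs ` S" "cs b"] U_closed by (simp add: G_def A_simps)
  have Gmult: "a * b \<in> G" if "a \<in> G" "b \<in> G" for a b
    using that generate_ring.eng_mult[of "cs a" A "cs ` S" "cs b"] U_closed by (simp add: G_def A_simps)
  have Gneg: "- a \<in> G" if a: "a \<in> G" for a
  proof -
    have aU: "a \<in> U" using a by (simp add: G_def)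
    have "\<ominus>\<^bsub>A\<^esub> cs a = cs (- a)"
      by (rule A.minus_equality) (use aU U_uminus in \<open>auto simp: A_simps A_carrier\<close>)
    thus ?thesis using generate_ring.a_inv[of "cs a" A "cs ` S"] a U_uminus by (simp add: G_def)
  qed
  have Gdiff: "a - b \<in> G" if "a \<in> G" "b \<in> G" for a b
  proof -
    have "a + - b \<in> G" by (rule Gadd[OF that(1) Gneg[OF that(2)]])
    thus ?thesis by simp
  qed
  have "1 - 1 \<in> G" by (rule Gdiff[OF G1 G1])
  hence G0: "0 \<in> G" by simp
  have "subring_set G" unfolding subring_set_def by (intro conjI ballI Gadd Gmult Gdiff G0 G1)
  moreover have "S \<subseteq> G" using SU by (auto simp: G_def intro: generate_ring.incl)
  moreover have "RI (int p) n \<subseteq> G"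
  proof
    fix i assume i: "i \<in> RI (int p) n"
    have "cs i = cs 0" using i by (simp add: cs_eq_iff)
    thus "i \<in> G" using G0 i RI_U by (auto simp: G_def)
  qed
  ultimately have "U \<subseteq> G" by (rule gen)
  thus "generate_ring A (cs ` S) = carrier A"
    using A.generate_ring_incl[OF SA] by (auto simp: A_carrier G_def)
qed

end

section \<open>Test rings\<close>

text \<open>Test rings are given by a carrier set, whereas the lifting above takes place in a ring that is a type. As for the
  residue fields, one fixed ring is chosen, a test ring that violates the lifting property if there is one. The factor
  \<open>\<int>\<close> makes the type a ring with \<open>0 \<noteq> 1\<close> even when the chosen ring is zero.\<close>

definition bad_ring :: "'b ring \<Rightarrow> bool" where
  "bad_ring B \<longleftrightarrow> (\<exists>m n p i J \<phi>. 2 \<le> m \<and> 1 \<le> n \<and> prime p \<and> \<not> p dvd m \<and>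
     \<not> int p dvd (if i then disc_delta m n else disc_Delta_prim m n) \<and>
     Fp_algebra p B \<and> ideal J B \<and> (\<forall>a\<in>J. \<forall>b\<in>J. a \<otimes>\<^bsub>B\<^esub> b = \<zero>\<^bsub>B\<^esub>) \<and>
     \<phi> \<in> Ring.ring_hom (if i then Y1_ring m n p else Y0_ring m n p) (B Quot J) \<and>
     \<not> (\<exists>\<psi>\<in>Ring.ring_hom (if i then Y1_ring m n p else Y0_ring m n p) B.
          \<forall>a\<in>carrier (if i then Y1_ring m n p else Y0_ring m n p). \<phi> a = J +>\<^bsub>B\<^esub> \<psi> a))"

definition chosen_ring :: "'b ring" where
  "chosen_ring = (SOME B. cring B \<and> ((\<exists>B' :: 'b ring. cring B' \<and> bad_ring B') \<longrightarrow> bad_ring B))"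

lemma chosen_ring: "cring (chosen_ring :: 'b ring)" "cring (B :: 'b ring) \<Longrightarrow> bad_ring B \<Longrightarrow> bad_ring (chosen_ring :: 'b ring)"
proof -
  define Z :: "'b ring" where
    "Z = \<lparr>carrier = {undefined}, monoid.mult = (\<lambda>_ _. undefined), one = undefined, ring.zero = undefined, add = (\<lambda>_ _. undefined)\<rparr>"
  have "cring Z"
  proof (rule cringI)
    show "abelian_group Z" by (rule abelian_groupI) (simp_all add: Z_def)
    show "Group.comm_monoid Z" by (rule comm_monoidI) (simp_all add: Z_def)
  qed (simp_all add: Z_def)
  note Z = this
  have ex: "\<exists>B :: 'b ring. cring B \<and> ((\<exists>B' :: 'b ring. cring B' \<and> bad_ring B') \<longrightarrow> bad_ring B)"
  proof (cases "\<exists>B' :: 'b ring. cring B' \<and> bad_ring B'")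
    case True
    then obtain B' :: "'b ring" where B': "cring B'" "bad_ring B'" by (elim exE conjE)
    show ?thesis by (rule exI[of _ B'], rule conjI[OF B'(1)], rule impI, rule B'(2))
  next
    case False
    show ?thesis by (rule exI[of _ Z], rule conjI[OF Z], rule impI, erule notE[OF False])
  qed
  have c: "cring (chosen_ring :: 'b ring) \<and> ((\<exists>B' :: 'b ring. cring B' \<and> bad_ring B') \<longrightarrow> bad_ring (chosen_ring :: 'b ring))"
    unfolding chosen_ring_def by (rule someI_ex[OF ex])
  thus "cring (chosen_ring :: 'b ring)" by (rule conjunct1)
  show "bad_ring (chosen_ring :: 'b ring)" if "cring (B :: 'b ring)" "bad_ring B"
    by (rule mp[OF conjunct2[OF c]], rule exI[of _ B], rule conjI[OF that])
qed

lemmas chosen_simps = cring.cring_simprules[OF chosen_ring(1)]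

typedef 'b sq_ring = "carrier (chosen_ring :: 'b ring) \<times> (UNIV :: int set)"
proof -
  have "(\<zero>\<^bsub>chosen_ring\<^esub>, 0) \<in> carrier (chosen_ring :: 'b ring) \<times> (UNIV :: int set)" by (simp add: chosen_simps)
  thus ?thesis by blast
qed

setup_lifting type_definition_sq_ring

instantiation sq_ring :: (type) comm_ring_1
begin

lift_definition zero_sq_ring :: "'a sq_ring" is "(\<zero>\<^bsub>chosen_ring\<^esub>, 0)" by (simp add: chosen_simps)
lift_definition one_sq_ring :: "'a sq_ring" is "(\<one>\<^bsub>chosen_ring\<^esub>, 1)" by (simp add: chosen_simps)
lift_definition plus_sq_ring :: "'a sq_ring \<Rightarrow> 'a sq_ring \<Rightarrow> 'a sq_ring" is
  "\<lambda>u v. (fst u \<oplus>\<^bsub>chosen_ring\<^esub> fst v, snd u + snd v)" by (auto simp: chosen_simps)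
lift_definition times_sq_ring :: "'a sq_ring \<Rightarrow> 'a sq_ring \<Rightarrow> 'a sq_ring" is
  "\<lambda>u v. (fst u \<otimes>\<^bsub>chosen_ring\<^esub> fst v, snd u * snd v)" by (auto simp: chosen_simps)
lift_definition uminus_sq_ring :: "'a sq_ring \<Rightarrow> 'a sq_ring" is
  "\<lambda>u. (\<ominus>\<^bsub>chosen_ring\<^esub> fst u, - snd u)" by (auto simp: chosen_simps)
definition minus_sq_ring :: "'a sq_ring \<Rightarrow> 'a sq_ring \<Rightarrow> 'a sq_ring" where "minus_sq_ring u v = u + - v"

instance
proof
  fix a b c :: "'a sq_ring"
  interpret C: cring "chosen_ring :: 'a ring" by (rule chosen_ring(1))
  show "a + b + c = a + (b + c)" by transfer (auto simp: C.a_assoc)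
  show "a + b = b + a" by transfer (auto simp: C.a_comm)
  show "0 + a = a" by transfer auto
  show "- a + a = 0" by transfer (auto simp: C.l_neg)
  show "a - b = a + - b" by (rule minus_sq_ring_def)
  show "a * b * c = a * (b * c)" by transfer (auto simp: C.m_assoc)
  show "a * b = b * a" by transfer (auto simp: C.m_comm)
  show "1 * a = a" by transfer auto
  show "(a + b) * c = a * c + b * c" by transfer (auto simp: C.l_distr distrib_right)
  show "(0 :: 'a sq_ring) \<noteq> 1" by transfer simp
qed

end

lift_definition val :: "'b sq_ring \<Rightarrow> 'b" is fst .

lemma val_simps:
  "val (u + v) = val u \<oplus>\<^bsub>chosen_ring\<^esub> val v" "val (u * v) = val u \<otimes>\<^bsub>chosen_ring\<^esub> val v" "val (- u) = \<ominus>\<^bsub>chosen_ring\<^esub> val u"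
  "val (0 :: 'b sq_ring) = \<zero>\<^bsub>chosen_ring\<^esub>" "val (1 :: 'b sq_ring) = \<one>\<^bsub>chosen_ring\<^esub>" "val w \<in> carrier chosen_ring"
  for u v w :: "'b sq_ring"
  using Rep_sq_ring[of w]
  by (simp_all add: val.rep_eq plus_sq_ring.rep_eq times_sq_ring.rep_eq uminus_sq_ring.rep_eq zero_sq_ring.rep_eq
    one_sq_ring.rep_eq mem_Times_iff)

lemma val_diff: "val (u - v) = val u \<ominus>\<^bsub>chosen_ring\<^esub> val v" for u v :: "'b sq_ring"
  unfolding minus_sq_ring_def a_minus_def by (simp only: val_simps)

lemma val_surj: "b \<in> carrier (chosen_ring :: 'b ring) \<Longrightarrow> \<exists>u. val u = b"
  by (rule exI[of _ "Abs_sq_ring (b, 0)"]) (simp add: val.rep_eq Abs_sq_ring_inverse)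

lemma val_of_nat: "val (of_nat k :: 'b sq_ring) = [k] \<cdot>\<^bsub>chosen_ring\<^esub> \<one>\<^bsub>chosen_ring\<^esub>"
proof -
  interpret C: cring "chosen_ring :: 'b ring" by (rule chosen_ring(1))
  show ?thesis by (induction k) (simp_all add: val_simps C.a_comm)
qed

context square_zero begin

text \<open>On \<open>Y\<^sub>1(n)\<close> the homomorphism may be replaced by an evaluation, which is a homomorphism exactly.\<close>

lemma Y1_lift_mod:
  assumes UU: "U = UNIV" and unit: "pderiv (\<Phi> n) * y + dc (\<Phi> n) * z - 1 \<in> RI p n"
  shows "\<exists>\<psi>. lifts \<psi>"
proof -
  define \<gamma> where "\<gamma> q = poly (map_poly of_int q) (\<phi> [:[:0, 1:]:])" for q :: "int poly"
  have "comm_ring_hom (of_int :: int \<Rightarrow> 't)" by unfold_locales simp_all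
  hence g: "comm_ring_hom \<gamma>" unfolding \<gamma>_def[abs_def] by (intro eval_hom comm_ring_hom_map_poly)
  define e where "e g = poly (map_poly \<gamma> g) (\<phi> [:0, 1:])" for g
  have e: "comm_ring_hom e" unfolding e_def[abs_def] by (intro eval_hom comm_ring_hom_map_poly g)
  interpret e: comm_ring_hom e by (rule e)
  define G where "G = {g. e g - \<phi> g \<in> J}"
  have add: "\<phi> (a + b) - (\<phi> a + \<phi> b) \<in> J" and mult: "\<phi> (a * b) - \<phi> a * \<phi> b \<in> J" for a b
    using phi_add phi_mult by (auto simp: UU)
  have Gadd: "a + b \<in> G" if "a \<in> G" "b \<in> G" for a b
  proof -
    have a: "e a - \<phi> a \<in> J" and b: "e b - \<phi> b \<in> J" using that by (simp_all only: G_def mem_Collect_eq)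
    have "(e a - \<phi> a) + (e b - \<phi> b) - (\<phi> (a + b) - (\<phi> a + \<phi> b)) \<in> J"
      by (rule is_ideal_diff[OF J is_ideal_add[OF J a b] add])
    moreover have "(e a - \<phi> a) + (e b - \<phi> b) - (\<phi> (a + b) - (\<phi> a + \<phi> b)) = e (a + b) - \<phi> (a + b)"
      unfolding e.hom_add by (simp add: algebra_simps)
    ultimately show ?thesis by (simp only: G_def mem_Collect_eq)
  qed
  have Gmult: "a * b \<in> G" if "a \<in> G" "b \<in> G" for a b
  proof -
    have a: "e a - \<phi> a \<in> J" and b: "e b - \<phi> b \<in> J" using that by (simp_all only: G_def mem_Collect_eq)
    have "(e a - \<phi> a) * e b + \<phi> a * (e b - \<phi> b) - (\<phi> (a * b) - \<phi> a * \<phi> b) \<in> J"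
      by (rule is_ideal_diff[OF J is_ideal_add[OF J is_ideal_multr[OF J a] is_ideal_multl[OF J b]] mult])
    moreover have "(e a - \<phi> a) * e b + \<phi> a * (e b - \<phi> b) - (\<phi> (a * b) - \<phi> a * \<phi> b) = e (a * b) - \<phi> (a * b)"
      unfolding e.hom_mult by (simp add: algebra_simps)
    ultimately show ?thesis by (simp only: G_def mem_Collect_eq)
  qed
  have G01: "0 \<in> G" "1 \<in> G" using is_ideal_zero[OF J] by (simp_all add: G_def phi_0 phi_1)
  have Gm1: "- 1 \<in> G"
  proof -
    have "\<phi> (- 1 + 1) - (\<phi> (- 1) + \<phi> 1) \<in> J" by (rule add)
    moreover have "\<phi> (- 1 + 1) - (\<phi> (- 1) + \<phi> 1) = e (- 1) - \<phi> (- 1)" by (simp add: e.hom_uminus phi_0 phi_1)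
    ultimately show ?thesis by (simp only: G_def mem_Collect_eq)
  qed
  have Gdiff: "a - b \<in> G" if "a \<in> G" "b \<in> G" for a b
  proof -
    have "a + (- 1) * b \<in> G" by (rule Gadd[OF that(1) Gmult[OF Gm1 that(2)]])
    thus ?thesis by simp
  qed
  have sub: "subring_set G" unfolding subring_set_def by (intro conjI ballI Gadd Gmult Gdiff G01)
  have ex: "e [:0, 1:] = \<phi> [:0, 1:]" by (simp add: e_def \<gamma>_def)
  have ec: "e [:[:0, 1:]:] = \<phi> [:[:0, 1:]:]" by (simp add: e_def \<gamma>_def)
  have eG: "e g - \<phi> g \<in> J" for g
  proof -
    have "[:0, 1:] \<in> G" "[:[:0, 1:]:] \<in> G" using is_ideal_zero[OF J] by (simp_all only: G_def mem_Collect_eq ex ec diff_self)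
    hence "g \<in> G" by (rule int_poly_poly_induct_subring[OF sub])
    thus ?thesis by (simp only: G_def mem_Collect_eq)
  qed
  interpret E: square_zero m p n U N J e
  proof
    show "e a \<in> J" if "a \<in> RI p n" for a
      using is_ideal_add[OF J eG[of a] phi_RI[OF that]] by simp
  qed (use n1 ok_p N J NJ JJ pN U RI_U is_ideal_zero[OF J] in \<open>auto simp: e.hom_add e.hom_mult\<close>)
  obtain \<psi> where psi: "E.lifts \<psi>" using E.Y1_lift[OF e UU unit] by blast
  have "\<psi> a - \<phi> a \<in> J" if "a \<in> U" for a
  proof -
    have "(\<psi> a - e a) + (e a - \<phi> a) \<in> J" using psi that by (intro is_ideal_add[OF J] eG) (auto simp: E.lifts_def)
    thus ?thesis by simp
  qed
  hence ph: "\<forall>a\<in>U. \<psi> a - \<phi> a \<in> J" by (intro ballI)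
  show ?thesis unfolding lifts_def
    by (rule exI[of _ \<psi>]) (use psi ph in \<open>unfold E.lifts_def, blast\<close>)
qed

end

context coordinate_ring begin

lemma chosen_ring_lift:
  fixes J :: "'b set" and \<phi> :: "int poly poly set \<Rightarrow> 'b set"
  assumes ok: "ok (int p) n" and Fp: "Fp_algebra p (chosen_ring :: 'b ring)" and J: "ideal J chosen_ring"
    and JJ: "\<forall>a\<in>J. \<forall>b\<in>J. a \<otimes>\<^bsub>chosen_ring\<^esub> b = \<zero>\<^bsub>chosen_ring\<^esub>"
    and phi: "\<phi> \<in> Ring.ring_hom A (chosen_ring Quot J)"
    and core: "\<And>N K (f :: int poly poly \<Rightarrow> 'b sq_ring). square_zero m (int p) n U N K f \<Longrightarrow>
      \<exists>\<psi>. square_zero.lifts m (int p) n U N K f \<psi>"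
  shows "\<exists>\<psi>\<in>Ring.ring_hom A chosen_ring. \<forall>a\<in>carrier A. \<phi> a = J +>\<^bsub>chosen_ring\<^esub> \<psi> a"
proof -
  let ?B = "chosen_ring :: 'b ring"
  interpret C: cring ?B by (rule chosen_ring(1))
  interpret J: ideal J ?B by (rule J)
  interpret A: cring A by (rule A_cring)
  interpret Q: cring "?B Quot J" by (rule J.quotient_is_cring[OF C.is_cring])
  note pi = J.rcos_ring_hom
  let ?pi = "\<lambda>u. J +>\<^bsub>?B\<^esub> val u"
  have pi_simps: "?pi (u + v) = ?pi u \<oplus>\<^bsub>?B Quot J\<^esub> ?pi v" "?pi (u * v) = ?pi u \<otimes>\<^bsub>?B Quot J\<^esub> ?pi v"
    "?pi 1 = \<one>\<^bsub>?B Quot J\<^esub>" "?pi 0 = \<zero>\<^bsub>?B Quot J\<^esub>" for u v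
    using ring_hom_add[OF pi, of "val u" "val v"] ring_hom_mult[OF pi, of "val u" "val v"] ring_hom_one[OF pi]
      ring_hom_zero[OF pi C.ring_axioms Q.ring_axioms] by (simp_all add: val_simps)
  have pi_eq: "?pi u = ?pi v \<longleftrightarrow> val (u - v) \<in> J" for u v
  proof
    assume "?pi u = ?pi v"
    hence "val u \<in> J +>\<^bsub>?B\<^esub> val v" using J.a_rcos_self[of "val u"] by (simp add: val_simps)
    thus "val (u - v) \<in> J" using J.a_rcos_module_minus[OF C.ring_axioms, of "val v" "val u"] by (simp add: val_simps val_diff)
  next
    assume "val (u - v) \<in> J"
    hence "val u \<in> J +>\<^bsub>?B\<^esub> val v" using J.a_rcos_module_minus[OF C.ring_axioms, of "val v" "val u"] by (simp add: val_simps val_diff)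
    from J.a_repr_independence'[OF this] show "?pi u = ?pi v" by (simp add: val_simps)
  qed
  define N where "N = {u :: 'b sq_ring. val u = \<zero>\<^bsub>?B\<^esub>}"
  define K where "K = {u :: 'b sq_ring. val u \<in> J}"
  have NI: "is_ideal N" by (auto simp: is_ideal_def N_def val_simps)
  have KI: "is_ideal K" unfolding is_ideal_def K_def
    using J.zero_closed J.a_closed J.I_l_closed by (auto simp: val_simps)
  define f0 where "f0 g = (SOME u. \<phi> (cs g) = ?pi u)" for g
  have f0: "\<phi> (cs g) = ?pi (f0 g)" if "g \<in> U" for g
  proof -
    have "\<phi> (cs g) \<in> carrier (?B Quot J)" using ring_hom_closed[OF phi] that by (simp add: A_carrier)
    then obtain b where "b \<in> carrier ?B" "\<phi> (cs g) = J +>\<^bsub>?B\<^esub> b" by (auto simp: FactRing_def A_RCOSETS_def')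
    then obtain u where "\<phi> (cs g) = ?pi u" using val_surj by metis
    thus ?thesis unfolding f0_def by (rule someI)
  qed
  define f where "f g = (if g = 0 then 0 else if g = 1 then 1 else f0 g)" for g
  have f: "\<phi> (cs g) = ?pi (f g)" if "g \<in> U" for g
    using f0[OF that] ring_hom_one[OF phi] ring_hom_zero[OF phi A.ring_axioms Q.ring_axioms]
    by (auto simp: f_def pi_simps A_simps)
  have sq: "square_zero m (int p) n U N K f"
  proof
    show "n \<ge> 1" by (rule n1)
    show "ok (int p) n" by (rule ok)
    show "is_ideal N" by (rule NI)
    show "is_ideal K" by (rule KI)
    show "subring_set U" by (rule U)
    show "RI (int p) n \<subseteq> U" by (rule RI_U)
    show "N \<subseteq> K" using J.zero_closed by (auto simp: N_def K_def)
    show "x * y \<in> N" if "x \<in> K" "y \<in> K" for x y using JJ that by (simp add: N_def K_def val_simps)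
    show "of_int (int p) \<in> N" using Fp by (simp add: N_def val_of_nat Fp_algebra_def)
    show "f 0 = 0" "f 1 = 1" by (simp_all add: f_def)
    show "f (a + b) - (f a + f b) \<in> K" if "a \<in> U" "b \<in> U" for a b
    proof -
      have "?pi (f (a + b)) = \<phi> (cs a \<oplus>\<^bsub>A\<^esub> cs b)" using f[OF U_closed(1)[OF that]] by (simp add: A_simps)
      also have "\<dots> = \<phi> (cs a) \<oplus>\<^bsub>?B Quot J\<^esub> \<phi> (cs b)" by (rule ring_hom_add[OF phi]) (use that in \<open>auto simp: A_carrier\<close>)
      also have "\<dots> = ?pi (f a + f b)" using that by (simp add: f pi_simps)
      finally show ?thesis by (simp add: pi_eq K_def)
    qed
    show "f (a * b) - f a * f b \<in> K" if "a \<in> U" "b \<in> U" for a b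
    proof -
      have "?pi (f (a * b)) = \<phi> (cs a \<otimes>\<^bsub>A\<^esub> cs b)" using f[OF U_closed(3)[OF that]] by (simp add: A_simps)
      also have "\<dots> = \<phi> (cs a) \<otimes>\<^bsub>?B Quot J\<^esub> \<phi> (cs b)" by (rule ring_hom_mult[OF phi]) (use that in \<open>auto simp: A_carrier\<close>)
      also have "\<dots> = ?pi (f a * f b)" using that by (simp add: f pi_simps)
      finally show ?thesis by (simp add: pi_eq K_def)
    qed
    show "f a \<in> K" if "a \<in> RI (int p) n" for a
    proof -
      have "cs a = cs 0" using that by (simp add: cs_eq_iff)
      hence "?pi (f a) = ?pi (f 0)" using f[of a] f[of 0] RI_U that U_closed(4) by auto
      thus ?thesis by (simp add: pi_eq K_def f_def)
    qed
  qed
  interpret S: square_zero m "int p" n U N K f by (rule sq)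
  obtain \<psi> where psi: "S.lifts \<psi>" using core[OF sq] by blast
  have Nd: "val u = val v" if "u - v \<in> N" for u v
  proof -
    have "u = v + (u - v)" by simp
    hence "val u = val v \<oplus>\<^bsub>?B\<^esub> val (u - v)" using val_simps(1)[of v "u - v"] by simp
    thus ?thesis using that by (simp add: N_def val_simps)
  qed
  have padd: "val (\<psi> (a + b)) = val (\<psi> a) \<oplus>\<^bsub>?B\<^esub> val (\<psi> b)" if "a \<in> U" "b \<in> U" for a b
    using psi that Nd[of "\<psi> (a + b)" "\<psi> a + \<psi> b"] by (simp add: S.lifts_def val_simps)
  have pmult: "val (\<psi> (a * b)) = val (\<psi> a) \<otimes>\<^bsub>?B\<^esub> val (\<psi> b)" if "a \<in> U" "b \<in> U" for a b
    using psi that Nd[of "\<psi> (a * b)" "\<psi> a * \<psi> b"] by (simp add: S.lifts_def val_simps)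
  have pone: "val (\<psi> 1) = \<one>\<^bsub>?B\<^esub>" using psi Nd[of "\<psi> 1" 1] by (simp add: S.lifts_def val_simps)
  have wd: "val (\<psi> a) = val (\<psi> b)" if ab: "a \<in> U" "b \<in> U" "cs a = cs b" for a b
  proof -
    have d: "a - b \<in> RI (int p) n" using ab(3) by (simp add: cs_eq_iff)
    hence "\<psi> (a - b) \<in> N" using psi by (simp add: S.lifts_def)
    hence "val (\<psi> (a - b)) = \<zero>\<^bsub>?B\<^esub>" by (simp add: N_def)
    thus ?thesis using padd[OF ab(2), of "a - b"] U_closed(2)[OF ab(1,2)] by (simp add: val_simps)
  qed
  define \<Psi>' where "\<Psi>' W = val (\<psi> (SOME g. g \<in> U \<and> W = cs g))" for W
  have Psi': "\<Psi>' (cs g) = val (\<psi> g)" if g: "g \<in> U" for g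
  proof -
    have "\<exists>g'. g' \<in> U \<and> cs g = cs g'" using g by blast
    from someI_ex[OF this] show ?thesis unfolding \<Psi>'_def using wd[OF g] by metis
  qed
  have hom: "\<Psi>' \<in> Ring.ring_hom A ?B"
    by (rule ring_hom_memI) (auto simp: A_carrier A_simps Psi' U_closed padd pmult pone val_simps)
  moreover have "\<phi> a = J +>\<^bsub>?B\<^esub> \<Psi>' a" if aA: "a \<in> carrier A" for a
  proof -
    obtain g where g: "g \<in> U" "a = cs g" using aA unfolding A_carrier by blast
    have "\<psi> g - f g \<in> K" using psi g(1) by (simp add: S.lifts_def)
    hence "?pi (\<psi> g) = ?pi (f g)" by (simp add: pi_eq K_def)
    thus ?thesis using f[OF g(1)] by (simp add: g Psi')
  qed
  ultimately show ?thesis by blast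
qed

end

section \<open>Good reduction\<close>

context unicritical begin

lemma Y1_ring_eq: assumes n: "n \<ge> 1"
  shows "coordinate_ring m p n UNIV" "Y1_ring m n p = coordinate_ring.A m p n UNIV"
proof -
  show c: "coordinate_ring m p n UNIV" by unfold_locales (use n in \<open>simp_all add: subring_set_UNIV\<close>)
  interpret coordinate_ring m p n UNIV by (rule c)
  have "carrier (Y1_ring m n p) = range cs"
    by (auto simp: Y1_ring_def FactRing_def A_RCOSETS_def' cs_def Zxc_simps)
  thus "Y1_ring m n p = A" unfolding A_def by simp
qed

lemma Y0_ring_eq: assumes n: "n \<ge> 1"
  shows "coordinate_ring m p n (Inv (int p) n)" "Y0_ring m n p = coordinate_ring.A m p n (Inv (int p) n)"
proof -
  show c: "coordinate_ring m p n (Inv (int p) n)" by unfold_locales (use n in \<open>simp_all add: subring_Inv RI_Inv\<close>)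
  interpret coordinate_ring m p n "Inv (int p) n" by (rule c)
  have s: "sigma_star m n p (cs g) = cs (pcompose g (fc m))" for g
  proof -
    have "(\<lambda>g. cs (pcompose g (fc m))) ` cs g = {cs (pcompose g (fc m))}"
    proof (intro equalityI subsetI)
      fix x assume "x \<in> (\<lambda>g. cs (pcompose g (fc m))) ` cs g"
      then obtain i where i: "i \<in> RI (int p) n" "x = cs (pcompose (i + g) (fc m))" by (auto simp: cs_eq[of g])
      have "pcompose (i + g) (fc m) - pcompose g (fc m) \<in> RI (int p) n"
        using RI_shift[OF n i(1), of 1] by (simp add: pcompose_add fc_eq_F)
      thus "x \<in> {cs (pcompose g (fc m))}" using i(2) by (simp add: cs_eq_iff)
    next
      fix x assume "x \<in> {cs (pcompose g (fc m))}"
      moreover have "g \<in> cs g" using is_ideal_zero[OF is_ideal_RI] by (auto simp: cs_eq)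
      ultimately show "x \<in> (\<lambda>g. cs (pcompose g (fc m))) ` cs g" by blast
    qed
    thus ?thesis unfolding sigma_star_def cs_def[symmetric] by simp
  qed
  have "carrier (Y1_ring m n p) = range cs"
    by (auto simp: Y1_ring_def FactRing_def A_RCOSETS_def' cs_def Zxc_simps)
  note c = this
  have fixed: "sigma_star m n p (cs g) = cs g \<longleftrightarrow> g \<in> Inv (int p) n" for g
    unfolding s cs_eq_iff Inv_def by simp
  have "{A \<in> carrier (Y1_ring m n p). sigma_star m n p A = A} = cs ` Inv (int p) n"
  proof (intro equalityI subsetI)
    fix x assume "x \<in> {A \<in> carrier (Y1_ring m n p). sigma_star m n p A = A}"
    hence x: "x \<in> range cs" "sigma_star m n p x = x" unfolding c by blast+
    obtain g where g: "x = cs g" using x(1) by (rule rangeE)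
    have "g \<in> Inv (int p) n" using x(2) unfolding g fixed .
    thus "x \<in> cs ` Inv (int p) n" unfolding g by (rule imageI)
  next
    fix x assume "x \<in> cs ` Inv (int p) n"
    then obtain g where g: "x = cs g" "g \<in> Inv (int p) n" by (rule imageE)
    show "x \<in> {A \<in> carrier (Y1_ring m n p). sigma_star m n p A = A}"
      unfolding c g(1) by (rule CollectI, rule conjI, rule rangeI, rule fixed[THEN iffD2, OF g(2)])
  qed
  thus "Y0_ring m n p = A" unfolding A_def Y0_ring_def by simp
qed

lemma Y1_chosen_ring_lift:
  assumes n: "n \<ge> 1" and p: "prime p" "\<not> p dvd m" and D: "\<not> int p dvd disc_delta m n"
    and h: "Fp_algebra p (chosen_ring :: 'b ring)" "ideal J (chosen_ring :: 'b ring)"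
      "\<forall>a\<in>J. \<forall>b\<in>J. a \<otimes>\<^bsub>chosen_ring\<^esub> b = \<zero>\<^bsub>chosen_ring\<^esub>" "\<phi> \<in> Ring.ring_hom (Y1_ring m n p) (chosen_ring Quot J)"
  shows "\<exists>\<psi>\<in>Ring.ring_hom (Y1_ring m n p) chosen_ring. \<forall>a\<in>carrier (Y1_ring m n p). \<phi> a = J +>\<^bsub>chosen_ring\<^esub> \<psi> a"
proof -
  have p': "prime (int p)" "\<not> int p dvd int m" using p by simp_all
  obtain y z where yz: "pderiv (\<Phi> n) * y + dc (\<Phi> n) * z - 1 \<in> RI (int p) n"
    using Y1_partials_unit[OF n p' D] by blast
  interpret coordinate_ring m p n UNIV by (rule Y1_ring_eq(1)[OF n])
  show ?thesis unfolding Y1_ring_eq(2)[OF n]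
  proof (rule chosen_ring_lift[OF ok_prime[OF n p'] h(1,2,3)])
    show "\<phi> \<in> Ring.ring_hom A (chosen_ring Quot J)" using h(4) unfolding Y1_ring_eq(2)[OF n] .
    show "\<exists>\<psi>. square_zero.lifts m (int p) n UNIV N K f \<psi>" if "square_zero m (int p) n UNIV N K f"
      for N K and f :: "int poly poly \<Rightarrow> 'b sq_ring" by (rule square_zero.Y1_lift_mod[OF that refl yz])
  qed
qed

lemma Y0_chosen_ring_lift:
  assumes n: "n \<ge> 1" and p: "prime p" "\<not> p dvd m" and D: "\<not> int p dvd disc_Delta_prim m n"
    and h: "Fp_algebra p (chosen_ring :: 'b ring)" "ideal J (chosen_ring :: 'b ring)"
      "\<forall>a\<in>J. \<forall>b\<in>J. a \<otimes>\<^bsub>chosen_ring\<^esub> b = \<zero>\<^bsub>chosen_ring\<^esub>" "\<phi> \<in> Ring.ring_hom (Y0_ring m n p) (chosen_ring Quot J)"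
  shows "\<exists>\<psi>\<in>Ring.ring_hom (Y0_ring m n p) chosen_ring. \<forall>a\<in>carrier (Y0_ring m n p). \<phi> a = J +>\<^bsub>chosen_ring\<^esub> \<psi> a"
proof -
  have p': "prime (int p)" "\<not> int p dvd int m" using p by simp_all
  obtain y z where yz: "\<And>i. y i \<in> Inv (int p) n" "\<And>i. z i \<in> Inv (int p) n"
    "(\<Sum>i<n. coeff (rP n) i * y i + coeff (\<phi>P n) i * z i) - 1 \<in> RI (int p) n"
    using Y0_weights_unit_Inv[OF n p' D] by blast
  interpret coordinate_ring m p n "Inv (int p) n" by (rule Y0_ring_eq(1)[OF n])
  show ?thesis unfolding Y0_ring_eq(2)[OF n]
  proof (rule chosen_ring_lift[OF ok_prime[OF n p'] h(1,2,3)])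
    show "\<phi> \<in> Ring.ring_hom A (chosen_ring Quot J)" using h(4) unfolding Y0_ring_eq(2)[OF n] .
    fix N K and f :: "int poly poly \<Rightarrow> 'b sq_ring"
    assume sq: "square_zero m (int p) n (Inv (int p) n) N K f"
    have "square_zero_inv m (int p) n (Inv (int p) n) N K f"
      by (intro square_zero_inv.intro sq square_zero_inv_axioms.intro refl)
    from square_zero_inv.Y0_lift[OF this yz] show "\<exists>\<psi>. square_zero.lifts m (int p) n (Inv (int p) n) N K f \<psi>" .
  qed
qed

lemma Y1_finitely_generated: assumes n: "n \<ge> 1"
  shows "\<exists>S. finite S \<and> S \<subseteq> carrier (Y1_ring m n p) \<and> generate_ring (Y1_ring m n p) S = carrier (Y1_ring m n p)"
proof -
  interpret coordinate_ring m p n UNIV by (rule Y1_ring_eq(1)[OF n])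
  show ?thesis unfolding Y1_ring_eq(2)[OF n]
    by (rule A_finitely_generated[of "{[:0, 1:], [:[:0, 1:]:]}"]) (auto intro: int_poly_poly_induct_subring)
qed

text \<open>The invariants are generated by \<open>c\<close> and the coefficients of the cycle polynomial: division of an invariant \<open>a\<close>,
  as a polynomial in \<open>Y\<close>, by the cycle polynomial leaves a remainder with coefficients in the subring that they
  generate, and this remainder is the constant \<open>a\<close> modulo the ideal.\<close>

lemma Y0_finitely_generated: assumes n: "n \<ge> 1" and p: "prime p" "\<not> p dvd m"
  shows "\<exists>S. finite S \<and> S \<subseteq> carrier (Y0_ring m n p) \<and> generate_ring (Y0_ring m n p) S = carrier (Y0_ring m n p)"
proof -
  have p': "prime (int p)" "\<not> int p dvd int m" using p by simp_all
  note ok = ok_prime[OF n p']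
  interpret coordinate_ring m p n "Inv (int p) n" by (rule Y0_ring_eq(1)[OF n])
  show ?thesis unfolding Y0_ring_eq(2)[OF n]
  proof (rule A_finitely_generated[of "insert [:[:0, 1:]:] (coeff (CP n) ` {..n})"])
    show "finite (insert [:[:0, 1:]:] (coeff (CP n) ` {..n}))" by simp
    show "insert [:[:0, 1:]:] (coeff (CP n) ` {..n}) \<subseteq> Inv (int p) n"
      using const_Inv CP_Inv[OF n] by (auto simp: poly_subring_def)
    fix G assume G: "subring_set G" and S: "insert [:[:0, 1:]:] (coeff (CP n) ` {..n}) \<subseteq> G" and RG: "RI (int p) n \<subseteq> G"
    have G': "a \<in> G \<Longrightarrow> b \<in> G \<Longrightarrow> a + b \<in> G" "a \<in> G \<Longrightarrow> b \<in> G \<Longrightarrow> a - b \<in> G" "a \<in> G \<Longrightarrow> b \<in> G \<Longrightarrow> a * b \<in> G" "0 \<in> G" "1 \<in> G" for a b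
      using G by (auto simp: subring_set_def)
    have CPG: "CP n \<in> poly_subring G"
      unfolding poly_subring_def
    proof (intro CollectI allI)
      fix i
      show "coeff (CP n) i \<in> G"
      proof (cases "i \<le> n")
        case True
        thus ?thesis using S by blast
      next
        case False
        hence "coeff (CP n) i = 0" by (intro coeff_eq_0) (simp add: CP_degree)
        thus ?thesis using G'(4) by simp
      qed
    qed
    have nat: "of_nat k \<in> G" for k by (induction k) (simp_all add: G')
    have int: "of_int z \<in> G" for z
    proof (cases z rule: int_cases2)
      case (nonpos k)
      thus ?thesis using G'(2)[OF G'(4) nat[of k]] by simp
    qed (simp add: nat)
    have q: "[:q:] \<in> G" for q :: "int poly"
    proof (induction q)
      case 0
      show ?case using G'(4) by simp
    next
      case (pCons a q)
      have "[:pCons a q:] = of_int a + [:[:0, 1:]:] * [:q:]" by (simp add: of_int_poly)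
      moreover have c: "[:[:0, 1:]:] \<in> G" using S by blast
      ultimately show ?case using G'(1)[OF int G'(3)[OF c pCons.IH], of a] by (simp only:)
    qed
    show "Inv (int p) n \<subseteq> G"
    proof
      fix a assume a: "a \<in> Inv (int p) n"
      have "mmod (CP n) (lift a) \<in> poly_subring G"
        by (intro mmod_subring G CP_monic CPG) (simp add: poly_subring_def q)
      hence r: "coeff (mmod (CP n) (lift a)) 0 \<in> G" by (simp add: poly_subring_def)
      have "mmod (CP n) ((lift a - [:a:]) * 1) \<in> poly_ideal (RI (int p) n)" by (rule lift_diff_const_Inv[OF ok a])
      moreover have "mmod (CP n) [:a:] = [:a:]"
        by (rule mdiv_mmod_eqI(2)[OF CP_monic, where Q = 0]) (use n in \<open>simp_all add: CP_degree coeff_pCons split: nat.split\<close>)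
      ultimately have "coeff (mmod (CP n) (lift a) - [:a:]) 0 \<in> RI (int p) n"
        by (intro poly_ideal_coeff) (simp add: mmod_diff[OF CP_monic])
      hence "coeff (mmod (CP n) (lift a)) 0 - a \<in> RI (int p) n" by simp
      hence "coeff (mmod (CP n) (lift a)) 0 - a \<in> G" using RG by blast
      from G'(2)[OF r this] show "a \<in> G" by simp
    qed
  qed
qed

end

lemma no_bad_ring: assumes "cring (B :: 'b ring)" shows "\<not> bad_ring B"
proof
  assume "bad_ring B"
  hence "bad_ring (chosen_ring :: 'b ring)" by (rule chosen_ring(2)[OF assms])
  then obtain m n p i J \<phi> where m: "2 \<le> m" and n: "1 \<le> n" and p: "prime p" "\<not> p dvd m"
    and D: "\<not> int p dvd (if i then disc_delta m n else disc_Delta_prim m n)"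
    and h: "Fp_algebra p (chosen_ring :: 'b ring)" "ideal J (chosen_ring :: 'b ring)"
      "\<forall>a\<in>J. \<forall>b\<in>J. a \<otimes>\<^bsub>chosen_ring\<^esub> b = \<zero>\<^bsub>chosen_ring\<^esub>"
      "\<phi> \<in> Ring.ring_hom (if i then Y1_ring m n p else Y0_ring m n p) (chosen_ring Quot J)"
    and no: "\<not> (\<exists>\<psi>\<in>Ring.ring_hom (if i then Y1_ring m n p else Y0_ring m n p) chosen_ring.
      \<forall>a\<in>carrier (if i then Y1_ring m n p else Y0_ring m n p). \<phi> a = J +>\<^bsub>chosen_ring\<^esub> \<psi> a)"
    unfolding bad_ring_def by (elim exE conjE) (rule that; assumption)
  interpret unicritical m by unfold_locales (rule m)
  show False
  proof (cases i)
    case True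
    note i = if_P[OF True]
    show False
      by (rule notE[OF no[unfolded i] Y1_chosen_ring_lift[OF n p D[unfolded i] h(1,2,3) h(4)[unfolded i]]])
  next
    case False
    note i = if_not_P[OF False]
    show False
      by (rule notE[OF no[unfolded i] Y0_chosen_ring_lift[OF n p D[unfolded i] h(1,2,3) h(4)[unfolded i]]])
  qed
qed

lemma formally_smooth_coordinate_ring:
  assumes "2 \<le> m" "1 \<le> n" "prime p" "\<not> p dvd m" "\<not> int p dvd (if i then disc_delta m n else disc_Delta_prim m n)"
  shows "formally_smooth_over_Fp TYPE('b) p (if i then Y1_ring m n p else Y0_ring m n p)"
  unfolding formally_smooth_over_Fp_def
proof (intro allI impI, elim conjE)
  fix B :: "'b ring" and J \<phi>
  assume h: "Fp_algebra p B" "ideal J B" "\<forall>a\<in>J. \<forall>b\<in>J. a \<otimes>\<^bsub>B\<^esub> b = \<zero>\<^bsub>B\<^esub>"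
    "\<phi> \<in> Ring.ring_hom (if i then Y1_ring m n p else Y0_ring m n p) (B Quot J)"
  have "cring B" using h(1) by (simp add: Fp_algebra_def)
  hence nb: "\<not> bad_ring B" by (rule no_bad_ring)
  show "\<exists>\<psi>\<in>Ring.ring_hom (if i then Y1_ring m n p else Y0_ring m n p) B.
      \<forall>a\<in>carrier (if i then Y1_ring m n p else Y0_ring m n p). \<phi> a = J +>\<^bsub>B\<^esub> \<psi> a"
  proof (rule ccontr)
    assume no: "\<not> ?thesis"
    have "bad_ring B" unfolding bad_ring_def
      by (rule exI[of _ m], rule exI[of _ n], rule exI[of _ p], rule exI[of _ i], rule exI[of _ J], rule exI[of _ \<phi>])
        (intro conjI assms h no)
    with nb show False ..
  qed
qed

theorem theorem3:
  fixes m n :: nat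
  assumes "m \<ge> 2" and "n \<ge> 1"
  shows "(\<forall>p::nat. prime p \<and> \<not> p dvd m \<and> Y1_bad_reduction TYPE('b) m n p \<longrightarrow> int p dvd disc_delta m n) \<and>
         (\<forall>p::nat. prime p \<and> \<not> p dvd m \<and> Y0_bad_reduction TYPE('b) m n p \<longrightarrow> int p dvd disc_Delta_prim m n)"
proof -
  interpret unicritical m by unfold_locales (rule assms(1))
  note n = assms(2)
  have "smooth_over_Fp TYPE('b) p (Y1_ring m n p)" if p: "prime p" "\<not> p dvd m" and D: "\<not> int p dvd disc_delta m n" for p
  proof -
    interpret coordinate_ring m p n UNIV by (rule Y1_ring_eq(1)[OF n])
    have "formally_smooth_over_Fp TYPE('b) p (Y1_ring m n p)"
      using formally_smooth_coordinate_ring[OF assms p, of True] D by simp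
    thus ?thesis unfolding smooth_over_Fp_def using Y1_finitely_generated[OF n] A_Fp Y1_ring_eq(2)[OF n] by simp
  qed
  moreover have "smooth_over_Fp TYPE('b) p (Y0_ring m n p)" if p: "prime p" "\<not> p dvd m" and D: "\<not> int p dvd disc_Delta_prim m n" for p
  proof -
    interpret coordinate_ring m p n "Inv (int p) n" by (rule Y0_ring_eq(1)[OF n])
    have "formally_smooth_over_Fp TYPE('b) p (Y0_ring m n p)"
      using formally_smooth_coordinate_ring[OF assms p, of False] D by simp
    thus ?thesis unfolding smooth_over_Fp_def using Y0_finitely_generated[OF n p] A_Fp Y0_ring_eq(2)[OF n] by simp
  qed
  ultimately show ?thesis unfolding Y1_bad_reduction_def Y0_bad_reduction_def by blast
qed

end
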